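(* Assume the two-sample network setting and the test statistics described in the context. Suppose (A1) and (A2) hold, and that one of (C1) and (C2) holds. Then, under $H_0:\boldsymbol{s}_1=\boldsymbol{s}_2$, for any $x\in\mathbb{R}$, $$\Pr\left(M_n-2\log q+\log\log q\le x\right)\to\exp\left\{-\pi^{-1/2}\exp(-x/2)\right\}\quad\text{as } n_1,n_2,q\to\infty .$$
   Context: Setting: for $d=1,2$, $\boldsymbol{S}_{d,1},\dots,\boldsymbol{S}_{d,n_d}$ are i.i.d. random symmetric $p\times p$ matrices $\boldsymbol{S}_{d,l}=(S_{d,l,i,j})$ with symmetric mean matrix $\boldsymbol{s}_d=(s_{d,i,j})$, and the two samples are independent. Let $n=n_1n_2/(n_1+n_2)$ and assume $n_1\asymp n_2$. Let $q=p(p-1)/2$. Define $\bar S_{d,i,j}=n_d^{-1}\sum_{l}S_{d,l,i,j}$, $V_{d,i,j}=n_d^{-1}\sum_{l}(S_{d,l,i,j}-\bar S_{d,i,j})^2$, $W_{i,j}=\bar S_{1,i,j}-\bar S_{2,i,j}$, $T_{i,j}=W_{i,j}/(V_{1,i,j}/n_1+V_{2,i,j}/n_2)^{1/2}$ for $1\le i<j\le p$, and $M_n=\max_{1\le i<j\le p}T_{i,j}^2$. Let $\boldsymbol{\Gamma}_d\in\mathbb{R}^{q\times q}$ be the covariance matrix of $\mathrm{vech}(\boldsymbol{S}_{d,l})$ (the vector of strictly upper-triangular entries) and $\boldsymbol{R}_d=(r_{d,i,j})$ the corresponding correlation matrix. (A1): $C_0^{-1}\le\lambda_{\min}(\boldsymbol{\Gamma}_d)\le\lambda_{\max}(\boldsymbol{\Gamma}_d)\le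 C_0$ for some constant $C_0>0$, $d=1,2$. (A2): $\max_{d=1,2}\max_{1\le i<j\le q}|r_{d,i,j}|<r<1$ for some constant $0<r<1$. (C1) (sub-Gaussian tail): $\log p=o(n^{1/5})$, and there are constants $\eta>0$, $K>0$ with $\mathbb{E}[\exp\{\eta(S_{d,l,i,j}-s_{d,i,j})^2/\mathrm{Var}(S_{d,l,i,j})\}]\le K$ for all $1\le i<j\le p$, $l$, $d=1,2$. (C2) (polynomial tail): $p\le cn^{\gamma_0}$ for some constants $\gamma_0,c>0$, and there are constants $\epsilon>0$, $K>0$ with $\mathbb{E}\{|(S_{d,l,i,j}-s_{d,i,j})/\mathrm{Var}(S_{d,l,i,j})^{1/2}|^{4\gamma_0+2+\epsilon}\}\le K$ for all $1\le i<j\le p$, $l$, $d=1,2$. *)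

theory Defs
  imports "HOL-Probability.Probability" "HOL-Library.Landau_Symbols"
begin

text \<open>A sample of size n of random matrices observed at one outcome is a function
  X :: nat => nat => nat => real, with X l i j the (i,j) entry of the l-th matrix (l < n).\<close>

definition sbar :: "nat \<Rightarrow> (nat \<Rightarrow> nat \<Rightarrow> nat \<Rightarrow> real) \<Rightarrow> nat \<Rightarrow> nat \<Rightarrow> real" where
  "sbar n X i j = (\<Sum>l<n. X l i j) / real n"

definition vhat :: "nat \<Rightarrow> (nat \<Rightarrow> nat \<Rightarrow> nat \<Rightarrow> real) \<Rightarrow> nat \<Rightarrow> nat \<Rightarrow> real" where
  "vhat n X i j = (\<Sum>l<n. (X l i j - sbar n X i j)^2) / real n"

definition Tstat :: "nat \<Rightarrow> (nat \<Rightarrow> nat \<Rightarrow> nat \<Rightarrow> real) \<Rightarrow> nat \<Rightarrow> (nat \<Rightarrow> nat \<Rightarrow> nat \<Rightarrow> real)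
    \<Rightarrow> nat \<Rightarrow> nat \<Rightarrow> real" where
  "Tstat n1 X1 n2 X2 i j =
     (sbar n1 X1 i j - sbar n2 X2 i j) / sqrt (vhat n1 X1 i j / real n1 + vhat n2 X2 i j / real n2)"

definition Mstat :: "nat \<Rightarrow> nat \<Rightarrow> (nat \<Rightarrow> nat \<Rightarrow> nat \<Rightarrow> real) \<Rightarrow> nat \<Rightarrow> (nat \<Rightarrow> nat \<Rightarrow> nat \<Rightarrow> real) \<Rightarrow> real" where
  "Mstat p n1 X1 n2 X2 = Max {(Tstat n1 X1 n2 X2 i j)^2 | i j. i < j \<and> j < p}"

definition covar :: "'a measure \<Rightarrow> ('a \<Rightarrow> real) \<Rightarrow> ('a \<Rightarrow> real) \<Rightarrow> real" where
  "covar M X Y = (\<integral>\<omega>. (X \<omega> - (\<integral>\<omega>'. X \<omega>' \<partial>M)) * (Y \<omega> - (\<integral>\<omega>'. Y \<omega>' \<partial>M)) \<partial>M)"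

definition correl :: "'a measure \<Rightarrow> ('a \<Rightarrow> real) \<Rightarrow> ('a \<Rightarrow> real) \<Rightarrow> real" where
  "correl M X Y = covar M X Y / sqrt (covar M X X * covar M Y Y)"

definition is_eigenvalue_on :: "'i set \<Rightarrow> ('i \<Rightarrow> 'i \<Rightarrow> real) \<Rightarrow> real \<Rightarrow> bool" where
  "is_eigenvalue_on I A \<mu> \<longleftrightarrow>
     (\<exists>v. (\<exists>i\<in>I. v i \<noteq> 0) \<and> (\<forall>i\<in>I. (\<Sum>j\<in>I. A i j * v j) = \<mu> * v i))"

definition upper_pairs :: "nat \<Rightarrow> (nat \<times> nat) set" where
  "upper_pairs p = {(i, j). i < j \<and> j < p}"

end

theory Submission
  imports Defs "HOL-Real_Asymp.Real_Asymp"
begin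

text \<open>
  Normalise and truncate the observations, so that the numerator of the statistic for the pair a
  becomes a sum S_a of independent bounded variables of total variance close to 1. The indicator
  of max |S_a| \<le> x is smoothed to the product over all a and both signs of
  1 - lgs (\<kappa> (\<plusminus>S_a - x)), where lgs is the logistic function. Since lgs (t + w) is at
  most exp |w| times lgs t, every Taylor remainder is bounded by lgs itself, so a Lindeberg
  replacement has a small error relative to the tail probability, which is of order 1/q. Two
  replacements are made: for a single coordinate the summands are exchanged for Gaussians, which
  gives the tail asymptotics; for the whole vector each summand is exchanged for one with the same
  marginals but independent coordinates, after which the product factorises.

  The second replacement costs the correlations. Pairs with correlation at most (log q)^-2 are
  harmless because the product of the smoothed indicators absorbs the square of the sum of all
  lgs terms. By (A1) there are only O(q (log q)^4) other pairs, and (A2) with an exponential moment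
  bound makes a joint exceedance of such a pair of order q^(-1-\<delta>), up to logarithms.

  The choice \<kappa> = (log q)^(3/5) balances two demands: \<kappa> must exceed (log q)^(1/2), the inverse
  of the distance between thresholds x belonging to different y, while \<kappa>^3 \<tau> / sqrt n must
  vanish for the truncation level \<tau>. Finally, Bernstein's inequality shows that replacing the
  empirical variances by the true ones shifts the threshold negligibly.
\<close>

section \<open>The logistic function and its products\<close>

definition lgs :: "real \<Rightarrow> real" where
  "lgs t = 1 / (1 + exp (- t))"

lemma one_plus_exp_pos: "0 < 1 + exp (t::real)"
  by (simp add: add_pos_pos)

lemma lgs_pos [simp]: "0 < lgs t"
  and lgs_less_1 [simp]: "lgs t < 1"
  using one_plus_exp_pos[of "-t"] by (simp_all add: lgs_def)

lemma lgs_nonneg [simp]: "0 \<le> lgs t"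
  and lgs_le_1 [simp]: "lgs t \<le> 1"
  using lgs_pos[of t] lgs_less_1[of t] by linarith+

lemma lgs_le_exp:
  assumes "0 \<le> c" "c \<le> 1"
  shows "lgs t \<le> exp (c * t)"
proof (cases "t \<ge> 0")
  case True
  then have "1 \<le> exp (c * t)" using assms by simp
  then show ?thesis using lgs_le_1[of t] by linarith
next
  case False
  have "exp t \<le> exp (c * t)" using False assms by (simp add: mult_le_cancel_right2)
  moreover have "lgs t \<le> exp t"
    using one_plus_exp_pos[of "-t"]
    by (simp add: lgs_def field_simps exp_minus)
  ultimately show ?thesis by linarith
qed

lemma lgs_shift_le: "lgs (t + w) \<le> exp \<bar>w\<bar> * lgs t"
proof -
  have 1: "1 \<le> exp \<bar>w\<bar>" by simp
  have "exp (-t) \<le> exp (\<bar>w\<bar> + (- (t + w)))" by simp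
  then have "1 + exp (-t) \<le> exp \<bar>w\<bar> * (1 + exp (- (t + w)))"
    using 1 by (simp only: exp_add distrib_left mult_1_right)
  then show ?thesis
    using one_plus_exp_pos[of "-t"] one_plus_exp_pos[of "-(t+w)"]
    by (simp add: lgs_def divide_simps mult.commute)
qed

lemma one_minus_lgs: "1 - lgs t = lgs (- t)"
  using one_plus_exp_pos[of "-t"] one_plus_exp_pos[of t]
  by (simp add: lgs_def divide_simps exp_minus)

lemma DERIV_lgs: "(lgs has_field_derivative lgs t * (1 - lgs t)) (at t)"
proof -
  have "((\<lambda>t. 1 / (1 + exp (- t))) has_field_derivative
     (exp (-t)) / (1 + exp (-t))^2) (at t)"
    using one_plus_exp_pos[of "-t"]
    by (auto intro!: derivative_eq_intros simp: power2_eq_square)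
  moreover have "(exp (-t)) / (1 + exp (-t))^2 = lgs t * (1 - lgs t)"
    using one_plus_exp_pos[of "-t"]
    by (simp add: lgs_def divide_simps power2_eq_square)
  ultimately show ?thesis unfolding lgs_def[abs_def] by simp
qed

lemma DERIV_lgs' [derivative_intros]:
  assumes "(f has_field_derivative D) (at s)"
  shows "((\<lambda>s. lgs (f s)) has_field_derivative (lgs (f s) * (1 - lgs (f s)) * D)) (at s)"
  using DERIV_chain2[OF DERIV_lgs assms] by simp

lemma continuous_on_lgs: "continuous_on UNIV lgs"
  by (intro continuous_at_imp_continuous_on ballI DERIV_isCont[OF DERIV_lgs])

lemma borel_measurable_lgs [measurable]: "lgs \<in> borel_measurable borel"
  by (intro borel_measurable_continuous_onI continuous_on_lgs)

lemma taylor3: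
  fixes f f1 f2 f3 :: "real \<Rightarrow> real"
  assumes "\<And>t. (f has_field_derivative f1 t) (at t)"
    "\<And>t. (f1 has_field_derivative f2 t) (at t)"
    "\<And>t. (f2 has_field_derivative f3 t) (at t)"
    and "\<And>t. 0 \<le> t \<Longrightarrow> t \<le> 1 \<Longrightarrow> \<bar>f3 t\<bar> \<le> B"
  shows "\<bar>f 1 - f 0 - f1 0 - f2 0 / 2\<bar> \<le> B / 6"
proof -
  define df where "df m = (if m = 0 then f else if m = 1 then f1 else if m = 2 then f2 else f3)" for m :: nat
  have "\<exists>t>0. t < 1 \<and> f 1 = (\<Sum>m<3. df m 0 / fact m * 1 ^ m) + df 3 t / fact 3 * 1 ^ 3"
  proof (rule Maclaurin)
    show "\<forall>m t. m < 3 \<and> 0 \<le> t \<and> t \<le> 1 \<longrightarrow> (df m has_real_derivative df (Suc m) t) (at t)"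
    proof (intro allI impI)
      fix m :: nat and t :: real assume "m < 3 \<and> 0 \<le> t \<and> t \<le> 1"
      then have "m = 0 \<or> m = 1 \<or> m = 2" by auto
      then show "(df m has_real_derivative df (Suc m) t) (at t)"
        using assms(1-3)[of t] by (auto simp: df_def)
    qed
  qed (auto simp: df_def)
  then obtain t where t: "0 < t" "t < 1"
    and e: "f 1 = (\<Sum>m<3. df m 0 / fact m * 1 ^ m) + df 3 t / fact 3 * 1 ^ 3" by blast
  have "f 1 - f 0 - f1 0 - f2 0 / 2 = f3 t / 6"
    unfolding e by (simp add: df_def numeral_3_eq_3 fact_numeral)
  moreover have "\<bar>f3 t\<bar> \<le> B" using assms(4)[of t] t by simp
  ultimately show ?thesis by linarith
qed

lemma lgs_taylor:
  "\<bar>lgs (t + w) - lgs t - lgs t * (1 - lgs t) * w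
      - lgs t * (1 - lgs t) * (1 - 2 * lgs t) * w^2 / 2\<bar> \<le> \<bar>w\<bar>^3 * exp \<bar>w\<bar> * lgs t / 6"
proof -
  let ?g = "\<lambda>\<theta>. lgs (t + \<theta> * w)"
  have "\<bar>?g 1 - ?g 0 - (\<lambda>\<theta>. ?g \<theta> * (1 - ?g \<theta>) * w) 0 -
      (\<lambda>\<theta>. ?g \<theta> * (1 - ?g \<theta>) * (1 - 2 * ?g \<theta>) * w^2) 0 / 2\<bar> \<le> (\<bar>w\<bar>^3 * exp \<bar>w\<bar> * lgs t) / 6"
  proof (rule taylor3[where ?f3.0 = "\<lambda>\<theta>. ?g \<theta> * (1 - ?g \<theta>) * (1 - 6 * ?g \<theta> + 6 * (?g \<theta>)^2) * w^3"])
    fix \<theta> :: real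
    show "(?g has_field_derivative ?g \<theta> * (1 - ?g \<theta>) * w) (at \<theta>)"
      by (auto intro!: derivative_eq_intros)
    show "((\<lambda>\<theta>. ?g \<theta> * (1 - ?g \<theta>) * w) has_field_derivative
          ?g \<theta> * (1 - ?g \<theta>) * (1 - 2 * ?g \<theta>) * w^2) (at \<theta>)"
      by (auto intro!: derivative_eq_intros simp: power2_eq_square algebra_simps)
    show "((\<lambda>\<theta>. ?g \<theta> * (1 - ?g \<theta>) * (1 - 2 * ?g \<theta>) * w^2) has_field_derivative
         ?g \<theta> * (1 - ?g \<theta>) * (1 - 6 * ?g \<theta> + 6 * (?g \<theta>)^2) * w^3) (at \<theta>)"
      by (rule derivative_eq_intros refl | simp)+ (simp add: power2_eq_square power3_eq_cube algebra_simps)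
    assume th: "0 \<le> \<theta>" "\<theta> \<le> 1"
    let ?s = "?g \<theta>"
    have s: "0 < ?s" "?s < 1" by simp_all
    have "\<bar>1 - 6 * ?s + 6 * ?s^2\<bar> \<le> 1"
    proof -
      have "0 \<le> ?s * (1 - ?s)" using s by simp
      moreover have "?s * (1 - ?s) \<le> 1/4"
        using zero_le_power2[of "?s - 1/2"] by (simp add: power2_eq_square algebra_simps)
      moreover have "1 - 6 * ?s + 6 * ?s^2 = 1 - 6 * (?s * (1 - ?s))"
        by (simp add: power2_eq_square algebra_simps)
      ultimately show ?thesis by linarith
    qed
    then have 1: "\<bar>(1 - ?s) * (1 - 6 * ?s + 6 * ?s^2)\<bar> \<le> 1"
      using s unfolding abs_mult by (intro mult_le_one) auto
    have "?s \<le> exp \<bar>\<theta> * w\<bar> * lgs t" by (rule lgs_shift_le)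
    also have "\<dots> \<le> exp \<bar>w\<bar> * lgs t"
      using th by (intro mult_right_mono) (auto simp: abs_mult mult_left_le_one_le)
    finally have 2: "?s \<le> exp \<bar>w\<bar> * lgs t" .
    have "\<bar>?s * (1 - ?s) * (1 - 6 * ?s + 6 * ?s^2) * w^3\<bar>
        = ?s * \<bar>(1 - ?s) * (1 - 6 * ?s + 6 * ?s^2)\<bar> * \<bar>w\<bar>^3"
      using s by (simp add: abs_mult power_abs)
    also have "\<dots> \<le> (exp \<bar>w\<bar> * lgs t) * 1 * \<bar>w\<bar>^3"
      using 1 2 s by (intro mult_right_mono mult_mono) auto
    finally show "\<bar>?s * (1 - ?s) * (1 - 6 * ?s + 6 * ?s^2) * w^3\<bar> \<le> \<bar>w\<bar>^3 * exp \<bar>w\<bar> * lgs t"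
      by (simp add: mult_ac)
  qed
  then show ?thesis by simp
qed

lemma one_minus_le_exp: "1 - (x::real) \<le> exp (- x)"
  using exp_ge_add_one_self[of "-x"] by simp

lemma prod_one_minus_le_exp:
  assumes "\<And>a. a \<in> J \<Longrightarrow> 0 \<le> (y a::real)" "\<And>a. a \<in> J \<Longrightarrow> y a \<le> 1"
  shows "(\<Prod>a\<in>J. 1 - y a) \<le> exp (- (\<Sum>a\<in>J. y a))"
proof (cases "finite J")
  case True
  have "(\<Prod>a\<in>J. 1 - y a) \<le> (\<Prod>a\<in>J. exp (- y a))"
    using assms by (intro prod_mono) (auto intro: one_minus_le_exp)
  then show ?thesis using True by (simp add: exp_sum sum_negf[symmetric])
qed simp

lemma mult_exp_le:
  assumes "0 \<le> (A::real)" shows "A * exp (- A / 3) \<le> 3" "A^2 * exp (- A / 3) \<le> 36"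
proof -
  have 1: "A / 3 \<le> exp (A/3)" using exp_ge_add_one_self[of "A/3"] by linarith
  have "A * exp (- A / 3) = 3 * ((A/3) * exp (-(A/3)))" by simp
  also have "\<dots> \<le> 3 * (exp (A/3) * exp (-(A/3)))"
    using 1 by (intro mult_left_mono mult_right_mono) auto
  finally show "A * exp (- A / 3) \<le> 3" by (simp add: exp_minus_inverse)
  have "A / 6 \<le> exp (A/6)" using exp_ge_add_one_self[of "A/6"] by linarith
  then have 2: "(A / 6)^2 \<le> exp (A/6)^2" using assms by (intro power_mono) simp_all
  have 3: "exp (A/6)^2 = exp (A/3)" by (simp flip: exp_double)
  have "A^2 * exp (- A / 3) = 36 * ((A/6)^2 * exp (-(A/3)))" by (simp add: power_divide)
  also have "\<dots> \<le> 36 * (exp (A/3) * exp (-(A/3)))"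
    using 2 3 by (intro mult_left_mono mult_right_mono) auto
  finally show "A^2 * exp (- A / 3) \<le> 36" by (simp add: exp_minus_inverse)
qed

lemma sum_mult_square_le:
  fixes w g :: "'j \<Rightarrow> real"
  assumes "\<And>a. a \<in> J \<Longrightarrow> 0 \<le> g a"
  shows "(\<Sum>a\<in>J. w a * g a)^2 \<le> (\<Sum>a\<in>J. g a) * (\<Sum>a\<in>J. (w a)^2 * g a)"
proof -
  have "(\<Sum>a\<in>J. sqrt (g a) * (w a * sqrt (g a)))^2
     \<le> (\<Sum>a\<in>J. (sqrt (g a))^2) * (\<Sum>a\<in>J. (w a * sqrt (g a))^2)"
    by (rule Cauchy_Schwarz_ineq_sum)
  moreover have "(\<Sum>a\<in>J. sqrt (g a) * (w a * sqrt (g a))) = (\<Sum>a\<in>J. w a * g a)"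
    using assms by (intro sum.cong) (auto simp: mult.left_commute[of _ "w _"])
  moreover have "(\<Sum>a\<in>J. (sqrt (g a))^2) = (\<Sum>a\<in>J. g a)"
    using assms by (intro sum.cong) auto
  moreover have "(\<Sum>a\<in>J. (w a * sqrt (g a))^2) = (\<Sum>a\<in>J. (w a)^2 * g a)"
    using assms by (intro sum.cong) (auto simp: power_mult_distrib)
  ultimately show ?thesis by simp
qed

definition hprod :: "'j set \<Rightarrow> ('j \<Rightarrow> real) \<Rightarrow> real" where
  "hprod J t = (\<Prod>a\<in>J. 1 - lgs (t a))"

lemma hprod_nonneg: "0 \<le> hprod J t" and hprod_le_1: "hprod J t \<le> 1"
  unfolding hprod_def by (auto intro!: prod_nonneg prod_le_1 simp: less_imp_le)

lemma hprod_le_exp: "hprod J t \<le> exp (- (\<Sum>a\<in>J. lgs (t a)))"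
  unfolding hprod_def by (rule prod_one_minus_le_exp) auto

lemma DERIV_hprod:
  assumes "finite J"
  shows "((\<lambda>\<theta>. hprod J (\<lambda>a. t a + \<theta> * w a)) has_field_derivative
     - (\<Sum>a\<in>J. w a * lgs (t a + \<theta> * w a)) * hprod J (\<lambda>a. t a + \<theta> * w a)) (at \<theta>)"
  using assms unfolding hprod_def
proof (induction J rule: finite_induct)
  case (insert b J)
  have "((\<lambda>\<theta>. 1 - lgs (t b + \<theta> * w b)) has_field_derivative
      - (lgs (t b + \<theta> * w b) * (1 - lgs (t b + \<theta> * w b)) * w b)) (at \<theta>)"
    by (auto intro!: derivative_eq_intros)
  from DERIV_mult[OF this insert.IH] show ?case
    using insert.hyps by (simp add: algebra_simps)
qed simp

lemma hprod_taylor: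
  fixes t w :: "'j \<Rightarrow> real"
  assumes fin: "finite J" and om: "\<omega> \<le> 1" and w: "\<And>a. a \<in> J \<Longrightarrow> \<bar>w a\<bar> \<le> \<omega>"
  defines "g \<equiv> \<lambda>a. lgs (t a)"
  shows "\<bar>hprod J (\<lambda>a. t a + w a) - hprod J t + (\<Sum>a\<in>J. w a * g a) * hprod J t
      - ((\<Sum>a\<in>J. w a * g a)^2 - (\<Sum>a\<in>J. (w a)^2 * (g a * (1 - g a)))) * hprod J t / 2\<bar>
    \<le> 176 * \<omega> * (\<Sum>a\<in>J. (w a)^2 * g a)"
proof (cases "J = {}")
  case True
  then show ?thesis by (simp add: hprod_def)
next
  case False
  then have om0: "0 \<le> \<omega>" using w by force
  define s where "s \<theta> a = lgs (t a + \<theta> * w a)" for \<theta> a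
  define G1 where "G1 \<theta> = (\<Sum>a\<in>J. w a * s \<theta> a)" for \<theta>
  define G2 where "G2 \<theta> = (\<Sum>a\<in>J. (w a)^2 * (s \<theta> a * (1 - s \<theta> a)))" for \<theta>
  define G3 where "G3 \<theta> = (\<Sum>a\<in>J. (w a)^3 * (s \<theta> a * (1 - s \<theta> a) * (1 - 2 * s \<theta> a)))" for \<theta>
  define F where "F \<theta> = hprod J (\<lambda>a. t a + \<theta> * w a)" for \<theta>
  define A where "A = (\<Sum>a\<in>J. g a)"
  define B where "B = (\<Sum>a\<in>J. (w a)^2 * g a)"
  have A0: "0 \<le> A" unfolding A_def g_def by (intro sum_nonneg) auto
  have B0: "0 \<le> B" unfolding B_def g_def by (intro sum_nonneg) auto
  have ds: "((\<lambda>\<theta>. s \<theta> a) has_field_derivative w a * (s \<theta> a * (1 - s \<theta> a))) (at \<theta>)" for \<theta> a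
    unfolding s_def by (auto intro!: derivative_eq_intros)
  have dF: "(F has_field_derivative - G1 \<theta> * F \<theta>) (at \<theta>)" for \<theta>
    using DERIV_hprod[OF fin, of t w \<theta>] by (simp add: F_def[abs_def] G1_def s_def)
  have dG1: "(G1 has_field_derivative G2 \<theta>) (at \<theta>)" for \<theta>
    unfolding G1_def[abs_def] G2_def
    by (auto intro!: DERIV_sum derivative_eq_intros ds simp: power2_eq_square algebra_simps)
  have dG2: "(G2 has_field_derivative G3 \<theta>) (at \<theta>)" for \<theta>
    unfolding G2_def[abs_def] G3_def
    by (auto intro!: DERIV_sum derivative_eq_intros ds simp: power2_eq_square power3_eq_cube algebra_simps)
  have "\<bar>F 1 - F 0 - (\<lambda>\<theta>. - G1 \<theta> * F \<theta>) 0 - (\<lambda>\<theta>. (G1 \<theta> ^ 2 - G2 \<theta>) * F \<theta>) 0 / 2\<bar>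
     \<le> (1056 * \<omega> * B) / 6"
  proof (rule taylor3[where ?f3.0 = "\<lambda>\<theta>. (3 * G1 \<theta> * G2 \<theta> - G3 \<theta> - G1 \<theta> ^ 3) * F \<theta>"])
    fix \<theta> :: real
    show "(F has_field_derivative - G1 \<theta> * F \<theta>) (at \<theta>)" by (rule dF)
    show "((\<lambda>\<theta>. - G1 \<theta> * F \<theta>) has_field_derivative (G1 \<theta> ^ 2 - G2 \<theta>) * F \<theta>) (at \<theta>)"
      by (rule derivative_eq_intros dF dG1 refl)+ (simp add: power2_eq_square algebra_simps)
    show "((\<lambda>\<theta>. (G1 \<theta> ^ 2 - G2 \<theta>) * F \<theta>) has_field_derivative
        (3 * G1 \<theta> * G2 \<theta> - G3 \<theta> - G1 \<theta> ^ 3) * F \<theta>) (at \<theta>)"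
      by (rule derivative_eq_intros dF dG1 dG2 refl)+ (simp add: power2_eq_square power3_eq_cube algebra_simps)
    assume th: "0 \<le> \<theta>" "\<theta> \<le> 1"
    have e3: "exp \<bar>\<theta> * w a\<bar> \<le> 3" if "a \<in> J" for a
    proof -
      have "\<bar>\<theta> * w a\<bar> \<le> 1" using th w[OF that] om by (simp add: abs_mult mult_le_one)
      then have "exp \<bar>\<theta> * w a\<bar> \<le> exp 1" by simp
      then show ?thesis using exp_le by linarith
    qed
    have su: "s \<theta> a \<le> 3 * g a" if "a \<in> J" for a
    proof -
      have "s \<theta> a \<le> exp \<bar>\<theta> * w a\<bar> * g a" unfolding s_def g_def by (rule lgs_shift_le)
      also have "\<dots> \<le> 3 * g a" using e3[OF that] by (intro mult_right_mono) (auto simp: g_def)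
      finally show ?thesis .
    qed
    have sl: "g a \<le> 3 * s \<theta> a" if "a \<in> J" for a
    proof -
      have "g a \<le> exp \<bar>- (\<theta> * w a)\<bar> * s \<theta> a"
        unfolding s_def g_def using lgs_shift_le[of "t a + \<theta> * w a" "- (\<theta> * w a)"] by simp
      also have "\<dots> \<le> 3 * s \<theta> a" using e3[OF that] by (intro mult_right_mono) (auto simp: s_def)
      finally show ?thesis .
    qed
    have s01: "0 \<le> s \<theta> a" "s \<theta> a \<le> 1" for a by (auto simp: s_def)
    have A3: "A \<le> 3 * (\<Sum>a\<in>J. s \<theta> a)" unfolding A_def sum_distrib_left by (intro sum_mono sl)
    have "F \<theta> \<le> exp (- (\<Sum>a\<in>J. s \<theta> a))" unfolding F_def s_def by (rule hprod_le_exp)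
    also have "\<dots> \<le> exp (- A / 3)" using A3 by simp
    finally have FA: "F \<theta> \<le> exp (- A / 3)" .
    have F0: "0 \<le> F \<theta>" unfolding F_def by (rule hprod_nonneg)
    have G1a: "\<bar>G1 \<theta>\<bar> \<le> 3 * (\<Sum>a\<in>J. \<bar>w a\<bar> * g a)"
    proof -
      have "\<bar>G1 \<theta>\<bar> \<le> (\<Sum>a\<in>J. \<bar>w a * s \<theta> a\<bar>)" unfolding G1_def by (rule sum_abs)
      also have "\<dots> \<le> (\<Sum>a\<in>J. 3 * (\<bar>w a\<bar> * g a))"
      proof (intro sum_mono)
        fix a assume "a \<in> J"
        then have "\<bar>w a\<bar> * s \<theta> a \<le> \<bar>w a\<bar> * (3 * g a)" by (intro mult_left_mono su) auto
        then show "\<bar>w a * s \<theta> a\<bar> \<le> 3 * (\<bar>w a\<bar> * g a)" using s01[of a] by (simp add: abs_mult)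
      qed
      finally show ?thesis by (simp add: sum_distrib_left)
    qed
    define Q where "Q = (\<Sum>a\<in>J. \<bar>w a\<bar> * g a)"
    have Q0: "0 \<le> Q" unfolding Q_def g_def by (intro sum_nonneg) auto
    have QA: "Q \<le> \<omega> * A" unfolding Q_def A_def sum_distrib_left
      by (intro sum_mono mult_right_mono w) (auto simp: g_def)
    have QAB: "Q^2 \<le> A * B" using sum_mult_square_le[of J g "\<lambda>a. \<bar>w a\<bar>"]
      unfolding Q_def A_def B_def by (simp add: g_def)
    have G2a: "\<bar>G2 \<theta>\<bar> \<le> 3 * B"
    proof -
      have "\<bar>G2 \<theta>\<bar> \<le> (\<Sum>a\<in>J. \<bar>(w a)^2 * (s \<theta> a * (1 - s \<theta> a))\<bar>)" unfolding G2_def by (rule sum_abs)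
      also have "\<dots> \<le> (\<Sum>a\<in>J. 3 * ((w a)^2 * g a))"
      proof (intro sum_mono)
        fix a assume a: "a \<in> J"
        have "s \<theta> a * (1 - s \<theta> a) \<le> s \<theta> a * 1" using s01[of a] by (intro mult_left_mono) auto
        then have "(w a)^2 * (s \<theta> a * (1 - s \<theta> a)) \<le> (w a)^2 * (3 * g a)"
          using su[OF a] by (intro mult_left_mono) auto
        then show "\<bar>(w a)^2 * (s \<theta> a * (1 - s \<theta> a))\<bar> \<le> 3 * ((w a)^2 * g a)"
          using s01[of a] by (simp add: abs_mult)
      qed
      finally show ?thesis unfolding B_def by (simp add: sum_distrib_left)
    qed
    have G3a: "\<bar>G3 \<theta>\<bar> \<le> 3 * \<omega> * B"
    proof -
      have "\<bar>G3 \<theta>\<bar> \<le> (\<Sum>a\<in>J. \<bar>(w a)^3 * (s \<theta> a * (1 - s \<theta> a) * (1 - 2 * s \<theta> a))\<bar>)"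
        unfolding G3_def by (rule sum_abs)
      also have "\<dots> \<le> (\<Sum>a\<in>J. 3 * \<omega> * ((w a)^2 * g a))"
      proof (intro sum_mono)
        fix a assume a: "a \<in> J"
        have 1: "\<bar>1 - 2 * s \<theta> a\<bar> \<le> 1" using s01[of a] by auto
        have "\<bar>s \<theta> a * (1 - s \<theta> a) * (1 - 2 * s \<theta> a)\<bar> \<le> s \<theta> a * 1 * 1"
          unfolding abs_mult using s01[of a] 1 by (intro mult_mono) auto
        then have "\<bar>s \<theta> a * (1 - s \<theta> a) * (1 - 2 * s \<theta> a)\<bar> \<le> 3 * g a" using su[OF a] by linarith
        moreover have "\<bar>(w a)^3\<bar> \<le> \<omega> * (w a)^2"
          using w[OF a] by (simp add: power3_eq_cube power2_eq_square abs_mult mult_mono)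
             (metis abs_ge_zero abs_mult_self_eq mult_right_mono mult.assoc zero_le_mult_iff)
        ultimately have "\<bar>(w a)^3\<bar> * \<bar>s \<theta> a * (1 - s \<theta> a) * (1 - 2 * s \<theta> a)\<bar> \<le> (\<omega> * (w a)^2) * (3 * g a)"
          using om0 by (intro mult_mono) auto
        then show "\<bar>(w a)^3 * (s \<theta> a * (1 - s \<theta> a) * (1 - 2 * s \<theta> a))\<bar> \<le> 3 * \<omega> * ((w a)^2 * g a)"
          by (simp add: abs_mult mult_ac)
      qed
      finally show ?thesis unfolding B_def by (simp add: sum_distrib_left)
    qed
    have G1Q: "\<bar>G1 \<theta>\<bar> \<le> 3 * Q" using G1a by (simp add: Q_def)
    have c3: "\<bar>G1 \<theta>\<bar>^3 \<le> 27 * (\<omega> * A * (A * B))"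
    proof -
      have "\<bar>G1 \<theta>\<bar>^3 \<le> (3 * Q)^3" using G1Q by (intro power_mono) auto
      also have "\<dots> = 27 * (Q * Q^2)" by (simp add: power3_eq_cube power2_eq_square)
      also have "\<dots> \<le> 27 * ((\<omega> * A) * (A * B))"
        using QA QAB Q0 om0 A0 by (intro mult_left_mono mult_mono) auto
      finally show ?thesis .
    qed
    have c12: "\<bar>3 * G1 \<theta> * G2 \<theta>\<bar> \<le> 27 * (\<omega> * A * B)"
    proof -
      have "\<bar>G1 \<theta>\<bar> * \<bar>G2 \<theta>\<bar> \<le> (3 * (\<omega> * A)) * (3 * B)"
        using G1Q QA G2a om0 A0 by (intro mult_mono) auto
      then show ?thesis by (simp add: abs_mult mult_ac)
    qed
    have "\<bar>3 * G1 \<theta> * G2 \<theta> - G3 \<theta> - G1 \<theta> ^ 3\<bar> \<le> \<bar>3 * G1 \<theta> * G2 \<theta>\<bar> + \<bar>G3 \<theta>\<bar> + \<bar>G1 \<theta>\<bar>^3"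
      by (simp add: power_abs[symmetric])
    also have "\<dots> \<le> 27 * (\<omega> * A * B) + 3 * \<omega> * B + 27 * (\<omega> * A * (A * B))"
      using c3 c12 G3a by linarith
    also have "\<dots> = (\<omega> * B) * (27 * A + 3 + 27 * A^2)" by (simp add: power2_eq_square algebra_simps)
    finally have P: "\<bar>3 * G1 \<theta> * G2 \<theta> - G3 \<theta> - G1 \<theta> ^ 3\<bar> \<le> (\<omega> * B) * (27 * A + 3 + 27 * A^2)" .
    have "\<bar>(3 * G1 \<theta> * G2 \<theta> - G3 \<theta> - G1 \<theta> ^ 3) * F \<theta>\<bar>
        \<le> ((\<omega> * B) * (27 * A + 3 + 27 * A^2)) * exp (- A / 3)"
      unfolding abs_mult using P FA F0 om0 B0 A0 by (intro mult_mono) auto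
    also have "\<dots> = (\<omega> * B) * (27 * (A * exp (- A / 3)) + 3 * exp (- A/3) + 27 * (A^2 * exp (- A / 3)))"
      by (simp add: algebra_simps)
    also have "\<dots> \<le> (\<omega> * B) * (27 * 3 + 3 * 1 + 27 * 36)"
      using mult_exp_le[OF A0] A0 om0 B0 by (intro mult_left_mono add_mono) auto
    finally show "\<bar>(3 * G1 \<theta> * G2 \<theta> - G3 \<theta> - G1 \<theta> ^ 3) * F \<theta>\<bar> \<le> 1056 * \<omega> * B" by simp
  qed
  then show ?thesis
    by (simp add: F_def G1_def G2_def s_def g_def B_def)
qed

section \<open>Replacement in one dimension\<close>

lemma measurable_fun_upd_PiM:
  assumes "i \<in> I"
  shows "(\<lambda>(x, y). x(i := y)) \<in> measurable (PiM (I - {i}) (\<lambda>_. N) \<Otimes>\<^sub>M N) (PiM I (\<lambda>_. N))"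
proof -
  have "(\<lambda>(f, y). f(i := y)) \<in> measurable (PiM (I - {i}) (\<lambda>_. N) \<Otimes>\<^sub>M N) (PiM (insert i (I - {i})) (\<lambda>_. N))"
    by (rule measurable_add_dim)
  then show ?thesis using assms by (simp add: insert_absorb)
qed

lemma integrable_bounded_prob:
  fixes f :: "'a \<Rightarrow> real"
  assumes "prob_space M" "f \<in> borel_measurable M" "\<And>x. x \<in> space M \<Longrightarrow> \<bar>f x\<bar> \<le> B"
  shows "integrable M f"
proof -
  interpret prob_space M by fact
  show ?thesis using assms(2,3) by (intro integrable_const_bound[where B = B]) auto
qed

lemma PiM_swap_integral:
  fixes F :: "('i \<Rightarrow> 'b) \<Rightarrow> real"
  assumes fin: "finite I" and i: "i \<in> I"
    and K: "\<And>j. prob_space (K j)" "\<And>j. sets (K j) = sets N"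
    and mu: "prob_space \<mu>" "sets \<mu> = sets N"
    and F: "F \<in> borel_measurable (PiM I (\<lambda>_. N))" "\<And>x. x \<in> space (PiM I (\<lambda>_. N)) \<Longrightarrow> \<bar>F x\<bar> \<le> B"
  shows "(\<integral>x. F x \<partial>PiM I (K(i := \<mu>))) = (\<integral>x. (\<integral>y. F (x(i := y)) \<partial>\<mu>) \<partial>PiM (I - {i}) K)"
    and "integrable (PiM (I - {i}) K) (\<lambda>x. \<integral>y. F (x(i := y)) \<partial>\<mu>)"
proof -
  let ?K = "K(i := \<mu>)"
  have pK: "prob_space (?K j)" for j using K mu by simp
  have sK: "sets (?K j) = sets N" for j using K mu by simp
  interpret product_prob_space ?K by (rule product_prob_spaceI) (rule pK)
  have II: "insert i (I - {i}) = I" using i by auto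
  have sI: "sets (PiM I ?K) = sets (PiM I (\<lambda>_. N))" by (intro sets_PiM_cong refl sK)
  have s': "sets (PiM (I - {i}) K) = sets (PiM (I - {i}) (\<lambda>_. N))" by (intro sets_PiM_cong refl K(2))
  have F': "F \<in> borel_measurable (PiM I ?K)" using F(1) sI by (simp cong: measurable_cong_sets)
  have "integrable (PiM I ?K) F"
    using F' F(2) sets_eq_imp_space_eq[OF sI]
    by (intro integrable_bounded_prob[where B = B] prob_space_PiM pK) auto
  then have "integrable (PiM (insert i (I - {i})) ?K) F" by (simp only: II)
  from product_integral_insert[OF _ _ this]
  have "(\<integral>x. F x \<partial>PiM (insert i (I - {i})) ?K) = (\<integral>x. (\<integral>y. F (x(i := y)) \<partial>?K i) \<partial>PiM (I - {i}) ?K)"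
    using fin by simp
  also have "PiM (I - {i}) ?K = PiM (I - {i}) K" by (intro PiM_cong) auto
  finally show "(\<integral>x. F x \<partial>PiM I ?K) = (\<integral>x. (\<integral>y. F (x(i := y)) \<partial>\<mu>) \<partial>PiM (I - {i}) K)"
    by (simp only: II fun_upd_same)
  interpret mu: prob_space \<mu> by fact
  interpret PK: prob_space "PiM (I - {i}) K" by (intro prob_space_PiM K)
  have m: "(\<lambda>(x, y). F (x(i := y))) \<in> borel_measurable (PiM (I - {i}) (\<lambda>_. N) \<Otimes>\<^sub>M N)"
    using measurable_compose[OF measurable_fun_upd_PiM[OF i] F(1)] by (simp add: case_prod_beta)
  have "sets (PiM (I - {i}) K \<Otimes>\<^sub>M \<mu>) = sets (PiM (I - {i}) (\<lambda>_. N) \<Otimes>\<^sub>M N)"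
    by (intro sets_pair_measure_cong s' mu)
  then have m': "(\<lambda>(x, y). F (x(i := y))) \<in> borel_measurable (PiM (I - {i}) K \<Otimes>\<^sub>M \<mu>)"
    using m by (simp cong: measurable_cong_sets)
  have meas: "(\<lambda>x. \<integral>y. F (x(i := y)) \<partial>\<mu>) \<in> borel_measurable (PiM (I - {i}) K)"
    using mu.borel_measurable_lebesgue_integral[OF m'] by simp
  have bd: "\<bar>\<integral>y. F (x(i := y)) \<partial>\<mu>\<bar> \<le> B" if x: "x \<in> space (PiM (I - {i}) K)" for x
  proof -
    have sp: "x(i := y) \<in> space (PiM I (\<lambda>_. N))" if y: "y \<in> space \<mu>" for y
    proof -
      have "y \<in> space N" using y sets_eq_imp_space_eq[OF mu(2)] by simp
      moreover have "x \<in> space (PiM (I - {i}) (\<lambda>_. N))" using x sets_eq_imp_space_eq[OF s'] by simp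
      ultimately show ?thesis
        using measurable_space[OF measurable_fun_upd_PiM[OF i, of N], of "(x, y)"]
        by (simp add: space_pair_measure)
    qed
    have "(\<lambda>y. F (x(i := y))) \<in> borel_measurable \<mu>"
      using measurable_Pair2[OF m' x] by simp
    then have int: "integrable \<mu> (\<lambda>y. F (x(i := y)))"
      by (intro integrable_bounded_prob[where B = B] mu F(2) sp)
    have 1: "(\<integral>y. F (x(i := y)) \<partial>\<mu>) \<le> B"
      by (intro mu.integral_le_const int AE_I2) (use F(2) sp in \<open>auto simp: abs_le_iff\<close>)
    have 2: "- B \<le> (\<integral>y. F (x(i := y)) \<partial>\<mu>)"
      by (intro mu.integral_ge_const int AE_I2) (use F(2) sp in \<open>fastforce simp: abs_le_iff\<close>)
    from 1 2 show ?thesis by (simp add: abs_le_iff)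
  qed
  show "integrable (PiM (I - {i}) K) (\<lambda>x. \<integral>y. F (x(i := y)) \<partial>\<mu>)"
    by (rule integrable_bounded_prob[OF PK.prob_space_axioms meas bd])
qed

lemma PiM_swap_bound:
  fixes F :: "('i \<Rightarrow> 'b) \<Rightarrow> real"
  assumes fin: "finite I" and i: "i \<in> I"
    and K: "\<And>j. prob_space (K j)" "\<And>j. sets (K j) = sets N"
    and mu: "prob_space \<mu>" "sets \<mu> = sets N"
    and nu: "prob_space \<nu>" "sets \<nu> = sets N"
    and F: "F \<in> borel_measurable (PiM I (\<lambda>_. N))" "\<And>x. x \<in> space (PiM I (\<lambda>_. N)) \<Longrightarrow> \<bar>F x\<bar> \<le> B"
    and R: "integrable (PiM (I - {i}) K) R"
      "\<And>x. x \<in> space (PiM (I - {i}) (\<lambda>_. N)) \<Longrightarrow>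
         \<bar>(\<integral>y. F (x(i := y)) \<partial>\<mu>) - (\<integral>y. F (x(i := y)) \<partial>\<nu>)\<bar> \<le> R x"
  shows "\<bar>(\<integral>x. F x \<partial>PiM I (K(i := \<mu>))) - (\<integral>x. F x \<partial>PiM I (K(i := \<nu>)))\<bar>
     \<le> (\<integral>x. R x \<partial>PiM (I - {i}) K)"
proof -
  note 1 = PiM_swap_integral[OF fin i K mu F] and 2 = PiM_swap_integral[OF fin i K nu F]
  have s': "sets (PiM (I - {i}) K) = sets (PiM (I - {i}) (\<lambda>_. N))" by (intro sets_PiM_cong refl K(2))
  let ?D = "\<lambda>x. (\<integral>y. F (x(i := y)) \<partial>\<mu>) - (\<integral>y. F (x(i := y)) \<partial>\<nu>)"
  have "\<bar>\<integral>x. ?D x \<partial>PiM (I - {i}) K\<bar> \<le> (\<integral>x. \<bar>?D x\<bar> \<partial>PiM (I - {i}) K)"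
    by (rule integral_abs_bound)
  also have "\<dots> \<le> (\<integral>x. R x \<partial>PiM (I - {i}) K)"
    using R 1(2) 2(2) sets_eq_imp_space_eq[OF s'] by (intro integral_mono) auto
  finally show ?thesis using 1 2 by simp
qed

lemma sum_fun_upd_remove:
  fixes x :: "'i \<Rightarrow> real"
  assumes "finite I" "i \<in> I"
  shows "(\<Sum>j\<in>I. (x(i := y)) j) = y + (\<Sum>j\<in>I - {i}. x j)"
proof -
  have "(\<Sum>j\<in>I. (x(i := y)) j) = (x(i := y)) i + (\<Sum>j\<in>I - {i}. (x(i := y)) j)"
    using assms by (rule sum.remove)
  also have "(\<Sum>j\<in>I - {i}. (x(i := y)) j) = (\<Sum>j\<in>I - {i}. x j)" by (intro sum.cong) auto
  finally show ?thesis by simp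
qed

lemma PiM_lgs_compare:
  fixes \<mu> \<nu> :: "'i \<Rightarrow> real measure"  and t :: real
  assumes fin: "finite I"
    and mu: "\<And>j. prob_space (\<mu> j)" "\<And>j. sets (\<mu> j) = sets borel"
    and nu: "\<And>j. prob_space (\<nu> j)" "\<And>j. sets (\<nu> j) = sets borel"
    and e: "\<And>j. j \<in> I \<Longrightarrow> 0 \<le> \<epsilon> j"
    and step: "\<And>j s. j \<in> I \<Longrightarrow> \<bar>(\<integral>y. lgs (s + y) \<partial>\<mu> j) - (\<integral>y. lgs (s + y) \<partial>\<nu> j)\<bar>
         \<le> \<epsilon> j * (\<integral>y. lgs (s + y) \<partial>\<nu> j)"
    and small: "(\<Sum>j\<in>I. \<epsilon> j) \<le> 1"
  defines "G \<equiv> \<integral>x. lgs (t + (\<Sum>j\<in>I. x j)) \<partial>PiM I \<nu>"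
  shows "\<bar>(\<integral>x. lgs (t + (\<Sum>j\<in>I. x j)) \<partial>PiM I \<mu>) - G\<bar> \<le> 2 * (\<Sum>j\<in>I. \<epsilon> j) * G"
proof -
  let ?F = "\<lambda>x. lgs (t + (\<Sum>j\<in>I. x j))"
  define H where "H B = (\<lambda>j. if j \<in> B then \<mu> j else \<nu> j)" for B
  have H: "prob_space (H B j)" "sets (H B j) = sets borel" for B j
    using mu nu by (auto simp: H_def)
  have F: "?F \<in> borel_measurable (PiM I (\<lambda>_. borel))" by measurable
  have F1: "\<bar>?F x\<bar> \<le> 1" for x by simp
  have sH: "sets (PiM I (H B)) = sets (PiM I (\<lambda>_. borel))" for B by (intro sets_PiM_cong refl H)
  have intF: "integrable (PiM I (H B)) ?F" for B
    using F F1 sH by (intro integrable_bounded_prob[where B=1] prob_space_PiM H) (auto cong: measurable_cong_sets)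
  have G0: "0 \<le> G" unfolding G_def by (intro Bochner_Integration.integral_nonneg) auto
  have key: "\<bar>(\<integral>x. ?F x \<partial>PiM I (H (insert i B))) - (\<integral>x. ?F x \<partial>PiM I (H B))\<bar>
      \<le> \<epsilon> i * (\<integral>x. ?F x \<partial>PiM I (H B))" if i: "i \<in> I" "i \<notin> B" for i B
  proof -
    have 1: "H (insert i B) = (H B)(i := \<mu> i)" and 2: "H B = (H B)(i := \<nu> i)"
      using i by (auto simp: H_def fun_eq_iff)
    note sw = PiM_swap_integral[where K = "H B" and \<mu> = "\<nu> i" and F = ?F, OF fin i(1) H nu F F1]
    have "\<bar>(\<integral>x. ?F x \<partial>PiM I ((H B)(i := \<mu> i))) - (\<integral>x. ?F x \<partial>PiM I ((H B)(i := \<nu> i)))\<bar>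
       \<le> (\<integral>x. \<epsilon> i * (\<integral>y. ?F (x(i := y)) \<partial>\<nu> i) \<partial>PiM (I - {i}) (H B))"
    proof (rule PiM_swap_bound[OF fin i(1) H mu nu F F1])
      show "integrable (PiM (I - {i}) (H B)) (\<lambda>x. \<epsilon> i * (\<integral>y. ?F (x(i := y)) \<partial>\<nu> i))"
        using sw(2) by (intro integrable_mult_right) auto
      fix x
      have "t + (\<Sum>j\<in>I. (x(i := y)) j) = (t + (\<Sum>j\<in>I - {i}. x j)) + y" for y
        by (simp only: sum_fun_upd_remove[OF fin i(1)])
      then show "\<bar>(\<integral>y. ?F (x(i := y)) \<partial>\<mu> i) - (\<integral>y. ?F (x(i := y)) \<partial>\<nu> i)\<bar>
         \<le> \<epsilon> i * (\<integral>y. ?F (x(i := y)) \<partial>\<nu> i)"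
        by (simp only:) (rule step[OF i(1)])
    qed
    also have "\<dots> = \<epsilon> i * (\<integral>x. ?F x \<partial>PiM I ((H B)(i := \<nu> i)))"
      using sw by simp
    finally show ?thesis using 1 2 by metis
  qed
  have "\<bar>(\<integral>x. ?F x \<partial>PiM I (H B)) - G\<bar> \<le> 2 * (\<Sum>j\<in>B. \<epsilon> j) * G" if "B \<subseteq> I" for B
  proof -
    have "finite B" using that fin by (rule finite_subset)
    have "\<bar>(\<integral>x. ?F x \<partial>PiM I (H B)) - G\<bar> \<le> ((\<Prod>j\<in>B. 1 + \<epsilon> j) - 1) * G"
      using \<open>finite B\<close> that
    proof (induction B rule: finite_induct)
      case empty
      then show ?case by (simp add: G_def H_def)
    next
      case (insert i B)
      let ?I = "\<integral>x. ?F x \<partial>PiM I (H B)" and ?P = "\<Prod>j\<in>B. 1 + \<epsilon> j"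
      have IH: "\<bar>?I - G\<bar> \<le> (?P - 1) * G" using insert by simp
      have "\<bar>(\<integral>x. ?F x \<partial>PiM I (H (insert i B))) - ?I\<bar> \<le> \<epsilon> i * ?I"
        using key[of i B] insert by simp
      also have "\<dots> \<le> \<epsilon> i * (?P * G)"
        using IH e[of i] insert by (intro mult_left_mono) (auto simp: algebra_simps abs_le_iff)
      finally have "\<bar>(\<integral>x. ?F x \<partial>PiM I (H (insert i B))) - G\<bar> \<le> \<epsilon> i * (?P * G) + (?P - 1) * G"
        using IH by linarith
      also have "\<dots> = ((\<Prod>j\<in>insert i B. 1 + \<epsilon> j) - 1) * G"
        using insert by (simp add: algebra_simps)
      finally show ?case .
    qed
    also have "\<dots> \<le> (2 * (\<Sum>j\<in>B. \<epsilon> j)) * G"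
    proof (intro mult_right_mono G0)
      have s1: "(\<Sum>j\<in>B. \<epsilon> j) \<le> 1" using small sum_mono2[OF fin that, of \<epsilon>] e by force
      have s0: "0 \<le> (\<Sum>j\<in>B. \<epsilon> j)" using e that by (intro sum_nonneg) auto
      have "(\<Prod>j\<in>B. 1 + \<epsilon> j) \<le> (\<Prod>j\<in>B. exp (\<epsilon> j))"
        using e that by (intro prod_mono) (auto intro: exp_ge_add_one_self add_nonneg_nonneg)
      also have "\<dots> = exp (\<Sum>j\<in>B. \<epsilon> j)" by (simp add: exp_sum \<open>finite B\<close>)
      also have "\<dots> \<le> 1 + (\<Sum>j\<in>B. \<epsilon> j) + (\<Sum>j\<in>B. \<epsilon> j)^2" using s0 s1 by (rule exp_bound)
      also have "(\<Sum>j\<in>B. \<epsilon> j)^2 \<le> (\<Sum>j\<in>B. \<epsilon> j)" using s0 s1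
        by (simp add: power2_eq_square mult_left_le)
      finally show "(\<Prod>j\<in>B. 1 + \<epsilon> j) - 1 \<le> 2 * (\<Sum>j\<in>B. \<epsilon> j)" by simp
    qed
    finally show ?thesis .
  qed
  from this[of I] have "\<bar>(\<integral>x. ?F x \<partial>PiM I (H I)) - G\<bar> \<le> 2 * (\<Sum>j\<in>I. \<epsilon> j) * G" by simp
  moreover have "PiM I (H I) = PiM I \<mu>" by (intro PiM_cong) (auto simp: H_def)
  ultimately show ?thesis by simp
qed

abbreviation gauss :: "real \<Rightarrow> real measure" where
  "gauss \<sigma> \<equiv> density lborel (\<lambda>x. ennreal (normal_density 0 \<sigma> x))"

lemma integral_gauss_scale:
  fixes F :: "real \<Rightarrow> real"
  assumes s: "0 < \<sigma>" and F: "F \<in> borel_measurable borel"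
  shows "(\<integral>z. F z \<partial>gauss \<sigma>) = (\<integral>u. std_normal_density u * F (\<sigma> * u) \<partial>lborel)"
proof -
  have "(\<integral>z. F z \<partial>gauss \<sigma>) = (\<integral>z. normal_density 0 \<sigma> z * F z \<partial>lborel)"
    using F by (subst integral_density) auto
  also have "\<dots> = \<bar>\<sigma>\<bar> *\<^sub>R (\<integral>u. normal_density 0 \<sigma> (0 + \<sigma> * u) * F (0 + \<sigma> * u) \<partial>lborel)"
    using s by (intro lborel_integral_real_affine) auto
  also have "\<dots> = (\<integral>u. \<sigma> * (normal_density 0 \<sigma> (\<sigma> * u) * F (\<sigma> * u)) \<partial>lborel)"
    using s by simp
  also have "\<dots> = (\<integral>u. std_normal_density u * F (\<sigma> * u) \<partial>lborel)"
    using s by (intro Bochner_Integration.integral_cong)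
      (auto simp: normal_density_def power_mult_distrib real_sqrt_mult field_simps)
  finally show ?thesis .
qed

text \<open>The constant in the third-order Taylor remainder under a Gaussian of standard deviation
  at most 1.\<close>

definition gauss_rem :: real where
  "gauss_rem = (\<integral>u. std_normal_density u * (\<bar>u\<bar>^3 * exp \<bar>u\<bar>) \<partial>lborel)"

lemma integrable_gauss_rem: "integrable lborel (\<lambda>u. std_normal_density u * (\<bar>u\<bar>^3 * exp \<bar>u\<bar>))"
proof (rule Bochner_Integration.integrable_bound)
  show "integrable lborel (\<lambda>u. (exp 1 * sqrt 2) * (normal_density 0 (sqrt 2) u * \<bar>u - 0\<bar>^3))"
    by (intro integrable_mult_right integrable_normal_moment_abs) simp
  show "AE u in lborel. norm (std_normal_density u * (\<bar>u\<bar>^3 * exp \<bar>u\<bar>))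
      \<le> norm ((exp 1 * sqrt 2) * (normal_density 0 (sqrt 2) u * \<bar>u - 0\<bar>^3))"
  proof (intro AE_I2)
    fix u :: real
    have "- u\<^sup>2 / 2 + \<bar>u\<bar> \<le> 1 + - u\<^sup>2 / 4"
      using zero_le_power2[of "\<bar>u\<bar> / 2 - 1"] by (simp add: power2_eq_square algebra_simps)
    then have "exp (- u\<^sup>2 / 2) * exp \<bar>u\<bar> \<le> exp 1 * exp (- u\<^sup>2 / 4)"
      by (simp add: exp_add[symmetric])
    then have "(1 / sqrt (2 * pi)) * (exp (- u\<^sup>2 / 2) * exp \<bar>u\<bar>) * \<bar>u\<bar>^3
       \<le> (1 / sqrt (2 * pi)) * (exp 1 * exp (- u\<^sup>2 / 4)) * \<bar>u\<bar>^3"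
      by (intro mult_right_mono mult_left_mono) auto
    moreover have "normal_density 0 (sqrt 2) u = (1 / sqrt 2) * (1 / sqrt (2 * pi)) * exp (- u\<^sup>2 / 4)"
      by (simp add: normal_density_def real_sqrt_mult)
    ultimately show "norm (std_normal_density u * (\<bar>u\<bar>^3 * exp \<bar>u\<bar>))
      \<le> norm ((exp 1 * sqrt 2) * (normal_density 0 (sqrt 2) u * \<bar>u - 0\<bar>^3))"
      by (simp add: std_normal_density_def abs_mult mult_ac)
  qed
qed measurable

lemma gauss_rem_nonneg: "0 \<le> gauss_rem"
  unfolding gauss_rem_def by (intro Bochner_Integration.integral_nonneg) auto

lemma lgs_poly_bounds:
  "\<bar>1 - lgs t\<bar> \<le> 1" "\<bar>(1 - lgs t) * (1 - 2 * lgs t)\<bar> \<le> 1"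
proof -
  have l: "0 < lgs t" "lgs t < 1" by auto
  show 1: "\<bar>1 - lgs t\<bar> \<le> 1" using l by (simp add: abs_le_iff)
  have "\<bar>1 - 2 * lgs t\<bar> \<le> 1" using l by (simp add: abs_le_iff)
  with 1 show "\<bar>(1 - lgs t) * (1 - 2 * lgs t)\<bar> \<le> 1" unfolding abs_mult by (intro mult_le_one) auto
qed

lemma lgs_smooth_gauss:
  assumes s: "0 < \<sigma>" "\<sigma> \<le> 1"
  shows "\<bar>(\<integral>y. lgs (t + y) \<partial>gauss \<sigma>) - lgs t * (1 + (1 - lgs t) * (1 - 2 * lgs t) * \<sigma>^2 / 2)\<bar>
     \<le> gauss_rem * \<sigma>^3 * lgs t"
proof -
  let ?n = std_normal_density
  let ?l = "lgs t"
  let ?T = "\<lambda>u. ?l + ?l * (1 - ?l) * (\<sigma> * u) + ?l * (1 - ?l) * (1 - 2 * ?l) * (\<sigma> * u)^2 / 2"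
  have i0: "integrable lborel ?n" by simp
  have i1: "integrable lborel (\<lambda>u. ?n u * u)" using integrable_std_normal_moment[of 1] by simp
  have i2: "integrable lborel (\<lambda>u. ?n u * u^2)" using integrable_std_normal_moment[of 2] by simp
  have v1: "(\<integral>u. ?n u * u \<partial>lborel) = 0" using integral_normal_moment_nz_1[of 1 0] by simp
  have v2: "(\<integral>u. ?n u * u^2 \<partial>lborel) = 1"
    using integral_normal_moment_even[of 1 0 1] by (simp add: fact_numeral numeral_2_eq_2)
  have iL: "integrable lborel (\<lambda>u. ?n u * lgs (t + \<sigma> * u))"
  proof (rule Bochner_Integration.integrable_bound[OF i0])
    show "AE u in lborel. norm (?n u * lgs (t + \<sigma> * u)) \<le> norm (?n u)"
      by (intro AE_I2) (simp add: abs_mult mult_left_le)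
  qed measurable
  have T: "?n u * ?T u = ?l * ?n u + (?l * (1 - ?l) * \<sigma>) * (?n u * u)
       + (?l * (1 - ?l) * (1 - 2 * ?l) * \<sigma>^2 / 2) * (?n u * u^2)" for u
    by (simp add: power_mult_distrib algebra_simps)
  have iT: "integrable lborel (\<lambda>u. ?n u * ?T u)"
    unfolding T using i0 i1 i2 by auto
  have vT: "(\<integral>u. ?n u * ?T u \<partial>lborel) = ?l * (1 + (1 - ?l) * (1 - 2 * ?l) * \<sigma>^2 / 2)"
    unfolding T using i0 i1 i2 v1 v2
    by (subst Bochner_Integration.integral_add; (intro Bochner_Integration.integrable_add integrable_mult_right i0 i1 i2)?)+
      (simp only: Bochner_Integration.integral_mult_right_zero v1 v2, simp add: algebra_simps)
  have "\<bar>(\<integral>u. ?n u * lgs (t + \<sigma> * u) \<partial>lborel) - (\<integral>u. ?n u * ?T u \<partial>lborel)\<bar>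
      = \<bar>\<integral>u. ?n u * lgs (t + \<sigma> * u) - ?n u * ?T u \<partial>lborel\<bar>"
    using iL iT by simp
  also have "\<dots> \<le> (\<integral>u. \<bar>?n u * lgs (t + \<sigma> * u) - ?n u * ?T u\<bar> \<partial>lborel)"
    by (rule integral_abs_bound)
  also have "\<dots> \<le> (\<integral>u. (\<sigma>^3 * ?l) * (?n u * (\<bar>u\<bar>^3 * exp \<bar>u\<bar>)) \<partial>lborel)"
  proof (intro integral_mono)
    show "integrable lborel (\<lambda>u. \<bar>?n u * lgs (t + \<sigma> * u) - ?n u * ?T u\<bar>)"
      using iL iT by auto
    show "integrable lborel (\<lambda>u. (\<sigma>^3 * ?l) * (?n u * (\<bar>u\<bar>^3 * exp \<bar>u\<bar>)))"
      by (intro integrable_mult_right integrable_gauss_rem)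
    fix u
    have "\<bar>lgs (t + \<sigma> * u) - ?T u\<bar> \<le> \<bar>\<sigma> * u\<bar>^3 * exp \<bar>\<sigma> * u\<bar> * ?l / 6"
      using lgs_taylor[of t "\<sigma> * u"] by (simp add: algebra_simps)
    also have "\<dots> \<le> \<bar>\<sigma> * u\<bar>^3 * exp \<bar>u\<bar> * ?l"
    proof -
      have "\<bar>\<sigma> * u\<bar>^3 * exp \<bar>\<sigma> * u\<bar> * ?l \<le> \<bar>\<sigma> * u\<bar>^3 * exp \<bar>u\<bar> * ?l"
        using s by (intro mult_right_mono mult_left_mono) (auto simp: abs_mult mult_left_le_one_le)
      moreover have "0 \<le> \<bar>\<sigma> * u\<bar>^3 * exp \<bar>\<sigma> * u\<bar> * ?l" by simp
      ultimately show ?thesis by linarith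
    qed
    finally have "?n u * \<bar>lgs (t + \<sigma> * u) - ?T u\<bar> \<le> ?n u * (\<bar>\<sigma> * u\<bar>^3 * exp \<bar>u\<bar> * ?l)"
      by (intro mult_left_mono) auto
    then show "\<bar>?n u * lgs (t + \<sigma> * u) - ?n u * ?T u\<bar> \<le> (\<sigma>^3 * ?l) * (?n u * (\<bar>u\<bar>^3 * exp \<bar>u\<bar>))"
      using s by (simp add: right_diff_distrib[symmetric] abs_mult power_mult_distrib mult_ac)
  qed
  also have "\<dots> = gauss_rem * \<sigma>^3 * ?l" by (simp add: gauss_rem_def)
  finally show ?thesis
    using vT by (subst integral_gauss_scale[OF s(1)]) (auto simp: mult_ac)
qed

lemma lgs_smooth_bounded:
  assumes M: "prob_space \<mu>" "sets \<mu> = sets borel"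
    and b: "AE y in \<mu>. \<bar>y\<bar> \<le> \<omega>" and om: "\<omega> \<le> 1"
  defines "m1 \<equiv> \<integral>y. y \<partial>\<mu>" and "m2 \<equiv> \<integral>y. y^2 \<partial>\<mu>"
  shows "\<bar>(\<integral>y. lgs (t + y) \<partial>\<mu>) - lgs t * (1 + (1 - lgs t) * m1 + (1 - lgs t) * (1 - 2 * lgs t) * m2 / 2)\<bar>
     \<le> \<omega> * m2 * lgs t"
proof -
  interpret prob_space \<mu> by fact
  have [measurable_cong]: "sets \<mu> = sets borel" by fact
  let ?l = "lgs t"
  let ?T = "\<lambda>y. ?l + ?l * (1 - ?l) * y + ?l * (1 - ?l) * (1 - 2 * ?l) * y^2 / 2"
  have i1: "integrable \<mu> (\<lambda>y. y)" using b by (intro integrable_const_bound[where B=\<omega>]) auto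
  have i2: "integrable \<mu> (\<lambda>y. y^2)"
  proof (rule integrable_const_bound[where B="\<omega>^2"])
    show "AE y in \<mu>. norm (y^2) \<le> \<omega>^2" using b by eventually_elim (auto simp: abs_le_square_iff[symmetric])
  qed auto
  have iL: "integrable \<mu> (\<lambda>y. lgs (t + y))" by (intro integrable_const_bound[where B=1]) auto
  have "\<bar>(\<integral>y. lgs (t + y) \<partial>\<mu>) - (\<integral>y. ?T y \<partial>\<mu>)\<bar> = \<bar>\<integral>y. lgs (t + y) - ?T y \<partial>\<mu>\<bar>"
    using iL i1 i2 by simp
  also have "\<dots> \<le> (\<integral>y. \<bar>lgs (t + y) - ?T y\<bar> \<partial>\<mu>)" by (rule integral_abs_bound)
  also have "\<dots> \<le> (\<integral>y. (\<omega> * ?l) * y^2 \<partial>\<mu>)"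
  proof (intro integral_mono_AE)
    show "integrable \<mu> (\<lambda>y. \<bar>lgs (t + y) - ?T y\<bar>)" using iL i1 i2 by auto
    show "integrable \<mu> (\<lambda>y. (\<omega> * ?l) * y^2)" using i2 by auto
    show "AE y in \<mu>. \<bar>lgs (t + y) - ?T y\<bar> \<le> (\<omega> * ?l) * y^2"
      using b
    proof eventually_elim
      fix y :: real assume y: "\<bar>y\<bar> \<le> \<omega>"
      have "\<bar>lgs (t + y) - ?T y\<bar> \<le> \<bar>y\<bar>^3 * exp \<bar>y\<bar> * ?l / 6"
        using lgs_taylor[of t y] by (simp add: algebra_simps)
      also have "\<dots> \<le> (\<omega> * y^2) * 3 * ?l / 6"
      proof (intro divide_right_mono mult_right_mono mult_mono)
        show "\<bar>y\<bar>^3 \<le> \<omega> * y^2" using mult_right_mono[OF y zero_le_power2[of y]] by (simp add: power3_eq_cube power2_eq_square mult_ac)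
        have "exp \<bar>y\<bar> \<le> exp 1" using y om by simp
        then show "exp \<bar>y\<bar> \<le> 3" using exp_le by linarith
      qed (use y in auto)
      also have "\<dots> \<le> (\<omega> * ?l) * y^2" using y by (simp add: mult_ac)
      finally show "\<bar>lgs (t + y) - ?T y\<bar> \<le> (\<omega> * ?l) * y^2" .
    qed
  qed
  also have "\<dots> = \<omega> * m2 * ?l" by (simp add: m2_def)
  finally show ?thesis using i1 i2 by (simp add: m1_def m2_def algebra_simps prob_space)
qed

lemma lgs_smooth_compare:
  assumes M: "prob_space \<mu>" "sets \<mu> = sets borel"
    and b: "AE y in \<mu>. \<bar>y\<bar> \<le> \<omega>" and om: "\<omega> \<le> 1"
    and s: "0 < \<sigma>" "\<sigma> \<le> 1" "\<sigma>^2 + 2 * gauss_rem * \<sigma>^3 \<le> 1"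
  defines "m1 \<equiv> \<integral>y. y \<partial>\<mu>" and "m2 \<equiv> \<integral>y. y^2 \<partial>\<mu>"
  shows "\<bar>(\<integral>y. lgs (t + y) \<partial>\<mu>) - (\<integral>y. lgs (t + y) \<partial>gauss \<sigma>)\<bar>
     \<le> (2 * (\<bar>m1\<bar> + \<bar>m2 - \<sigma>^2\<bar> + \<omega> * m2 + gauss_rem * \<sigma>^3)) * (\<integral>y. lgs (t + y) \<partial>gauss \<sigma>)"
proof -
  let ?l = "lgs t"
  define D where "D = \<bar>m1\<bar> + \<bar>m2 - \<sigma>^2\<bar> + \<omega> * m2 + gauss_rem * \<sigma>^3"
  define p2 where "p2 = (1 - ?l) * (1 - 2 * ?l)"
  define Im where "Im = (\<integral>y. lgs (t + y) \<partial>\<mu>)"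
  define Ig where "Ig = (\<integral>y. lgs (t + y) \<partial>gauss \<sigma>)"
  have p1: "\<bar>1 - ?l\<bar> \<le> 1" and p2': "\<bar>p2\<bar> \<le> 1" using lgs_poly_bounds by (auto simp: p2_def)
  have l0: "0 < ?l" by simp
  have A: "\<bar>Im - ?l * (1 + (1 - ?l) * m1 + p2 * m2 / 2)\<bar> \<le> \<omega> * m2 * ?l"
    using lgs_smooth_bounded[OF M b om, of t] by (simp add: m1_def m2_def p2_def Im_def)
  have B: "\<bar>Ig - ?l * (1 + p2 * \<sigma>^2 / 2)\<bar> \<le> gauss_rem * \<sigma>^3 * ?l"
    using lgs_smooth_gauss[OF s(1,2), of t] by (simp add: p2_def Ig_def)
  have C1: "\<bar>(1 - ?l) * m1\<bar> \<le> \<bar>m1\<bar>" using p1 by (simp add: abs_mult mult_left_le_one_le)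
  have C2: "\<bar>p2 * (m2 - \<sigma>^2)\<bar> \<le> \<bar>m2 - \<sigma>^2\<bar>" using p2' by (simp add: abs_mult mult_left_le_one_le)
  have "\<bar>(1 - ?l) * m1 + p2 * (m2 - \<sigma>^2) / 2\<bar> \<le> \<bar>m1\<bar> + \<bar>m2 - \<sigma>^2\<bar>" using C1 C2 by linarith
  then have "?l * \<bar>(1 - ?l) * m1 + p2 * (m2 - \<sigma>^2) / 2\<bar> \<le> ?l * (\<bar>m1\<bar> + \<bar>m2 - \<sigma>^2\<bar>)"
    by (intro mult_left_mono) auto
  moreover have "?l * (1 + (1 - ?l) * m1 + p2 * m2 / 2) - ?l * (1 + p2 * \<sigma>^2 / 2)
      = ?l * ((1 - ?l) * m1 + p2 * (m2 - \<sigma>^2) / 2)" by (simp add: algebra_simps diff_divide_distrib)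
  ultimately have C: "\<bar>?l * (1 + (1 - ?l) * m1 + p2 * m2 / 2) - ?l * (1 + p2 * \<sigma>^2 / 2)\<bar>
       \<le> ?l * (\<bar>m1\<bar> + \<bar>m2 - \<sigma>^2\<bar>)" by (simp add: abs_mult)
  have 1: "\<bar>Im - Ig\<bar> \<le> D * ?l" using A B C by (simp add: D_def algebra_simps)
  have m20: "0 \<le> m2" unfolding m2_def by simp
  have om0: "0 \<le> \<omega>"
  proof (rule ccontr)
    assume "\<not> 0 \<le> \<omega>"
    then have "AE y in \<mu>. False" using b by (auto elim: eventually_mono)
    then show False using prob_space.AE_False[OF M(1)] by simp
  qed
  have D0: "0 \<le> D" unfolding D_def using m20 om0 gauss_rem_nonneg s by simp
  have "p2 * \<sigma>^2 / 2 \<ge> - (\<sigma>^2 / 2)" using p2' mult_right_mono[of "-1" p2 "\<sigma>^2"] by (simp add: abs_le_iff)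
  then have "1 + p2 * \<sigma>^2 / 2 - gauss_rem * \<sigma>^3 \<ge> 1/2" using s(3) by linarith
  then have "?l * (1 + p2 * \<sigma>^2 / 2 - gauss_rem * \<sigma>^3) \<ge> ?l * (1/2)" by (intro mult_left_mono) auto
  then have "?l \<le> 2 * Ig" using B by (simp add: algebra_simps)
  then have "D * ?l \<le> D * (2 * Ig)" using D0 by (intro mult_left_mono)
  then have "\<bar>Im - Ig\<bar> \<le> (2 * D) * Ig" using 1 by linarith
  then show ?thesis by (simp only: D_def Im_def Ig_def)
qed

lemma (in prob_space) integral_PiM_indep:
  fixes X :: "'i \<Rightarrow> 'a \<Rightarrow> 'b" and F :: "('i \<Rightarrow> 'b) \<Rightarrow> real"
  assumes I: "I \<noteq> {}" and ind: "indep_vars (\<lambda>_. N) X I"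
    and F: "F \<in> borel_measurable (PiM I (\<lambda>_. N))"
  shows "(\<integral>x. F x \<partial>PiM I (\<lambda>i. distr M N (X i))) = expectation (\<lambda>\<omega>. F (\<lambda>i\<in>I. X i \<omega>))"
proof -
  have X: "\<And>i. i \<in> I \<Longrightarrow> random_variable N (X i)" using ind by (auto simp: indep_vars_def)
  have "distr M (PiM I (\<lambda>_. N)) (\<lambda>x. \<lambda>i\<in>I. X i x) = PiM I (\<lambda>i. distr M N (X i))"
    using indep_vars_iff_distr_eq_PiM'[where M' = "\<lambda>_. N" and X = X, OF I X] ind by blast
  then have "(\<integral>x. F x \<partial>PiM I (\<lambda>i. distr M N (X i))) = (\<integral>x. F x \<partial>distr M (PiM I (\<lambda>_. N)) (\<lambda>x. \<lambda>i\<in>I. X i x))"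
    by simp
  also have "\<dots> = expectation (\<lambda>\<omega>. F (\<lambda>i\<in>I. X i \<omega>))"
    by (intro integral_distr measurable_restrict F X)
  finally show ?thesis .
qed

lemma integral_PiM_gauss_sum:
  fixes F :: "real \<Rightarrow> real"
  assumes fin: "finite I" and ne: "I \<noteq> {}" and s: "\<And>i. 0 < \<sigma> i"
    and F: "F \<in> borel_measurable borel"
  shows "(\<integral>x. F (\<Sum>i\<in>I. x i) \<partial>PiM I (\<lambda>i. gauss (\<sigma> i))) = (\<integral>z. F z \<partial>gauss (sqrt (\<Sum>i\<in>I. (\<sigma> i)^2)))"
proof -
  let ?P = "PiM I (\<lambda>i. gauss (\<sigma> i))"
  have pg: "prob_space (gauss (\<sigma> i))" for i using s by (intro prob_space_normal_density)
  interpret P: prob_space ?P by (intro prob_space_PiM pg)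
  have sP: "sets ?P = sets (PiM I (\<lambda>_. borel))" by (intro sets_PiM_cong) auto
  have c[measurable]: "(\<lambda>x. x i) \<in> borel_measurable ?P" if "i \<in> I" for i
    using that by (simp add: measurable_cong_sets[OF sP refl])
  have dc: "distr ?P borel (\<lambda>x. x i) = gauss (\<sigma> i)" if "i \<in> I" for i
  proof -
    have "distr ?P borel (\<lambda>x. x i) = distr ?P (gauss (\<sigma> i)) (\<lambda>x. x i)"
      by (intro distr_cong) auto
    also have "\<dots> = gauss (\<sigma> i)" using distr_PiM_component[of I "\<lambda>i. gauss (\<sigma> i)", OF pg that] by simp
    finally show ?thesis .
  qed
  have ind: "P.indep_vars (\<lambda>_. borel) (\<lambda>i x. x i) I"
  proof (subst P.indep_vars_iff_distr_eq_PiM'[OF ne])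
    have "distr ?P (PiM I (\<lambda>_. borel)) (\<lambda>x. \<lambda>i\<in>I. x i) = distr ?P ?P (\<lambda>x. x)"
      using sP by (intro distr_cong) (auto simp: space_PiM PiE_def extensional_restrict)
    also have "\<dots> = ?P" by (rule distr_id2) simp
    also have "\<dots> = PiM I (\<lambda>i. distr ?P borel (\<lambda>x. x i))" using dc by (intro PiM_cong) auto
    finally show "distr ?P (PiM I (\<lambda>_. borel)) (\<lambda>x. \<lambda>i\<in>I. x i) = PiM I (\<lambda>i. distr ?P borel (\<lambda>x. x i))" .
  qed (use c in auto)
  have "distributed ?P lborel (\<lambda>x. \<Sum>i\<in>I. x i) (normal_density (\<Sum>i\<in>I. 0) (sqrt (\<Sum>i\<in>I. (\<sigma> i)^2)))"
  proof (rule P.sum_indep_normal[OF fin ne ind])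
    fix i assume i: "i \<in> I"
    have "distr ?P lborel (\<lambda>x. x i) = distr ?P borel (\<lambda>x. x i)" by (intro distr_cong) auto
    then show "distributed ?P lborel (\<lambda>x. x i) (normal_density 0 (\<sigma> i))"
      using dc[OF i] c[OF i] by (auto simp: distributed_def)
  qed (use s in auto)
  then have "distributed ?P lborel (\<lambda>x. \<Sum>i\<in>I. x i) (normal_density 0 (sqrt (\<Sum>i\<in>I. (\<sigma> i)^2)))"
    by simp
  from distributed_integral[OF this, of F] F show ?thesis
    by (subst integral_density) auto
qed

section \<open>Decoupling the coordinates\<close>

lemma hprod_expectation_taylor:
  fixes s :: "'j \<Rightarrow> real"
  assumes fin: "finite J" and M: "prob_space \<mu>" "sets \<mu> = sets (PiM J (\<lambda>_. borel))"
    and b: "\<And>a. a \<in> J \<Longrightarrow> AE z in \<mu>. \<bar>z a\<bar> \<le> \<omega>" and om: "\<omega> \<le> 1"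
  defines "g \<equiv> \<lambda>a. lgs (s a)"
  shows "\<bar>(\<integral>z. hprod J (\<lambda>a. s a + z a) \<partial>\<mu>)
      - (hprod J s - (\<Sum>a\<in>J. g a * (\<integral>z. z a \<partial>\<mu>)) * hprod J s
      + ((\<Sum>a\<in>J. \<Sum>b\<in>J. g a * g b * (\<integral>z. z a * z b \<partial>\<mu>))
          - (\<Sum>a\<in>J. g a * (1 - g a) * (\<integral>z. (z a)^2 \<partial>\<mu>))) * hprod J s / 2)\<bar>
    \<le> 176 * \<omega> * (\<Sum>a\<in>J. g a * (\<integral>z. (z a)^2 \<partial>\<mu>))"
proof -
  interpret prob_space \<mu> by fact
  have [measurable_cong]: "sets \<mu> = sets (PiM J (\<lambda>_. borel))" by fact
  have bb: "AE z in \<mu>. \<forall>a\<in>J. \<bar>z a\<bar> \<le> \<omega>" using fin b by (simp add: AE_finite_all)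
  have mc[measurable]: "(\<lambda>z. z a) \<in> borel_measurable \<mu>" if "a \<in> J" for a using that by measurable
  have i1: "integrable \<mu> (\<lambda>z. z a)" if "a \<in> J" for a
    using b[OF that] that by (intro integrable_const_bound[where B=\<omega>]) auto
  have i2: "integrable \<mu> (\<lambda>z. z a * z b)" if "a \<in> J" "b \<in> J" for a b
  proof (rule integrable_const_bound[where B="\<omega> * \<omega>"])
    show "AE z in \<mu>. norm (z a * z b) \<le> \<omega> * \<omega>" using b[OF that(1)] b[OF that(2)]
      by eventually_elim (auto simp: abs_mult intro!: mult_mono)
  qed (use that in measurable)
  have i3: "integrable \<mu> (\<lambda>z. (z a)^2)" if "a \<in> J" for a
    using i2[OF that that] by (simp add: power2_eq_square)
  have mh: "(\<lambda>z. hprod J (\<lambda>a. s a + z a)) \<in> borel_measurable \<mu>"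
    unfolding hprod_def by measurable
  have ih: "integrable \<mu> (\<lambda>z. hprod J (\<lambda>a. s a + z a))"
    using mh by (intro integrable_const_bound[where B=1]) (auto simp: hprod_nonneg hprod_le_1)
  let ?hp = "hprod J s"
  let ?T = "\<lambda>z. ?hp - (\<Sum>a\<in>J. g a * z a) * ?hp
      + ((\<Sum>a\<in>J. \<Sum>b\<in>J. g a * g b * (z a * z b)) - (\<Sum>a\<in>J. g a * (1 - g a) * (z a)^2)) * ?hp / 2"
  have iT: "integrable \<mu> ?T"
    using i1 i2 i3 by (intro Bochner_Integration.integrable_add Bochner_Integration.integrable_diff
      integrable_mult_left Bochner_Integration.integrable_sum integrable_mult_right integrable_divide) auto
  have vT: "(\<integral>z. ?T z \<partial>\<mu>) = ?hp - (\<Sum>a\<in>J. g a * (\<integral>z. z a \<partial>\<mu>)) * ?hp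
      + ((\<Sum>a\<in>J. \<Sum>b\<in>J. g a * g b * (\<integral>z. z a * z b \<partial>\<mu>))
          - (\<Sum>a\<in>J. g a * (1 - g a) * (\<integral>z. (z a)^2 \<partial>\<mu>))) * ?hp / 2"
    using i1 i2 i3 by (simp add: prob_space Bochner_Integration.integral_sum Bochner_Integration.integrable_sum)
  have "\<bar>(\<integral>z. hprod J (\<lambda>a. s a + z a) \<partial>\<mu>) - (\<integral>z. ?T z \<partial>\<mu>)\<bar>
      = \<bar>\<integral>z. hprod J (\<lambda>a. s a + z a) - ?T z \<partial>\<mu>\<bar>" using ih iT by simp
  also have "\<dots> \<le> (\<integral>z. \<bar>hprod J (\<lambda>a. s a + z a) - ?T z\<bar> \<partial>\<mu>)" by (rule integral_abs_bound)
  also have "\<dots> \<le> (\<integral>z. 176 * \<omega> * (\<Sum>a\<in>J. g a * (z a)^2) \<partial>\<mu>)"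
  proof (intro integral_mono_AE)
    show "integrable \<mu> (\<lambda>z. \<bar>hprod J (\<lambda>a. s a + z a) - ?T z\<bar>)" using ih iT by auto
    show "integrable \<mu> (\<lambda>z. 176 * \<omega> * (\<Sum>a\<in>J. g a * (z a)^2))"
      using i3 by (intro integrable_mult_right Bochner_Integration.integrable_sum) auto
    show "AE z in \<mu>. \<bar>hprod J (\<lambda>a. s a + z a) - ?T z\<bar> \<le> 176 * \<omega> * (\<Sum>a\<in>J. g a * (z a)^2)"
      using bb
    proof eventually_elim
      fix z assume z: "\<forall>a\<in>J. \<bar>z a\<bar> \<le> \<omega>"
      have sq: "(\<Sum>a\<in>J. z a * g a)^2 = (\<Sum>a\<in>J. \<Sum>b\<in>J. g a * g b * (z a * z b))"
        by (simp add: power2_eq_square sum_product mult_ac)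
      have "\<bar>hprod J (\<lambda>a. s a + z a) - hprod J s + (\<Sum>a\<in>J. z a * g a) * hprod J s
          - ((\<Sum>a\<in>J. z a * g a)^2 - (\<Sum>a\<in>J. (z a)^2 * (g a * (1 - g a)))) * hprod J s / 2\<bar>
        \<le> 176 * \<omega> * (\<Sum>a\<in>J. (z a)^2 * g a)"
        using hprod_taylor[OF fin om, of z s] z by (simp add: g_def)
      moreover have "(\<Sum>a\<in>J. z a * g a) = (\<Sum>a\<in>J. g a * z a)" by (simp add: mult.commute)
      moreover have "(\<Sum>a\<in>J. (z a)^2 * (g a * (1 - g a))) = (\<Sum>a\<in>J. g a * (1 - g a) * (z a)^2)"
        by (simp add: mult_ac)
      moreover have "(\<Sum>a\<in>J. (z a)^2 * g a) = (\<Sum>a\<in>J. g a * (z a)^2)" by (simp add: mult.commute)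
      ultimately show "\<bar>hprod J (\<lambda>a. s a + z a) - ?T z\<bar> \<le> 176 * \<omega> * (\<Sum>a\<in>J. g a * (z a)^2)"
        unfolding sq by (simp add: algebra_simps)
    qed
  qed
  also have "\<dots> = 176 * \<omega> * (\<Sum>a\<in>J. g a * (\<integral>z. (z a)^2 \<partial>\<mu>))"
    using i3 by (simp add: Bochner_Integration.integral_sum)
  finally show ?thesis unfolding vT .
qed

text \<open>This lets the factor hprod pay for a double sum of lgs terms over weakly correlated pairs.\<close>

lemma square_exp_le: "0 \<le> A \<Longrightarrow> A^2 * exp (- A) \<le> (36::real)"
  using mult_exp_le(2)[of A] mult_left_mono[of "exp (- A)" "exp (- A / 3)" "A^2"] by simp

lemma hprod_step:
  fixes s :: "'j \<Rightarrow> real"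
  assumes fin: "finite J"
    and mu: "prob_space \<mu>" "sets \<mu> = sets (PiM J (\<lambda>_. borel))" "\<And>a. a \<in> J \<Longrightarrow> AE z in \<mu>. \<bar>z a\<bar> \<le> \<omega>"
    and nu: "prob_space \<nu>" "sets \<nu> = sets (PiM J (\<lambda>_. borel))" "\<And>a. a \<in> J \<Longrightarrow> AE z in \<nu>. \<bar>z a\<bar> \<le> \<omega>"
    and om: "\<omega> \<le> 1"
    and m1: "\<And>a. a \<in> J \<Longrightarrow> (\<integral>z. z a \<partial>\<mu>) = (\<integral>z. z a \<partial>\<nu>)"
    and m2: "\<And>a. a \<in> J \<Longrightarrow> (\<integral>z. (z a)^2 \<partial>\<mu>) = (\<integral>z. (z a)^2 \<partial>\<nu>)"
    and le: "0 \<le> \<omega>" "0 \<le> \<rho>" "0 \<le> \<beta>" "\<And>a. a \<in> J \<Longrightarrow> (\<integral>z. (z a)^2 \<partial>\<nu>) \<le> \<beta>"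
    and Sg: "Sg \<subseteq> J \<times> J"
    and weak: "\<And>a b. a \<in> J \<Longrightarrow> b \<in> J \<Longrightarrow> a \<noteq> b \<Longrightarrow> (a, b) \<notin> Sg \<Longrightarrow>
        \<bar>(\<integral>z. z a * z b \<partial>\<mu>) - (\<integral>z. z a * z b \<partial>\<nu>)\<bar> \<le> \<rho>"
    and strong: "\<And>a b. a \<in> J \<Longrightarrow> b \<in> J \<Longrightarrow> a \<noteq> b \<Longrightarrow>
        \<bar>(\<integral>z. z a * z b \<partial>\<mu>) - (\<integral>z. z a * z b \<partial>\<nu>)\<bar> \<le> \<beta>"
    and c: "0 \<le> c" "c \<le> 1"
  shows "\<bar>(\<integral>z. hprod J (\<lambda>a. s a + z a) \<partial>\<mu>) - (\<integral>z. hprod J (\<lambda>a. s a + z a) \<partial>\<nu>)\<bar>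
    \<le> 18 * \<rho> + \<beta> / 2 * (\<Sum>(a, b)\<in>Sg. exp (c * (s a + s b))) + 352 * \<omega> * \<beta> * (\<Sum>a\<in>J. lgs (s a))"
proof -
  define g where "g a = lgs (s a)" for a
  define hp where "hp = hprod J s"
  define C where "C a b = (\<integral>z. z a * z b \<partial>\<mu>) - (\<integral>z. z a * z b \<partial>\<nu>)" for a b
  have g0: "0 \<le> g a" for a by (simp add: g_def)
  have hp: "0 \<le> hp" "hp \<le> 1" by (auto simp: hp_def hprod_nonneg hprod_le_1)
  have Caa: "C a a = 0" if "a \<in> J" for a using m2[OF that] by (simp add: C_def power2_eq_square)
  define P where "P Q = hp - (\<Sum>a\<in>J. g a * (\<integral>z. z a \<partial>Q)) * hp
      + ((\<Sum>a\<in>J. \<Sum>b\<in>J. g a * g b * (\<integral>z. z a * z b \<partial>Q))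
          - (\<Sum>a\<in>J. g a * (1 - g a) * (\<integral>z. (z a)^2 \<partial>Q))) * hp / 2" for Q
  define V where "V = 176 * \<omega> * (\<Sum>a\<in>J. g a * (\<integral>z. (z a)^2 \<partial>\<nu>))"
  have 1: "\<bar>(\<integral>z. hprod J (\<lambda>a. s a + z a) \<partial>\<mu>) - P \<mu>\<bar> \<le> V"
    using hprod_expectation_taylor[OF fin mu om, of s] m2
    by (simp add: P_def V_def g_def hp_def)
  have 2: "\<bar>(\<integral>z. hprod J (\<lambda>a. s a + z a) \<partial>\<nu>) - P \<nu>\<bar> \<le> V"
    using hprod_expectation_taylor[OF fin nu om, of s]
    by (simp add: P_def V_def g_def hp_def)
  have "P \<mu> - P \<nu> = (\<Sum>a\<in>J. \<Sum>b\<in>J. g a * g b * C a b) * hp / 2"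
  proof -
    define A1 A2 where "A1 = (\<Sum>a\<in>J. g a * (\<integral>z. z a \<partial>\<nu>))"
      and "A2 = (\<Sum>a\<in>J. g a * (1 - g a) * (\<integral>z. (z a)^2 \<partial>\<nu>))"
    define B1 B2 where "B1 = (\<Sum>a\<in>J. \<Sum>b\<in>J. g a * g b * (\<integral>z. z a * z b \<partial>\<mu>))"
      and "B2 = (\<Sum>a\<in>J. \<Sum>b\<in>J. g a * g b * (\<integral>z. z a * z b \<partial>\<nu>))"
    have e: "P \<mu> = hp - A1 * hp + (B1 - A2) * hp / 2" "P \<nu> = hp - A1 * hp + (B2 - A2) * hp / 2"
      unfolding P_def A1_def A2_def B1_def B2_def using m1 m2 by simp_all
    have e3: "(\<Sum>a\<in>J. \<Sum>b\<in>J. g a * g b * C a b) = B1 - B2"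
      unfolding B1_def B2_def C_def by (simp add: sum_subtractf right_diff_distrib)
    show ?thesis unfolding e e3 by (simp add: algebra_simps diff_divide_distrib)
  qed
  then have "\<bar>P \<mu> - P \<nu>\<bar> = \<bar>\<Sum>a\<in>J. \<Sum>b\<in>J. g a * g b * C a b\<bar> * hp / 2"
    using hp by (simp only: abs_mult abs_divide)
  also have "\<dots> \<le> ((\<Sum>a\<in>J. \<Sum>b\<in>J. g a * g b * \<rho>) + (\<Sum>(a, b)\<in>Sg. \<beta> * (g a * g b))) * hp / 2"
  proof (intro divide_right_mono mult_right_mono hp)
    have finS: "finite Sg" using Sg fin finite_subset by blast
    have "\<bar>\<Sum>a\<in>J. \<Sum>b\<in>J. g a * g b * C a b\<bar> = \<bar>\<Sum>(a, b)\<in>J \<times> J. g a * g b * C a b\<bar>"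
      by (simp add: sum.cartesian_product)
    also have "\<dots> \<le> (\<Sum>(a, b)\<in>J \<times> J. \<bar>g a * g b * C a b\<bar>)"
      by (rule order_trans[OF sum_abs]) (simp add: case_prod_beta)
    also have "\<dots> \<le> (\<Sum>(a, b)\<in>J \<times> J. g a * g b * \<rho> + (if (a, b) \<in> Sg then \<beta> * (g a * g b) else 0))"
    proof (intro sum_mono, clarify)
      fix a b assume ab: "a \<in> J" "b \<in> J"
      have gg: "0 \<le> g a * g b" using g0 by simp
      show "\<bar>g a * g b * C a b\<bar> \<le> g a * g b * \<rho> + (if (a, b) \<in> Sg then \<beta> * (g a * g b) else 0)"
      proof (cases "a = b")
        case True
        then show ?thesis using Caa[OF ab(1)] gg le by simp
      next
        case False
        show ?thesis
        proof (cases "(a, b) \<in> Sg")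
          case True
          have "\<bar>C a b\<bar> \<le> \<beta>" using strong[OF ab False] by (simp add: C_def)
          then have "(g a * g b) * \<bar>C a b\<bar> \<le> (g a * g b) * \<beta>" using gg by (rule mult_left_mono)
          moreover have "0 \<le> g a * g b * \<rho>" using gg le by simp
          ultimately show ?thesis using True gg by (simp add: abs_mult g0 mult_ac)
        next
          case False
          have "\<bar>C a b\<bar> \<le> \<rho>" using weak[OF ab \<open>a \<noteq> b\<close> False] by (simp add: C_def)
          then have "(g a * g b) * \<bar>C a b\<bar> \<le> (g a * g b) * \<rho>" using gg by (rule mult_left_mono)
          then show ?thesis using False by (simp add: abs_mult g0)
        qed
      qed
    qed
    also have "\<dots> = (\<Sum>(a, b)\<in>J \<times> J. g a * g b * \<rho>) + (\<Sum>x\<in>J \<times> J. if x \<in> Sg then \<beta> * (g (fst x) * g (snd x)) else 0)"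
      by (simp add: case_prod_beta sum.distrib)
    also have "(\<Sum>x\<in>J \<times> J. if x \<in> Sg then \<beta> * (g (fst x) * g (snd x)) else 0) = (\<Sum>x\<in>Sg. \<beta> * (g (fst x) * g (snd x)))"
      using Sg fin by (subst sum.inter_restrict[symmetric]) (auto simp: Int_absorb1)
    finally show "\<bar>\<Sum>a\<in>J. \<Sum>b\<in>J. g a * g b * C a b\<bar>
       \<le> (\<Sum>a\<in>J. \<Sum>b\<in>J. g a * g b * \<rho>) + (\<Sum>(a, b)\<in>Sg. \<beta> * (g a * g b))"
      by (simp add: case_prod_beta sum.cartesian_product)
  qed simp
  also have "\<dots> = \<rho> / 2 * ((\<Sum>a\<in>J. g a)^2 * hp) + \<beta> / 2 * ((\<Sum>(a, b)\<in>Sg. g a * g b) * hp)"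
    by (simp add: power2_eq_square sum_product sum_distrib_left sum_distrib_right case_prod_beta algebra_simps
         add_divide_distrib sum_divide_distrib)
  also have "\<dots> \<le> \<rho> / 2 * 36 + \<beta> / 2 * (\<Sum>(a, b)\<in>Sg. exp (c * (s a + s b)))"
  proof (intro add_mono mult_left_mono)
    have "(\<Sum>a\<in>J. g a)^2 * hp \<le> (\<Sum>a\<in>J. g a)^2 * exp (- (\<Sum>a\<in>J. g a))"
      unfolding hp_def g_def by (intro mult_left_mono hprod_le_exp) auto
    also have "\<dots> \<le> 36" by (intro square_exp_le sum_nonneg g0)
    finally show "(\<Sum>a\<in>J. g a)^2 * hp \<le> 36" .
    have "(\<Sum>(a, b)\<in>Sg. g a * g b) * hp \<le> (\<Sum>(a, b)\<in>Sg. g a * g b) * 1"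
      using hp by (intro mult_left_mono sum_nonneg) (auto simp: g0)
    also have "\<dots> \<le> (\<Sum>(a, b)\<in>Sg. exp (c * (s a + s b)))"
    proof (simp, intro sum_mono, clarify)
      fix a b
      have "g a * g b \<le> exp (c * s a) * exp (c * s b)"
        unfolding g_def using c by (intro mult_mono lgs_le_exp) auto
      then show "g a * g b \<le> exp (c * (s a + s b))" by (simp add: distrib_left exp_add)
    qed
    finally show "(\<Sum>(a, b)\<in>Sg. g a * g b) * hp \<le> (\<Sum>(a, b)\<in>Sg. exp (c * (s a + s b)))" .
  qed (use le in auto)
  finally have 3: "\<bar>P \<mu> - P \<nu>\<bar> \<le> 18 * \<rho> + \<beta> / 2 * (\<Sum>(a, b)\<in>Sg. exp (c * (s a + s b)))" by simp
  have "V \<le> 176 * \<omega> * (\<Sum>a\<in>J. g a * \<beta>)"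
    unfolding V_def using le g0 by (intro mult_left_mono sum_mono) auto
  then have 4: "V \<le> 176 * \<omega> * \<beta> * (\<Sum>a\<in>J. lgs (s a))"
    by (simp add: g_def mult_ac sum_distrib_right[symmetric] sum_distrib_left[symmetric])
  show ?thesis using 1 2 3 4 by linarith
qed

lemma measurable_PiM_component2:
  "i \<in> I \<Longrightarrow> a \<in> J \<Longrightarrow> (\<lambda>x. x i a) \<in> borel_measurable (PiM I (\<lambda>_. PiM J (\<lambda>_. borel)))"
  by (rule measurable_compose[of "\<lambda>x. x i" _ "PiM J (\<lambda>_. borel)" "\<lambda>z. z a"]) simp_all

lemma PiM_component_sum_integral:
  fixes K :: "'i \<Rightarrow> ('j \<Rightarrow> real) measure" and F :: "real \<Rightarrow> real"
  assumes fin: "finite I" and a: "a \<in> J"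
    and K: "\<And>j. prob_space (K j)" "\<And>j. sets (K j) = sets (PiM J (\<lambda>_. borel))"
    and F: "F \<in> borel_measurable borel"
  shows "(\<integral>y. F (\<Sum>j\<in>I. y j a) \<partial>PiM I K) = (\<integral>x. F (\<Sum>j\<in>I. x j) \<partial>PiM I (\<lambda>j. distr (K j) borel (\<lambda>z. z a)))"
proof -
  let ?L = "\<lambda>j. distr (K j) borel (\<lambda>z. z a)"
  have mc: "(\<lambda>z. z a) \<in> measurable (K j) borel" for j
    using a by (simp add: measurable_cong_sets[OF K(2) refl])
  have pL: "prob_space (?L j)" for j using K(1) mc by (rule prob_space.prob_space_distr)
  have "distr (PiM I K) (PiM I ?L) (compose I (\<lambda>z. z a)) = PiM I (\<lambda>j. distr (K j) (?L j) (\<lambda>z. z a))"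
    using mc by (intro distr_PiM_finite_prob_space' fin K pL) (auto cong: measurable_cong_sets)
  also have "\<dots> = PiM I ?L" by (intro PiM_cong distr_cong) auto
  finally have "(\<integral>x. F (\<Sum>j\<in>I. x j) \<partial>PiM I ?L) = (\<integral>x. F (\<Sum>j\<in>I. x j) \<partial>distr (PiM I K) (PiM I ?L) (compose I (\<lambda>z. z a)))"
    by simp
  also have "\<dots> = (\<integral>y. F (\<Sum>j\<in>I. compose I (\<lambda>z. z a) y j) \<partial>PiM I K)"
  proof (rule integral_distr)
    have sL: "sets (PiM I ?L) = sets (PiM I (\<lambda>_. borel))" by (intro sets_PiM_cong) auto
    show "compose I (\<lambda>z. z a) \<in> measurable (PiM I K) (PiM I ?L)"
      unfolding compose_def using mc
      by (intro measurable_restrict measurable_compose[OF measurable_component_singleton]) (auto cong: measurable_cong_sets)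
    show "(\<lambda>x. F (\<Sum>j\<in>I. x j)) \<in> borel_measurable (PiM I ?L)"
      using F by (simp add: measurable_cong_sets[OF sL refl])
  qed
  also have "\<dots> = (\<integral>y. F (\<Sum>j\<in>I. y j a) \<partial>PiM I K)"
    by (intro Bochner_Integration.integral_cong refl arg_cong[where f=F] sum.cong) (auto simp: compose_def)
  finally show ?thesis ..
qed

lemma PiM_PiM_prod_integral:
  fixes L :: "'i \<Rightarrow> 'j \<Rightarrow> real measure" and h :: "'j \<Rightarrow> real \<Rightarrow> real"
  assumes J: "finite J" and L: "\<And>i a. prob_space (L i a)" "\<And>i a. sets (L i a) = sets borel"
    and I: "finite I"
    and h: "\<And>a. h a \<in> borel_measurable borel" "\<And>a x. \<bar>h a x\<bar> \<le> 1"
  shows "(\<integral>y. (\<Prod>a\<in>J. h a (\<Sum>i\<in>I. y i a)) \<partial>PiM I (\<lambda>i. PiM J (L i)))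
     = (\<Prod>a\<in>J. \<integral>x. h a (\<Sum>i\<in>I. x i) \<partial>PiM I (\<lambda>i. L i a))"
  using I h
proof (induction I arbitrary: h rule: finite_induct)
  case empty
  show ?case by (simp add: PiM_empty lebesgue_integral_count_space_finite)
next
  case (insert i I)
  have pJ: "prob_space (PiM J (L j))" for j by (intro prob_space_PiM L)
  interpret PJ: product_prob_space "\<lambda>i. PiM J (L i)" by (rule product_prob_spaceI) (rule pJ)
  have sJ: "sets (PiM J (L j)) = sets (PiM J (\<lambda>_. borel))" for j by (intro sets_PiM_cong L refl)
  have sI: "sets (PiM I (\<lambda>i. PiM J (L i))) = sets (PiM I (\<lambda>_. PiM J (\<lambda>_. borel)))" for I
    by (intro sets_PiM_cong sJ refl)
  note hm[measurable] = insert.prems(1)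
  define h' where "h' a u = (\<integral>y. h a (y + u) \<partial>L i a)" for a u
  have h'm: "h' a \<in> borel_measurable borel" for a
  proof -
    interpret prob_space "L i a" by (rule L)
    have [measurable_cong]: "sets (L i a) = sets borel" by (rule L)
    have "(\<lambda>(u, y). h a (y + u)) \<in> borel_measurable (borel \<Otimes>\<^sub>M L i a)" by measurable
    from borel_measurable_lebesgue_integral[OF this] show ?thesis unfolding h'_def[abs_def] by simp
  qed
  have ih: "integrable (L j a) (\<lambda>y. h a (y + u))" for j a u
  proof -
    have [measurable_cong]: "sets (L j a) = sets borel" by (rule L)
    show ?thesis using insert.prems by (intro integrable_bounded_prob[where B=1] L) auto
  qed
  have h'b: "\<bar>h' a x\<bar> \<le> 1" for a x
  proof -
    interpret prob_space "L i a" by (rule L)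
    have "\<bar>h' a x\<bar> \<le> (\<integral>y. \<bar>h a (y + x)\<bar> \<partial>L i a)" unfolding h'_def by (rule integral_abs_bound)
    also have "\<dots> \<le> (\<integral>y. 1 \<partial>L i a)" using ih insert.prems by (intro integral_mono) auto
    finally show ?thesis by (simp add: prob_space)
  qed
  have m1: "(\<lambda>y. \<Prod>a\<in>J. h a (\<Sum>i\<in>I. y i a)) \<in> borel_measurable (PiM I (\<lambda>i. PiM J (L i)))" for I
    unfolding measurable_cong_sets[OF sI refl]
    by (intro borel_measurable_prod measurable_compose[OF _ hm] borel_measurable_sum measurable_PiM_component2)
  have b1: "\<bar>\<Prod>a\<in>J. h a (f a)\<bar> \<le> 1" for f
    unfolding abs_prod by (intro prod_le_1) (auto simp: insert.prems)
  have su: "(\<Sum>j\<in>insert i I. (x(i := y)) j) = y + (\<Sum>j\<in>I. x j)" for x and y :: real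
    using sum_fun_upd_remove[of "insert i I" i x y] insert.hyps by (simp del: fun_upd_apply)
  have su2: "(\<Sum>j\<in>insert i I. (x(i := y)) j a) = y a + (\<Sum>j\<in>I. x j a)" for x :: "'i \<Rightarrow> 'j \<Rightarrow> real" and y a
  proof -
    have "(\<Sum>j\<in>I. (x(i := y)) j a) = (\<Sum>j\<in>I. x j a)" using insert.hyps by (intro sum.cong) auto
    then show ?thesis using insert.hyps by simp
  qed
  have "(\<integral>y. (\<Prod>a\<in>J. h a (\<Sum>i\<in>insert i I. y i a)) \<partial>PiM (insert i I) (\<lambda>i. PiM J (L i)))
    = (\<integral>x. (\<integral>y. (\<Prod>a\<in>J. h a (\<Sum>j\<in>insert i I. (x(i := y)) j a)) \<partial>PiM J (L i)) \<partial>PiM I (\<lambda>i. PiM J (L i)))"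
    by (intro PJ.product_integral_insert insert.hyps integrable_bounded_prob[where B=1] prob_space_PiM pJ m1 b1)
  also have "\<dots> = (\<integral>x. (\<integral>y. (\<Prod>a\<in>J. h a (y a + (\<Sum>j\<in>I. x j a))) \<partial>PiM J (L i)) \<partial>PiM I (\<lambda>i. PiM J (L i)))"
    by (simp only: su2)
  also have "\<dots> = (\<integral>x. (\<Prod>a\<in>J. h' a (\<Sum>j\<in>I. x j a)) \<partial>PiM I (\<lambda>i. PiM J (L i)))"
  proof (rule Bochner_Integration.integral_cong[OF refl])
    fix x :: "'i \<Rightarrow> 'j \<Rightarrow> real"
    interpret Li: product_sigma_finite "L i" by (intro product_sigma_finite.intro prob_space_imp_sigma_finite L)
    show "(\<integral>y. (\<Prod>a\<in>J. h a (y a + (\<Sum>j\<in>I. x j a))) \<partial>PiM J (L i)) = (\<Prod>a\<in>J. h' a (\<Sum>j\<in>I. x j a))"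
      unfolding h'_def by (rule Li.product_integral_prod[OF J]) (rule ih)
  qed
  also have "\<dots> = (\<Prod>a\<in>J. \<integral>x. h' a (\<Sum>i\<in>I. x i) \<partial>PiM I (\<lambda>i. L i a))"
    by (rule insert.IH) (auto intro: h'm h'b)
  also have "\<dots> = (\<Prod>a\<in>J. \<integral>x. h a (\<Sum>i\<in>insert i I. x i) \<partial>PiM (insert i I) (\<lambda>i. L i a))"
  proof (rule prod.cong[OF refl])
    fix a
    interpret La: product_prob_space "\<lambda>i. L i a" by (rule product_prob_spaceI) (rule L)
    have sLa: "sets (PiM (insert i I) (\<lambda>i. L i a)) = sets (PiM (insert i I) (\<lambda>_. borel))"
      by (intro sets_PiM_cong L refl)
    have "integrable (PiM (insert i I) (\<lambda>i. L i a)) (\<lambda>x. h a (\<Sum>i\<in>insert i I. x i))"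
      using insert.prems(2)
      by (intro integrable_bounded_prob[where B=1] prob_space_PiM L)
        (unfold measurable_cong_sets[OF sLa refl], measurable)
    from La.product_integral_insert[OF insert.hyps this]
    show "(\<integral>x. h' a (\<Sum>i\<in>I. x i) \<partial>PiM I (\<lambda>i. L i a)) = (\<integral>x. h a (\<Sum>i\<in>insert i I. x i) \<partial>PiM (insert i I) (\<lambda>i. L i a))"
      by (simp only: su h'_def)
  qed
  finally show ?case .
qed

lemma hprod_swap_coordinate:
  fixes K :: "'i \<Rightarrow> ('j \<Rightarrow> real) measure" and t :: real and J :: "'j set"
  defines "N \<equiv> PiM J (\<lambda>_. borel)"
  assumes I: "finite I" "i \<in> I" and J: "finite J"
    and K: "\<And>j. prob_space (K j)" "\<And>j. sets (K j) = sets N" "\<And>j a. a \<in> J \<Longrightarrow> AE z in K j. \<bar>z a\<bar> \<le> \<omega>"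
    and mu: "prob_space \<mu>" "sets \<mu> = sets N" "\<And>a. a \<in> J \<Longrightarrow> AE z in \<mu>. \<bar>z a\<bar> \<le> \<omega>"
    and nu: "prob_space \<nu>" "sets \<nu> = sets N" "\<And>a. a \<in> J \<Longrightarrow> AE z in \<nu>. \<bar>z a\<bar> \<le> \<omega>"
    and om: "0 \<le> \<omega>" "\<omega> \<le> 1"
    and m1: "\<And>a. a \<in> J \<Longrightarrow> (\<integral>z. z a \<partial>\<mu>) = (\<integral>z. z a \<partial>\<nu>)"
    and m2: "\<And>a. a \<in> J \<Longrightarrow> (\<integral>z. (z a)^2 \<partial>\<mu>) = (\<integral>z. (z a)^2 \<partial>\<nu>)"
    and le: "0 \<le> \<rho>" "0 \<le> \<beta>" "\<And>a. a \<in> J \<Longrightarrow> (\<integral>z. (z a)^2 \<partial>\<nu>) \<le> \<beta>"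
    and Sg: "Sg \<subseteq> J \<times> J"
    and weak: "\<And>a b. a \<in> J \<Longrightarrow> b \<in> J \<Longrightarrow> a \<noteq> b \<Longrightarrow> (a, b) \<notin> Sg \<Longrightarrow>
        \<bar>(\<integral>z. z a * z b \<partial>\<mu>) - (\<integral>z. z a * z b \<partial>\<nu>)\<bar> \<le> \<rho>"
    and strong: "\<And>a b. a \<in> J \<Longrightarrow> b \<in> J \<Longrightarrow> a \<noteq> b \<Longrightarrow>
        \<bar>(\<integral>z. z a * z b \<partial>\<mu>) - (\<integral>z. z a * z b \<partial>\<nu>)\<bar> \<le> \<beta>"
    and c: "0 \<le> c" "c \<le> 1"
    and ex: "\<And>j a b. j \<in> I \<Longrightarrow> (a, b) \<in> Sg \<Longrightarrow> (\<integral>z. exp (c * (z a + z b)) \<partial>K j) \<le> exp (m j a b)"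
    and m0: "\<And>j a b. j \<in> I \<Longrightarrow> (a, b) \<in> Sg \<Longrightarrow> 0 \<le> m j a b"
    and mx: "\<And>a b. (a, b) \<in> Sg \<Longrightarrow> (\<Sum>j\<in>I. m j a b) \<le> Mx"
    and G: "\<And>a. a \<in> J \<Longrightarrow> (\<integral>y. lgs (t + (\<Sum>j\<in>I. y j a)) \<partial>PiM I (K(i := \<nu>))) \<le> Gm"
  shows "\<bar>(\<integral>y. hprod J (\<lambda>a. t + (\<Sum>j\<in>I. y j a)) \<partial>PiM I (K(i := \<mu>)))
       - (\<integral>y. hprod J (\<lambda>a. t + (\<Sum>j\<in>I. y j a)) \<partial>PiM I (K(i := \<nu>)))\<bar>
    \<le> 18 * \<rho> + \<beta> / 2 * (real (card Sg) * exp (2 * c * t + Mx)) + 1056 * \<omega> * \<beta> * (real (card J) * Gm)"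
proof -
  let ?F = "\<lambda>y. hprod J (\<lambda>a. t + (\<Sum>j\<in>I. y j a))"
  let ?I = "I - {i}"
  let ?P = "PiM ?I K"
  have fS: "finite Sg" using Sg J finite_subset by blast
  have fI: "finite ?I" using I by simp
  interpret P: prob_space ?P by (intro prob_space_PiM K)
  interpret PK: product_prob_space K by (rule product_prob_spaceI) (rule K)
  have sP: "sets ?P = sets (PiM ?I (\<lambda>_. N))" by (intro sets_PiM_cong K refl)
  have [measurable]: "(\<lambda>z. z a) \<in> borel_measurable N" if "a \<in> J" for a
    unfolding N_def using that by measurable
  have c2: "(\<lambda>y. y j a) \<in> borel_measurable (PiM I (\<lambda>_. N))" if "j \<in> I" "a \<in> J" for I :: "'i set" and j a
    unfolding N_def using that by (rule measurable_PiM_component2)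
  have F: "?F \<in> borel_measurable (PiM I (\<lambda>_. N))" unfolding hprod_def
    by (intro borel_measurable_prod borel_measurable_diff borel_measurable_const measurable_compose[OF _ borel_measurable_lgs]
        borel_measurable_add borel_measurable_sum c2)
  have F1: "\<bar>?F x\<bar> \<le> 1" for x by (simp add: abs_of_nonneg hprod_nonneg hprod_le_1)
  define s where "s y a = t + (\<Sum>j\<in>?I. y j a)" for y :: "'i \<Rightarrow> 'j \<Rightarrow> real" and a
  have sm[measurable]: "(\<lambda>y. s y a) \<in> borel_measurable ?P" if "a \<in> J" for a
    unfolding s_def measurable_cong_sets[OF sP refl] using that
    by (intro borel_measurable_add borel_measurable_const borel_measurable_sum c2)
  have upd: "t + (\<Sum>j\<in>I. (x(i := y)) j a) = s x a + y a" for x :: "'i \<Rightarrow> 'j \<Rightarrow> real" and y a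
  proof -
    have "(\<Sum>j\<in>I. (x(i := y)) j a) = (x(i := y)) i a + (\<Sum>j\<in>I - {i}. (x(i := y)) j a)"
      using I by (rule sum.remove)
    also have "(\<Sum>j\<in>I - {i}. (x(i := y)) j a) = (\<Sum>j\<in>I - {i}. x j a)" by (intro sum.cong) auto
    finally show ?thesis by (simp add: s_def)
  qed
  define E where "E a b y = exp (2 * c * t) * (\<Prod>j\<in>?I. exp (c * (y j a + y j b)))"
    for a b and y :: "'i \<Rightarrow> 'j \<Rightarrow> real"
  have Es: "exp (c * (s y a + s y b)) = E a b y" for y a b
    unfolding E_def s_def using fI
    by (simp add: exp_sum[symmetric] exp_add[symmetric] sum.distrib sum_distrib_left algebra_simps)
  have iK: "integrable (K j) (\<lambda>z. exp (c * (z a + z b)))" if "(a, b) \<in> Sg" for j a b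
  proof -
    have ab: "a \<in> J" "b \<in> J" using that Sg by auto
    show ?thesis
    proof (rule finite_measure.integrable_const_bound[OF prob_space.finite_measure[OF K(1)], where B="exp (c * (\<omega> + \<omega>))"])
      show "AE z in K j. norm (exp (c * (z a + z b))) \<le> exp (c * (\<omega> + \<omega>))"
        using K(3)[OF ab(1), of j] K(3)[OF ab(2), of j]
        by eventually_elim (use c in \<open>auto intro!: mult_left_mono\<close>)
      show "(\<lambda>z. exp (c * (z a + z b))) \<in> borel_measurable (K j)"
        unfolding measurable_cong_sets[OF K(2) refl] using ab by measurable
    qed
  qed
  have iE: "integrable ?P (E a b)" if "(a, b) \<in> Sg" for a b
    unfolding E_def by (intro integrable_mult_right PK.product_integrable_prod fI iK that)
  have vE: "(\<integral>y. E a b y \<partial>?P) \<le> exp (2 * c * t + Mx)" if "(a, b) \<in> Sg" for a b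
  proof -
    have "(\<integral>y. E a b y \<partial>?P) = exp (2 * c * t) * (\<Prod>j\<in>?I. \<integral>z. exp (c * (z a + z b)) \<partial>K j)"
      unfolding E_def using PK.product_integral_prod[OF fI, of "\<lambda>j z. exp (c * (z a + z b))"] iK[OF that] by simp
    also have "\<dots> \<le> exp (2 * c * t) * (\<Prod>j\<in>?I. exp (m j a b))"
      by (intro mult_left_mono prod_mono conjI ex that Bochner_Integration.integral_nonneg) auto
    also have "\<dots> = exp (2 * c * t + (\<Sum>j\<in>?I. m j a b))" using fI by (simp add: exp_add exp_sum)
    also have "\<dots> \<le> exp (2 * c * t + Mx)"
      using I m0[OF _ that] mx[OF that] sum_mono2[of I ?I "\<lambda>j. m j a b"] by fastforce
    finally show ?thesis .
  qed
  have iL: "integrable ?P (\<lambda>y. lgs (s y a))" if "a \<in> J" for a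
    using that by (intro P.integrable_const_bound[where B=1]) auto
  have vL: "(\<integral>y. lgs (s y a) \<partial>?P) \<le> 3 * Gm" if a: "a \<in> J" for a
  proof -
    let ?Fa = "\<lambda>y. lgs (t + (\<Sum>j\<in>I. y j a))"
    interpret nu: prob_space \<nu> by (rule nu)
    have Fa: "?Fa \<in> borel_measurable (PiM I (\<lambda>_. N))" using a
      by (intro measurable_compose[OF _ borel_measurable_lgs] borel_measurable_add borel_measurable_const borel_measurable_sum c2)
    have sw: "(\<integral>y. ?Fa y \<partial>PiM I (K(i := \<nu>))) = (\<integral>x. (\<integral>y. ?Fa (x(i := y)) \<partial>\<nu>) \<partial>?P)"
      "integrable ?P (\<lambda>x. \<integral>y. ?Fa (x(i := y)) \<partial>\<nu>)"
      by (rule PiM_swap_integral[where B=1, OF I K(1,2) nu(1,2) Fa]; simp)+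
    have "(\<integral>y. lgs (s y a) \<partial>?P) \<le> (\<integral>x. 3 * (\<integral>y. ?Fa (x(i := y)) \<partial>\<nu>) \<partial>?P)"
    proof (intro integral_mono iL a integrable_mult_right sw(2))
      fix x
      have "(\<integral>y. lgs (s x a) \<partial>\<nu>) \<le> (\<integral>y. 3 * ?Fa (x(i := y)) \<partial>\<nu>)"
      proof (intro integral_mono_AE)
        have "integrable \<nu> (\<lambda>y. lgs (s x a + y a))"
          using a by (intro nu.integrable_const_bound[where B=1]) (auto simp: measurable_cong_sets[OF nu(2) refl])
        then show "integrable \<nu> (\<lambda>y. 3 * ?Fa (x(i := y)))" unfolding upd by simp
        show "AE y in \<nu>. lgs (s x a) \<le> 3 * ?Fa (x(i := y))"
          using nu(3)[OF a]
        proof eventually_elim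
          fix y assume y: "\<bar>y a\<bar> \<le> \<omega>"
          have "lgs (s x a) \<le> exp \<bar>- y a\<bar> * lgs (s x a + y a)"
            using lgs_shift_le[of "s x a + y a" "- y a"] by simp
          also have "\<dots> \<le> 3 * lgs (s x a + y a)"
          proof (intro mult_right_mono)
            have "exp \<bar>- y a\<bar> \<le> exp 1" using y om by simp
            then show "exp \<bar>- y a\<bar> \<le> 3" using exp_le by linarith
          qed simp
          finally show "lgs (s x a) \<le> 3 * ?Fa (x(i := y))" unfolding upd .
        qed
      qed auto
      then show "lgs (s x a) \<le> 3 * (\<integral>y. ?Fa (x(i := y)) \<partial>\<nu>)" by (simp add: nu.prob_space del: fun_upd_apply)
    qed
    also have "\<dots> = 3 * (\<integral>y. ?Fa y \<partial>PiM I (K(i := \<nu>)))" using sw(1) by simp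
    also have "\<dots> \<le> 3 * Gm" using G[OF a] by simp
    finally show ?thesis .
  qed
  define R where "R y = 18 * \<rho> + \<beta> / 2 * (\<Sum>(a, b)\<in>Sg. E a b y) + 352 * \<omega> * \<beta> * (\<Sum>a\<in>J. lgs (s y a))" for y
  have iS: "integrable ?P (\<lambda>y. \<Sum>(a, b)\<in>Sg. E a b y)"
    using iE by (intro Bochner_Integration.integrable_sum) auto
  have iG: "integrable ?P (\<lambda>y. \<Sum>a\<in>J. lgs (s y a))"
    using iL by (intro Bochner_Integration.integrable_sum) auto
  have iR: "integrable ?P R" unfolding R_def[abs_def] using iS iG by auto
  have "\<bar>(\<integral>y. ?F y \<partial>PiM I (K(i := \<mu>))) - (\<integral>y. ?F y \<partial>PiM I (K(i := \<nu>)))\<bar> \<le> (\<integral>y. R y \<partial>?P)"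
  proof (rule PiM_swap_bound[OF I K(1,2) mu(1,2) nu(1,2) F F1 iR])
    fix x
    show "\<bar>(\<integral>y. ?F (x(i := y)) \<partial>\<mu>) - (\<integral>y. ?F (x(i := y)) \<partial>\<nu>)\<bar> \<le> R x"
      unfolding upd R_def Es[symmetric]
      by (rule hprod_step[OF J mu[unfolded N_def] nu[unfolded N_def] om(2) m1 m2 om(1) le Sg weak strong c])
  qed
  also have "(\<integral>y. R y \<partial>?P) = 18 * \<rho> + \<beta> / 2 * (\<Sum>(a, b)\<in>Sg. \<integral>y. E a b y \<partial>?P)
      + 352 * \<omega> * \<beta> * (\<Sum>a\<in>J. \<integral>y. lgs (s y a) \<partial>?P)"
  proof -
    have "(\<integral>y. (\<Sum>(a, b)\<in>Sg. E a b y) \<partial>?P) = (\<Sum>(a, b)\<in>Sg. \<integral>y. E a b y \<partial>?P)"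
      using iE by (subst Bochner_Integration.integral_sum) (auto simp: case_prod_beta)
    moreover have "(\<integral>y. (\<Sum>a\<in>J. lgs (s y a)) \<partial>?P) = (\<Sum>a\<in>J. \<integral>y. lgs (s y a) \<partial>?P)"
      using iL by (rule Bochner_Integration.integral_sum)
    ultimately show ?thesis unfolding R_def[abs_def] using iS iG by (simp add: P.prob_space)
  qed
  also have "\<dots> \<le> 18 * \<rho> + \<beta> / 2 * (\<Sum>(a, b)\<in>Sg. exp (2 * c * t + Mx))
      + 352 * \<omega> * \<beta> * (\<Sum>a\<in>J. 3 * Gm)"
    using le om vE vL by (intro add_mono mult_left_mono sum_mono order_refl) auto
  also have "\<dots> = 18 * \<rho> + \<beta> / 2 * (real (card Sg) * exp (2 * c * t + Mx)) + 1056 * \<omega> * \<beta> * (real (card J) * Gm)"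
    by (simp add: case_prod_beta)
  finally show ?thesis .
qed

lemma (in prob_space) decouple:
  fixes W :: "'i \<Rightarrow> 'j \<Rightarrow> 'a \<Rightarrow> real" and t :: real
  assumes I: "finite I" "I \<noteq> {}" and J: "finite J"
    and W: "\<And>i a. W i a \<in> borel_measurable M" "\<And>i a \<omega>. \<bar>W i a \<omega>\<bar> \<le> b"
    and b: "b \<le> 1"
    and ind: "indep_vars (\<lambda>_. PiM J (\<lambda>_. borel)) (\<lambda>i \<omega>. \<lambda>a\<in>J. W i a \<omega>) I"
    and le: "\<And>i. i \<in> I \<Longrightarrow> 0 \<le> \<rho> i" "\<And>i a. i \<in> I \<Longrightarrow> a \<in> J \<Longrightarrow> expectation (\<lambda>\<omega>. (W i a \<omega>)^2) \<le> \<beta> i"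
      "\<And>i. i \<in> I \<Longrightarrow> 0 \<le> \<beta> i"
    and Sg: "Sg \<subseteq> J \<times> J" "\<And>a. (a, a) \<notin> Sg"
    and weak: "\<And>i a b. i \<in> I \<Longrightarrow> a \<in> J \<Longrightarrow> b \<in> J \<Longrightarrow> a \<noteq> b \<Longrightarrow> (a, b) \<notin> Sg \<Longrightarrow>
        \<bar>expectation (\<lambda>\<omega>. W i a \<omega> * W i b \<omega>) - expectation (W i a) * expectation (W i b)\<bar> \<le> \<rho> i"
    and strong: "\<And>i a b. i \<in> I \<Longrightarrow> a \<in> J \<Longrightarrow> b \<in> J \<Longrightarrow> a \<noteq> b \<Longrightarrow>
        \<bar>expectation (\<lambda>\<omega>. W i a \<omega> * W i b \<omega>) - expectation (W i a) * expectation (W i b)\<bar> \<le> \<beta> i"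
    and c: "0 \<le> c" "c \<le> 1"
    and ex: "\<And>i a b. i \<in> I \<Longrightarrow> (a, b) \<in> Sg \<Longrightarrow> expectation (\<lambda>\<omega>. exp (c * (W i a \<omega> + W i b \<omega>))) \<le> exp (m i a b)"
      "\<And>i a b. i \<in> I \<Longrightarrow> (a, b) \<in> Sg \<Longrightarrow>
         expectation (\<lambda>\<omega>. exp (c * W i a \<omega>)) * expectation (\<lambda>\<omega>. exp (c * W i b \<omega>)) \<le> exp (m i a b)"
    and m0: "\<And>i a b. i \<in> I \<Longrightarrow> (a, b) \<in> Sg \<Longrightarrow> 0 \<le> m i a b"
    and mx: "\<And>a b. (a, b) \<in> Sg \<Longrightarrow> (\<Sum>j\<in>I. m j a b) \<le> Mx"
    and G: "\<And>a. a \<in> J \<Longrightarrow> expectation (\<lambda>\<omega>. lgs (t + (\<Sum>i\<in>I. W i a \<omega>))) \<le> Gm"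
  shows "\<bar>expectation (\<lambda>\<omega>. hprod J (\<lambda>a. t + (\<Sum>i\<in>I. W i a \<omega>)))
       - (\<Prod>a\<in>J. 1 - expectation (\<lambda>\<omega>. lgs (t + (\<Sum>i\<in>I. W i a \<omega>))))\<bar>
    \<le> 18 * (\<Sum>i\<in>I. \<rho> i) + (\<Sum>i\<in>I. \<beta> i) * (real (card Sg) * exp (2 * c * t + Mx)
        + 1056 * b * (real (card J) * Gm))"
proof -
  let ?N = "PiM J (\<lambda>_. borel) :: ('j \<Rightarrow> real) measure"
  define L where "L i a = distr M borel (W i a)" for i a
  define mu where "mu i = distr M ?N (\<lambda>\<omega>. \<lambda>a\<in>J. W i a \<omega>)" for i
  define nu where "nu i = PiM J (L i)" for i
  define H where "H B i = (if i \<in> B then mu i else nu i)" for B i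
  note [measurable] = W(1)
  have b0: "0 \<le> b" using W(2) abs_ge_zero order_trans by blast
  have vm[measurable]: "(\<lambda>\<omega>. \<lambda>a\<in>J. W i a \<omega>) \<in> measurable M ?N" for i by measurable
  have L: "prob_space (L i a)" "sets (L i a) = sets borel" for i a
    unfolding L_def by (auto intro: prob_space_distr)
  have mu: "prob_space (mu i)" "sets (mu i) = sets ?N" for i unfolding mu_def by (auto intro: prob_space_distr)
  have nu: "prob_space (nu i)" "sets (nu i) = sets ?N" for i
    unfolding nu_def by (auto intro!: prob_space_PiM L sets_PiM_cong)
  have H: "prob_space (H B i)" "sets (H B i) = sets ?N" for B i using mu nu by (auto simp: H_def)
  have dmu: "distr (mu i) borel (\<lambda>z. z a) = L i a" if "a \<in> J" for i a
    unfolding mu_def L_def using that by (subst distr_distr) (auto simp: comp_def)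
  have dnu: "distr (nu i) borel (\<lambda>z. z a) = L i a" if "a \<in> J" for i a
  proof -
    have "distr (nu i) borel (\<lambda>z. z a) = distr (PiM J (L i)) (L i a) (\<lambda>z. z a)"
      unfolding nu_def by (intro distr_cong) (auto simp: L)
    also have "\<dots> = L i a" by (rule distr_PiM_component[OF L(1) that])
    finally show ?thesis .
  qed
  have dH: "distr (H B i) borel (\<lambda>z. z a) = L i a" if "a \<in> J" for B i a
    using dmu[OF that] dnu[OF that] by (simp add: H_def)
  have cm: "(\<lambda>z. z a) \<in> measurable (H B i) borel" if "a \<in> J" for B i a
    using that by (simp add: measurable_cong_sets[OF H(2) refl])
  have iH: "(\<integral>z. f (z a) \<partial>H B i) = expectation (\<lambda>\<omega>. f (W i a \<omega>))"
    if "a \<in> J" "f \<in> borel_measurable borel" for B i a and f :: "real \<Rightarrow> real"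
  proof -
    have "(\<integral>z. f (z a) \<partial>H B i) = (\<integral>u. f u \<partial>L i a)"
      unfolding dH[OF that(1), of B i, symmetric] by (rule integral_distr[symmetric, OF cm[OF that(1)] that(2)])
    also have "\<dots> = expectation (\<lambda>\<omega>. f (W i a \<omega>))" unfolding L_def by (rule integral_distr[OF W(1) that(2)])
    finally show ?thesis .
  qed
  have bH: "AE z in H B i. \<bar>z a\<bar> \<le> b" if "a \<in> J" for B i a
  proof -
    have "AE u in L i a. \<bar>u\<bar> \<le> b" unfolding L_def by (subst AE_distr_iff) (auto simp: W(2))
    then have "AE u in distr (H B i) borel (\<lambda>z. z a). \<bar>u\<bar> \<le> b" by (simp only: dH[OF that])
    then show ?thesis by (subst (asm) AE_distr_iff) (use cm[OF that] in auto)
  qed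
  have imu: "(\<integral>z. f z \<partial>mu i) = expectation (\<lambda>\<omega>. f (\<lambda>a\<in>J. W i a \<omega>))" if "f \<in> borel_measurable ?N" for f :: "_ \<Rightarrow> real" and i
    unfolding mu_def by (rule integral_distr[OF vm that])
  have inu: "(\<integral>z. f (z a) * g (z d) \<partial>nu i) = expectation (\<lambda>\<omega>. f (W i a \<omega>)) * expectation (\<lambda>\<omega>. g (W i d \<omega>))"
    if ab: "a \<in> J" "d \<in> J" "a \<noteq> d" and f: "continuous_on UNIV f" and g: "continuous_on UNIV g" for i a d and f g :: "real \<Rightarrow> real"
  proof -
    interpret Li: product_sigma_finite "L i" by (intro product_sigma_finite.intro prob_space_imp_sigma_finite L)
    define h where "h c = (if c = a then f else if c = d then g else (\<lambda>_. 1))" for c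
    have [measurable]: "f \<in> borel_measurable borel" "g \<in> borel_measurable borel"
      using f g by (auto intro: borel_measurable_continuous_onI)
    have bound: "\<exists>C. \<forall>\<omega>. \<bar>f (W i c \<omega>)\<bar> \<le> C" if f: "continuous_on UNIV f" for f :: "real \<Rightarrow> real" and c
    proof -
      have "compact (f ` {-b..b})" by (intro compact_continuous_image continuous_on_subset[OF f]) auto
      then obtain C where "\<And>x. x \<in> f ` {-b..b} \<Longrightarrow> \<bar>x\<bar> \<le> C"
        using compact_imp_bounded bounded_real by metis
      moreover have "W i c \<omega> \<in> {-b..b}" for \<omega> using W(2)[of i c \<omega>] by (auto simp: abs_le_iff)
      ultimately show ?thesis by blast
    qed
    have if': "integrable (L i c) f" if f: "continuous_on UNIV f" for f :: "real \<Rightarrow> real" and c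
    proof -
      have [measurable]: "f \<in> borel_measurable borel" using f by (auto intro: borel_measurable_continuous_onI)
      obtain C where "\<And>\<omega>. \<bar>f (W i c \<omega>)\<bar> \<le> C" using bound[OF f] by blast
      then have "integrable M (\<lambda>\<omega>. f (W i c \<omega>))" by (intro integrable_const_bound[where B=C]) auto
      then show ?thesis unfolding L_def by (subst integrable_distr_eq) auto
    qed
    have ih: "integrable (L i c) (h c)" for c unfolding h_def using if' f g by auto
    have "(\<integral>z. f (z a) * g (z d) \<partial>nu i) = (\<integral>z. (\<Prod>c\<in>J. h c (z c)) \<partial>PiM J (L i))"
    proof -
      have "(\<Prod>c\<in>J. h c (z c)) = f (z a) * g (z d)" for z
      proof -
        have "(\<Prod>c\<in>J. h c (z c)) = (\<Prod>c\<in>{a, d}. h c (z c))"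
          using J ab by (intro prod.mono_neutral_right) (auto simp: h_def)
        then show ?thesis using ab by (simp add: h_def)
      qed
      then show ?thesis by (simp add: nu_def)
    qed
    also have "\<dots> = (\<Prod>c\<in>J. integral\<^sup>L (L i c) (h c))"
      by (rule Li.product_integral_prod[OF J ih])
    also have "\<dots> = (\<Prod>c\<in>{a, d}. integral\<^sup>L (L i c) (h c))"
      using J ab L by (intro prod.mono_neutral_right) (auto simp: h_def prob_space.prob_space)
    also have "\<dots> = integral\<^sup>L (L i a) f * integral\<^sup>L (L i d) g" using ab by (simp add: h_def)
    also have "\<dots> = expectation (\<lambda>\<omega>. f (W i a \<omega>)) * expectation (\<lambda>\<omega>. g (W i d \<omega>))"
      unfolding L_def by (simp add: integral_distr)
    finally show ?thesis .
  qed
  let ?F = "\<lambda>y. hprod J (\<lambda>a. t + (\<Sum>j\<in>I. y j a))"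
  have GH: "(\<integral>y. lgs (t + (\<Sum>j\<in>I. y j a)) \<partial>PiM I (H B)) = expectation (\<lambda>\<omega>. lgs (t + (\<Sum>i\<in>I. W i a \<omega>)))"
    if a: "a \<in> J" for a B
  proof -
    have "indep_vars (\<lambda>_. borel) (\<lambda>i \<omega>. (\<lambda>z. z a) (\<lambda>a\<in>J. W i a \<omega>)) I"
      by (rule indep_vars_compose2[OF ind]) (use a in measurable)
    then have ia: "indep_vars (\<lambda>_. borel) (\<lambda>i. W i a) I" using a by simp
    have "(\<integral>y. lgs (t + (\<Sum>j\<in>I. y j a)) \<partial>PiM I (H B)) = (\<integral>x. lgs (t + (\<Sum>j\<in>I. x j)) \<partial>PiM I (\<lambda>j. distr (H B j) borel (\<lambda>z. z a)))"
      by (rule PiM_component_sum_integral[where F="\<lambda>u. lgs (t + u)", OF I(1) a H]) measurable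
    also have "\<dots> = (\<integral>x. lgs (t + (\<Sum>j\<in>I. x j)) \<partial>PiM I (\<lambda>j. distr M borel (W j a)))"
      by (simp only: dH[OF a] L_def)
    also have "\<dots> = expectation (\<lambda>\<omega>. lgs (t + (\<Sum>j\<in>I. (\<lambda>i\<in>I. W i a \<omega>) j)))"
      by (rule integral_PiM_indep[OF I(2) ia]) measurable
    also have "\<dots> = expectation (\<lambda>\<omega>. lgs (t + (\<Sum>i\<in>I. W i a \<omega>)))" by (simp cong: sum.cong)
    finally show ?thesis .
  qed
  define er where "er i = 18 * \<rho> i + \<beta> i * (real (card Sg) * exp (2 * c * t + Mx)
        + 1056 * b * (real (card J) * Gm))" for i
  have step: "\<bar>(\<integral>y. ?F y \<partial>PiM I (H (insert i B))) - (\<integral>y. ?F y \<partial>PiM I (H B))\<bar> \<le> er i"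
    if i: "i \<in> I" "i \<notin> B" for i B
  proof -
    have e1: "H (insert i B) = (H B)(i := mu i)" and e2: "H B = (H B)(i := nu i)"
      using i by (auto simp: H_def fun_eq_iff)
    have Hm: "H {i} i = mu i" and Hn: "H {} i = nu i" by (auto simp: H_def)
    have cross: "(\<integral>z. z a * z b \<partial>mu i) - (\<integral>z. z a * z b \<partial>nu i)
       = expectation (\<lambda>\<omega>. W i a \<omega> * W i b \<omega>) - expectation (W i a) * expectation (W i b)"
      if "a \<in> J" "b \<in> J" "a \<noteq> b" for a b
      using imu[of "\<lambda>z. z a * z b" i] inu[OF that, of "\<lambda>x. x" "\<lambda>x. x" i] that by simp
    have "\<bar>(\<integral>y. ?F y \<partial>PiM I ((H B)(i := mu i))) - (\<integral>y. ?F y \<partial>PiM I ((H B)(i := nu i)))\<bar>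
      \<le> 18 * \<rho> i + \<beta> i / 2 * (real (card Sg) * exp (2 * c * t + Mx)) + 1056 * b * \<beta> i * (real (card J) * Gm)"
    proof (rule hprod_swap_coordinate[OF I(1) i(1) J H bH mu _ nu _ b0 b])
      show "AE z in mu i. \<bar>z a\<bar> \<le> b" if "a \<in> J" for a
        using bH[OF that, of "{i}" i] by (simp only: Hm)
      show "AE z in nu i. \<bar>z a\<bar> \<le> b" if "a \<in> J" for a
        using bH[OF that, of "{}" i] by (simp only: Hn)
      show "(\<integral>z. z a \<partial>mu i) = (\<integral>z. z a \<partial>nu i)" if "a \<in> J" for a
        using iH[OF that, of "\<lambda>x. x" "{i}" i] iH[OF that, of "\<lambda>x. x" "{}" i] by (auto simp: Hm Hn)
      show "(\<integral>z. (z a)^2 \<partial>mu i) = (\<integral>z. (z a)^2 \<partial>nu i)" if "a \<in> J" for a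
        using iH[OF that, of "\<lambda>x. x^2" "{i}" i] iH[OF that, of "\<lambda>x. x^2" "{}" i] by (auto simp: Hm Hn)
      show "(\<integral>z. (z a)^2 \<partial>nu i) \<le> \<beta> i" if "a \<in> J" for a
        using iH[OF that, of "\<lambda>x. x^2" "{}" i] le(2)[OF i(1) that] by (auto simp: Hn)
      show "\<bar>(\<integral>z. z a * z b \<partial>mu i) - (\<integral>z. z a * z b \<partial>nu i)\<bar> \<le> \<rho> i"
        if "a \<in> J" "b \<in> J" "a \<noteq> b" "(a, b) \<notin> Sg" for a b
        using weak[OF i(1) that] cross[OF that(1-3)] by simp
      show "\<bar>(\<integral>z. z a * z b \<partial>mu i) - (\<integral>z. z a * z b \<partial>nu i)\<bar> \<le> \<beta> i"
        if "a \<in> J" "b \<in> J" "a \<noteq> b" for a b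
        using strong[OF i(1) that] cross[OF that(1-3)] by simp
      show "(\<integral>z. exp (c * (z a + z b)) \<partial>H B j) \<le> exp (m j a b)" if j: "j \<in> I" "(a, b) \<in> Sg" for j a b
      proof -
        have ab: "a \<in> J" "b \<in> J" "a \<noteq> b" using j Sg by auto
        have "(\<integral>z. exp (c * (z a + z b)) \<partial>mu j) \<le> exp (m j a b)"
          using imu[of "\<lambda>z. exp (c * (z a + z b))" j] ex(1)[OF j] ab by simp
        moreover have "(\<integral>z. exp (c * (z a + z b)) \<partial>nu j) \<le> exp (m j a b)"
          using inu[OF ab, of "\<lambda>x. exp (c * x)" "\<lambda>x. exp (c * x)" j] ex(2)[OF j]
          by (simp add: distrib_left exp_add continuous_intros)
        ultimately show ?thesis by (simp add: H_def)
      qed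
      show "(\<integral>y. lgs (t + (\<Sum>j\<in>I. y j a)) \<partial>PiM I ((H B)(i := nu i))) \<le> Gm" if "a \<in> J" for a
        using GH[OF that, of B] G[OF that] e2 by metis
    qed (use le i Sg c m0 mx in auto)
    also have "\<dots> \<le> er i"
      using le(3)[OF i(1)] by (simp add: er_def algebra_simps)
    finally show ?thesis using e1 e2 by metis
  qed
  have "\<bar>(\<integral>y. ?F y \<partial>PiM I (H B)) - (\<integral>y. ?F y \<partial>PiM I (H {}))\<bar> \<le> (\<Sum>i\<in>B. er i)" if "B \<subseteq> I" for B
    using finite_subset[OF that I(1)] that
  proof (induction B rule: finite_induct)
    case (insert i B)
    then have "\<bar>(\<integral>y. ?F y \<partial>PiM I (H B)) - (\<integral>y. ?F y \<partial>PiM I (H {}))\<bar> \<le> (\<Sum>i\<in>B. er i)" by simp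
    moreover have "\<bar>(\<integral>y. ?F y \<partial>PiM I (H (insert i B))) - (\<integral>y. ?F y \<partial>PiM I (H B))\<bar> \<le> er i"
      using insert by (intro step) auto
    ultimately show ?case using insert.hyps by simp
  qed simp
  from this[of I] have main: "\<bar>(\<integral>y. ?F y \<partial>PiM I (H I)) - (\<integral>y. ?F y \<partial>PiM I (H {}))\<bar> \<le> (\<Sum>i\<in>I. er i)" by simp
  have Fm: "?F \<in> borel_measurable (PiM I (\<lambda>_. ?N))" unfolding hprod_def
    by (intro borel_measurable_prod borel_measurable_diff borel_measurable_const measurable_compose[OF _ borel_measurable_lgs]
        borel_measurable_add borel_measurable_sum measurable_PiM_component2)
  have "(\<integral>y. ?F y \<partial>PiM I (H I)) = (\<integral>y. ?F y \<partial>PiM I mu)"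
    by (intro arg_cong[where f="\<lambda>Q. integral\<^sup>L Q ?F"] PiM_cong) (auto simp: H_def)
  also have "\<dots> = expectation (\<lambda>\<omega>. ?F (\<lambda>i\<in>I. \<lambda>a\<in>J. W i a \<omega>))"
    unfolding mu_def by (rule integral_PiM_indep[OF I(2) ind Fm])
  also have "\<dots> = expectation (\<lambda>\<omega>. hprod J (\<lambda>a. t + (\<Sum>i\<in>I. W i a \<omega>)))"
    unfolding hprod_def by (simp cong: sum.cong prod.cong)
  finally have v1: "(\<integral>y. ?F y \<partial>PiM I (H I)) = expectation (\<lambda>\<omega>. hprod J (\<lambda>a. t + (\<Sum>i\<in>I. W i a \<omega>)))" .
  have "(\<integral>y. ?F y \<partial>PiM I (H {})) = (\<integral>y. (\<Prod>a\<in>J. (\<lambda>u. 1 - lgs (t + u)) (\<Sum>i\<in>I. y i a)) \<partial>PiM I (\<lambda>i. PiM J (L i)))"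
    unfolding hprod_def by (intro arg_cong2[where f="integral\<^sup>L"] PiM_cong) (auto simp: H_def nu_def)
  also have "\<dots> = (\<Prod>a\<in>J. \<integral>x. 1 - lgs (t + (\<Sum>i\<in>I. x i)) \<partial>PiM I (\<lambda>i. L i a))"
    by (rule PiM_PiM_prod_integral[where h="\<lambda>a u. 1 - lgs (t + u)", OF J L I(1)]) (auto simp: abs_le_iff less_imp_le intro: order_trans[of _ 1])
  also have "\<dots> = (\<Prod>a\<in>J. 1 - expectation (\<lambda>\<omega>. lgs (t + (\<Sum>i\<in>I. W i a \<omega>))))"
  proof (rule prod.cong[OF refl])
    fix a assume a: "a \<in> J"
    interpret La: prob_space "PiM I (\<lambda>i. L i a)" by (intro prob_space_PiM L)
    have sLa: "sets (PiM I (\<lambda>i. L i a)) = sets (PiM I (\<lambda>_. borel))" by (intro sets_PiM_cong L refl)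
    have "integrable (PiM I (\<lambda>i. L i a)) (\<lambda>x. lgs (t + (\<Sum>i\<in>I. x i)))"
      by (intro La.integrable_const_bound[where B=1]) (auto simp: measurable_cong_sets[OF sLa refl])
    then have "(\<integral>x. 1 - lgs (t + (\<Sum>i\<in>I. x i)) \<partial>PiM I (\<lambda>i. L i a)) = 1 - (\<integral>x. lgs (t + (\<Sum>i\<in>I. x i)) \<partial>PiM I (\<lambda>i. L i a))"
      by (simp add: La.prob_space)
    also have "(\<integral>x. lgs (t + (\<Sum>i\<in>I. x i)) \<partial>PiM I (\<lambda>i. L i a)) = (\<integral>y. lgs (t + (\<Sum>j\<in>I. y j a)) \<partial>PiM I (H {}))"
      using PiM_component_sum_integral[where F="\<lambda>u. lgs (t + u)" and K="H {}", OF I(1) a H] by (simp add: dH[OF a])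
    finally show "(\<integral>x. 1 - lgs (t + (\<Sum>i\<in>I. x i)) \<partial>PiM I (\<lambda>i. L i a)) = 1 - expectation (\<lambda>\<omega>. lgs (t + (\<Sum>i\<in>I. W i a \<omega>)))"
      using GH[OF a] by simp
  qed
  finally have v2: "(\<integral>y. ?F y \<partial>PiM I (H {})) = (\<Prod>a\<in>J. 1 - expectation (\<lambda>\<omega>. lgs (t + (\<Sum>i\<in>I. W i a \<omega>))))" .
  have "(\<Sum>i\<in>I. er i) = 18 * (\<Sum>i\<in>I. \<rho> i) + (\<Sum>i\<in>I. \<beta> i) * (real (card Sg) * exp (2 * c * t + Mx)
        + 1056 * b * (real (card J) * Gm))"
    unfolding er_def by (simp add: sum.distrib sum_distrib_left sum_distrib_right)
  then show ?thesis using main unfolding v1 v2 by simp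
qed

section \<open>Single sums: Gaussian comparison and exponential bounds\<close>

lemma (in prob_space) lgs_sum_gauss:
  fixes W :: "'i \<Rightarrow> 'a \<Rightarrow> real" and t :: real
  assumes I: "finite I" "I \<noteq> {}"
    and W: "\<And>i. W i \<in> borel_measurable M" "\<And>i \<omega>. \<bar>W i \<omega>\<bar> \<le> b" and b: "b \<le> 1"
    and ind: "indep_vars (\<lambda>_. borel) W I"
    and s: "\<And>i. i \<in> I \<Longrightarrow> 0 < \<sigma> i" "\<And>i. i \<in> I \<Longrightarrow> \<sigma> i \<le> 1"
      "\<And>i. i \<in> I \<Longrightarrow> (\<sigma> i)^2 + 2 * gauss_rem * (\<sigma> i)^3 \<le> 1"
    and e: "(\<Sum>i\<in>I. 2 * (\<bar>expectation (W i)\<bar> + \<bar>expectation (\<lambda>\<omega>. (W i \<omega>)^2) - (\<sigma> i)^2\<bar>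
       + b * expectation (\<lambda>\<omega>. (W i \<omega>)^2) + gauss_rem * (\<sigma> i)^3)) \<le> e"
    and e1: "e \<le> 1"
  defines "\<gamma> \<equiv> \<integral>z. lgs (t + z) \<partial>gauss (sqrt (\<Sum>i\<in>I. (\<sigma> i)^2))"
  shows "\<bar>expectation (\<lambda>\<omega>. lgs (t + (\<Sum>i\<in>I. W i \<omega>))) - \<gamma>\<bar> \<le> 2 * e * \<gamma>"
proof -
  define s' where "s' i = (if i \<in> I then \<sigma> i else 1)" for i
  define mu where "mu i = distr M borel (W i)" for i
  define ep where "ep i = 2 * (\<bar>expectation (W i)\<bar> + \<bar>expectation (\<lambda>\<omega>. (W i \<omega>)^2) - (\<sigma> i)^2\<bar>
       + b * expectation (\<lambda>\<omega>. (W i \<omega>)^2) + gauss_rem * (\<sigma> i)^3)" for i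
  note [measurable] = W(1)
  have b0: "0 \<le> b" using W(2) abs_ge_zero order_trans by blast
  have s'0: "0 < s' i" for i using s by (simp add: s'_def)
  have mu: "prob_space (mu i)" "sets (mu i) = sets borel" for i
    unfolding mu_def by (auto intro: prob_space_distr)
  have g: "prob_space (gauss (s' i))" "sets (gauss (s' i)) = sets borel" for i
    using s'0 by (auto intro: prob_space_normal_density)
  have ep0: "0 \<le> ep i" if "i \<in> I" for i
    unfolding ep_def using b0 gauss_rem_nonneg s(1)[OF that]
    by (intro mult_nonneg_nonneg add_nonneg_nonneg) auto
  have st: "\<bar>(\<integral>y. lgs (u + y) \<partial>mu i) - (\<integral>y. lgs (u + y) \<partial>gauss (s' i))\<bar>
      \<le> ep i * (\<integral>y. lgs (u + y) \<partial>gauss (s' i))" if i: "i \<in> I" for i u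
  proof -
    have m1: "(\<integral>y. y \<partial>mu i) = expectation (W i)" unfolding mu_def by (simp add: integral_distr)
    have m2: "(\<integral>y. y^2 \<partial>mu i) = expectation (\<lambda>\<omega>. (W i \<omega>)^2)" unfolding mu_def by (simp add: integral_distr)
    have "AE y in mu i. \<bar>y\<bar> \<le> b" unfolding mu_def by (subst AE_distr_iff) (auto simp: W(2))
    from lgs_smooth_compare[OF mu this b s(1-3)[OF i], of u] show ?thesis
      using i by (simp only: m1 m2 ep_def s'_def if_True)
  qed
  have "\<bar>(\<integral>x. lgs (t + (\<Sum>j\<in>I. x j)) \<partial>PiM I mu) - (\<integral>x. lgs (t + (\<Sum>j\<in>I. x j)) \<partial>PiM I (\<lambda>i. gauss (s' i)))\<bar>
     \<le> 2 * (\<Sum>j\<in>I. ep j) * (\<integral>x. lgs (t + (\<Sum>j\<in>I. x j)) \<partial>PiM I (\<lambda>i. gauss (s' i)))"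
    using e e1 by (intro PiM_lgs_compare[OF I(1) mu g ep0 st]) (auto simp: ep_def)
  also have "(\<integral>x. lgs (t + (\<Sum>j\<in>I. x j)) \<partial>PiM I (\<lambda>i. gauss (s' i))) = \<gamma>"
  proof -
    have "(\<Sum>i\<in>I. (s' i)^2) = (\<Sum>i\<in>I. (\<sigma> i)^2)" by (intro sum.cong) (auto simp: s'_def)
    then show ?thesis
      using integral_PiM_gauss_sum[OF I s'0, of "\<lambda>u. lgs (t + u)"] by (simp add: \<gamma>_def)
  qed
  also have "(\<integral>x. lgs (t + (\<Sum>j\<in>I. x j)) \<partial>PiM I mu) = expectation (\<lambda>\<omega>. lgs (t + (\<Sum>j\<in>I. (\<lambda>i\<in>I. W i \<omega>) j)))"
    unfolding mu_def by (rule integral_PiM_indep[OF I(2) ind]) measurable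
  also have "\<dots> = expectation (\<lambda>\<omega>. lgs (t + (\<Sum>i\<in>I. W i \<omega>)))" by (simp cong: sum.cong)
  finally have 1: "\<bar>expectation (\<lambda>\<omega>. lgs (t + (\<Sum>i\<in>I. W i \<omega>))) - \<gamma>\<bar> \<le> 2 * (\<Sum>j\<in>I. ep j) * \<gamma>" .
  have "0 \<le> \<gamma>" unfolding \<gamma>_def by (intro Bochner_Integration.integral_nonneg) auto
  then have "2 * (\<Sum>j\<in>I. ep j) * \<gamma> \<le> 2 * e * \<gamma>"
    using e by (intro mult_right_mono) (auto simp: ep_def)
  with 1 show ?thesis by linarith
qed

lemma exp_le_quadratic: "\<bar>u\<bar> \<le> 1 \<Longrightarrow> exp u \<le> 1 + u + (u::real)^2"
proof (cases "u \<ge> 0")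
  case False
  assume "\<bar>u\<bar> \<le> 1"
  obtain t where t: "u < t" "t < 0" "exp u = (\<Sum>m<2. exp 0 / fact m * u^m) + exp t / fact 2 * u^2"
    using Maclaurin_minus[of u 2 "\<lambda>_. exp" exp] False by (auto intro: DERIV_exp)
  have "exp t * u^2 \<le> 1 * u^2" using t by (intro mult_right_mono) auto
  moreover have "exp u = 1 + u + exp t * u^2 / 2" using t(3) by (simp add: numeral_2_eq_2)
  moreover have "0 \<le> u^2" by simp
  ultimately show ?thesis by linarith
qed (use exp_bound in auto)

lemma exp_le_cubic:
  assumes "\<bar>u\<bar> \<le> 1" shows "exp u \<le> 1 + u + u^2 / 2 + \<bar>u\<bar>^3 * (1::real)"
proof -
  obtain t where t: "\<bar>t\<bar> \<le> \<bar>u\<bar>" "exp u = (\<Sum>m<3. u^m / fact m) + exp t / fact 3 * u^3"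
    using Maclaurin_exp_le[of u 3] by blast
  have "exp t \<le> exp 1" using t assms by simp
  then have "exp t \<le> 3" using exp_le by linarith
  then have "exp t * \<bar>u\<bar>^3 \<le> 3 * \<bar>u\<bar>^3" by (intro mult_right_mono) auto
  moreover have "exp t * u^3 \<le> exp t * \<bar>u\<bar>^3" by (simp add: power_abs[symmetric])
  moreover have "0 \<le> \<bar>u\<bar>^3" by simp
  moreover have "exp t / fact 3 * u^3 = exp t * u^3 / 6" by (simp add: fact_numeral)
  ultimately have "exp t / fact 3 * u^3 \<le> \<bar>u\<bar>^3" by linarith
  moreover have "(\<Sum>m<3. u^m / fact m) = 1 + u + u^2 / 2" by (simp add: numeral_3_eq_3 power2_eq_square)
  ultimately show ?thesis using t(2) by simp
qed

lemma (in prob_space) expectation_exp_le: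
  fixes U :: "'a \<Rightarrow> real"
  assumes U: "U \<in> borel_measurable M" "\<And>\<omega>. \<bar>U \<omega>\<bar> \<le> B" and c: "0 \<le> c" "c * B \<le> 1"
  shows "expectation (\<lambda>\<omega>. exp (c * U \<omega>)) \<le>
     exp (c * \<bar>expectation U\<bar> + (c^2 / 2 + c^3 * B) * expectation (\<lambda>\<omega>. (U \<omega>)^2))"
proof -
  note [measurable] = U(1)
  have B0: "0 \<le> B" using U(2) abs_ge_zero order_trans by blast
  have i1: "integrable M U" using U by (intro integrable_const_bound[where B=B]) auto
  have i2: "integrable M (\<lambda>\<omega>. (U \<omega>)^2)"
    using U by (intro integrable_const_bound[where B="B^2"]) (auto simp: abs_le_square_iff[symmetric] B0)
  have cU: "\<bar>c * U \<omega>\<bar> \<le> 1" for \<omega>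
    using mult_left_mono[OF U(2)[of \<omega>] c(1)] c by (simp add: abs_mult)
  have ie: "integrable M (\<lambda>\<omega>. exp (c * U \<omega>))"
  proof (rule integrable_const_bound[where B="exp 1"])
    show "AE \<omega> in M. norm (exp (c * U \<omega>)) \<le> exp 1" using cU by (auto simp: abs_le_iff)
  qed measurable
  have "expectation (\<lambda>\<omega>. exp (c * U \<omega>)) \<le> expectation (\<lambda>\<omega>. 1 + c * U \<omega> + (c^2 / 2 + c^3 * B) * (U \<omega>)^2)"
  proof (intro integral_mono ie)
    show "integrable M (\<lambda>\<omega>. 1 + c * U \<omega> + (c^2 / 2 + c^3 * B) * (U \<omega>)^2)" using i1 i2 by auto
    fix \<omega>
    have "\<bar>c * U \<omega>\<bar>^3 = c^3 * (\<bar>U \<omega>\<bar> * (U \<omega>)^2)"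
      using c by (simp add: abs_mult power_mult_distrib power3_eq_cube power2_eq_square)
    also have "\<dots> \<le> c^3 * (B * (U \<omega>)^2)" using c U(2) by (intro mult_left_mono mult_right_mono) auto
    finally show "exp (c * U \<omega>) \<le> 1 + c * U \<omega> + (c^2 / 2 + c^3 * B) * (U \<omega>)^2"
      using exp_le_cubic[OF cU[of \<omega>]] by (simp add: power_mult_distrib algebra_simps)
  qed
  also have "\<dots> = 1 + (c * expectation U + (c^2 / 2 + c^3 * B) * expectation (\<lambda>\<omega>. (U \<omega>)^2))"
    using i1 i2 by (simp add: prob_space)
  also have "\<dots> \<le> exp (c * expectation U + (c^2 / 2 + c^3 * B) * expectation (\<lambda>\<omega>. (U \<omega>)^2))"
    by (rule exp_ge_add_one_self)
  also have "\<dots> \<le> exp (c * \<bar>expectation U\<bar> + (c^2 / 2 + c^3 * B) * expectation (\<lambda>\<omega>. (U \<omega>)^2))"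
    using c by (auto intro!: mult_left_mono)
  finally show ?thesis .
qed

lemma (in prob_space) bernstein_upper:
  fixes X :: "'i \<Rightarrow> 'a \<Rightarrow> real"
  assumes I: "finite I" and ind: "indep_vars (\<lambda>_. borel) X I"
    and X: "\<And>i \<omega>. i \<in> I \<Longrightarrow> \<bar>X i \<omega>\<bar> \<le> b" "\<And>i. i \<in> I \<Longrightarrow> expectation (\<lambda>\<omega>. (X i \<omega>)^2) \<le> v"
    and t: "0 < t" "0 < v" "t * b \<le> v"
  shows "prob {\<omega> \<in> space M. (\<Sum>i\<in>I. X i \<omega> - expectation (X i)) \<ge> real (card I) * t}
     \<le> exp (- real (card I) * t^2 / (4 * v))"
proof -
  define c where "c = t / (2 * v)"
  have c: "0 < c" using t by (simp add: c_def)
  define Y where "Y i \<omega> = X i \<omega> - expectation (X i)" for i \<omega>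
  have Xm[measurable]: "X i \<in> borel_measurable M" if "i \<in> I" for i using ind that by (auto simp: indep_vars_def)
  have Ym[measurable]: "Y i \<in> borel_measurable M" if "i \<in> I" for i unfolding Y_def[abs_def] using that by measurable
  have iX: "integrable M (X i)" if "i \<in> I" for i
    using X(1) that by (intro integrable_const_bound[where B=b]) auto
  have iX2: "integrable M (\<lambda>\<omega>. (X i \<omega>)^2)" if "i \<in> I" for i
  proof (rule integrable_const_bound[where B="b^2"])
    show "AE \<omega> in M. norm ((X i \<omega>)^2) \<le> b^2"
      using X(1)[OF that] by (intro AE_I2) (metis norm_power power_mono abs_ge_zero real_norm_def)
  qed (use that in measurable)
  have Yb: "\<bar>c * Y i \<omega>\<bar> \<le> 1" if "i \<in> I" for i \<omega>
  proof -
    have "\<bar>expectation (X i)\<bar> \<le> expectation (\<lambda>\<omega>. \<bar>X i \<omega>\<bar>)" by (rule integral_abs_bound)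
    also have "\<dots> \<le> expectation (\<lambda>_. b)" using iX[OF that] X(1)[OF that] by (intro integral_mono) auto
    finally have "\<bar>expectation (X i)\<bar> \<le> b" by (simp add: prob_space)
    then have "\<bar>Y i \<omega>\<bar> \<le> 2 * b" using X(1)[OF that, of \<omega>] unfolding Y_def by linarith
    then have "c * \<bar>Y i \<omega>\<bar> \<le> c * (2 * b)" using c by (intro mult_left_mono) auto
    also have "\<dots> \<le> 1" using t by (simp add: c_def field_simps)
    finally show ?thesis using c by (simp add: abs_mult)
  qed
  have iY: "integrable M (Y i)" if "i \<in> I" for i unfolding Y_def[abs_def] using iX[OF that] by auto
  have Y2: "(Y i \<omega>)^2 = (X i \<omega>)^2 - 2 * expectation (X i) * X i \<omega> + (expectation (X i))^2" for i \<omega>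
    by (simp add: Y_def power2_eq_square algebra_simps)
  have iY2: "integrable M (\<lambda>\<omega>. (Y i \<omega>)^2)" if "i \<in> I" for i
    unfolding Y2 using iX[OF that] iX2[OF that] by auto
  have EY2: "expectation (\<lambda>\<omega>. (Y i \<omega>)^2) \<le> v" if "i \<in> I" for i
  proof -
    have "expectation (\<lambda>\<omega>. (Y i \<omega>)^2) = expectation (\<lambda>\<omega>. (X i \<omega>)^2) - (expectation (X i))^2"
      unfolding Y2 using iX[OF that] iX2[OF that] by (simp add: prob_space power2_eq_square)
    then show ?thesis using X(2)[OF that] zero_le_power2[of "expectation (X i)"] by linarith
  qed
  have iE: "integrable M (\<lambda>\<omega>. exp (c * Y i \<omega>))" if "i \<in> I" for i
    using that Yb[OF that] by (intro integrable_const_bound[where B="exp 1"]) (auto simp: abs_le_iff)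
  have E: "expectation (\<lambda>\<omega>. exp (c * Y i \<omega>)) \<le> exp (c^2 * v)" if i: "i \<in> I" for i
  proof -
    have "expectation (\<lambda>\<omega>. exp (c * Y i \<omega>)) \<le> expectation (\<lambda>\<omega>. 1 + c * Y i \<omega> + c^2 * (Y i \<omega>)^2)"
      using iY[OF i] iY2[OF i] exp_le_quadratic[OF Yb[OF i]]
      by (intro integral_mono iE[OF i]) (auto simp: power_mult_distrib)
    also have "\<dots> = 1 + c^2 * expectation (\<lambda>\<omega>. (Y i \<omega>)^2)"
      using iY[OF i] iY2[OF i] iX[OF i] by (simp add: prob_space Y_def[abs_def])
    also have "\<dots> \<le> 1 + c^2 * v" using EY2[OF i] by (intro add_left_mono mult_left_mono) auto
    also have "\<dots> \<le> exp (c^2 * v)" by (rule exp_ge_add_one_self)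
    finally show ?thesis .
  qed
  have indE: "indep_vars (\<lambda>_. borel) (\<lambda>i \<omega>. exp (c * Y i \<omega>)) I"
  proof -
    have "indep_vars (\<lambda>_. borel) (\<lambda>i \<omega>. (\<lambda>x. exp (c * (x - expectation (X i)))) (X i \<omega>)) I"
      by (rule indep_vars_compose2[OF ind]) measurable
    then show ?thesis by (simp add: Y_def)
  qed
  have pr: "exp (c * (\<Sum>i\<in>I. Y i \<omega>)) = (\<Prod>i\<in>I. exp (c * Y i \<omega>))" for \<omega>
    using I by (simp add: sum_distrib_left exp_sum)
  have iP: "integrable M (\<lambda>\<omega>. exp (c * (\<Sum>i\<in>I. Y i \<omega>)))"
    unfolding pr by (rule indep_vars_integrable[OF I indE iE])
  have "expectation (\<lambda>\<omega>. exp (c * (\<Sum>i\<in>I. Y i \<omega>))) = (\<Prod>i\<in>I. expectation (\<lambda>\<omega>. exp (c * Y i \<omega>)))"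
    unfolding pr by (rule indep_vars_lebesgue_integral[OF I indE iE])
  also have "\<dots> \<le> (\<Prod>i\<in>I. exp (c^2 * v))"
    by (intro prod_mono conjI E Bochner_Integration.integral_nonneg) auto
  also have "\<dots> = exp (real (card I) * (c^2 * v))" by (simp add: exp_of_nat_mult)
  finally have EP: "expectation (\<lambda>\<omega>. exp (c * (\<Sum>i\<in>I. Y i \<omega>))) \<le> exp (real (card I) * (c^2 * v))" .
  have "prob {\<omega> \<in> space M. (\<Sum>i\<in>I. Y i \<omega>) \<ge> real (card I) * t}
     \<le> exp (- c * (real (card I) * t)) * expectation (\<lambda>\<omega>. exp (c * (\<Sum>i\<in>I. Y i \<omega>)))"
  proof -
    have "set_integrable M (space M) (\<lambda>\<omega>. exp (c * (\<Sum>i\<in>I. Y i \<omega>)))"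
      unfolding set_integrable_def by (intro integrable_mult_indicator iP sets.top)
    from Chernoff_ineq_ge[OF c this sets.top, of "real (card I) * t"] show ?thesis
      by (simp only: set_integral_space[OF iP])
  qed
  also have "\<dots> \<le> exp (- c * (real (card I) * t)) * exp (real (card I) * (c^2 * v))"
    by (intro mult_left_mono EP) auto
  also have "\<dots> = exp (- real (card I) * t^2 / (4 * v))"
  proof -
    have "- c * (real (card I) * t) + real (card I) * (c^2 * v) = - real (card I) * t^2 / (4 * v)"
      using t by (simp add: c_def field_simps power2_eq_square)
    then show ?thesis by (simp only: exp_add[symmetric])
  qed
  finally show ?thesis by (simp add: Y_def)
qed

lemma (in prob_space) bernstein:
  fixes X :: "'i \<Rightarrow> 'a \<Rightarrow> real"
  assumes I: "finite I" and ind: "indep_vars (\<lambda>_. borel) X I"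
    and X: "\<And>i \<omega>. i \<in> I \<Longrightarrow> \<bar>X i \<omega>\<bar> \<le> b" "\<And>i. i \<in> I \<Longrightarrow> expectation (\<lambda>\<omega>. (X i \<omega>)^2) \<le> v"
    and t: "0 < t" "0 < v" "t * b \<le> v"
  shows "prob {\<omega> \<in> space M. \<bar>\<Sum>i\<in>I. X i \<omega> - expectation (X i)\<bar> \<ge> real (card I) * t}
     \<le> 2 * exp (- real (card I) * t^2 / (4 * v))"
proof -
  have Xm[measurable]: "X i \<in> borel_measurable M" if "i \<in> I" for i using ind that by (auto simp: indep_vars_def)
  have "indep_vars (\<lambda>_. borel) (\<lambda>i \<omega>. (\<lambda>x. - x) (X i \<omega>)) I"
    by (rule indep_vars_compose2[OF ind]) measurable
  then have ind': "indep_vars (\<lambda>_. borel) (\<lambda>i \<omega>. - X i \<omega>) I" by simp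
  let ?S = "\<lambda>\<omega>. \<Sum>i\<in>I. X i \<omega> - expectation (X i)"
  let ?n = "real (card I)"
  have S[measurable]: "?S \<in> borel_measurable M" by measurable
  have 1: "prob {\<omega> \<in> space M. ?S \<omega> \<ge> ?n * t} \<le> exp (- ?n * t^2 / (4 * v))"
    by (rule bernstein_upper[OF assms])
  have "prob {\<omega> \<in> space M. (\<Sum>i\<in>I. - X i \<omega> - expectation (\<lambda>\<omega>. - X i \<omega>)) \<ge> ?n * t} \<le> exp (- ?n * t^2 / (4 * v))"
    using X t by (intro bernstein_upper[OF I ind']) auto
  moreover have "(\<Sum>i\<in>I. - X i \<omega> - expectation (\<lambda>\<omega>. - X i \<omega>)) = - ?S \<omega>" for \<omega>
    by (simp add: sum_negf[symmetric] algebra_simps)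
  ultimately have 2: "prob {\<omega> \<in> space M. - ?S \<omega> \<ge> ?n * t} \<le> exp (- ?n * t^2 / (4 * v))" by simp
  have "prob {\<omega> \<in> space M. \<bar>?S \<omega>\<bar> \<ge> ?n * t} \<le> prob ({\<omega> \<in> space M. ?S \<omega> \<ge> ?n * t} \<union> {\<omega> \<in> space M. - ?S \<omega> \<ge> ?n * t})"
    by (intro finite_measure_mono) auto
  also have "\<dots> \<le> prob {\<omega> \<in> space M. ?S \<omega> \<ge> ?n * t} + prob {\<omega> \<in> space M. - ?S \<omega> \<ge> ?n * t}"
    by (intro measure_Un_le) auto
  finally show ?thesis using 1 2 by linarith
qed

section \<open>Smoothed Gaussian tails at the extreme value threshold\<close>

lemma exponential_density_1:
  "integrable lborel (exponential_density 1)" "(\<integral>x. exponential_density 1 x \<partial>lborel) = 1"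
proof -
  have p: "prob_space (density lborel (exponential_density 1))"
    by (rule prob_space_exponential_density) simp
  have nn: "0 \<le> exponential_density 1 x" for x by (simp add: exponential_density_def)
  have e: "(\<integral>\<^sup>+x. ennreal (exponential_density 1 x) \<partial>lborel) = 1"
    using prob_space.emeasure_space_1[OF p] by (simp add: emeasure_density)
  have "has_bochner_integral lborel (exponential_density 1) 1"
    by (rule has_bochner_integral_nn_integral) (auto simp: nn e)
  then show "integrable lborel (exponential_density 1)" "(\<integral>x. exponential_density 1 x \<partial>lborel) = 1"
    by (auto simp: has_bochner_integral_iff)
qed

lemma gauss_lgs_tail_eq:
  assumes x: "0 < x" and k: "0 < \<kappa>"
  shows "(\<integral>z. lgs (- \<kappa> * x + z) \<partial>gauss \<kappa>)
     = std_normal_density x / x * (\<integral>v. lgs (\<kappa> / x * v) * exp (- v - v^2 / (2 * x^2)) \<partial>lborel)"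
proof -
  have "(\<integral>z. lgs (- \<kappa> * x + z) \<partial>gauss \<kappa>) = (\<integral>u. std_normal_density u * lgs (- \<kappa> * x + \<kappa> * u) \<partial>lborel)"
    using k by (intro integral_gauss_scale) auto
  also have "\<dots> = \<bar>1 / x\<bar> *\<^sub>R (\<integral>v. std_normal_density (x + 1 / x * v) * lgs (- \<kappa> * x + \<kappa> * (x + 1 / x * v)) \<partial>lborel)"
    using x by (intro lborel_integral_real_affine) auto
  also have "(\<integral>v. std_normal_density (x + 1 / x * v) * lgs (- \<kappa> * x + \<kappa> * (x + 1 / x * v)) \<partial>lborel)
     = (\<integral>v. std_normal_density x * (lgs (\<kappa> / x * v) * exp (- v - v^2 / (2 * x^2))) \<partial>lborel)"
  proof (rule Bochner_Integration.integral_cong[OF refl])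
    fix v
    have "- (x + 1 / x * v)\<^sup>2 / 2 = - x\<^sup>2 / 2 + (- v - v^2 / (2 * x^2))"
      using x by (simp add: field_simps power2_eq_square)
    then have "std_normal_density (x + 1 / x * v) = std_normal_density x * exp (- v - v^2 / (2 * x^2))"
      by (simp only: std_normal_density_def exp_add mult.assoc)
    moreover have "- \<kappa> * x + \<kappa> * (x + 1 / x * v) = \<kappa> / x * v" by (simp add: algebra_simps)
    ultimately show "std_normal_density (x + 1 / x * v) * lgs (- \<kappa> * x + \<kappa> * (x + 1 / x * v))
       = std_normal_density x * (lgs (\<kappa> / x * v) * exp (- v - v^2 / (2 * x^2)))" by simp
  qed
  finally show ?thesis using x by simp
qed

lemma lgs_tendsto_1: "filterlim f at_top F \<Longrightarrow> ((\<lambda>k. lgs (f k)) \<longlongrightarrow> 1) F"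
  and lgs_tendsto_0: "filterlim f at_bot F \<Longrightarrow> ((\<lambda>k. lgs (f k)) \<longlongrightarrow> 0) F"
proof -
  have "(lgs \<longlongrightarrow> 1) at_top" unfolding lgs_def[abs_def] by real_asymp
  then show "filterlim f at_top F \<Longrightarrow> ((\<lambda>k. lgs (f k)) \<longlongrightarrow> 1) F" by (rule filterlim_compose)
  have "(lgs \<longlongrightarrow> 0) at_bot" unfolding lgs_def[abs_def] by real_asymp
  then show "filterlim f at_bot F \<Longrightarrow> ((\<lambda>k. lgs (f k)) \<longlongrightarrow> 0) F" by (rule filterlim_compose)
qed

lemma laplace_integral_tendsto:
  fixes x w :: "nat \<Rightarrow> real"
  assumes x: "filterlim x at_top sequentially" and w: "filterlim w at_top sequentially"
  shows "(\<lambda>k. \<integral>v. lgs (w k * v) * exp (- v - v^2 / (2 * (x k)^2)) \<partial>lborel) \<longlonglongrightarrow> 1"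
proof -
  have "eventually (\<lambda>k. 2 \<le> w k) sequentially" using w by (simp add: filterlim_at_top)
  then obtain k0 where k0: "\<And>k. k \<ge> k0 \<Longrightarrow> 2 \<le> w k" by (auto simp: eventually_sequentially)
  let ?s = "\<lambda>k v. lgs (w (k + k0) * v) * exp (- v - v^2 / (2 * (x (k + k0))^2))"
  let ?d = "\<lambda>v. exponential_density 1 v + exponential_density 1 (- v)"
  have w': "filterlim (\<lambda>k. w (k + k0)) at_top sequentially"
    using w by (rule filterlim_compose) (rule filterlim_add_const_nat_at_top)
  have x': "filterlim (\<lambda>k. x (k + k0)) at_top sequentially"
    using x by (rule filterlim_compose) (rule filterlim_add_const_nat_at_top)
  have "(\<lambda>k. \<integral>v. ?s k v \<partial>lborel) \<longlonglongrightarrow> (\<integral>v. exponential_density 1 v \<partial>lborel)"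
  proof (rule integral_dominated_convergence[where w="?d"])
    show "integrable lborel ?d"
    proof (intro Bochner_Integration.integrable_add exponential_density_1)
      show "integrable lborel (\<lambda>v. exponential_density 1 (- v))"
        using lborel_integrable_real_affine[OF exponential_density_1(1), of "-1" 0] by simp
    qed
    have ex: "(\<lambda>k. exp (- v - v^2 / (2 * (x (k + k0))^2))) \<longlonglongrightarrow> exp (- v)" for v
    proof -
      have "(\<lambda>k. v^2 / (2 * (x (k + k0))^2)) \<longlonglongrightarrow> 0"
      proof (rule real_tendsto_divide_at_top[OF tendsto_const])
        have "filterlim (\<lambda>u. 2 * u^2 :: real) at_top at_top" by real_asymp
        then show "filterlim (\<lambda>k. 2 * (x (k + k0))^2) at_top sequentially" using x' by (rule filterlim_compose)
      qed
      then have "(\<lambda>k. exp (- v - v^2 / (2 * (x (k + k0))^2))) \<longlonglongrightarrow> exp (- v - 0)"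
        by (intro tendsto_exp tendsto_diff tendsto_const)
      then show ?thesis by simp
    qed
    have "(\<lambda>k. ?s k v) \<longlonglongrightarrow> exponential_density 1 v" if v: "v \<noteq> 0" for v
    proof (cases "v > 0")
      case True
      have "filterlim (\<lambda>k. w (k + k0) * v) at_top sequentially"
        using w' True by (intro filterlim_at_top_mult_tendsto_pos[OF tendsto_const]) (auto simp: mult.commute)
      then have "(\<lambda>k. ?s k v) \<longlonglongrightarrow> 1 * exp (- v)" by (intro tendsto_mult ex lgs_tendsto_1)
      then show ?thesis using True by (simp add: exponential_density_def)
    next
      case False
      have "filterlim (\<lambda>k. w (k + k0) * v) at_bot sequentially"
        using filterlim_tendsto_neg_mult_at_bot[OF tendsto_const[of v] _ w'] False v by (simp add: mult.commute)
      then have "(\<lambda>k. ?s k v) \<longlonglongrightarrow> 0 * exp (- v)" by (intro tendsto_mult ex lgs_tendsto_0)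
      then show ?thesis using False v by (simp add: exponential_density_def)
    qed
    then show "AE v in lborel. (\<lambda>k. ?s k v) \<longlonglongrightarrow> exponential_density 1 v"
      using AE_lborel_singleton[of "0::real"] by (auto elim: eventually_mono)
    fix k
    show "AE v in lborel. norm (?s k v) \<le> ?d v"
    proof (intro AE_I2)
      fix v :: real
      have e: "exp (- v - v^2 / (2 * (x (k + k0))^2)) \<le> exp (- v)" by simp
      show "norm (?s k v) \<le> ?d v"
      proof (cases "v \<ge> 0")
        case True
        have "?s k v \<le> 1 * exp (- v)" using e by (intro mult_mono) auto
        moreover have "exp (- v) \<le> ?d v" using True by (simp add: exponential_density_def)
        ultimately show ?thesis by (simp add: abs_mult)
      next
        case False
        have w2: "2 \<le> w (k + k0)" by (rule k0) simp
        have "lgs (w (k + k0) * v) \<le> exp (1 * (w (k + k0) * v))" by (rule lgs_le_exp) auto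
        also have "\<dots> \<le> exp (2 * v)" using w2 False by (simp add: mult_right_mono_neg)
        finally have "?s k v \<le> exp (2 * v) * exp (- v)" using e by (intro mult_mono) auto
        also have "\<dots> = exp v" by (simp add: exp_add[symmetric])
        finally show ?thesis using False by (simp add: exponential_density_def abs_mult)
      qed
    qed
  qed measurable
  then have "(\<lambda>k. \<integral>v. ?s k v \<partial>lborel) \<longlonglongrightarrow> 1" by (simp add: exponential_density_1)
  then show ?thesis by (rule LIMSEQ_offset)
qed

definition xcrit :: "real \<Rightarrow> real \<Rightarrow> real" where
  "xcrit y Q = sqrt (2 * ln Q - ln (ln Q) + y)"

lemma xcrit_at_top: "filterlim (xcrit y) at_top at_top"
  unfolding xcrit_def[abs_def] by real_asymp

lemma gauss_lgs_tail_tendsto: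
  fixes q \<kappa> :: "nat \<Rightarrow> real"
  assumes q: "filterlim q at_top sequentially"
    and w: "filterlim (\<lambda>k. \<kappa> k / xcrit y (q k)) at_top sequentially"
  shows "(\<lambda>k. q k * (\<integral>z. lgs (- \<kappa> k * xcrit y (q k) + z) \<partial>gauss (\<kappa> k))) \<longlonglongrightarrow> exp (- y / 2) / (2 * sqrt pi)"
proof -
  let ?x = "\<lambda>k. xcrit y (q k)"
  have x: "filterlim ?x at_top sequentially" using xcrit_at_top q by (rule filterlim_compose)
  have ev: "eventually (\<lambda>k. 0 < ?x k \<and> 0 < \<kappa> k / ?x k) sequentially"
    using x w by (intro eventually_conj) (auto simp: filterlim_at_top_dense)
  have "((\<lambda>Q. Q * (exp (- (2 * ln Q - ln (ln Q) + y) / 2) / sqrt (2 * pi) / sqrt (2 * ln Q - ln (ln Q) + y)))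
     \<longlongrightarrow> exp (- y / 2) / (2 * sqrt pi)) at_top" for y :: real
  proof -
    have 1: "((\<lambda>Q. sqrt (ln Q) / sqrt (2 * ln Q - ln (ln Q) + y)) \<longlongrightarrow> 1 / sqrt 2) at_top"
    proof -
      have "((\<lambda>Q. (ln Q) / (2 * ln Q - ln (ln Q) + y)) \<longlongrightarrow> 1 / 2) at_top" by real_asymp
      from tendsto_real_sqrt[OF this] show ?thesis by (simp add: real_sqrt_divide)
    qed
    have "eventually (\<lambda>Q::real. Q > exp 1) at_top" by (rule eventually_gt_at_top)
    then have 2: "eventually (\<lambda>Q. Q * (exp (- (2 * ln Q - ln (ln Q) + y) / 2) / sqrt (2 * pi) / sqrt (2 * ln Q - ln (ln Q) + y))
       = (exp (- y / 2) / sqrt (2 * pi)) * (sqrt (ln Q) / sqrt (2 * ln Q - ln (ln Q) + y))) at_top"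
    proof eventually_elim
      case (elim Q)
      have Q: "0 < Q" using elim exp_gt_zero[of "1::real"] by linarith
      have "ln (exp (1::real)) < ln Q" using elim Q by (subst ln_less_cancel_iff) auto
      then have lQ: "0 < ln Q" by simp
      have "- (2 * ln Q - ln (ln Q) + y) / 2 = - ln Q + (ln (ln Q) / 2 + - y / 2)" by (simp add: field_simps)
      then have "exp (- (2 * ln Q - ln (ln Q) + y) / 2) = exp (- ln Q) * (exp (ln (ln Q) / 2) * exp (- y / 2))"
        by (simp only: exp_add)
      moreover have "exp (- ln Q) = 1 / Q" using Q by (simp add: exp_minus inverse_eq_divide)
      moreover have "exp (ln (ln Q) / 2) = sqrt (ln Q)"
        using lQ by (simp add: powr_half_sqrt[symmetric] powr_def)
      ultimately show ?case using Q by simp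
    qed
    have "((\<lambda>Q. (exp (- y / 2) / sqrt (2 * pi)) * (sqrt (ln Q) / sqrt (2 * ln Q - ln (ln Q) + y)))
      \<longlongrightarrow> (exp (- y / 2) / sqrt (2 * pi)) * (1 / sqrt 2)) at_top"
      by (intro tendsto_mult tendsto_const 1)
    moreover have "(exp (- y / 2) / sqrt (2 * pi)) * (1 / sqrt 2) = exp (- y / 2) / (2 * sqrt pi)"
      by (simp add: real_sqrt_mult)
    ultimately have "((\<lambda>Q. (exp (- y / 2) / sqrt (2 * pi)) * (sqrt (ln Q) / sqrt (2 * ln Q - ln (ln Q) + y)))
      \<longlongrightarrow> exp (- y / 2) / (2 * sqrt pi)) at_top" by (simp only:)
    then show ?thesis by (simp only: tendsto_cong[OF 2])
  qed
  from filterlim_compose[OF this q] have A: "(\<lambda>k. q k * (std_normal_density (?x k) / ?x k)) \<longlonglongrightarrow> exp (- y / 2) / (2 * sqrt pi)"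
  proof (rule Lim_transform_eventually)
    show "\<forall>\<^sub>F k in sequentially. q k * (exp (- (2 * ln (q k) - ln (ln (q k)) + y) / 2) / sqrt (2 * pi)
        / sqrt (2 * ln (q k) - ln (ln (q k)) + y)) = q k * (std_normal_density (?x k) / ?x k)"
      using ev
    proof eventually_elim
      case (elim k)
      then have "0 \<le> 2 * ln (q k) - ln (ln (q k)) + y" by (simp add: xcrit_def)
      then show ?case by (simp add: xcrit_def std_normal_density_def)
    qed
  qed
  have "(\<lambda>k. q k * (std_normal_density (?x k) / ?x k)
      * (\<integral>v. lgs (\<kappa> k / ?x k * v) * exp (- v - v^2 / (2 * (?x k)^2)) \<partial>lborel)) \<longlonglongrightarrow> exp (- y / 2) / (2 * sqrt pi) * 1"
    by (intro tendsto_mult A laplace_integral_tendsto x w)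
  then have "(\<lambda>k. q k * (std_normal_density (?x k) / ?x k)
      * (\<integral>v. lgs (\<kappa> k / ?x k * v) * exp (- v - v^2 / (2 * (?x k)^2)) \<partial>lborel)) \<longlonglongrightarrow> exp (- y / 2) / (2 * sqrt pi)"
    by (simp only: mult_1_right)
  then show ?thesis
  proof (rule Lim_transform_eventually)
    show "\<forall>\<^sub>F k in sequentially. q k * (std_normal_density (?x k) / ?x k)
      * (\<integral>v. lgs (\<kappa> k / ?x k * v) * exp (- v - v^2 / (2 * (?x k)^2)) \<partial>lborel)
      = q k * (\<integral>z. lgs (- \<kappa> k * ?x k + z) \<partial>gauss (\<kappa> k))"
      using ev
    proof eventually_elim
      case (elim k)
      then have "0 < \<kappa> k" by (auto simp: zero_less_divide_iff)
      with elim show ?case by (simp only: gauss_lgs_tail_eq mult.assoc)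
    qed
  qed
qed

lemma prod_one_minus_tendsto:
  fixes pr :: "nat \<Rightarrow> 'j \<Rightarrow> real" and \<gamma> \<delta> :: "nat \<Rightarrow> real"
  assumes J: "eventually (\<lambda>k. finite (J k)) sequentially"
    and p: "eventually (\<lambda>k. \<forall>a\<in>J k. \<bar>pr k a - \<gamma> k\<bar> \<le> \<delta> k * \<gamma> k) sequentially"
    and g: "\<And>k. 0 \<le> \<gamma> k" "(\<lambda>k. real (card (J k)) * \<gamma> k) \<longlonglongrightarrow> l" "\<gamma> \<longlonglongrightarrow> 0" and d: "\<delta> \<longlonglongrightarrow> 0"
  shows "(\<lambda>k. \<Prod>a\<in>J k. 1 - pr k a) \<longlonglongrightarrow> exp (- l)"
proof -
  let ?n = "\<lambda>k. real (card (J k))"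
  have d1: "eventually (\<lambda>k. \<bar>\<delta> k\<bar> < 1/2) sequentially"
    using tendstoD[OF d, of "1/2"] by (simp add: dist_real_def)
  have g1: "eventually (\<lambda>k. \<bar>\<gamma> k\<bar> < 1/4) sequentially"
    using tendstoD[OF g(3), of "1/4"] by (simp add: dist_real_def)
  have ev: "eventually (\<lambda>k. (\<Prod>a\<in>J k. 1 - pr k a) \<le> exp (- (?n k * \<gamma> k * (1 - \<delta> k))) \<and>
     exp (- (?n k * \<gamma> k * (1 + \<delta> k)) - ?n k * \<gamma> k * (8 * \<gamma> k)) \<le> (\<Prod>a\<in>J k. 1 - pr k a)) sequentially"
    using J p d1 g1
  proof eventually_elim
    case (elim k)
    have pb: "\<gamma> k * (1 - \<delta> k) \<le> pr k a" "pr k a \<le> \<gamma> k * (1 + \<delta> k)" if "a \<in> J k" for a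
      using elim(2) that by (auto simp: abs_le_iff algebra_simps)
    have "\<gamma> k * (1 - \<delta> k) \<ge> 0" using elim g(1)[of k] by simp
    then have p0: "0 \<le> pr k a" if "a \<in> J k" for a using pb(1)[OF that] by linarith
    have "\<gamma> k * (1 + \<delta> k) \<le> \<gamma> k * 2" using elim g(1)[of k] by (intro mult_left_mono) auto
    then have p2: "pr k a \<le> 2 * \<gamma> k" if "a \<in> J k" for a using pb(2)[OF that] by linarith
    have ph: "pr k a \<le> 1/2" if "a \<in> J k" for a using p2[OF that] elim by linarith
    have "(\<Prod>a\<in>J k. 1 - pr k a) \<le> exp (- (\<Sum>a\<in>J k. pr k a))"
      using p0 ph by (intro prod_one_minus_le_exp) (auto intro: order_trans[of _ "1/2"])
    also have "\<dots> \<le> exp (- (\<Sum>a\<in>J k. \<gamma> k * (1 - \<delta> k)))" 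
      unfolding exp_le_cancel_iff neg_le_iff_le by (intro sum_mono pb)
    also have "\<dots> = exp (- (?n k * \<gamma> k * (1 - \<delta> k)))" by simp
    finally have 1: "(\<Prod>a\<in>J k. 1 - pr k a) \<le> exp (- (?n k * \<gamma> k * (1 - \<delta> k)))" .
    have "exp (- (?n k * \<gamma> k * (1 + \<delta> k)) - ?n k * \<gamma> k * (8 * \<gamma> k))
        = (\<Prod>a\<in>J k. exp (- (\<gamma> k * (1 + \<delta> k)) - 2 * (2 * \<gamma> k)^2))"
      by (simp add: exp_of_nat_mult[symmetric] algebra_simps power2_eq_square)
    also have "\<dots> \<le> (\<Prod>a\<in>J k. 1 - pr k a)"
    proof (intro prod_mono conjI)
      fix a assume a: "a \<in> J k"
      have "(pr k a)^2 \<le> (2 * \<gamma> k)^2" using p0[OF a] p2[OF a] by (intro power_mono) auto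
      then have "exp (- (\<gamma> k * (1 + \<delta> k)) - 2 * (2 * \<gamma> k)^2) \<le> exp (- pr k a - 2 * (pr k a)^2)"
        using pb(2)[OF a] by simp
      also have "\<dots> \<le> exp (ln (1 - pr k a))"
        using ln_one_minus_pos_lower_bound[OF p0[OF a] ph[OF a]] by simp
      also have "\<dots> = 1 - pr k a" using ph[OF a] by simp
      finally show "exp (- (\<gamma> k * (1 + \<delta> k)) - 2 * (2 * \<gamma> k)^2) \<le> 1 - pr k a" .
    qed simp
    finally show ?case using 1 by simp
  qed
  have u: "(\<lambda>k. exp (- (?n k * \<gamma> k * (1 - \<delta> k)))) \<longlonglongrightarrow> exp (- (l * (1 - 0)))"
    by (intro tendsto_intros g d)
  have l: "(\<lambda>k. exp (- (?n k * \<gamma> k * (1 + \<delta> k)) - ?n k * \<gamma> k * (8 * \<gamma> k))) \<longlonglongrightarrow> exp (- (l * (1 + 0)) - l * (8 * 0))"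
    by (intro tendsto_intros g d)
  show ?thesis
    by (rule tendsto_sandwich[of "\<lambda>k. exp (- (?n k * \<gamma> k * (1 + \<delta> k)) - ?n k * \<gamma> k * (8 * \<gamma> k))"
        _ _ "\<lambda>k. exp (- (?n k * \<gamma> k * (1 - \<delta> k)))"])
      (use ev u l in \<open>auto elim: eventually_mono\<close>)
qed

section \<open>Eigenvalue bounds and the entries of a covariance matrix\<close>

definition qform :: "'i set \<Rightarrow> ('i \<Rightarrow> 'i \<Rightarrow> real) \<Rightarrow> ('i \<Rightarrow> real) \<Rightarrow> ('i \<Rightarrow> real) \<Rightarrow> real" where
  "qform I A u v = (\<Sum>i\<in>I. u i * (\<Sum>j\<in>I. A i j * v j))"

lemma qform_sym:
  assumes "\<And>i j. i \<in> I \<Longrightarrow> j \<in> I \<Longrightarrow> A i j = A j i"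
  shows "qform I A u v = qform I A v u"
proof -
  have "qform I A u v = (\<Sum>i\<in>I. \<Sum>j\<in>I. A i j * u i * v j)"
    by (simp add: qform_def sum_distrib_left mult_ac)
  also have "\<dots> = (\<Sum>j\<in>I. \<Sum>i\<in>I. A i j * u i * v j)" by (rule sum.swap)
  also have "\<dots> = (\<Sum>j\<in>I. \<Sum>i\<in>I. A j i * u i * v j)" using assms by (intro sum.cong refl) simp
  also have "\<dots> = qform I A v u" by (simp add: qform_def sum_distrib_left mult_ac)
  finally show ?thesis .
qed

lemma qform_add_left: "qform I A (\<lambda>i. u i + c * w i) v = qform I A u v + c * qform I A w v"
  by (simp add: qform_def sum.distrib distrib_right sum_distrib_left[of c] mult.assoc)

lemma qform_add_right: "qform I A v (\<lambda>i. u i + c * w i) = qform I A v u + c * qform I A v w"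
  by (simp add: qform_def sum.distrib distrib_left sum_distrib_left mult_ac)

lemma psd_cauchy_schwarz:
  assumes sym: "\<And>i j. i \<in> I \<Longrightarrow> j \<in> I \<Longrightarrow> A i j = A j i"
    and psd: "\<And>w. 0 \<le> qform I A w w"
  shows "(qform I A u v)^2 \<le> qform I A u u * qform I A v v"
proof -
  let ?a = "qform I A u u" and ?b = "qform I A u v" and ?c = "qform I A v v"
  have q: "0 \<le> ?a + 2 * c * ?b + c^2 * ?c" for c
  proof -
    have "qform I A (\<lambda>i. u i + c * v i) (\<lambda>i. u i + c * v i) = ?a + 2 * c * ?b + c^2 * ?c"
      by (simp only: qform_add_left qform_add_right qform_sym[of I A v u, OF sym])
         (simp add: power2_eq_square algebra_simps)
    then show ?thesis using psd by metis
  qed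
  show ?thesis
  proof (cases "?c = 0")
    case True
    show ?thesis
    proof (cases "?b = 0")
      case False
      have "0 \<le> ?a + 2 * (- (?a + 1) / (2 * ?b)) * ?b" using q[of "- (?a + 1) / (2 * ?b)"] True by simp
      moreover have "2 * (- (?a + 1) / (2 * ?b)) * ?b = - (?a + 1)" using False by simp
      ultimately show ?thesis by linarith
    qed (simp add: True)
  next
    case False
    then have c0: "0 < ?c" using psd[of v] by simp
    have "0 \<le> ?a + 2 * (- ?b / ?c) * ?b + (- ?b / ?c)^2 * ?c" by (rule q)
    then have "0 \<le> (?a * ?c - ?b^2) / ?c" using c0 by (simp add: field_simps power2_eq_square)
    then show ?thesis using c0 by (simp add: zero_le_divide_iff)
  qed
qed

lemma compact_unit_sphere_fun:
  assumes "finite I"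
  shows "compact {v :: 'i \<Rightarrow> real. (\<forall>i. i \<notin> I \<longrightarrow> v i = 0) \<and> (\<Sum>i\<in>I. (v i)^2) = 1}"
proof -
  let ?B = "PiE UNIV (\<lambda>i. if i \<in> I then {-1..1} else {0}) :: ('i \<Rightarrow> real) set"
  have "compactin (product_topology (\<lambda>_. euclidean) UNIV) ?B"
    by (subst compactin_PiE) auto
  then have cB: "compact ?B" by (simp add: euclidean_product_topology)
  have "closed {v :: 'i \<Rightarrow> real. (\<Sum>i\<in>I. (v i)^2) = 1}"
    by (intro closed_Collect_eq continuous_intros continuous_on_subset[OF continuous_on_product_coordinates] subset_UNIV)
  with cB have "compact (?B \<inter> {v. (\<Sum>i\<in>I. (v i)^2) = 1})" by (rule compact_Int_closed)
  also have "?B \<inter> {v. (\<Sum>i\<in>I. (v i)^2) = 1} = {v. (\<forall>i. i \<notin> I \<longrightarrow> v i = 0) \<and> (\<Sum>i\<in>I. (v i)^2) = 1}"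
  proof (intro set_eqI iffI)
    fix v :: "'i \<Rightarrow> real" assume v: "v \<in> {v. (\<forall>i. i \<notin> I \<longrightarrow> v i = 0) \<and> (\<Sum>i\<in>I. (v i)^2) = 1}"
    have "\<bar>v i\<bar> \<le> 1" if "i \<in> I" for i
    proof -
      have "(v i)^2 \<le> (\<Sum>i\<in>I. (v i)^2)" using assms that by (intro member_le_sum) auto
      then show ?thesis using v by (simp add: abs_square_le_1)
    qed
    then show "v \<in> ?B \<inter> {v. (\<Sum>i\<in>I. (v i)^2) = 1}" using v by (auto simp: abs_le_iff)
  next
    fix v :: "'i \<Rightarrow> real" assume v: "v \<in> ?B \<inter> {v. (\<Sum>i\<in>I. (v i)^2) = 1}"
    then have "v i \<in> (if i \<in> I then {-1..1} else {0})" for i by blast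
    then have "v i = 0" if "i \<notin> I" for i using that by (metis singletonD)
    then show "v \<in> {v. (\<forall>i. i \<notin> I \<longrightarrow> v i = 0) \<and> (\<Sum>i\<in>I. (v i)^2) = 1}" using v by auto
  qed
  finally show ?thesis .
qed

lemma eigenvalue_upper_bound:
  fixes A :: "'i \<Rightarrow> 'i \<Rightarrow> real"
  assumes I: "finite I"
    and sym: "\<And>i j. i \<in> I \<Longrightarrow> j \<in> I \<Longrightarrow> A i j = A j i"
    and ev: "\<And>\<mu>. is_eigenvalue_on I A \<mu> \<Longrightarrow> \<mu> \<le> hi"
  shows "qform I A v v \<le> hi * (\<Sum>i\<in>I. (v i)^2)"
proof (cases "\<forall>i\<in>I. v i = 0")
  case True
  then show ?thesis by (simp add: qform_def)
next
  case False
  let ?K = "{v :: 'i \<Rightarrow> real. (\<forall>i. i \<notin> I \<longrightarrow> v i = 0) \<and> (\<Sum>i\<in>I. (v i)^2) = 1}"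
  define unit where "unit w = (\<lambda>i. if i \<in> I then w i / sqrt (\<Sum>i\<in>I. (w i)^2) else (0::real))" for w
  have npos: "0 < (\<Sum>i\<in>I. (w i)^2)" if nz: "\<not> (\<forall>i\<in>I. w i = 0)" for w :: "'i \<Rightarrow> real"
  proof -
    obtain i where "i \<in> I" "w i \<noteq> 0" using nz by blast
    then show ?thesis using I by (intro sum_pos2[of I i]) auto
  qed
  have unit: "unit w \<in> ?K" "qform I A w w = (\<Sum>i\<in>I. (w i)^2) * qform I A (unit w) (unit w)"
    if "\<not> (\<forall>i\<in>I. w i = 0)" for w
  proof -
    let ?n = "\<Sum>i\<in>I. (w i)^2"
    note n = npos[OF that]
    have "(\<Sum>i\<in>I. (unit w i)^2) = (\<Sum>i\<in>I. (w i)^2 / ?n)"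
      using n by (intro sum.cong) (auto simp: unit_def power_divide)
    then show "unit w \<in> ?K" using n by (simp add: sum_divide_distrib[symmetric] unit_def)
    have "qform I A (unit w) (unit w) = (\<Sum>i\<in>I. (w i / sqrt ?n) * (\<Sum>j\<in>I. A i j * (w j / sqrt ?n)))"
      unfolding qform_def by (intro sum.cong arg_cong2[where f="(*)"]) (auto simp: unit_def)
    also have "\<dots> = qform I A w w / ?n"
      using n by (simp add: qform_def sum_divide_distrib[symmetric])
    finally show "qform I A w w = ?n * qform I A (unit w) (unit w)" using n by simp
  qed
  have "?K \<noteq> {}" using unit(1)[OF False] by blast
  moreover have "continuous_on ?K (\<lambda>v. qform I A v v)"
    unfolding qform_def
    by (intro continuous_intros continuous_on_subset[OF continuous_on_product_coordinates] subset_UNIV)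
  ultimately have "\<exists>u\<in>?K. \<forall>w\<in>?K. qform I A w w \<le> qform I A u u"
    by (rule continuous_attains_sup[OF compact_unit_sphere_fun[OF I]])
  then obtain v0 where v0: "v0 \<in> ?K" and mx': "\<forall>w\<in>?K. qform I A w w \<le> qform I A v0 v0"
    by (rule bexE)
  note mx = bspec[OF mx']
  define m where "m = qform I A v0 v0"
  define B where "B i j = (if i = j then m else 0) - A i j" for i j
  have qB: "qform I B u w = m * (\<Sum>i\<in>I. u i * w i) - qform I A u w" for u w
  proof -
    have "(\<Sum>j\<in>I. B i j * w j) = m * w i - (\<Sum>j\<in>I. A i j * w j)" if "i \<in> I" for i
    proof -
      have "(\<Sum>j\<in>I. B i j * w j) = (\<Sum>j\<in>I. (if j = i then m * w j else 0)) - (\<Sum>j\<in>I. A i j * w j)"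
        unfolding B_def sum_subtractf[symmetric] by (intro sum.cong) (auto simp: left_diff_distrib)
      then show ?thesis using that I by simp
    qed
    then have "qform I B u w = (\<Sum>i\<in>I. u i * (m * w i - (\<Sum>j\<in>I. A i j * w j)))"
      unfolding qform_def by (intro sum.cong) auto
    then show ?thesis by (simp add: qform_def right_diff_distrib sum_subtractf sum_distrib_left mult_ac)
  qed
  have symB: "\<And>i j. i \<in> I \<Longrightarrow> j \<in> I \<Longrightarrow> B i j = B j i" using sym by (simp add: B_def)
  have psdB: "0 \<le> qform I B w w" for w
  proof (cases "\<forall>i\<in>I. w i = 0")
    case True
    then show ?thesis by (simp add: qform_def)
  next
    case False
    have "qform I A w w \<le> (\<Sum>i\<in>I. (w i)^2) * m"
      unfolding unit(2)[OF False] m_def using npos[OF False] unit(1)[OF False] by (intro mult_left_mono mx) auto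
    then show ?thesis unfolding qB by (simp add: power2_eq_square mult.commute)
  qed
  have B0: "qform I B v0 v0 = 0" using v0 unfolding qB m_def[symmetric] by (simp add: power2_eq_square)
  have Bv: "qform I B w v0 = 0" for w
    using psd_cauchy_schwarz[of I B w v0, OF symB psdB] B0 by simp
  have "(\<Sum>j\<in>I. A i j * v0 j) = m * v0 i" if i: "i \<in> I" for i
  proof -
    have "qform I B (\<lambda>k. if k = i then 1 else 0) v0 = m * v0 i - (\<Sum>j\<in>I. A i j * v0 j)"
      unfolding qB using i I by (simp add: qform_def if_distrib[of "\<lambda>x. x * _"] cong: if_cong)
    then show ?thesis using Bv by simp
  qed
  moreover have "\<exists>i\<in>I. v0 i \<noteq> 0"
  proof (rule ccontr)
    assume "\<not> (\<exists>i\<in>I. v0 i \<noteq> 0)"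
    then have "(\<Sum>i\<in>I. (v0 i)^2) = 0" by simp
    then show False using v0 by simp
  qed
  ultimately have "is_eigenvalue_on I A m" unfolding is_eigenvalue_on_def by blast
  then have "m \<le> hi" by (rule ev)
  moreover have "qform I A v v \<le> (\<Sum>i\<in>I. (v i)^2) * m"
    unfolding unit(2)[OF False] m_def using npos[OF False] unit(1)[OF False] by (intro mult_left_mono mx) auto
  moreover have "(\<Sum>i\<in>I. (v i)^2) * m \<le> (\<Sum>i\<in>I. (v i)^2) * hi"
    using npos[OF False] \<open>m \<le> hi\<close> by (intro mult_left_mono) auto
  ultimately show ?thesis by (simp add: mult.commute)
qed

lemma eigenvalue_lower_bound:
  fixes A :: "'i \<Rightarrow> 'i \<Rightarrow> real"
  assumes I: "finite I"
    and sym: "\<And>i j. i \<in> I \<Longrightarrow> j \<in> I \<Longrightarrow> A i j = A j i"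
    and ev: "\<And>\<mu>. is_eigenvalue_on I A \<mu> \<Longrightarrow> lo \<le> \<mu>"
  shows "lo * (\<Sum>i\<in>I. (v i)^2) \<le> qform I A v v"
proof -
  have "qform I (\<lambda>i j. - A i j) v v \<le> (- lo) * (\<Sum>i\<in>I. (v i)^2)"
  proof (rule eigenvalue_upper_bound[OF I])
    fix \<mu> assume "is_eigenvalue_on I (\<lambda>i j. - A i j) \<mu>"
    then obtain w where w: "\<exists>i\<in>I. w i \<noteq> 0" "\<And>i. i \<in> I \<Longrightarrow> (\<Sum>j\<in>I. - A i j * w j) = \<mu> * w i"
      unfolding is_eigenvalue_on_def by blast
    have "(\<Sum>j\<in>I. A i j * w j) = - \<mu> * w i" if "i \<in> I" for i
      using w(2)[OF that] by (simp add: sum_negf)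
    then have "is_eigenvalue_on I A (- \<mu>)" using w(1) unfolding is_eigenvalue_on_def by blast
    then show "\<mu> \<le> - lo" using ev by fastforce
  qed (use sym in auto)
  then show ?thesis by (simp add: qform_def sum_negf)
qed

lemma eigenvalue_bounds_entries:
  fixes A :: "'i \<Rightarrow> 'i \<Rightarrow> real"
  assumes I: "finite I"
    and sym: "\<And>i j. i \<in> I \<Longrightarrow> j \<in> I \<Longrightarrow> A i j = A j i"
    and C: "0 < C"
    and ev: "\<And>\<mu>. is_eigenvalue_on I A \<mu> \<Longrightarrow> 1 / C \<le> \<mu> \<and> \<mu> \<le> C"
    and i: "i \<in> I"
  shows "1 / C \<le> A i i" "(\<Sum>j\<in>I. (A i j)^2) \<le> C^2"
proof -
  let ?e = "\<lambda>k. if k = i then 1 else 0 :: real"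
  have qe: "qform I A w ?e = (\<Sum>k\<in>I. w k * A k i)" for w
    unfolding qform_def using i I by (simp add: if_distrib[of "\<lambda>x. _ * x"] cong: if_cong)
  have qee: "qform I A ?e ?e = A i i" unfolding qe using i I by (simp add: if_distrib[of "\<lambda>x. x * _"] cong: if_cong)
  have n: "(\<Sum>k\<in>I. (?e k)^2) = 1" using i I by (simp add: if_distrib[of "\<lambda>x. x^2"] cong: if_cong)
  have lo: "1 / C * (\<Sum>i\<in>I. (v i)^2) \<le> qform I A v v" for v
    using ev by (intro eigenvalue_lower_bound[OF I sym]) auto
  have hi: "qform I A v v \<le> C * (\<Sum>i\<in>I. (v i)^2)" for v
    using ev by (intro eigenvalue_upper_bound[OF I sym]) auto
  show "1 / C \<le> A i i" using lo[of ?e] by (simp add: qee n)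
  have Aii: "A i i \<le> C" using hi[of ?e] by (simp add: qee n)
  have psd: "0 \<le> qform I A w w" for w
  proof -
    have "0 \<le> 1 / C * (\<Sum>i\<in>I. (w i)^2)" using C by (intro mult_nonneg_nonneg sum_nonneg) auto
    then show ?thesis using lo[of w] by linarith
  qed
  define S where "S = (\<Sum>j\<in>I. (A i j)^2)"
  have S0: "0 \<le> S" unfolding S_def by (intro sum_nonneg) auto
  have "qform I A (\<lambda>j. A i j) ?e = S" unfolding qe S_def using sym i by (intro sum.cong) (auto simp: power2_eq_square)
  then have "S^2 \<le> qform I A (\<lambda>j. A i j) (\<lambda>j. A i j) * A i i"
    using psd_cauchy_schwarz[of I A "\<lambda>j. A i j" ?e, OF sym psd] by (simp add: qee)
  also have "\<dots> \<le> (C * S) * C"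
    using hi[of "\<lambda>j. A i j"] Aii psd[of "\<lambda>j. A i j"] C S0 qee psd[of ?e] by (intro mult_mono) (auto simp: S_def)
  finally have "S * S \<le> C^2 * S" by (simp add: power2_eq_square mult_ac)
  then show "(\<Sum>j\<in>I. (A i j)^2) \<le> C^2" using S0 by (cases "S = 0") (auto simp: S_def)
qed

section \<open>Maxima of sums of bounded random vectors\<close>

locale max_array = prob_space M for M :: "'a measure" +
  fixes I :: "'i set" and A :: "'j set" and X :: "'i \<Rightarrow> 'j \<Rightarrow> 'a \<Rightarrow> real"
    and s :: "'i \<Rightarrow> 'j \<Rightarrow> real" and \<beta> :: "'i \<Rightarrow> real" and b e1 e2 e3 r :: real and Sg :: "('j \<times> 'j) set"
  assumes finI: "finite I" "I \<noteq> {}" and finA: "finite A"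
    and Xm [measurable]: "\<And>i a. X i a \<in> borel_measurable M" and Xb: "\<And>i a \<omega>. \<bar>X i a \<omega>\<bar> \<le> b"
    and ind: "indep_vars (\<lambda>_. PiM A (\<lambda>_. borel)) (\<lambda>i \<omega>. \<lambda>a\<in>A. X i a \<omega>) I"
    and s: "\<And>i a. i \<in> I \<Longrightarrow> a \<in> A \<Longrightarrow> 0 < s i a" "\<And>i a. i \<in> I \<Longrightarrow> a \<in> A \<Longrightarrow> s i a \<le> b"
      "\<And>a. a \<in> A \<Longrightarrow> (\<Sum>i\<in>I. (s i a)^2) = 1"
    and m1: "\<And>a. a \<in> A \<Longrightarrow> (\<Sum>i\<in>I. \<bar>expectation (X i a)\<bar>) \<le> e1"
    and m2: "\<And>i a. i \<in> I \<Longrightarrow> a \<in> A \<Longrightarrow> \<bar>expectation (\<lambda>\<omega>. (X i a \<omega>)^2) - (s i a)^2\<bar> \<le> e2 * \<beta> i"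
      "\<And>i a. i \<in> I \<Longrightarrow> a \<in> A \<Longrightarrow> expectation (\<lambda>\<omega>. (X i a \<omega>)^2) \<le> \<beta> i"
    and beta: "\<And>i. i \<in> I \<Longrightarrow> 0 \<le> \<beta> i" "(\<Sum>i\<in>I. \<beta> i) \<le> 2"
    and e0: "0 \<le> e1" "0 \<le> e2" "0 \<le> e3" and r: "0 < r" "r < 1"
    and Sg: "Sg \<subseteq> A \<times> A" "\<And>a. (a, a) \<notin> Sg"
    and weak: "\<And>i a c. i \<in> I \<Longrightarrow> a \<in> A \<Longrightarrow> c \<in> A \<Longrightarrow> a \<noteq> c \<Longrightarrow> (a, c) \<notin> Sg \<Longrightarrow>
        \<bar>expectation (\<lambda>\<omega>. X i a \<omega> * X i c \<omega>) - expectation (X i a) * expectation (X i c)\<bar> \<le> e3 * \<beta> i"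
    and strong: "\<And>i a c. i \<in> I \<Longrightarrow> (a, c) \<in> Sg \<Longrightarrow>
        \<bar>expectation (\<lambda>\<omega>. X i a \<omega> * X i c \<omega>)\<bar> \<le> r / 2 * ((s i a)^2 + (s i c)^2) + e3 * \<beta> i"
begin

definition S :: "'j \<Rightarrow> 'a \<Rightarrow> real" where "S a \<omega> = (\<Sum>i\<in>I. X i a \<omega>)"

definition sg :: "bool \<Rightarrow> real" where "sg u = (if u then 1 else -1)"

lemma sg_simps [simp]: "\<bar>sg u\<bar> = 1" "(sg u)^2 = 1" "sg u * sg u = 1" by (auto simp: sg_def)

lemma Sm [measurable]: "S a \<in> borel_measurable M" unfolding S_def[abs_def] by measurable

lemma b0: "0 \<le> b" using Xb abs_ge_zero order_trans by blast

lemma int1: "integrable M (X i a)"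
  using Xb by (intro integrable_const_bound[where B=b]) auto

lemma int2: "integrable M (\<lambda>\<omega>. X i a \<omega> * X i c \<omega>)"
proof (rule integrable_const_bound[where B="b * b"])
  show "AE \<omega> in M. norm (X i a \<omega> * X i c \<omega>) \<le> b * b"
    using Xb b0 by (intro AE_I2) (auto simp: abs_mult intro!: mult_mono)
qed measurable

lemma int2': "integrable M (\<lambda>\<omega>. (X i a \<omega>)^2)"
  using int2[of i a a] by (simp add: power2_eq_square)

lemma ind1: "a \<in> A \<Longrightarrow> indep_vars (\<lambda>_. borel) (\<lambda>i. X i a) I"
proof -
  assume a: "a \<in> A"
  have "indep_vars (\<lambda>_. borel) (\<lambda>i \<omega>. (\<lambda>z. z a) (\<lambda>a\<in>A. X i a \<omega>)) I"
    by (rule indep_vars_compose2[OF ind]) (use a in measurable)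
  then show ?thesis using a by simp
qed

lemma sum_m2:
  assumes "a \<in> A"
  shows "(\<Sum>i\<in>I. expectation (\<lambda>\<omega>. (X i a \<omega>)^2)) \<le> 1 + 2 * e2"
proof -
  have "(\<Sum>i\<in>I. expectation (\<lambda>\<omega>. (X i a \<omega>)^2)) \<le> (\<Sum>i\<in>I. (s i a)^2 + e2 * \<beta> i)"
    using m2(1)[OF _ assms] by (intro sum_mono) (force simp: abs_le_iff)
  also have "\<dots> = 1 + e2 * (\<Sum>i\<in>I. \<beta> i)" using s(3)[OF assms] by (simp add: sum.distrib sum_distrib_left)
  also have "\<dots> \<le> 1 + e2 * 2" using beta(2) e0 by (intro add_left_mono mult_left_mono) auto
  finally show ?thesis by simp
qed

definition err1 :: "real \<Rightarrow> real" where
  "err1 \<kappa> = 2 * (\<kappa> * e1 + 2 * \<kappa>^2 * e2 + 2 * \<kappa>^3 * b + gauss_rem * \<kappa>^3 * b)"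

lemma one_dim:
  fixes t :: real
  assumes a: "a \<in> A" and k: "0 < \<kappa>" "\<kappa> * b \<le> 1" "(\<kappa> * b)^2 + 2 * gauss_rem * (\<kappa> * b)^3 \<le> 1" "err1 \<kappa> \<le> 1"
  defines "\<gamma> \<equiv> \<integral>z. lgs (t + z) \<partial>gauss \<kappa>"
  shows "\<bar>expectation (\<lambda>\<omega>. lgs (t + \<kappa> * (sg u * S a \<omega>))) - \<gamma>\<bar> \<le> 2 * err1 \<kappa> * \<gamma>"
proof -
  let ?W = "\<lambda>i \<omega>. \<kappa> * (sg u * X i a \<omega>)"
  let ?s = "\<lambda>i. \<kappa> * s i a"
  have ind': "indep_vars (\<lambda>_. borel) (\<lambda>i \<omega>. (\<lambda>x. \<kappa> * (sg u * x)) (X i a \<omega>)) I"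
    by (rule indep_vars_compose2[OF ind1[OF a]]) measurable
  have sb: "?s i \<le> \<kappa> * b" if "i \<in> I" for i using s(2)[OF that a] k by (intro mult_left_mono) auto
  have s0: "0 < ?s i" if "i \<in> I" for i using s(1)[OF that a] k by simp
  have E1: "expectation (?W i) = \<kappa> * (sg u * expectation (X i a))" for i using int1 by simp
  have W2: "(?W i \<omega>)^2 = \<kappa>^2 * (X i a \<omega>)^2" for i \<omega> by (simp add: power_mult_distrib)
  have E2: "expectation (\<lambda>\<omega>. (?W i \<omega>)^2) = \<kappa>^2 * expectation (\<lambda>\<omega>. (X i a \<omega>)^2)" for i
    unfolding W2 using int2' by simp
  have "\<bar>expectation (\<lambda>\<omega>. lgs (t + (\<Sum>i\<in>I. ?W i \<omega>))) - (\<integral>z. lgs (t + z) \<partial>gauss (sqrt (\<Sum>i\<in>I. (?s i)^2)))\<bar>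
     \<le> 2 * err1 \<kappa> * (\<integral>z. lgs (t + z) \<partial>gauss (sqrt (\<Sum>i\<in>I. (?s i)^2)))"
  proof (rule lgs_sum_gauss[OF finI _ _ k(2) ind'])
    show "\<bar>?W i \<omega>\<bar> \<le> \<kappa> * b" for i \<omega> using Xb[of i a \<omega>] k by (simp add: abs_mult mult_left_mono)
    fix i assume i: "i \<in> I"
    show "0 < ?s i" by (rule s0[OF i])
    show "?s i \<le> 1" using sb[OF i] k by linarith
    have "(?s i)^2 \<le> (\<kappa> * b)^2" "(?s i)^3 \<le> (\<kappa> * b)^3"
      using sb[OF i] s0[OF i] by (auto intro!: power_mono)
    then show "(?s i)^2 + 2 * gauss_rem * (?s i)^3 \<le> 1"
      using k(3) mult_left_mono[of "(?s i)^3" "(\<kappa> * b)^3" "2 * gauss_rem"] gauss_rem_nonneg by linarith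
  next
    show "(\<Sum>i\<in>I. 2 * (\<bar>expectation (?W i)\<bar> + \<bar>expectation (\<lambda>\<omega>. (?W i \<omega>)^2) - (?s i)^2\<bar>
       + \<kappa> * b * expectation (\<lambda>\<omega>. (?W i \<omega>)^2) + gauss_rem * (?s i)^3)) \<le> err1 \<kappa>"
    proof -
      have "(\<Sum>i\<in>I. 2 * (\<bar>expectation (?W i)\<bar> + \<bar>expectation (\<lambda>\<omega>. (?W i \<omega>)^2) - (?s i)^2\<bar>
         + \<kappa> * b * expectation (\<lambda>\<omega>. (?W i \<omega>)^2) + gauss_rem * (?s i)^3))
       \<le> (\<Sum>i\<in>I. 2 * (\<kappa> * \<bar>expectation (X i a)\<bar> + \<kappa>^2 * (e2 * \<beta> i) + \<kappa>^3 * b * \<beta> i + gauss_rem * (\<kappa>^3 * b) * (s i a)^2))"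
      proof (intro sum_mono mult_left_mono add_mono)
        fix i assume i: "i \<in> I"
        show "\<bar>expectation (?W i)\<bar> \<le> \<kappa> * \<bar>expectation (X i a)\<bar>" unfolding E1 using k by (simp add: abs_mult)
        have "\<bar>\<kappa>^2 * expectation (\<lambda>\<omega>. (X i a \<omega>)^2) - (?s i)^2\<bar> = \<kappa>^2 * \<bar>expectation (\<lambda>\<omega>. (X i a \<omega>)^2) - (s i a)^2\<bar>"
          by (simp add: power_mult_distrib abs_mult flip: right_diff_distrib)
        then show "\<bar>expectation (\<lambda>\<omega>. (?W i \<omega>)^2) - (?s i)^2\<bar> \<le> \<kappa>^2 * (e2 * \<beta> i)"
          unfolding E2 using m2(1)[OF i a] by (simp add: mult_left_mono)
        have "\<kappa>^3 * b * expectation (\<lambda>\<omega>. (X i a \<omega>)^2) \<le> \<kappa>^3 * b * \<beta> i"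
          using m2(2)[OF i a] k b0 by (intro mult_left_mono) auto
        then show "\<kappa> * b * expectation (\<lambda>\<omega>. (?W i \<omega>)^2) \<le> \<kappa>^3 * b * \<beta> i"
          unfolding E2 by (simp add: power2_eq_square power3_eq_cube mult_ac)
        have "(s i a)^3 \<le> b * (s i a)^2"
          using s(1,2)[OF i a] by (simp add: power2_eq_square power3_eq_cube mult_right_mono mult.assoc)
        then have "gauss_rem * \<kappa>^3 * (s i a)^3 \<le> gauss_rem * \<kappa>^3 * (b * (s i a)^2)"
          using k gauss_rem_nonneg by (intro mult_left_mono) auto
        then show "gauss_rem * (?s i)^3 \<le> gauss_rem * (\<kappa>^3 * b) * (s i a)^2"
          by (simp add: power_mult_distrib mult_ac)
      qed simp
      also have "\<dots> = 2 * (\<kappa> * (\<Sum>i\<in>I. \<bar>expectation (X i a)\<bar>) + \<kappa>^2 * e2 * (\<Sum>i\<in>I. \<beta> i) + \<kappa>^3 * b * (\<Sum>i\<in>I. \<beta> i)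
          + gauss_rem * (\<kappa>^3 * b) * (\<Sum>i\<in>I. (s i a)^2))"
        by (simp add: sum.distrib sum_distrib_left[symmetric] mult.assoc)
      also have "\<dots> \<le> 2 * (\<kappa> * e1 + \<kappa>^2 * e2 * 2 + \<kappa>^3 * b * 2 + gauss_rem * (\<kappa>^3 * b) * 1)"
        using m1[OF a] beta(2) s(3)[OF a] k e0 b0 gauss_rem_nonneg by (intro mult_left_mono add_mono) auto
      finally show ?thesis by (simp add: err1_def mult_ac)
    qed
  qed (use k in auto)
  moreover have "sqrt (\<Sum>i\<in>I. (?s i)^2) = \<kappa>"
    using s(3)[OF a] k by (simp add: power_mult_distrib sum_distrib_left[symmetric])
  moreover have "(\<Sum>i\<in>I. ?W i \<omega>) = \<kappa> * (sg u * S a \<omega>)" for \<omega> by (simp add: S_def sum_distrib_left)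
  ultimately show ?thesis by (simp add: \<gamma>_def)
qed

text \<open>The two-sided maximum is a one-sided one over the index set A \<times> bool, the second
  component being the sign.\<close>

definition hp :: "real \<Rightarrow> real \<Rightarrow> real" where
  "hp \<kappa> x = expectation (\<lambda>\<omega>. hprod (A \<times> UNIV) (\<lambda>(a, u). - \<kappa> * x + \<kappa> * (sg u * S a \<omega>)))"

definition err2 :: "real \<Rightarrow> real" where
  "err2 \<theta> = 2 * \<theta> * e1 + \<theta>^2 * (2 * e2 + 2 * e3) + 2 * \<theta>^3 * b * (4 + 4 * e2 + 4 * e3)"

lemma cov_le:
  assumes "i \<in> I" "a \<in> A" "c \<in> A"
  shows "\<bar>expectation (\<lambda>\<omega>. X i a \<omega> * X i c \<omega>) - expectation (X i a) * expectation (X i c)\<bar> \<le> \<beta> i"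
proof -
  define Y where "Y a \<omega> = X i a \<omega> - expectation (X i a)" for a \<omega>
  have Y2: "(Y a \<omega>)^2 = (X i a \<omega>)^2 - 2 * expectation (X i a) * X i a \<omega> + (expectation (X i a))^2" for a \<omega>
    by (simp add: Y_def power2_eq_square algebra_simps)
  have iY: "integrable M (\<lambda>\<omega>. (Y a \<omega>)^2)" for a unfolding Y2 using int1 int2' by auto
  have EY: "expectation (\<lambda>\<omega>. (Y a \<omega>)^2) \<le> \<beta> i" if "a \<in> A" for a
  proof -
    have "expectation (\<lambda>\<omega>. (Y a \<omega>)^2) = expectation (\<lambda>\<omega>. (X i a \<omega>)^2) - (expectation (X i a))^2"
      unfolding Y2 using int1 int2' by (simp add: prob_space power2_eq_square)
    then show ?thesis using m2(2)[OF assms(1) that] zero_le_power2[of "expectation (X i a)"] by linarith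
  qed
  have YY: "Y a \<omega> * Y c \<omega> = X i a \<omega> * X i c \<omega> - expectation (X i c) * X i a \<omega> - expectation (X i a) * X i c \<omega>
      + expectation (X i a) * expectation (X i c)" for \<omega>
    by (simp add: Y_def algebra_simps)
  have iYY: "integrable M (\<lambda>\<omega>. Y a \<omega> * Y c \<omega>)" unfolding YY using int1 int2 by auto
  have "expectation (\<lambda>\<omega>. X i a \<omega> * X i c \<omega>) - expectation (X i a) * expectation (X i c) = expectation (\<lambda>\<omega>. Y a \<omega> * Y c \<omega>)"
    unfolding YY using int1 int2 by (simp add: prob_space)
  also have "\<bar>\<dots>\<bar> \<le> expectation (\<lambda>\<omega>. \<bar>Y a \<omega> * Y c \<omega>\<bar>)" by (rule integral_abs_bound)
  also have "\<dots> \<le> expectation (\<lambda>\<omega>. ((Y a \<omega>)^2 + (Y c \<omega>)^2) / 2)"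
  proof (intro integral_mono)
    fix \<omega>
    have "0 \<le> (\<bar>Y a \<omega>\<bar> - \<bar>Y c \<omega>\<bar>)^2" by simp
    then show "\<bar>Y a \<omega> * Y c \<omega>\<bar> \<le> ((Y a \<omega>)^2 + (Y c \<omega>)^2) / 2"
      by (simp add: power2_diff abs_mult)
  qed (use iY iYY in auto)
  also have "\<dots> = (expectation (\<lambda>\<omega>. (Y a \<omega>)^2) + expectation (\<lambda>\<omega>. (Y c \<omega>)^2)) / 2" using iY by simp
  also have "\<dots> \<le> \<beta> i" using EY[OF assms(2)] EY[OF assms(3)] by simp
  finally show ?thesis .
qed

lemma exp_pair_bounds:
  assumes l: "0 \<le> \<theta>" "2 * \<theta> * b \<le> 1"
  defines "m i a u c v \<equiv> \<theta> * (\<bar>expectation (X i a)\<bar> + \<bar>expectation (X i c)\<bar>)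
     + (\<theta>^2 / 2 + 2 * \<theta>^3 * b) * (expectation (\<lambda>\<omega>. (X i a \<omega>)^2) + expectation (\<lambda>\<omega>. (X i c \<omega>)^2)
        + 2 * max 0 (sg u * sg v * expectation (\<lambda>\<omega>. X i a \<omega> * X i c \<omega>)))"
  shows "expectation (\<lambda>\<omega>. exp (\<theta> * (sg u * X i a \<omega> + sg v * X i c \<omega>))) \<le> exp (m i a u c v)"
    and "expectation (\<lambda>\<omega>. exp (\<theta> * (sg u * X i a \<omega>))) * expectation (\<lambda>\<omega>. exp (\<theta> * (sg v * X i c \<omega>))) \<le> exp (m i a u c v)"
    and "0 \<le> m i a u c v"
proof -
  have co: "0 \<le> \<theta>^2 / 2 + 2 * \<theta>^3 * b" using l b0 by simp
  have E0: "0 \<le> expectation (\<lambda>\<omega>. (X i a \<omega>)^2)" for a by simp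
  show "0 \<le> m i a u c v" unfolding m_def
    by (intro add_nonneg_nonneg mult_nonneg_nonneg[OF l(1)] mult_nonneg_nonneg[OF co] E0) auto
  let ?U = "\<lambda>\<omega>. sg u * X i a \<omega> + sg v * X i c \<omega>"
  have sx: "\<bar>sg u * X i a \<omega>\<bar> \<le> b" for u a \<omega> using Xb[of i a \<omega>] by (simp add: abs_mult)
  have UB: "\<bar>?U \<omega>\<bar> \<le> 2 * b" for \<omega> using sx[of u a \<omega>] sx[of v c \<omega>] by linarith
  have "expectation (\<lambda>\<omega>. exp (\<theta> * ?U \<omega>)) \<le>
     exp (\<theta> * \<bar>expectation ?U\<bar> + (\<theta>^2 / 2 + \<theta>^3 * (2 * b)) * expectation (\<lambda>\<omega>. (?U \<omega>)^2))"
    using l by (intro expectation_exp_le UB) (auto simp: mult_ac)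
  also have "\<dots> \<le> exp (m i a u c v)"
  proof -
    have "expectation ?U = sg u * expectation (X i a) + sg v * expectation (X i c)" using int1 by simp
    then have 1: "\<bar>expectation ?U\<bar> \<le> \<bar>expectation (X i a)\<bar> + \<bar>expectation (X i c)\<bar>"
      using abs_triangle_ineq[of "sg u * expectation (X i a)" "sg v * expectation (X i c)"] by (simp add: abs_mult)
    have "(?U \<omega>)^2 = (X i a \<omega>)^2 + (X i c \<omega>)^2 + 2 * (sg u * sg v) * (X i a \<omega> * X i c \<omega>)" for \<omega>
      by (simp add: power2_sum power_mult_distrib)
    then have "expectation (\<lambda>\<omega>. (?U \<omega>)^2) = expectation (\<lambda>\<omega>. (X i a \<omega>)^2) + expectation (\<lambda>\<omega>. (X i c \<omega>)^2)
       + 2 * (sg u * sg v * expectation (\<lambda>\<omega>. X i a \<omega> * X i c \<omega>))" using int2' int2 by simp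
    then have 2: "expectation (\<lambda>\<omega>. (?U \<omega>)^2) \<le> expectation (\<lambda>\<omega>. (X i a \<omega>)^2) + expectation (\<lambda>\<omega>. (X i c \<omega>)^2)
       + 2 * max 0 (sg u * sg v * expectation (\<lambda>\<omega>. X i a \<omega> * X i c \<omega>))" by simp
    have "\<theta> * \<bar>expectation ?U\<bar> + (\<theta>^2 / 2 + 2 * \<theta>^3 * b) * expectation (\<lambda>\<omega>. (?U \<omega>)^2) \<le> m i a u c v"
      unfolding m_def using 1 2 l co by (intro add_mono mult_left_mono)
    then show ?thesis by (simp add: mult_ac)
  qed
  finally show "expectation (\<lambda>\<omega>. exp (\<theta> * ?U \<omega>)) \<le> exp (m i a u c v)" .
  have one: "expectation (\<lambda>\<omega>. exp (\<theta> * (sg u * X i a \<omega>))) \<le>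
     exp (\<theta> * \<bar>expectation (X i a)\<bar> + (\<theta>^2 / 2 + 2 * \<theta>^3 * b) * expectation (\<lambda>\<omega>. (X i a \<omega>)^2))" for u a
  proof -
    have lb: "\<theta> * b \<le> 1" using l b0 mult_nonneg_nonneg[of \<theta> b] by linarith
    have "expectation (\<lambda>\<omega>. exp (\<theta> * (sg u * X i a \<omega>))) \<le>
       exp (\<theta> * \<bar>expectation (\<lambda>\<omega>. sg u * X i a \<omega>)\<bar> + (\<theta>^2 / 2 + \<theta>^3 * b) * expectation (\<lambda>\<omega>. (sg u * X i a \<omega>)^2))"
      by (intro expectation_exp_le sx l lb) measurable
    also have "\<dots> = exp (\<theta> * \<bar>expectation (X i a)\<bar> + (\<theta>^2 / 2 + \<theta>^3 * b) * expectation (\<lambda>\<omega>. (X i a \<omega>)^2))"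
      using int1 by (simp add: abs_mult power_mult_distrib)
    also have "\<dots> \<le> exp (\<theta> * \<bar>expectation (X i a)\<bar> + (\<theta>^2 / 2 + 2 * \<theta>^3 * b) * expectation (\<lambda>\<omega>. (X i a \<omega>)^2))"
    proof -
      have "(\<theta>^2 / 2 + \<theta>^3 * b) * expectation (\<lambda>\<omega>. (X i a \<omega>)^2) \<le> (\<theta>^2 / 2 + 2 * \<theta>^3 * b) * expectation (\<lambda>\<omega>. (X i a \<omega>)^2)"
        using l b0 by (intro mult_right_mono) auto
      then show ?thesis by simp
    qed
    finally show ?thesis .
  qed
  have "expectation (\<lambda>\<omega>. exp (\<theta> * (sg u * X i a \<omega>))) * expectation (\<lambda>\<omega>. exp (\<theta> * (sg v * X i c \<omega>)))
    \<le> exp (\<theta> * \<bar>expectation (X i a)\<bar> + (\<theta>^2 / 2 + 2 * \<theta>^3 * b) * expectation (\<lambda>\<omega>. (X i a \<omega>)^2))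
     * exp (\<theta> * \<bar>expectation (X i c)\<bar> + (\<theta>^2 / 2 + 2 * \<theta>^3 * b) * expectation (\<lambda>\<omega>. (X i c \<omega>)^2))"
    by (intro mult_mono one Bochner_Integration.integral_nonneg) auto
  also have "\<dots> = exp (\<theta> * (\<bar>expectation (X i a)\<bar> + \<bar>expectation (X i c)\<bar>)
     + (\<theta>^2 / 2 + 2 * \<theta>^3 * b) * (expectation (\<lambda>\<omega>. (X i a \<omega>)^2) + expectation (\<lambda>\<omega>. (X i c \<omega>)^2) + 0))"
    by (simp add: exp_add[symmetric] algebra_simps)
  also have "\<dots> \<le> exp (m i a u c v)"
    unfolding m_def exp_le_cancel_iff using co by (intro add_left_mono mult_left_mono) auto
  finally show "expectation (\<lambda>\<omega>. exp (\<theta> * (sg u * X i a \<omega>))) * expectation (\<lambda>\<omega>. exp (\<theta> * (sg v * X i c \<omega>))) \<le> exp (m i a u c v)" .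
qed

lemma hp_decouple:
  assumes k: "0 < \<kappa>" "\<kappa> * b \<le> 1" and x: "0 \<le> x" and l: "\<theta> = x / (1 + r)" "\<theta> \<le> \<kappa>" "2 * \<theta> * b \<le> 1"
    and G: "\<And>a u. a \<in> A \<Longrightarrow> expectation (\<lambda>\<omega>. lgs (- \<kappa> * x + \<kappa> * (sg u * S a \<omega>))) \<le> Gm"
  shows "\<bar>hp \<kappa> x - (\<Prod>(a, u)\<in>A \<times> UNIV. 1 - expectation (\<lambda>\<omega>. lgs (- \<kappa> * x + \<kappa> * (sg u * S a \<omega>))))\<bar>
    \<le> 36 * \<kappa>^2 * e3 + 2 * \<kappa>^2 * ((4 * real (card Sg) + 2 * real (card A)) * exp (- (x^2 / (1 + r)) + err2 \<theta>)
       + 1056 * (\<kappa> * b) * (2 * real (card A) * Gm))"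
proof -
  define W where "W i = (\<lambda>(a, u) \<omega>. \<kappa> * (sg u * X i a \<omega>))" for i
  let ?J = "A \<times> (UNIV :: bool set)"
  \<comment> \<open>The two signs of one coordinate are perfectly correlated, so they count as a strong pair.\<close>
  define SJ where "SJ = {((a, u :: bool), (c, v :: bool)) | a u c v. (a, c) \<in> Sg \<or> (a = c \<and> a \<in> A \<and> u \<noteq> v)}"
  define c where "c = \<theta> / \<kappa>"
  have l0: "0 \<le> \<theta>" using x r l by simp
  have c: "0 \<le> c" "c \<le> 1" using k(1) l(2) l0 unfolding c_def by simp_all
  have ck: "c * (\<kappa> * z) = \<theta> * z" for z using k by (simp add: c_def)
  have Wm: "W i j \<in> borel_measurable M" for i j by (cases j) (simp add: W_def)
  have Wb: "\<bar>W i j \<omega>\<bar> \<le> \<kappa> * b" for i j \<omega>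
    using Xb[of i "fst j" \<omega>] k by (cases j) (simp add: W_def abs_mult mult_left_mono)
  have EW: "expectation (W i (a, u)) = \<kappa> * (sg u * expectation (X i a))" for i a u using int1 by (simp add: W_def)
  have EWW: "expectation (\<lambda>\<omega>. W i (a, u) \<omega> * W i (a', v) \<omega>) = \<kappa>^2 * (sg u * sg v * expectation (\<lambda>\<omega>. X i a \<omega> * X i a' \<omega>))"
    for i a u a' v
  proof -
    have "W i (a, u) \<omega> * W i (a', v) \<omega> = (\<kappa>^2 * (sg u * sg v)) * (X i a \<omega> * X i a' \<omega>)" for \<omega>
      by (simp add: W_def power2_eq_square)
    then show ?thesis using int2 by simp
  qed
  have cv: "\<bar>expectation (\<lambda>\<omega>. W i (a, u) \<omega> * W i (a', v) \<omega>) - expectation (W i (a, u)) * expectation (W i (a', v))\<bar>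
     = \<kappa>^2 * \<bar>expectation (\<lambda>\<omega>. X i a \<omega> * X i a' \<omega>) - expectation (X i a) * expectation (X i a')\<bar>" for i a u a' v
  proof -
    have "expectation (\<lambda>\<omega>. W i (a, u) \<omega> * W i (a', v) \<omega>) - expectation (W i (a, u)) * expectation (W i (a', v))
      = \<kappa>^2 * (sg u * sg v * (expectation (\<lambda>\<omega>. X i a \<omega> * X i a' \<omega>) - expectation (X i a) * expectation (X i a')))"
      unfolding EW EWW by (simp add: power2_eq_square algebra_simps)
    then show ?thesis by (simp add: abs_mult)
  qed
  define m where "m i j j' = (case j of (a, u) \<Rightarrow> case j' of (c, v) \<Rightarrow>
       \<theta> * (\<bar>expectation (X i a)\<bar> + \<bar>expectation (X i c)\<bar>)
     + (\<theta>^2 / 2 + 2 * \<theta>^3 * b) * (expectation (\<lambda>\<omega>. (X i a \<omega>)^2) + expectation (\<lambda>\<omega>. (X i c \<omega>)^2)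
        + 2 * max 0 (sg u * sg v * expectation (\<lambda>\<omega>. X i a \<omega> * X i c \<omega>))))" for i and j j' :: "'j \<times> bool"
  have indW: "indep_vars (\<lambda>_. PiM ?J (\<lambda>_. borel)) (\<lambda>i \<omega>. \<lambda>j\<in>?J. W i j \<omega>) I"
  proof -
    have "indep_vars (\<lambda>_. PiM ?J (\<lambda>_. borel)) (\<lambda>i \<omega>. (\<lambda>z. \<lambda>j\<in>?J. \<kappa> * (sg (snd j) * z (fst j))) (\<lambda>a\<in>A. X i a \<omega>)) I"
    proof (rule indep_vars_compose2[OF ind])
      have "(\<lambda>z. z (fst j)) \<in> borel_measurable (PiM A (\<lambda>_. borel))" if "j \<in> ?J" for j :: "'j \<times> bool"
        using that by (intro measurable_component_singleton) auto
      then show "(\<lambda>z. \<lambda>j\<in>?J. \<kappa> * (sg (snd j) * z (fst j))) \<in> measurable (PiM A (\<lambda>_. borel)) (PiM ?J (\<lambda>_. borel))"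
        by (intro measurable_restrict borel_measurable_times borel_measurable_const)
    qed
    also have "(\<lambda>i \<omega>. (\<lambda>z. \<lambda>j\<in>?J. \<kappa> * (sg (snd j) * z (fst j))) (\<lambda>a\<in>A. X i a \<omega>)) = (\<lambda>i \<omega>. \<lambda>j\<in>?J. W i j \<omega>)"
      by (auto simp: fun_eq_iff restrict_def W_def)
    finally show ?thesis .
  qed
  have dec: "\<bar>expectation (\<lambda>\<omega>. hprod ?J (\<lambda>j. - \<kappa> * x + (\<Sum>i\<in>I. W i j \<omega>)))
       - (\<Prod>j\<in>?J. 1 - expectation (\<lambda>\<omega>. lgs (- \<kappa> * x + (\<Sum>i\<in>I. W i j \<omega>))))\<bar>
    \<le> 18 * (\<Sum>i\<in>I. \<kappa>^2 * (e3 * \<beta> i)) + (\<Sum>i\<in>I. \<kappa>^2 * \<beta> i) * (real (card SJ) * exp (2 * c * (- \<kappa> * x) + (\<theta>^2 * (1 + r) + err2 \<theta>))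
        + 1056 * (\<kappa> * b) * (real (card ?J) * Gm))"
  proof (rule decouple[where I=I and J="?J" and W=W and b="\<kappa> * b" and c=c and t="- \<kappa> * x"
      and \<rho>="\<lambda>i. \<kappa>^2 * (e3 * \<beta> i)" and \<beta>="\<lambda>i. \<kappa>^2 * \<beta> i" and Sg=SJ and m=m
      and Mx="\<theta>^2 * (1 + r) + err2 \<theta>" and Gm=Gm, OF finI _ Wm Wb k(2) indW _ _ _ _ _ _ _ c])
    show "finite ?J" using finA by simp
    show "0 \<le> \<kappa>^2 * (e3 * \<beta> i)" "0 \<le> \<kappa>^2 * \<beta> i" if "i \<in> I" for i using that beta e0 by auto
    show "expectation (\<lambda>\<omega>. (W i j \<omega>)^2) \<le> \<kappa>^2 * \<beta> i" if i: "i \<in> I" and j: "j \<in> ?J" for i j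
    proof -
      obtain a u where "j = (a, u)" "a \<in> A" using j by auto
      then show ?thesis using EWW[of i a u a u] m2(2)[OF i, of a] by (simp add: power2_eq_square mult_left_mono)
    qed
    show "SJ \<subseteq> ?J \<times> ?J" using Sg(1) by (auto simp: SJ_def)
    show "(j, j) \<notin> SJ" for j using Sg(2) by (auto simp: SJ_def)
    show "\<bar>expectation (\<lambda>\<omega>. W i j \<omega> * W i j' \<omega>) - expectation (W i j) * expectation (W i j')\<bar> \<le> \<kappa>^2 * (e3 * \<beta> i)"
      if i: "i \<in> I" and j: "j \<in> ?J" "j' \<in> ?J" "j \<noteq> j'" "(j, j') \<notin> SJ" for i j j'
    proof -
      obtain a u a' v where e: "j = (a, u)" "j' = (a', v)" "a \<in> A" "a' \<in> A" using j by auto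
      then have "a \<noteq> a'" "(a, a') \<notin> Sg" using j by (auto simp: SJ_def)
      then show ?thesis unfolding e cv using weak[OF i e(3,4)] by (simp add: mult_left_mono)
    qed
    show "\<bar>expectation (\<lambda>\<omega>. W i j \<omega> * W i j' \<omega>) - expectation (W i j) * expectation (W i j')\<bar> \<le> \<kappa>^2 * \<beta> i"
      if i: "i \<in> I" and j: "j \<in> ?J" "j' \<in> ?J" "j \<noteq> j'" for i j j'
    proof -
      obtain a u a' v where e: "j = (a, u)" "j' = (a', v)" "a \<in> A" "a' \<in> A" using j by auto
      show ?thesis unfolding e cv using cov_le[OF i e(3,4)] by (simp add: mult_left_mono)
    qed
    show "expectation (\<lambda>\<omega>. exp (c * (W i j \<omega> + W i j' \<omega>))) \<le> exp (m i j j')" for i j j'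
      using exp_pair_bounds(1)[OF l0 l(3), of "snd j" i "fst j" "snd j'" "fst j'"]
      by (cases j; cases j') (simp add: W_def m_def distrib_left[symmetric] ck)
    show "expectation (\<lambda>\<omega>. exp (c * W i j \<omega>)) * expectation (\<lambda>\<omega>. exp (c * W i j' \<omega>)) \<le> exp (m i j j')" for i j j'
      using exp_pair_bounds(2)[OF l0 l(3), of "snd j" i "fst j" "snd j'" "fst j'"]
      by (cases j; cases j') (simp add: W_def m_def ck)
    show "0 \<le> m i j j'" for i j j'
      using exp_pair_bounds(3)[OF l0 l(3), of i "fst j" "fst j'" "snd j" "snd j'"]
      by (cases j; cases j') (simp add: m_def)
    show "(\<Sum>i\<in>I. m i j j') \<le> \<theta>^2 * (1 + r) + err2 \<theta>" if jj: "(j, j') \<in> SJ" for j j'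
    proof -
      obtain a u a' v where e: "j = (a, u)" "j' = (a', v)" and d: "(a, a') \<in> Sg \<or> (a = a' \<and> a \<in> A \<and> u \<noteq> v)"
        using jj by (auto simp: SJ_def)
      have aA: "a \<in> A" "a' \<in> A" using d Sg(1) by auto
      let ?p = "\<lambda>i. max 0 (sg u * sg v * expectation (\<lambda>\<omega>. X i a \<omega> * X i a' \<omega>))"
      have p: "?p i \<le> r / 2 * ((s i a)^2 + (s i a')^2) + e3 * \<beta> i" if i: "i \<in> I" for i
      proof -
        have nn: "0 \<le> r / 2 * ((s i a)^2 + (s i a')^2) + e3 * \<beta> i"
          using r e0 beta(1)[OF i] by (intro add_nonneg_nonneg mult_nonneg_nonneg) auto
        show ?thesis
        proof (cases "(a, a') \<in> Sg")
          case True
          have "\<bar>sg u * sg v * expectation (\<lambda>\<omega>. X i a \<omega> * X i a' \<omega>)\<bar> \<le> r / 2 * ((s i a)^2 + (s i a')^2) + e3 * \<beta> i"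
            using strong[OF i True] by (simp add: abs_mult)
          then show ?thesis using nn by (simp add: abs_le_iff)
        next
          case False
          then have "a = a'" "sg u * sg v = -1" using d by (auto simp: sg_def)
          then have "sg u * sg v * expectation (\<lambda>\<omega>. X i a \<omega> * X i a' \<omega>) \<le> 0"
            by (simp add: power2_eq_square[symmetric])
          then show ?thesis using nn by simp
        qed
      qed
      have "(\<Sum>i\<in>I. ?p i) \<le> (\<Sum>i\<in>I. r / 2 * ((s i a)^2 + (s i a')^2) + e3 * \<beta> i)" by (intro sum_mono p)
      also have "\<dots> = r / 2 * ((\<Sum>i\<in>I. (s i a)^2) + (\<Sum>i\<in>I. (s i a')^2)) + e3 * (\<Sum>i\<in>I. \<beta> i)"
        by (simp only: sum.distrib sum_distrib_left[symmetric])
      also have "\<dots> \<le> r / 2 * (1 + 1) + e3 * 2"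
        using s(3) aA beta(2) e0 r by (intro add_mono mult_left_mono) auto
      finally have P: "(\<Sum>i\<in>I. ?p i) \<le> r + 2 * e3" by simp
      have "(\<Sum>i\<in>I. m i j j') = \<theta> * ((\<Sum>i\<in>I. \<bar>expectation (X i a)\<bar>) + (\<Sum>i\<in>I. \<bar>expectation (X i a')\<bar>))
        + (\<theta>^2 / 2 + 2 * \<theta>^3 * b) * ((\<Sum>i\<in>I. expectation (\<lambda>\<omega>. (X i a \<omega>)^2)) + (\<Sum>i\<in>I. expectation (\<lambda>\<omega>. (X i a' \<omega>)^2)) + 2 * (\<Sum>i\<in>I. ?p i))"
        unfolding e m_def by (simp add: sum.distrib sum_distrib_left[symmetric])
      also have "\<dots> \<le> \<theta> * (e1 + e1) + (\<theta>^2 / 2 + 2 * \<theta>^3 * b) * ((1 + 2 * e2) + (1 + 2 * e2) + 2 * (r + 2 * e3))"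
        using l0 b0 m1 sum_m2 aA P by (intro add_mono mult_left_mono) auto
      also have "\<dots> = \<theta>^2 * (1 + r) + (2 * \<theta> * e1 + \<theta>^2 * (2 * e2 + 2 * e3) + 2 * \<theta>^3 * b * (2 + 2 * r + 4 * e2 + 4 * e3))"
        by (simp add: algebra_simps)
      also have "\<dots> \<le> \<theta>^2 * (1 + r) + err2 \<theta>"
        unfolding err2_def using r l0 b0 by (intro add_left_mono mult_left_mono) auto
      finally show ?thesis .
    qed
    show "expectation (\<lambda>\<omega>. lgs (- \<kappa> * x + (\<Sum>i\<in>I. W i j \<omega>))) \<le> Gm" if jJ: "j \<in> ?J" for j
    proof -
      obtain a u where j: "j = (a, u)" "a \<in> A" using jJ by auto
      show ?thesis using G[OF j(2), of u] by (simp add: j(1) W_def S_def sum_distrib_left)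
    qed
  qed
  have W_S: "(\<Sum>i\<in>I. W i j \<omega>) = (case j of (a, u) \<Rightarrow> \<kappa> * (sg u * S a \<omega>))" for j \<omega>
    by (cases j) (simp add: W_def S_def sum_distrib_left)
  have v1: "expectation (\<lambda>\<omega>. hprod ?J (\<lambda>j. - \<kappa> * x + (\<Sum>i\<in>I. W i j \<omega>))) = hp \<kappa> x"
    unfolding hp_def W_S by (simp add: case_prod_beta')
  have v2: "(\<Prod>j\<in>?J. 1 - expectation (\<lambda>\<omega>. lgs (- \<kappa> * x + (\<Sum>i\<in>I. W i j \<omega>))))
     = (\<Prod>(a, u)\<in>?J. 1 - expectation (\<lambda>\<omega>. lgs (- \<kappa> * x + \<kappa> * (sg u * S a \<omega>))))"
    unfolding W_S by (simp add: case_prod_beta')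
  have v3: "2 * c * (- \<kappa> * x) + (\<theta>^2 * (1 + r) + err2 \<theta>) = - (x^2 / (1 + r)) + err2 \<theta>"
  proof -
    have "2 * c * (- \<kappa> * x) = - (2 * \<theta> * x)" using k by (simp add: c_def)
    also have "\<dots> = - 2 * (x^2 / (1 + r))" by (simp add: l(1) power2_eq_square)
    finally have 1: "2 * c * (- \<kappa> * x) = - 2 * (x^2 / (1 + r))" .
    have 2: "\<theta>^2 * (1 + r) = x^2 / (1 + r)" using r by (simp add: l(1) power_divide power2_eq_square)
    show ?thesis unfolding 1 2 by simp
  qed
  have SJc: "real (card SJ) \<le> 4 * real (card Sg) + 2 * real (card A)"
  proof -
    let ?f = "\<lambda>((a, c), (u, v)). ((a, u), (c, v)) :: ('j \<times> bool) \<times> ('j \<times> bool)"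
    have fS: "finite Sg" using Sg(1) finA finite_subset by blast
    have "SJ \<subseteq> ?f ` (Sg \<times> UNIV) \<union> (\<lambda>(a, u). ((a, u), (a, \<not> u))) ` (A \<times> UNIV)"
    proof
      fix z assume "z \<in> SJ"
      then obtain a u c v where z: "z = ((a, u), (c, v))" "(a, c) \<in> Sg \<or> (a = c \<and> a \<in> A \<and> u \<noteq> v)"
        by (auto simp: SJ_def)
      show "z \<in> ?f ` (Sg \<times> UNIV) \<union> (\<lambda>(a, u). ((a, u), (a, \<not> u))) ` (A \<times> UNIV)"
      proof (cases "(a, c) \<in> Sg")
        case True
        then show ?thesis using z by (intro UnI1 image_eqI[of _ _ "((a, c), (u, v))"]) auto
      next
        case False
        then show ?thesis using z by (intro UnI2 image_eqI[of _ _ "(a, u)"]) auto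
      qed
    qed
    then have "card SJ \<le> card (?f ` (Sg \<times> UNIV) \<union> (\<lambda>(a, u). ((a, u), (a, \<not> u))) ` (A \<times> UNIV))"
      using fS finA by (intro card_mono) auto
    also have "\<dots> \<le> card (?f ` (Sg \<times> UNIV)) + card ((\<lambda>(a, u). ((a, u), (a, \<not> u))) ` (A \<times> (UNIV :: bool set)))"
      by (rule card_Un_le)
    also have "\<dots> \<le> card (Sg \<times> (UNIV :: (bool \<times> bool) set)) + card (A \<times> (UNIV :: bool set))"
      using fS finA by (intro add_mono card_image_le) auto
    also have "\<dots> = 4 * card Sg + 2 * card A"
      by (simp add: card_cartesian_product)
    finally show ?thesis by linarith
  qed
  have Gm0: "0 \<le> Gm" if ne: "A \<noteq> {}"
  proof -
    obtain a where "a \<in> A" using ne by auto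
    then have "0 \<le> expectation (\<lambda>\<omega>. lgs (- \<kappa> * x + \<kappa> * (sg True * S a \<omega>)))" by simp
    then show ?thesis using G[OF \<open>a \<in> A\<close>, of True] by linarith
  qed
  have cG: "real (card ?J) * Gm = 2 * real (card A) * Gm" by (simp add: card_cartesian_product)
  have cG0: "0 \<le> 2 * real (card A) * Gm" using Gm0 by (cases "A = {}") auto
  have "18 * (\<Sum>i\<in>I. \<kappa>^2 * (e3 * \<beta> i)) \<le> 18 * (\<kappa>^2 * (e3 * 2))"
    unfolding sum_distrib_left[symmetric] using beta(2) e0 by (intro mult_left_mono) auto
  moreover have "(\<Sum>i\<in>I. \<kappa>^2 * \<beta> i) * (real (card SJ) * exp (- (x^2 / (1 + r)) + err2 \<theta>)
        + 1056 * (\<kappa> * b) * (2 * real (card A) * Gm))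
     \<le> (\<kappa>^2 * 2) * ((4 * real (card Sg) + 2 * real (card A)) * exp (- (x^2 / (1 + r)) + err2 \<theta>)
        + 1056 * (\<kappa> * b) * (2 * real (card A) * Gm))"
  proof (intro mult_mono)
    show "(\<Sum>i\<in>I. \<kappa>^2 * \<beta> i) \<le> \<kappa>^2 * 2" using beta(2) by (auto simp: sum_distrib_left[symmetric] intro!: mult_left_mono)
    show "real (card SJ) * exp (- (x^2 / (1 + r)) + err2 \<theta>) + 1056 * (\<kappa> * b) * (2 * real (card A) * Gm)
      \<le> (4 * real (card Sg) + 2 * real (card A)) * exp (- (x^2 / (1 + r)) + err2 \<theta>) + 1056 * (\<kappa> * b) * (2 * real (card A) * Gm)"
      by (intro add_right_mono mult_right_mono SJc) auto
    have "0 \<le> 1056 * (\<kappa> * b) * (2 * real (card A) * Gm)" using k b0 by (intro mult_nonneg_nonneg[OF _ cG0]) auto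
    then show "0 \<le> real (card SJ) * exp (- (x^2 / (1 + r)) + err2 \<theta>) + 1056 * (\<kappa> * b) * (2 * real (card A) * Gm)"
      by (intro add_nonneg_nonneg) auto
  qed simp
  moreover have "18 * (\<kappa>^2 * (e3 * 2)) = 36 * \<kappa>^2 * e3" by simp
  ultimately show ?thesis using dec unfolding v1 v2 v3 cG mult.commute[of "\<kappa>^2" 2] by linarith
qed

lemma hp_le_prob:
  assumes k: "0 < \<kappa>" and x: "x \<le> x'"
  shows "hp \<kappa> x \<le> prob {\<omega> \<in> space M. \<forall>a\<in>A. \<bar>S a \<omega>\<bar> \<le> x'} + exp (- \<kappa> * (x' - x))"
proof -
  let ?J = "A \<times> (UNIV :: bool set)"
  let ?h = "\<lambda>\<omega>. hprod ?J (\<lambda>(a, u). - \<kappa> * x + \<kappa> * (sg u * S a \<omega>))"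
  let ?E = "{\<omega> \<in> space M. \<forall>a\<in>A. \<bar>S a \<omega>\<bar> \<le> x'}"
  have E[measurable]: "?E \<in> sets M" using finA by measurable
  have hm: "?h \<in> borel_measurable M" unfolding hprod_def by (simp add: case_prod_beta') 
  have ih: "integrable M ?h" using hm by (intro integrable_const_bound[where B=1]) (auto simp: hprod_nonneg hprod_le_1)
  have iE: "integrable M (indicator ?E :: _ \<Rightarrow> real)"
    by (rule integrable_real_indicator[OF E]) (simp add: emeasure_eq_measure)
  have "hp \<kappa> x \<le> expectation (\<lambda>\<omega>. indicator ?E \<omega> + exp (- \<kappa> * (x' - x)))"
    unfolding hp_def
  proof (intro integral_mono ih)
    show "integrable M (\<lambda>\<omega>. indicator ?E \<omega> + exp (- \<kappa> * (x' - x)))" using iE by simp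
    fix \<omega> assume w: "\<omega> \<in> space M"
    show "?h \<omega> \<le> indicator ?E \<omega> + exp (- \<kappa> * (x' - x))"
    proof (cases "\<omega> \<in> ?E")
      case True
      have "?h \<omega> \<le> 1" by (rule hprod_le_1)
      then show ?thesis using True by (simp add: add_increasing2)
    next
      case False
      then obtain a where a: "a \<in> A" "x' < \<bar>S a \<omega>\<bar>" using w by auto
      obtain u where u: "sg u * S a \<omega> = \<bar>S a \<omega>\<bar>"
        by (cases "S a \<omega> \<ge> 0") (auto simp: sg_def intro: that[of True] that[of False])
      let ?t = "- \<kappa> * x + \<kappa> * (sg u * S a \<omega>)"
      have "?h \<omega> \<le> 1 - lgs ?t"
      proof -
        have "?h \<omega> = (1 - lgs ?t) * (\<Prod>j\<in>?J - {(a, u)}. 1 - lgs (case j of (a, u) \<Rightarrow> - \<kappa> * x + \<kappa> * (sg u * S a \<omega>)))"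
          unfolding hprod_def using finA a by (subst prod.remove[of _ "(a, u)"]) auto
        also have "\<dots> \<le> (1 - lgs ?t) * 1"
          by (intro mult_left_mono prod_le_1) (auto simp: less_imp_le)
        finally show ?thesis by simp
      qed
      also have "\<dots> = lgs (- ?t)" by (rule one_minus_lgs)
      also have "\<dots> \<le> exp (1 * (- ?t))" by (rule lgs_le_exp) auto
      also have "\<dots> \<le> exp (- \<kappa> * (x' - x))"
      proof -
        have "\<kappa> * x' \<le> \<kappa> * (sg u * S a \<omega>)" using a u k by (intro mult_left_mono) auto
        then show ?thesis by (simp add: algebra_simps)
      qed
      finally show ?thesis using False by simp
    qed
  qed
  also have "\<dots> = prob ?E + exp (- \<kappa> * (x' - x))"
    using iE by (subst Bochner_Integration.integral_add) (auto simp: prob_space)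
  finally show ?thesis .
qed

lemma prob_le_hp:
  assumes k: "0 < \<kappa>" and x: "x \<le> x'"
    and G: "\<And>a u. a \<in> A \<Longrightarrow> expectation (\<lambda>\<omega>. lgs (- (\<kappa> / 2) * x' + (\<kappa> / 2) * (sg u * S a \<omega>))) \<le> Gm"
  shows "prob {\<omega> \<in> space M. \<forall>a\<in>A. \<bar>S a \<omega>\<bar> \<le> x} \<le> hp \<kappa> x' + 2 * exp (- (\<kappa> / 2) * (x' - x)) * (2 * real (card A) * Gm)"
proof -
  let ?J = "A \<times> (UNIV :: bool set)"
  let ?h = "\<lambda>\<omega>. hprod ?J (\<lambda>(a, u). - \<kappa> * x' + \<kappa> * (sg u * S a \<omega>))"
  let ?E = "{\<omega> \<in> space M. \<forall>a\<in>A. \<bar>S a \<omega>\<bar> \<le> x}"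
  let ?g = "\<lambda>j \<omega>. lgs (- (\<kappa> / 2) * x' + (\<kappa> / 2) * (sg (snd j) * S (fst j) \<omega>))"
  have E[measurable]: "?E \<in> sets M" using finA by measurable
  have hm: "?h \<in> borel_measurable M" unfolding hprod_def by (simp add: case_prod_beta')
  have ih: "integrable M ?h" using hm by (intro integrable_const_bound[where B=1]) (auto simp: hprod_nonneg hprod_le_1)
  have ig: "integrable M (?g j)" for j by (intro integrable_const_bound[where B=1]) auto
  let ?c = "2 * exp (- (\<kappa> / 2) * (x' - x))"
  have "prob ?E = expectation (indicator ?E)" by simp
  also have "\<dots> \<le> expectation (\<lambda>\<omega>. ?h \<omega> + ?c * (\<Sum>j\<in>?J. ?g j \<omega>))"
  proof (intro integral_mono)
    show "integrable M (\<lambda>\<omega>. ?h \<omega> + ?c * (\<Sum>j\<in>?J. ?g j \<omega>))" using ih ig by auto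
    fix \<omega> assume w: "\<omega> \<in> space M"
    have g0: "0 \<le> (\<Sum>j\<in>?J. ?g j \<omega>)" by (intro sum_nonneg) auto
    show "indicator ?E \<omega> \<le> ?h \<omega> + ?c * (\<Sum>j\<in>?J. ?g j \<omega>)"
    proof (cases "\<omega> \<in> ?E")
      case False
      then show ?thesis using g0 hprod_nonneg[of ?J] by simp
    next
      case True
      have "1 - ?h \<omega> \<le> (\<Sum>j\<in>?J. lgs (case j of (a, u) \<Rightarrow> - \<kappa> * x' + \<kappa> * (sg u * S a \<omega>)))"
      proof -
        have "1 - (\<Sum>j\<in>?J. lgs (t j)) \<le> (\<Prod>j\<in>?J. 1 - lgs (t j))" for t
          by (rule Weierstrass_prod_ineq) auto
        then show ?thesis unfolding hprod_def by (simp add: algebra_simps)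
      qed
      also have "\<dots> \<le> (\<Sum>j\<in>?J. ?c * ?g j \<omega>)"
      proof (rule sum_mono)
        fix j assume "j \<in> ?J"
        then obtain a u where j: "j = (a, u)" "a \<in> A" by auto
        have "sg u * S a \<omega> \<le> \<bar>S a \<omega>\<bar>" by (auto simp: sg_def)
        then have le: "sg u * S a \<omega> \<le> x" using True j by fastforce
        let ?v = "sg u * S a \<omega> - x'"
        have v0: "\<kappa> / 2 * ?v \<le> - (\<kappa> / 2) * (x' - x)" 
          
        proof -
          have "\<kappa> / 2 * ?v \<le> \<kappa> / 2 * (x - x')" using k le by (intro mult_left_mono) auto
          also have "\<dots> = - (\<kappa> / 2) * (x' - x)" by (simp only: mult_minus_left mult_minus_right[symmetric] minus_diff_eq)
          finally show ?thesis .
        qed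
        have v1: "\<kappa> / 2 * ?v \<le> 0" using k le x by (intro mult_nonneg_nonpos) auto
        have "exp (\<kappa> / 2 * ?v) \<le> 2 * lgs (\<kappa> / 2 * ?v)"
        proof -
          have e: "exp (\<kappa> / 2 * ?v) \<le> 1" using v1 by simp
          have "lgs (\<kappa> / 2 * ?v) = exp (\<kappa> / 2 * ?v) / (exp (\<kappa> / 2 * ?v) + 1)"
            unfolding lgs_def using one_plus_exp_pos[of "- (\<kappa> / 2 * ?v)"] by (simp add: exp_minus field_simps)
          then show ?thesis using e by (simp add: field_simps add_pos_pos)
        qed
        moreover have "lgs (\<kappa> * ?v) \<le> exp (\<kappa> / 2 * ?v) * exp (\<kappa> / 2 * ?v)"
          using lgs_le_exp[of 1 "\<kappa> * ?v"] by (simp add: exp_add[symmetric])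
        moreover have "exp (\<kappa> / 2 * ?v) \<le> exp (- (\<kappa> / 2) * (x' - x))" using v0 by simp
        ultimately have main: "lgs (\<kappa> * ?v) \<le> exp (- (\<kappa> / 2) * (x' - x)) * (2 * lgs (\<kappa> / 2 * ?v))"
          by (meson exp_ge_zero mult_mono order_trans)
        have q1: "- \<kappa> * x' + \<kappa> * (sg u * S a \<omega>) = \<kappa> * ?v" by (simp add: algebra_simps)
        have q2: "- (\<kappa> / 2) * x' + (\<kappa> / 2) * (sg u * S a \<omega>) = \<kappa> / 2 * ?v" by (simp add: algebra_simps)
        show "lgs (case j of (a, u) \<Rightarrow> - \<kappa> * x' + \<kappa> * (sg u * S a \<omega>)) \<le> ?c * ?g j \<omega>"
          unfolding j prod.case fst_conv snd_conv q1 q2 using main by (simp only: mult_ac)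
      qed
      finally show ?thesis using True by (simp add: sum_distrib_left[symmetric])
    qed
  qed (rule integrable_real_indicator[OF E], simp add: emeasure_eq_measure)
  also have "\<dots> = hp \<kappa> x' + ?c * (\<Sum>j\<in>?J. expectation (?g j))"
    unfolding hp_def using ih ig by (simp add: Bochner_Integration.integral_sum Bochner_Integration.integrable_sum)
  also have "\<dots> \<le> hp \<kappa> x' + ?c * (\<Sum>j\<in>?J. Gm)"
    using G by (intro add_left_mono mult_left_mono sum_mono) auto
  also have "\<dots> = hp \<kappa> x' + ?c * (2 * real (card A) * Gm)" by (simp add: card_cartesian_product)
  finally show ?thesis .
qed

end

lemma tendsto_shift_sandwich:
  fixes p :: "nat \<Rightarrow> real" and F :: "real \<Rightarrow> real"
  assumes F: "isCont F y"
    and u: "\<And>d. 0 < d \<Longrightarrow> \<exists>u. u \<longlonglongrightarrow> F (y + d) \<and> eventually (\<lambda>k. p k \<le> u k) sequentially"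
    and l: "\<And>d. 0 < d \<Longrightarrow> \<exists>l. l \<longlonglongrightarrow> F (y - d) \<and> eventually (\<lambda>k. l k \<le> p k) sequentially"
  shows "p \<longlonglongrightarrow> F y"
proof (rule order_tendstoI)
  have Fy: "(F \<longlongrightarrow> F y) (at y)" using F by (simp add: isCont_def)
  fix a assume a: "a < F y"
  have "eventually (\<lambda>z. a < F z) (at y)" using order_tendstoD(1)[OF Fy a] .
  then obtain e where e: "0 < e" "\<And>z. z \<noteq> y \<Longrightarrow> dist z y < e \<Longrightarrow> a < F z" by (auto simp: eventually_at)
  have "a < F (y - e / 2)" using e by (intro e(2)) (auto simp: dist_real_def)
  moreover obtain l where "l \<longlonglongrightarrow> F (y - e / 2)" and le: "eventually (\<lambda>k. l k \<le> p k) sequentially"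
    using l[of "e / 2"] e by auto
  ultimately have "eventually (\<lambda>k. a < l k) sequentially" by (auto dest: order_tendstoD(1))
  with le show "eventually (\<lambda>k. a < p k) sequentially" by eventually_elim auto
next
  have Fy: "(F \<longlongrightarrow> F y) (at y)" using F by (simp add: isCont_def)
  fix a assume a: "F y < a"
  have "eventually (\<lambda>z. F z < a) (at y)" using order_tendstoD(2)[OF Fy a] .
  then obtain e where e: "0 < e" "\<And>z. z \<noteq> y \<Longrightarrow> dist z y < e \<Longrightarrow> F z < a" by (auto simp: eventually_at)
  have "F (y + e / 2) < a" using e by (intro e(2)) (auto simp: dist_real_def)
  moreover obtain u where "u \<longlonglongrightarrow> F (y + e / 2)" and le: "eventually (\<lambda>k. p k \<le> u k) sequentially"
    using u[of "e / 2"] e by auto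
  ultimately have "eventually (\<lambda>k. u k < a) sequentially" by (auto dest: order_tendstoD(2))
  with le show "eventually (\<lambda>k. p k < a) sequentially" by eventually_elim auto
qed

definition gumbel :: "real \<Rightarrow> real" where
  "gumbel y = exp (- (1 / sqrt pi) * exp (- y / 2))"

lemma isCont_gumbel: "isCont gumbel y"
  unfolding gumbel_def[abs_def] by (intro continuous_intros) auto

lemma kap_times_gap: "d > 0 \<Longrightarrow> filterlim (\<lambda>Q. ln Q powr (3/5) * (xcrit (y + d) Q - xcrit y Q)) at_top at_top"
  unfolding xcrit_def by real_asymp

lemma kap_over_xcrit: "filterlim (\<lambda>Q. ln Q powr (3/5) / xcrit y Q) at_top at_top"
  unfolding xcrit_def by real_asymp

lemma kap_at_top: "filterlim (\<lambda>Q::real. ln Q powr (3/5)) at_top at_top"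
  by real_asymp

lemma strong_pairs_negligible:
  fixes \<delta> C y :: real
  assumes "0 < \<delta>" "0 < C"
  shows "((\<lambda>Q. 2 * (ln Q powr (3/5))^2 * ((4 * (C * Q * (ln Q)^4) + 2 * Q)
     * exp (- ((2 * ln Q - ln (ln Q) + y) * ((1 + \<delta>)/2))))) \<longlongrightarrow> 0) at_top"
  using assms by real_asymp

locale max_array_seq =
  fixes M :: "nat \<Rightarrow> 'a measure" and I :: "nat \<Rightarrow> 'i set" and A :: "nat \<Rightarrow> 'j set"
    and X :: "nat \<Rightarrow> 'i \<Rightarrow> 'j \<Rightarrow> 'a \<Rightarrow> real" and s :: "nat \<Rightarrow> 'i \<Rightarrow> 'j \<Rightarrow> real"
    and \<beta> :: "nat \<Rightarrow> 'i \<Rightarrow> real" and b e1 e2 e3 :: "nat \<Rightarrow> real" and r C :: real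
    and Sg :: "nat \<Rightarrow> ('j \<times> 'j) set"
    and q \<kappa> :: "nat \<Rightarrow> real"
  assumes arr: "eventually (\<lambda>k. max_array (M k) (I k) (A k) (X k) (s k) (\<beta> k) (b k) (e1 k) (e2 k) (e3 k) r (Sg k)) sequentially"
    and q: "\<And>k. q k = real (card (A k))" "filterlim q at_top sequentially"
    and kap: "\<And>k. \<kappa> k = ln (q k) powr (3/5)"
    and limb: "(\<lambda>k. \<kappa> k ^ 3 * b k) \<longlonglongrightarrow> 0" and lim1: "(\<lambda>k. \<kappa> k * e1 k) \<longlonglongrightarrow> 0"
    and lim2: "(\<lambda>k. \<kappa> k ^ 2 * e2 k) \<longlonglongrightarrow> 0" and lim3: "(\<lambda>k. \<kappa> k ^ 2 * e3 k) \<longlonglongrightarrow> 0"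
    and C: "0 < C" and Sgc: "eventually (\<lambda>k. real (card (Sg k)) \<le> C * q k * (ln (q k))^4) sequentially"
begin

abbreviation "SS k \<equiv> max_array.S (I k) (X k)"
abbreviation "sgn' \<equiv> max_array.sg"
abbreviation "er k \<equiv> max_array.err1 (b k) (e1 k) (e2 k)"
abbreviation "hh k \<equiv> max_array.hp (M k) (I k) (A k) (X k)"

lemma rr: "0 < r" "r < 1"
  using eventually_happens[OF arr] max_array.r by (auto simp: trivial_limit_sequentially)

lemma kap_lim: "filterlim \<kappa> at_top sequentially"
  using filterlim_compose[OF kap_at_top q(2)] by (simp add: kap[abs_def])

lemma kap_ge_1: "eventually (\<lambda>k. 1 \<le> \<kappa> k) sequentially"
  using kap_lim by (simp add: filterlim_at_top)

lemma kb_lim: "(\<lambda>k. \<kappa> k * b k) \<longlonglongrightarrow> 0"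
proof (rule Lim_null_comparison[OF _ limb])
  show "eventually (\<lambda>k. norm (\<kappa> k * b k) \<le> \<kappa> k ^ 3 * b k) sequentially"
    using kap_ge_1 arr
  proof eventually_elim
    case (elim k)
    have "\<kappa> k ^ 1 \<le> \<kappa> k ^ 3" using elim by (intro power_increasing) auto
    then show ?case using max_array.b0[OF elim(2)] elim(1) by (simp add: mult_right_mono)
  qed
qed

lemma err1_scaled_lim: "(\<lambda>k. er k (c * \<kappa> k)) \<longlonglongrightarrow> 0"
proof -
  have "(\<lambda>k. 2 * (c * (\<kappa> k * e1 k) + 2 * c^2 * (\<kappa> k ^ 2 * e2 k) + 2 * c^3 * (\<kappa> k ^ 3 * b k)
      + gauss_rem * c^3 * (\<kappa> k ^ 3 * b k))) \<longlonglongrightarrow> 2 * (c * 0 + 2 * c^2 * 0 + 2 * c^3 * 0 + gauss_rem * c^3 * 0)"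
    by (intro tendsto_intros limb lim1 lim2)
  moreover have "eventually (\<lambda>k. 2 * (c * (\<kappa> k * e1 k) + 2 * c^2 * (\<kappa> k ^ 2 * e2 k) + 2 * c^3 * (\<kappa> k ^ 3 * b k)
      + gauss_rem * c^3 * (\<kappa> k ^ 3 * b k)) = er k (c * \<kappa> k)) sequentially"
    using arr by eventually_elim (simp add: max_array.err1_def power_mult_distrib mult_ac)
  ultimately show ?thesis by (auto intro: Lim_transform_eventually)
qed

definition \<gamma> :: "real \<Rightarrow> real \<Rightarrow> nat \<Rightarrow> real" where
  "\<gamma> c y k = (\<integral>z. lgs (- (c * \<kappa> k) * xcrit y (q k) + z) \<partial>gauss (c * \<kappa> k))"

lemma gam_nonneg: "0 \<le> \<gamma> c y k"
  unfolding \<gamma>_def by (intro Bochner_Integration.integral_nonneg) auto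

lemma q_gam_lim:
  assumes c: "0 < c"
  shows "(\<lambda>k. q k * \<gamma> c y k) \<longlonglongrightarrow> exp (- y / 2) / (2 * sqrt pi)"
  unfolding \<gamma>_def
proof (rule gauss_lgs_tail_tendsto[OF q(2)])
  have "filterlim (\<lambda>k. \<kappa> k / xcrit y (q k)) at_top sequentially"
    using filterlim_compose[OF kap_over_xcrit q(2)] by (simp add: kap)
  from filterlim_tendsto_pos_mult_at_top[OF tendsto_const[of c] c this]
  show "filterlim (\<lambda>k. c * \<kappa> k / xcrit y (q k)) at_top sequentially" by simp
qed

lemma gam_lim: "0 < c \<Longrightarrow> \<gamma> c y \<longlonglongrightarrow> 0"
proof -
  assume c: "0 < c"
  have "(\<lambda>k. (q k * \<gamma> c y k) / q k) \<longlonglongrightarrow> 0"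
    by (rule real_tendsto_divide_at_top[OF q_gam_lim[OF c] q(2)])
  moreover have "eventually (\<lambda>k. (q k * \<gamma> c y k) / q k = \<gamma> c y k) sequentially"
  proof -
    have "eventually (\<lambda>k. 0 < q k) sequentially" using q(2) by (simp add: filterlim_at_top_dense)
    then show ?thesis by eventually_elim simp
  qed
  ultimately show ?thesis by (rule Lim_transform_eventually)
qed

lemma one_dim_uniform:
  assumes c: "0 < c" "c \<le> 1"
  shows "eventually (\<lambda>k. \<forall>a\<in>A k. \<forall>u. \<bar>(\<integral>\<omega>. lgs (- (c * \<kappa> k) * xcrit y (q k) + (c * \<kappa> k) * (sgn' u * SS k a \<omega>)) \<partial>M k) - \<gamma> c y k\<bar>
     \<le> (2 * er k (c * \<kappa> k)) * \<gamma> c y k) sequentially"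
proof -
  have "(\<lambda>k. (\<kappa> k * b k)^2 + 2 * gauss_rem * (\<kappa> k * b k)^3) \<longlonglongrightarrow> 0^2 + 2 * gauss_rem * 0^3"
    by (intro tendsto_intros kb_lim)
  then have l1: "eventually (\<lambda>k. (\<kappa> k * b k)^2 + 2 * gauss_rem * (\<kappa> k * b k)^3 < 1) sequentially"
    by (auto dest: order_tendstoD(2)[where a=1])
  have l2: "eventually (\<lambda>k. \<kappa> k * b k < 1) sequentially" using order_tendstoD(2)[OF kb_lim, of 1] by simp
  have l3: "eventually (\<lambda>k. er k (c * \<kappa> k) < 1) sequentially" using order_tendstoD(2)[OF err1_scaled_lim, of 1] by simp
  show ?thesis using arr kap_ge_1 l1 l2 l3
  proof eventually_elim
    case (elim k)
    interpret max_array "M k" "I k" "A k" "X k" "s k" "\<beta> k" "b k" "e1 k" "e2 k" "e3 k" r "Sg k" by (rule elim(1))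
    have kb: "0 \<le> c * \<kappa> k * b k" "c * \<kappa> k * b k \<le> \<kappa> k * b k"
      using c elim b0 by (auto simp: mult.assoc mult_left_le_one_le)
    have kb1: "c * \<kappa> k * b k \<le> 1" using kb elim(4) by linarith
    have "(c * \<kappa> k * b k)^2 \<le> (\<kappa> k * b k)^2" "(c * \<kappa> k * b k)^3 \<le> (\<kappa> k * b k)^3"
      using kb by (auto intro!: power_mono)
    then have "(c * \<kappa> k * b k)^2 + 2 * gauss_rem * (c * \<kappa> k * b k)^3 \<le> 1"
      using elim(3) mult_left_mono[of "(c * \<kappa> k * b k)^3" "(\<kappa> k * b k)^3" "2 * gauss_rem"] gauss_rem_nonneg by linarith
    then show ?case
      unfolding \<gamma>_def using c elim(2,5) kb1 by (intro ballI allI one_dim) auto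
  qed
qed

lemma one_dim_le:
  assumes c: "0 < c" "c \<le> 1"
  shows "eventually (\<lambda>k. \<forall>a\<in>A k. \<forall>u. (\<integral>\<omega>. lgs (- (c * \<kappa> k) * xcrit y (q k) + (c * \<kappa> k) * (sgn' u * SS k a \<omega>)) \<partial>M k)
     \<le> 2 * \<gamma> c y k) sequentially"
proof -
  have "eventually (\<lambda>k. er k (c * \<kappa> k) < 1/2) sequentially" using order_tendstoD(2)[OF err1_scaled_lim, of "1/2"] by simp
  with one_dim_uniform[OF c, of y] show ?thesis
  proof eventually_elim
    case (elim k)
    have *: "(2 * er k (c * \<kappa> k)) * \<gamma> c y k \<le> 1 * \<gamma> c y k"
      using elim gam_nonneg by (intro mult_right_mono) auto
    show ?case
    proof (intro ballI allI)
      fix a u assume "a \<in> A k"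
      then have "\<bar>(\<integral>\<omega>. lgs (- (c * \<kappa> k) * xcrit y (q k) + (c * \<kappa> k) * (sgn' u * SS k a \<omega>)) \<partial>M k) - \<gamma> c y k\<bar>
         \<le> (2 * er k (c * \<kappa> k)) * \<gamma> c y k" using elim(1) by blast
      then show "(\<integral>\<omega>. lgs (- (c * \<kappa> k) * xcrit y (q k) + (c * \<kappa> k) * (sgn' u * SS k a \<omega>)) \<partial>M k) \<le> 2 * \<gamma> c y k"
        using * by linarith
    qed
  qed
qed

lemma hp_lim: "(\<lambda>k. hh k (\<kappa> k) (xcrit y (q k))) \<longlonglongrightarrow> gumbel y"
proof -
  let ?x = "\<lambda>k. xcrit y (q k)"
  let ?th = "\<lambda>k. ?x k / (1 + r)"
  define pr where "pr k = (\<lambda>(a, u). \<integral>\<omega>. lgs (- \<kappa> k * ?x k + \<kappa> k * (sgn' u * SS k a \<omega>)) \<partial>M k)" for k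
  let ?J = "\<lambda>k. A k \<times> (UNIV :: bool set)"
  have "(\<lambda>k. \<Prod>j\<in>?J k. 1 - pr k j) \<longlonglongrightarrow> exp (- (2 * (exp (- y / 2) / (2 * sqrt pi))))"
  proof (rule prod_one_minus_tendsto[where \<gamma> = "\<gamma> 1 y" and \<delta> = "\<lambda>k. 2 * er k (1 * \<kappa> k)"])
    show "eventually (\<lambda>k. finite (?J k)) sequentially"
      using arr by eventually_elim (simp add: max_array.finA)
    show "eventually (\<lambda>k. \<forall>j\<in>?J k. \<bar>pr k j - \<gamma> 1 y k\<bar> \<le> 2 * er k (1 * \<kappa> k) * \<gamma> 1 y k) sequentially"
      using one_dim_uniform[OF zero_less_one order_refl, of y] by eventually_elim (auto simp: pr_def)
    have "(\<lambda>k. 2 * (q k * \<gamma> 1 y k)) \<longlonglongrightarrow> 2 * (exp (- y / 2) / (2 * sqrt pi))"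
      by (intro tendsto_intros q_gam_lim) simp
    then show "(\<lambda>k. real (card (?J k)) * \<gamma> 1 y k) \<longlonglongrightarrow> 2 * (exp (- y / 2) / (2 * sqrt pi))"
      by (simp add: card_cartesian_product q mult_ac)
    have "(\<lambda>k. 2 * er k (1 * \<kappa> k)) \<longlonglongrightarrow> 2 * 0" by (intro tendsto_intros err1_scaled_lim)
    then show "(\<lambda>k. 2 * er k (1 * \<kappa> k)) \<longlonglongrightarrow> 0" by simp
  qed (auto intro: gam_nonneg gam_lim)
  also have "exp (- (2 * (exp (- y / 2) / (2 * sqrt pi)))) = gumbel y" by (simp add: gumbel_def)
  finally have P: "(\<lambda>k. \<Prod>j\<in>?J k. 1 - pr k j) \<longlonglongrightarrow> gumbel y" .
  define Bd where "Bd k = 36 * (\<kappa> k ^ 2 * e3 k)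
     + (2 * (ln (q k) powr (3/5))^2 * ((4 * (C * q k * (ln (q k))^4) + 2 * q k)
         * exp (- ((2 * ln (q k) - ln (ln (q k)) + y) * ((1 + (1 - r) / (1 + r))/2))))) * exp 1
     + 8448 * (\<kappa> k ^ 3 * b k) * (q k * \<gamma> 1 y k)" for k
  have dl: "0 < (1 - r) / (1 + r)" using rr by simp
  have "Bd \<longlonglongrightarrow> 36 * 0 + 0 * exp 1 + 8448 * 0 * (exp (- y / 2) / (2 * sqrt pi))"
    unfolding Bd_def
    by (intro tendsto_add tendsto_mult tendsto_const lim3 limb q_gam_lim
        filterlim_compose[OF strong_pairs_negligible[OF dl C] q(2)]) simp
  then have Bd0: "Bd \<longlonglongrightarrow> 0" by simp
  have xt: "filterlim ?x at_top sequentially" using xcrit_at_top q(2) by (rule filterlim_compose)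
  have x0: "eventually (\<lambda>k. 0 < ?x k) sequentially" using xt by (simp add: filterlim_at_top_dense)
  have kx: "eventually (\<lambda>k. 1 < \<kappa> k / ?x k) sequentially"
    using filterlim_compose[OF kap_over_xcrit q(2)] by (simp add: kap filterlim_at_top_dense)
  have kb: "eventually (\<lambda>k. \<kappa> k * b k < 1/2) sequentially" using order_tendstoD(2)[OF kb_lim, of "1/2"] by simp
  have "(\<lambda>k. 2 * (\<kappa> k * e1 k) + (2 * (\<kappa> k ^ 2 * e2 k) + 2 * (\<kappa> k ^ 2 * e3 k))
     + 2 * (\<kappa> k ^ 3 * b k) * (4 + 4 * (\<kappa> k ^ 2 * e2 k) + 4 * (\<kappa> k ^ 2 * e3 k))) \<longlonglongrightarrow>
     2 * 0 + (2 * 0 + 2 * 0) + 2 * 0 * (4 + 4 * 0 + 4 * 0)"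
    by (intro tendsto_intros lim1 lim2 lim3 limb)
  then have er2: "eventually (\<lambda>k. 2 * (\<kappa> k * e1 k) + (2 * (\<kappa> k ^ 2 * e2 k) + 2 * (\<kappa> k ^ 2 * e3 k))
     + 2 * (\<kappa> k ^ 3 * b k) * (4 + 4 * (\<kappa> k ^ 2 * e2 k) + 4 * (\<kappa> k ^ 2 * e3 k)) < 1) sequentially"
    by (auto dest: order_tendstoD(2)[where a=1])
  have ql: "eventually (\<lambda>k. 1 < q k) sequentially" using q(2) by (simp add: filterlim_at_top_dense)
  have "eventually (\<lambda>k. \<bar>hh k (\<kappa> k) (?x k) - (\<Prod>j\<in>?J k. 1 - pr k j)\<bar> \<le> Bd k) sequentially"
    using arr kap_ge_1 x0 kx kb er2 one_dim_le[OF zero_less_one order_refl, of y] Sgc ql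
  proof eventually_elim
    case (elim k)
    interpret max_array "M k" "I k" "A k" "X k" "s k" "\<beta> k" "b k" "e1 k" "e2 k" "e3 k" r "Sg k" by (rule elim(1))
    have k0: "0 < \<kappa> k" using elim(2) by simp
    have xk: "?x k \<le> \<kappa> k" using elim(3,4) by (simp add: field_simps)
    have thx: "?th k \<le> ?x k" using elim(3) rr by (simp add: field_simps)
    have th0: "0 \<le> ?th k" using elim(3) rr by simp
    have thk: "?th k \<le> \<kappa> k" using thx xk by linarith
    have thb: "2 * ?th k * b k \<le> 1"
      using mult_right_mono[OF thk b0] elim(5) by simp
    have dec: "\<bar>hp (\<kappa> k) (?x k) - (\<Prod>(a, u)\<in>?J k. 1 - expectation (\<lambda>\<omega>. lgs (- \<kappa> k * ?x k + \<kappa> k * (sg u * S a \<omega>))))\<bar>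
      \<le> 36 * (\<kappa> k)^2 * e3 k + 2 * (\<kappa> k)^2 * ((4 * real (card (Sg k)) + 2 * real (card (A k))) * exp (- ((?x k)^2 / (1 + r)) + err2 (?th k))
       + 1056 * (\<kappa> k * b k) * (2 * real (card (A k)) * (2 * \<gamma> 1 y k)))"
      using elim(3,5,7) by (intro hp_decouple[OF k0 _ _ refl thk thb]) auto
    have e2: "err2 (?th k) \<le> 1"
    proof -
      have p2: "(?th k)^2 \<le> (\<kappa> k)^2" and p3: "(?th k)^3 \<le> (\<kappa> k)^3" using thk th0 by (auto intro!: power_mono)
      have k1: "1 \<le> (\<kappa> k)^2" using elim(2) by simp
      have e2k: "e2 k \<le> (\<kappa> k)^2 * e2 k" "e3 k \<le> (\<kappa> k)^2 * e3 k"
        using mult_right_mono[OF k1] e0 by fastforce+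
      have "err2 (?th k) \<le> 2 * (\<kappa> k * e1 k) + (\<kappa> k)^2 * (2 * e2 k + 2 * e3 k) + 2 * ((\<kappa> k)^3 * b k) * (4 + 4 * ((\<kappa> k)^2 * e2 k) + 4 * ((\<kappa> k)^2 * e3 k))"
        unfolding err2_def
      proof (intro add_mono)
        show "2 * ?th k * e1 k \<le> 2 * (\<kappa> k * e1 k)" using mult_right_mono[OF thk e0(1)] by simp
        show "(?th k)^2 * (2 * e2 k + 2 * e3 k) \<le> (\<kappa> k)^2 * (2 * e2 k + 2 * e3 k)"
          using p2 e0 by (intro mult_right_mono) auto
        have h1: "2 * ((?th k)^3 * b k) \<le> 2 * ((\<kappa> k)^3 * b k)"
          using mult_right_mono[OF p3 b0] by simp
        have h2: "4 + 4 * e2 k + 4 * e3 k \<le> 4 + 4 * ((\<kappa> k)^2 * e2 k) + 4 * ((\<kappa> k)^2 * e3 k)"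
          using e2k by linarith
        have "(2 * ((?th k)^3 * b k)) * (4 + 4 * e2 k + 4 * e3 k)
            \<le> 2 * ((\<kappa> k)^3 * b k) * (4 + 4 * ((\<kappa> k)^2 * e2 k) + 4 * ((\<kappa> k)^2 * e3 k))"
          using e0 b0 k0 by (intro mult_mono[OF h1 h2]) auto
        then show "2 * (?th k)^3 * b k * (4 + 4 * e2 k + 4 * e3 k)
            \<le> 2 * ((\<kappa> k)^3 * b k) * (4 + 4 * ((\<kappa> k)^2 * e2 k) + 4 * ((\<kappa> k)^2 * e3 k))" by (simp only: mult.assoc)
      qed
      then show ?thesis using elim(6) by (simp add: algebra_simps)
    qed
    have x2: "(?x k)^2 = 2 * ln (q k) - ln (ln (q k)) + y" using elim(3) by (simp add: xcrit_def)
    have rr2: "(1 + (1 - r) / (1 + r)) / 2 = 1 / (1 + r)" using rr by (simp add: field_simps)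
    have "(4 * real (card (Sg k)) + 2 * real (card (A k))) * exp (- ((?x k)^2 / (1 + r)) + err2 (?th k))
      \<le> (4 * (C * q k * (ln (q k))^4) + 2 * q k) * (exp (- ((?x k)^2 / (1 + r))) * exp 1)"
      unfolding exp_add using elim(8) e2 by (intro mult_mono add_mono) (auto simp: q)
    then have "2 * (\<kappa> k)^2 * ((4 * real (card (Sg k)) + 2 * real (card (A k))) * exp (- ((?x k)^2 / (1 + r)) + err2 (?th k)))
      \<le> 2 * (\<kappa> k)^2 * ((4 * (C * q k * (ln (q k))^4) + 2 * q k) * (exp (- ((?x k)^2 / (1 + r))) * exp 1))"
      by (intro mult_left_mono) auto
    also have "\<dots> = (2 * (ln (q k) powr (3/5))^2 * ((4 * (C * q k * (ln (q k))^4) + 2 * q k)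
         * exp (- ((2 * ln (q k) - ln (ln (q k)) + y) * ((1 + (1 - r) / (1 + r))/2))))) * exp 1"
      unfolding rr2 x2 kap by (simp only: mult.assoc times_divide_eq_right mult_1_right)
    finally have "\<dots> \<ge> 2 * (\<kappa> k)^2 * ((4 * real (card (Sg k)) + 2 * real (card (A k))) * exp (- ((?x k)^2 / (1 + r)) + err2 (?th k)))" .
    moreover have "2 * (\<kappa> k)^2 * (1056 * (\<kappa> k * b k) * (2 * real (card (A k)) * (2 * \<gamma> 1 y k)))
       = 8448 * (\<kappa> k ^ 3 * b k) * (q k * \<gamma> 1 y k)"
      by (simp add: q power3_eq_cube power2_eq_square)
    ultimately have "36 * (\<kappa> k)^2 * e3 k + 2 * (\<kappa> k)^2 * ((4 * real (card (Sg k)) + 2 * real (card (A k))) * exp (- ((?x k)^2 / (1 + r)) + err2 (?th k))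
       + 1056 * (\<kappa> k * b k) * (2 * real (card (A k)) * (2 * \<gamma> 1 y k))) \<le> Bd k"
      unfolding Bd_def by (simp only: distrib_left mult.assoc)
    then show ?case using dec by (simp add: pr_def case_prod_beta')
  qed
  then have "(\<lambda>k. hh k (\<kappa> k) (?x k) - (\<Prod>j\<in>?J k. 1 - pr k j)) \<longlonglongrightarrow> 0"
    by (intro Lim_null_comparison[OF _ Bd0]) simp
  from tendsto_add[OF this P] show ?thesis by simp
qed

lemma max_prob_lim:
  "(\<lambda>k. measure (M k) {\<omega> \<in> space (M k). \<forall>a\<in>A k. \<bar>\<Sum>i\<in>I k. X k i a \<omega>\<bar> \<le> xcrit y (q k)}) \<longlonglongrightarrow> gumbel y"
proof (rule tendsto_shift_sandwich[OF isCont_gumbel])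
  let ?P = "\<lambda>k. measure (M k) {\<omega> \<in> space (M k). \<forall>a\<in>A k. \<bar>\<Sum>i\<in>I k. X k i a \<omega>\<bar> \<le> xcrit y (q k)}"
  fix d :: real assume d: "0 < d"
  have half: "0 < (1/2::real)" "1/2 \<le> (1::real)" by simp_all
  have gap: "filterlim (\<lambda>k. \<kappa> k * (xcrit (y' + d) (q k) - xcrit y' (q k))) at_top sequentially" for y'
    using filterlim_compose[OF kap_times_gap[OF d] q(2)] by (simp add: kap)
  have mono: "eventually (\<lambda>k. xcrit y' (q k) \<le> xcrit (y' + d) (q k)) sequentially" for y'
    using d by (auto simp: xcrit_def)
  have gap0: "(\<lambda>k. exp (- c * (\<kappa> k * (xcrit (y' + d) (q k) - xcrit y' (q k))))) \<longlonglongrightarrow> 0" if c: "0 < c" for c y'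
  proof -
    have "filterlim (\<lambda>k. - c * (\<kappa> k * (xcrit (y' + d) (q k) - xcrit y' (q k)))) at_bot sequentially"
      using c by (intro filterlim_tendsto_neg_mult_at_bot[OF tendsto_const _ gap]) auto
    from filterlim_compose[OF exp_at_bot this] show ?thesis .
  qed
  show "\<exists>u. u \<longlonglongrightarrow> gumbel (y + d) \<and> eventually (\<lambda>k. ?P k \<le> u k) sequentially"
  proof (intro exI conjI)
    let ?u = "\<lambda>k. hh k (\<kappa> k) (xcrit (y + d) (q k)) + 8 * exp (- (1/2) * (\<kappa> k * (xcrit (y + d) (q k) - xcrit y (q k)))) * (q k * \<gamma> (1/2) (y + d) k)"
    have "?u \<longlonglongrightarrow> gumbel (y + d) + 8 * 0 * (exp (- (y + d) / 2) / (2 * sqrt pi))"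
      by (intro tendsto_add tendsto_mult tendsto_const hp_lim gap0 q_gam_lim) auto
    then show "?u \<longlonglongrightarrow> gumbel (y + d)" by simp
    show "eventually (\<lambda>k. ?P k \<le> ?u k) sequentially"
      using arr kap_ge_1 mono[of y] one_dim_le[OF half, of "y + d"]
    proof eventually_elim
      case (elim k)
      interpret max_array "M k" "I k" "A k" "X k" "s k" "\<beta> k" "b k" "e1 k" "e2 k" "e3 k" r "Sg k" by (rule elim(1))
      have "prob {\<omega> \<in> space (M k). \<forall>a\<in>A k. \<bar>S a \<omega>\<bar> \<le> xcrit y (q k)} \<le> hp (\<kappa> k) (xcrit (y + d) (q k))
         + 2 * exp (- (\<kappa> k / 2) * (xcrit (y + d) (q k) - xcrit y (q k))) * (2 * real (card (A k)) * (2 * \<gamma> (1/2) (y + d) k))"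
        using elim by (intro prob_le_hp) auto
      then show ?case by (simp add: S_def q mult_ac)
    qed
  qed
  show "\<exists>l. l \<longlonglongrightarrow> gumbel (y - d) \<and> eventually (\<lambda>k. l k \<le> ?P k) sequentially"
  proof (intro exI conjI)
    let ?l = "\<lambda>k. hh k (\<kappa> k) (xcrit (y - d) (q k)) - exp (- 1 * (\<kappa> k * (xcrit ((y - d) + d) (q k) - xcrit (y - d) (q k))))"
    have "?l \<longlonglongrightarrow> gumbel (y - d) - 0"
      by (intro tendsto_diff hp_lim gap0) auto
    then show "?l \<longlonglongrightarrow> gumbel (y - d)" by simp
    show "eventually (\<lambda>k. ?l k \<le> ?P k) sequentially"
      using arr kap_ge_1 mono[of "y - d"]
    proof eventually_elim
      case (elim k)
      interpret max_array "M k" "I k" "A k" "X k" "s k" "\<beta> k" "b k" "e1 k" "e2 k" "e3 k" r "Sg k" by (rule elim(1))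
      have "hp (\<kappa> k) (xcrit (y - d) (q k)) \<le> prob {\<omega> \<in> space (M k). \<forall>a\<in>A k. \<bar>S a \<omega>\<bar> \<le> xcrit y (q k)}
         + exp (- \<kappa> k * (xcrit y (q k) - xcrit (y - d) (q k)))"
        using elim by (intro hp_le_prob) auto
      then show ?case by (simp add: S_def)
    qed
  qed
qed

end

section \<open>The two-sample array\<close>

lemma (in prob_space) expectation_abs_mult_le:
  fixes f g :: "'a \<Rightarrow> real"
  assumes [measurable]: "f \<in> borel_measurable M" "g \<in> borel_measurable M"
    and f: "integrable M (\<lambda>\<omega>. (f \<omega>)^2)" "expectation (\<lambda>\<omega>. (f \<omega>)^2) \<le> t"
    and g: "integrable M (\<lambda>\<omega>. (g \<omega>)^2)" "expectation (\<lambda>\<omega>. (g \<omega>)^2) \<le> 1" and t: "0 < t"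
  shows "integrable M (\<lambda>\<omega>. f \<omega> * g \<omega>)" "expectation (\<lambda>\<omega>. \<bar>f \<omega> * g \<omega>\<bar>) \<le> sqrt t"
proof -
  have pw: "\<bar>f \<omega> * g \<omega>\<bar> \<le> ((f \<omega>)^2 / sqrt t + sqrt t * (g \<omega>)^2) / 2" for \<omega>
  proof -
    have "0 \<le> (\<bar>f \<omega>\<bar> - sqrt t * \<bar>g \<omega>\<bar>)^2" by simp
    then have "2 * (sqrt t * \<bar>f \<omega> * g \<omega>\<bar>) \<le> (f \<omega>)^2 + t * (g \<omega>)^2"
      using t by (simp add: power2_diff power_mult_distrib abs_mult mult_ac)
    then have "(2 * (sqrt t * \<bar>f \<omega> * g \<omega>\<bar>)) / sqrt t \<le> ((f \<omega>)^2 + t * (g \<omega>)^2) / sqrt t"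
      using t by (intro divide_right_mono) auto
    moreover have "t * (g \<omega>)^2 / sqrt t = sqrt t * (g \<omega>)^2"
      using t by (simp add: field_simps real_sqrt_mult_self)
    moreover have "(2 * (sqrt t * \<bar>f \<omega> * g \<omega>\<bar>)) / sqrt t = 2 * \<bar>f \<omega> * g \<omega>\<bar>" using t by simp
    ultimately show ?thesis by (simp add: add_divide_distrib)
  qed
  have ib: "integrable M (\<lambda>\<omega>. ((f \<omega>)^2 / sqrt t + sqrt t * (g \<omega>)^2) / 2)" using f g by auto
  show fg: "integrable M (\<lambda>\<omega>. f \<omega> * g \<omega>)"
  proof (rule Bochner_Integration.integrable_bound[OF ib])
    show "AE \<omega> in M. norm (f \<omega> * g \<omega>) \<le> norm (((f \<omega>)^2 / sqrt t + sqrt t * (g \<omega>)^2) / 2)"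
      using pw t by (intro AE_I2) (auto intro: order_trans[OF _ abs_ge_self])
  qed measurable
  have "expectation (\<lambda>\<omega>. \<bar>f \<omega> * g \<omega>\<bar>) \<le> expectation (\<lambda>\<omega>. ((f \<omega>)^2 / sqrt t + sqrt t * (g \<omega>)^2) / 2)"
    using fg ib by (intro integral_mono pw) auto
  also have "\<dots> = (expectation (\<lambda>\<omega>. (f \<omega>)^2) / sqrt t + sqrt t * expectation (\<lambda>\<omega>. (g \<omega>)^2)) / 2"
    using f g by simp
  also have "\<dots> \<le> (t / sqrt t + sqrt t * 1) / 2"
    using f g t by (intro divide_right_mono add_mono mult_left_mono) auto
  also have "\<dots> = sqrt t" using t by (simp add: real_div_sqrt)
  finally show "expectation (\<lambda>\<omega>. \<bar>f \<omega> * g \<omega>\<bar>) \<le> sqrt t" .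
qed

locale two_sample = prob_space M for M :: "'a measure" +
  fixes N :: "nat \<Rightarrow> nat" and p :: nat and S :: "nat \<Rightarrow> nat \<Rightarrow> 'a \<Rightarrow> nat \<Rightarrow> nat \<Rightarrow> real"
    and C0 r \<tau> \<theta> \<pi>0 :: real
  assumes npos: "0 < N 1" "0 < N 2"
    and meas: "\<And>d l i j. d \<in> {1, 2} \<Longrightarrow> l < N d \<Longrightarrow> i < p \<Longrightarrow> j < p \<Longrightarrow> (\<lambda>\<omega>. S d l \<omega> i j) \<in> borel_measurable M"
    and indep: "indep_vars (\<lambda>_. PiM ({..<p} \<times> {..<p}) (\<lambda>_. borel))
       (\<lambda>(d, l) \<omega>. restrict (\<lambda>(i, j). S d l \<omega> i j) ({..<p} \<times> {..<p})) (SIGMA d:{1, 2}. {..<N d})"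
    and ident: "\<And>d l. d \<in> {1, 2} \<Longrightarrow> l < N d \<Longrightarrow>
        distr M (PiM ({..<p} \<times> {..<p}) (\<lambda>_. borel)) (\<lambda>\<omega>. restrict (\<lambda>(i, j). S d l \<omega> i j) ({..<p} \<times> {..<p}))
      = distr M (PiM ({..<p} \<times> {..<p}) (\<lambda>_. borel)) (\<lambda>\<omega>. restrict (\<lambda>(i, j). S d 0 \<omega> i j) ({..<p} \<times> {..<p}))"
    and sq_int: "\<And>d l i j. d \<in> {1, 2} \<Longrightarrow> l < N d \<Longrightarrow> i < j \<Longrightarrow> j < p \<Longrightarrow> integrable M (\<lambda>\<omega>. (S d l \<omega> i j)^2)"
    and H0: "\<And>i j. i < p \<Longrightarrow> j < p \<Longrightarrow> expectation (\<lambda>\<omega>. S 1 0 \<omega> i j) = expectation (\<lambda>\<omega>. S 2 0 \<omega> i j)"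
    and C0: "0 < C0"
    and A1: "\<And>d \<mu>. d \<in> {1, 2} \<Longrightarrow> is_eigenvalue_on (upper_pairs p)
        (\<lambda>a c. covar M (\<lambda>\<omega>. S d 0 \<omega> (fst a) (snd a)) (\<lambda>\<omega>. S d 0 \<omega> (fst c) (snd c))) \<mu> \<Longrightarrow> 1 / C0 \<le> \<mu> \<and> \<mu> \<le> C0"
    and r: "0 < r" "r < 1"
    and A2: "\<And>d a c. d \<in> {1, 2} \<Longrightarrow> a \<in> upper_pairs p \<Longrightarrow> c \<in> upper_pairs p \<Longrightarrow> a \<noteq> c \<Longrightarrow>
        \<bar>correl M (\<lambda>\<omega>. S d 0 \<omega> (fst a) (snd a)) (\<lambda>\<omega>. S d 0 \<omega> (fst c) (snd c))\<bar> < r"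
    and tau: "1 \<le> \<tau>" and theta: "0 < \<theta>" "\<theta> \<le> 1" and pi0: "0 < \<pi>0"
    and tail2: "\<And>d l i j. d \<in> {1, 2} \<Longrightarrow> l < N d \<Longrightarrow> i < j \<Longrightarrow> j < p \<Longrightarrow>
        expectation (\<lambda>\<omega>. let z = (S d l \<omega> i j - expectation (\<lambda>\<omega>. S d l \<omega> i j))
           / sqrt (covar M (\<lambda>\<omega>. S d l \<omega> i j) (\<lambda>\<omega>. S d l \<omega> i j)) in if \<bar>z\<bar> \<le> \<tau> then 0 else z^2) \<le> \<theta>"
    and tail0: "\<And>d l i j. d \<in> {1, 2} \<Longrightarrow> l < N d \<Longrightarrow> i < j \<Longrightarrow> j < p \<Longrightarrow>
        prob {\<omega> \<in> space M. \<tau> < \<bar>(S d l \<omega> i j - expectation (\<lambda>\<omega>. S d l \<omega> i j))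
           / sqrt (covar M (\<lambda>\<omega>. S d l \<omega> i j) (\<lambda>\<omega>. S d l \<omega> i j))\<bar>} \<le> \<pi>0"
begin

abbreviation "U \<equiv> upper_pairs p"
abbreviation "\<Lambda> \<equiv> (SIGMA d:{1, 2}. {..<N d})"

definition Sa :: "nat \<Rightarrow> nat \<Rightarrow> nat \<times> nat \<Rightarrow> 'a \<Rightarrow> real" where "Sa d l a \<omega> = S d l \<omega> (fst a) (snd a)"
definition m :: "nat \<times> nat \<Rightarrow> real" where "m a = expectation (Sa 1 0 a)"
definition V :: "nat \<Rightarrow> nat \<times> nat \<Rightarrow> real" where "V d a = covar M (Sa d 0 a) (Sa d 0 a)"
definition R :: "nat \<Rightarrow> nat \<times> nat \<Rightarrow> nat \<times> nat \<Rightarrow> real" where "R d a c = correl M (Sa d 0 a) (Sa d 0 c)"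
definition zt :: "nat \<Rightarrow> nat \<Rightarrow> nat \<times> nat \<Rightarrow> 'a \<Rightarrow> real" where "zt d l a \<omega> = (Sa d l a \<omega> - m a) / sqrt (V d a)"
definition trunc :: "real \<Rightarrow> real" where "trunc z = (if \<bar>z\<bar> \<le> \<tau> then z else 0)"
definition Z :: "nat \<Rightarrow> nat \<Rightarrow> nat \<times> nat \<Rightarrow> 'a \<Rightarrow> real" where "Z d l a \<omega> = trunc (zt d l a \<omega>)"
definition sig :: "nat \<times> nat \<Rightarrow> real" where "sig a = sqrt (V 1 a / real (N 1) + V 2 a / real (N 2))"
definition cc :: "nat \<Rightarrow> nat \<times> nat \<Rightarrow> real" where "cc d a = sqrt (V d a) / (real (N d) * sig a)"
definition sn :: "nat \<Rightarrow> real" where "sn d = (if d = 1 then 1 else -1)"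
definition X :: "nat \<times> nat \<Rightarrow> nat \<times> nat \<Rightarrow> 'a \<Rightarrow> real" where
  "X i a \<omega> = (if i \<in> \<Lambda> \<and> a \<in> U then sn (fst i) * cc (fst i) a * Z (fst i) (snd i) a \<omega> else 0)"
definition nn :: real where "nn = real (N 1) * real (N 2) / (real (N 1) + real (N 2))"

lemma finU: "finite U"
  by (rule finite_subset[of _ "{..<p} \<times> {..<p}"]) (auto simp: upper_pairs_def)

lemma UD: "a \<in> U \<Longrightarrow> fst a < p \<and> snd a < p \<and> fst a < snd a"
  by (auto simp: upper_pairs_def)

lemma Np: "d \<in> {1, 2} \<Longrightarrow> 0 < N d" using npos by auto

lemma Sm: "d \<in> {1, 2} \<Longrightarrow> l < N d \<Longrightarrow> a \<in> U \<Longrightarrow> Sa d l a \<in> borel_measurable M"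
  unfolding Sa_def[abs_def] using UD[of a] by (intro meas) auto

lemma Sq: "d \<in> {1, 2} \<Longrightarrow> l < N d \<Longrightarrow> a \<in> U \<Longrightarrow> integrable M (\<lambda>\<omega>. (Sa d l a \<omega>)^2)"
  unfolding Sa_def[abs_def] using UD[of a] by (intro sq_int) auto

lemma S1: "d \<in> {1, 2} \<Longrightarrow> l < N d \<Longrightarrow> a \<in> U \<Longrightarrow> integrable M (Sa d l a)"
  using Sm Sq square_integrable_imp_integrable by blast

lemma ident_expectation:
  fixes F :: "(nat \<times> nat \<Rightarrow> real) \<Rightarrow> real"
  assumes d: "d \<in> {1, 2}" "l < N d" and F: "F \<in> borel_measurable (PiM ({..<p} \<times> {..<p}) (\<lambda>_. borel))"
  shows "expectation (\<lambda>\<omega>. F (restrict (\<lambda>(i, j). S d l \<omega> i j) ({..<p} \<times> {..<p})))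
     = expectation (\<lambda>\<omega>. F (restrict (\<lambda>(i, j). S d 0 \<omega> i j) ({..<p} \<times> {..<p})))"
proof -
  have vm: "(\<lambda>\<omega>. restrict (\<lambda>(i, j). S d l \<omega> i j) ({..<p} \<times> {..<p})) \<in> measurable M (PiM ({..<p} \<times> {..<p}) (\<lambda>_. borel))"
    if "l < N d" for l
    using meas[OF d(1) that] by (intro measurable_restrict) auto
  show ?thesis
    using integral_distr[OF vm[OF d(2)] F] integral_distr[OF vm[OF Np[OF d(1)]] F] ident[OF d] by simp
qed

lemma comp_m: "a \<in> U \<Longrightarrow> (\<lambda>z. z a) \<in> borel_measurable (PiM ({..<p} \<times> {..<p}) (\<lambda>_. borel :: real measure))"
  using UD[of a] by (intro measurable_component_singleton) (cases a, auto)

lemma restr_eval: "a \<in> U \<Longrightarrow> restrict (\<lambda>(i, j). S d l \<omega> i j) ({..<p} \<times> {..<p}) a = Sa d l a \<omega>"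
  using UD[of a] by (cases a) (auto simp: Sa_def)

lemma mean: "d \<in> {1, 2} \<Longrightarrow> l < N d \<Longrightarrow> a \<in> U \<Longrightarrow> expectation (Sa d l a) = m a"
proof -
  assume d: "d \<in> {1, 2}" "l < N d" and a: "a \<in> U"
  have "expectation (Sa d l a) = expectation (Sa d 0 a)"
    using ident_expectation[OF d comp_m[OF a]] by (simp only: restr_eval[OF a])
  also have "\<dots> = m a" using H0[of "fst a" "snd a"] UD[OF a] d by (auto simp: m_def Sa_def[abs_def])
  finally show ?thesis .
qed

lemma covar_eq:
  assumes d: "d \<in> {1, 2}" "l < N d" and a: "a \<in> U" "c \<in> U"
  shows "covar M (Sa d l a) (Sa d l c) = covar M (Sa d 0 a) (Sa d 0 c)"
proof -
  let ?F = "\<lambda>z. (z a - m a) * (z c - m c)"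
  have "?F \<in> borel_measurable (PiM ({..<p} \<times> {..<p}) (\<lambda>_. borel))"
    using comp_m a by (intro borel_measurable_times borel_measurable_diff borel_measurable_const) auto
  from ident_expectation[OF d this] show ?thesis
    unfolding covar_def using mean[OF d a(1)] mean[OF d a(2)] mean[OF d(1) Np[OF d(1)] a(1)] mean[OF d(1) Np[OF d(1)] a(2)]
    by (simp only: restr_eval[OF a(1)] restr_eval[OF a(2)])
qed

lemma covar_sym: "covar M f g = covar M g f" unfolding covar_def by (simp add: mult.commute)

lemma gam_entries:
  assumes d: "d \<in> {1, 2}" and a: "a \<in> U"
  shows "1 / C0 \<le> V d a" "(\<Sum>c\<in>U. (covar M (Sa d 0 a) (Sa d 0 c))^2) \<le> C0^2"
proof -
  have ev: "1 / C0 \<le> \<mu> \<and> \<mu> \<le> C0" if "is_eigenvalue_on U (\<lambda>a c. covar M (Sa d 0 a) (Sa d 0 c)) \<mu>" for \<mu>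
    using A1[OF d] that by (simp add: Sa_def[abs_def])
  from eigenvalue_bounds_entries[of U "\<lambda>a c. covar M (Sa d 0 a) (Sa d 0 c)", OF finU covar_sym C0 ev a]
  show "1 / C0 \<le> V d a" "(\<Sum>c\<in>U. (covar M (Sa d 0 a) (Sa d 0 c))^2) \<le> C0^2" by (auto simp: V_def)
qed

lemma Vpos: "d \<in> {1, 2} \<Longrightarrow> a \<in> U \<Longrightarrow> 0 < V d a"
  using gam_entries(1)[of d a] C0 by (meson less_le_trans zero_less_divide_1_iff)

lemma R_eq: "R d a c = covar M (Sa d 0 a) (Sa d 0 c) / sqrt (V d a * V d c)"
  by (simp add: R_def correl_def V_def)

lemma R_lt: "d \<in> {1, 2} \<Longrightarrow> a \<in> U \<Longrightarrow> c \<in> U \<Longrightarrow> a \<noteq> c \<Longrightarrow> \<bar>R d a c\<bar> < r"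
  using A2[of d a c] by (simp add: R_def Sa_def[abs_def])

lemma R_row:
  assumes d: "d \<in> {1, 2}" and a: "a \<in> U"
  shows "(\<Sum>c\<in>U. (R d a c)^2) \<le> C0^4"
proof -
  have "(\<Sum>c\<in>U. (R d a c)^2) \<le> (\<Sum>c\<in>U. C0^2 * (covar M (Sa d 0 a) (Sa d 0 c))^2)"
  proof (intro sum_mono)
    fix c assume c: "c \<in> U"
    have "1 / C0 * (1 / C0) \<le> V d a * V d c"
      using gam_entries(1)[OF d a] gam_entries(1)[OF d c] C0 Vpos[OF d a] by (intro mult_mono) auto
    then have v: "1 / C0^2 \<le> V d a * V d c" by (simp add: power2_eq_square)
    have vp: "0 < V d a * V d c" using Vpos[OF d a] Vpos[OF d c] by simp
    have "(R d a c)^2 = (covar M (Sa d 0 a) (Sa d 0 c))^2 / (V d a * V d c)"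
      unfolding R_eq using vp by (simp add: power_divide)
    also have "\<dots> \<le> (covar M (Sa d 0 a) (Sa d 0 c))^2 / (1 / C0^2)"
      using v C0 vp by (intro divide_left_mono) auto
    finally show "(R d a c)^2 \<le> C0^2 * (covar M (Sa d 0 a) (Sa d 0 c))^2" by (simp add: mult.commute)
  qed
  also have "\<dots> \<le> C0^2 * C0^2"
    unfolding sum_distrib_left[symmetric] using gam_entries(2)[OF d a] by (intro mult_left_mono) auto
  finally show ?thesis by (simp add: power2_eq_square power4_eq_xxxx)
qed

lemma zt_m [measurable (raw)]: "d \<in> {1, 2} \<Longrightarrow> l < N d \<Longrightarrow> a \<in> U \<Longrightarrow> zt d l a \<in> borel_measurable M"
  unfolding zt_def[abs_def] using Sm by (intro borel_measurable_divide borel_measurable_diff) auto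

lemma zt_eq:
  assumes d: "d \<in> {1, 2}" "l < N d" and a: "a \<in> U"
  shows "zt d l a \<omega> = (S d l \<omega> (fst a) (snd a) - expectation (\<lambda>\<omega>. S d l \<omega> (fst a) (snd a)))
     / sqrt (covar M (\<lambda>\<omega>. S d l \<omega> (fst a) (snd a)) (\<lambda>\<omega>. S d l \<omega> (fst a) (snd a)))"
  using mean[OF assms] covar_eq[OF d a a] by (simp add: zt_def V_def Sa_def[abs_def])

lemma zt_int:
  assumes d: "d \<in> {1, 2}" "l < N d" and a: "a \<in> U"
  shows "integrable M (zt d l a)" "integrable M (\<lambda>\<omega>. (zt d l a \<omega>)^2)"
proof -
  show "integrable M (zt d l a)" unfolding zt_def[abs_def] using S1[OF assms] by auto
  have "(zt d l a \<omega>)^2 = ((Sa d l a \<omega>)^2 - 2 * m a * Sa d l a \<omega> + (m a)^2) / V d a" for \<omega>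
    using Vpos[OF d(1) a] by (simp add: zt_def power_divide power2_diff mult_ac)
  then show "integrable M (\<lambda>\<omega>. (zt d l a \<omega>)^2)" using S1[OF assms] Sq[OF assms] by simp
qed

lemma zt_mean: "d \<in> {1, 2} \<Longrightarrow> l < N d \<Longrightarrow> a \<in> U \<Longrightarrow> expectation (zt d l a) = 0"
  unfolding zt_def[abs_def] using S1 mean by (simp add: prob_space)

lemma zt_cov:
  assumes d: "d \<in> {1, 2}" "l < N d" and a: "a \<in> U" "c \<in> U"
  shows "expectation (\<lambda>\<omega>. zt d l a \<omega> * zt d l c \<omega>) = R d a c"
proof -
  have "zt d l a \<omega> * zt d l c \<omega> = ((Sa d l a \<omega> - m a) * (Sa d l c \<omega> - m c)) / sqrt (V d a * V d c)" for \<omega>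
    by (simp add: zt_def real_sqrt_mult)
  then have "expectation (\<lambda>\<omega>. zt d l a \<omega> * zt d l c \<omega>) = covar M (Sa d l a) (Sa d l c) / sqrt (V d a * V d c)"
    unfolding covar_def using mean[OF d a(1)] mean[OF d a(2)] by simp
  then show ?thesis by (simp add: covar_eq[OF assms] R_eq)
qed

lemma zt_var: "d \<in> {1, 2} \<Longrightarrow> l < N d \<Longrightarrow> a \<in> U \<Longrightarrow> expectation (\<lambda>\<omega>. (zt d l a \<omega>)^2) = 1"
  using zt_cov[of d l a a] Vpos[of d a] by (simp add: R_eq V_def[symmetric] power2_eq_square)

lemma trunc_m [measurable]: "trunc \<in> borel_measurable borel"
  unfolding trunc_def[abs_def] by measurable

lemma trunc_le: "\<bar>trunc z\<bar> \<le> \<tau>" "(trunc z)^2 \<le> z^2" "(trunc z)^2 \<le> \<tau>^2"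
  using tau by (auto simp: trunc_def abs_le_square_iff[symmetric])

lemma Z_m [measurable (raw)]: "d \<in> {1, 2} \<Longrightarrow> l < N d \<Longrightarrow> a \<in> U \<Longrightarrow> Z d l a \<in> borel_measurable M"
  unfolding Z_def[abs_def] by (intro measurable_compose[OF zt_m trunc_m])

lemma Z_int:
  assumes d: "d \<in> {1, 2}" "l < N d" and a: "a \<in> U"
  shows "integrable M (Z d l a)" "integrable M (\<lambda>\<omega>. (Z d l a \<omega>)^2)" "integrable M (\<lambda>\<omega>. zt d l a \<omega> - Z d l a \<omega>)"
    "integrable M (\<lambda>\<omega>. (zt d l a \<omega> - Z d l a \<omega>)^2)"
proof -
  note [measurable] = Z_m[OF assms] zt_m[OF assms]
  show 1: "integrable M (Z d l a)"
    using trunc_le by (intro integrable_const_bound[where B=\<tau>]) (auto simp: Z_def)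
  show 2: "integrable M (\<lambda>\<omega>. (Z d l a \<omega>)^2)"
    using trunc_le by (intro integrable_const_bound[where B="\<tau>^2"]) (auto simp: Z_def)
  show "integrable M (\<lambda>\<omega>. zt d l a \<omega> - Z d l a \<omega>)" using 1 zt_int(1)[OF assms] by auto
  have "(zt d l a \<omega> - Z d l a \<omega>)^2 = (zt d l a \<omega>)^2 - (Z d l a \<omega>)^2" for \<omega> by (auto simp: Z_def trunc_def)
  then show "integrable M (\<lambda>\<omega>. (zt d l a \<omega> - Z d l a \<omega>)^2)" using 2 zt_int(2)[OF assms] by simp
qed

lemma rest2:
  assumes d: "d \<in> {1, 2}" "l < N d" and a: "a \<in> U"
  shows "expectation (\<lambda>\<omega>. (zt d l a \<omega> - Z d l a \<omega>)^2) \<le> \<theta>"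
proof -
  have "(zt d l a \<omega> - Z d l a \<omega>)^2 = (if \<bar>zt d l a \<omega>\<bar> \<le> \<tau> then 0 else (zt d l a \<omega>)^2)" for \<omega>
    by (auto simp: Z_def trunc_def)
  then show ?thesis
    using tail2[OF d, of "fst a" "snd a"] UD[OF a] by (simp add: Let_def zt_eq[OF assms, symmetric])
qed

lemma tail_prob:
  assumes d: "d \<in> {1, 2}" "l < N d" and a: "a \<in> U"
  shows "prob {\<omega> \<in> space M. \<tau> < \<bar>zt d l a \<omega>\<bar>} \<le> \<pi>0"
  using tail0[OF d, of "fst a" "snd a"] UD[OF a] unfolding zt_eq[OF assms] by simp

lemma Z_mean:
  assumes d: "d \<in> {1, 2}" "l < N d" and a: "a \<in> U"
  shows "\<bar>expectation (Z d l a)\<bar> \<le> sqrt \<pi>0" "\<bar>expectation (Z d l a)\<bar> \<le> sqrt \<theta>"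
proof -
  note [measurable] = Z_m[OF assms] zt_m[OF assms]
  let ?D = "\<lambda>\<omega>. zt d l a \<omega> - Z d l a \<omega>"
  let ?E = "{\<omega> \<in> space M. \<tau> < \<bar>zt d l a \<omega>\<bar>}"
  have "expectation (Z d l a) = - expectation ?D"
    using zt_mean[OF assms] zt_int(1)[OF assms] Z_int(1)[OF assms] by simp
  then have "\<bar>expectation (Z d l a)\<bar> = \<bar>expectation ?D\<bar>" by simp
  also have "\<dots> \<le> expectation (\<lambda>\<omega>. \<bar>?D \<omega>\<bar>)" by (rule integral_abs_bound)
  finally have 1: "\<bar>expectation (Z d l a)\<bar> \<le> expectation (\<lambda>\<omega>. \<bar>?D \<omega>\<bar>)" .
  have "expectation (\<lambda>\<omega>. \<bar>?D \<omega> * 1\<bar>) \<le> sqrt \<theta>"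
    using Z_int(4)[OF assms] rest2[OF assms] theta by (intro expectation_abs_mult_le) (auto simp: prob_space)
  then show "\<bar>expectation (Z d l a)\<bar> \<le> sqrt \<theta>" using 1 by simp
  have E[measurable]: "?E \<in> sets M" by measurable
  have i2: "(indicator ?E \<omega> :: real)^2 = indicator ?E \<omega>" for \<omega> by (simp add: indicator_def)
  have "expectation (\<lambda>\<omega>. \<bar>indicator ?E \<omega> * zt d l a \<omega>\<bar>) \<le> sqrt \<pi>0"
  proof (intro expectation_abs_mult_le)
    show "integrable M (\<lambda>\<omega>. (indicator ?E \<omega> :: real)^2)"
      unfolding i2 using E by (intro integrable_real_indicator) (auto simp: emeasure_eq_measure)
    show "expectation (\<lambda>\<omega>. (indicator ?E \<omega> :: real)^2) \<le> \<pi>0"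
      unfolding i2 using tail_prob[OF assms] E by simp
  qed (use zt_int[OF assms] zt_var[OF assms] pi0 in auto)
  also have "expectation (\<lambda>\<omega>. \<bar>indicator ?E \<omega> * zt d l a \<omega>\<bar>) = expectation (\<lambda>\<omega>. \<bar>?D \<omega>\<bar>)"
    by (intro Bochner_Integration.integral_cong) (auto simp: indicator_def Z_def trunc_def)
  finally show "\<bar>expectation (Z d l a)\<bar> \<le> sqrt \<pi>0" using 1 by simp
qed

lemma Z_var:
  assumes d: "d \<in> {1, 2}" "l < N d" and a: "a \<in> U"
  shows "expectation (\<lambda>\<omega>. (Z d l a \<omega>)^2) \<le> 1" "1 - \<theta> \<le> expectation (\<lambda>\<omega>. (Z d l a \<omega>)^2)"
proof -
  have "(zt d l a \<omega> - Z d l a \<omega>)^2 = (zt d l a \<omega>)^2 - (Z d l a \<omega>)^2" for \<omega> by (auto simp: Z_def trunc_def)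
  then have "expectation (\<lambda>\<omega>. (zt d l a \<omega> - Z d l a \<omega>)^2) = 1 - expectation (\<lambda>\<omega>. (Z d l a \<omega>)^2)"
    using zt_var[OF assms] zt_int(2)[OF assms] Z_int(2)[OF assms] by simp
  moreover have "0 \<le> expectation (\<lambda>\<omega>. (zt d l a \<omega> - Z d l a \<omega>)^2)" by simp
  ultimately show "expectation (\<lambda>\<omega>. (Z d l a \<omega>)^2) \<le> 1" "1 - \<theta> \<le> expectation (\<lambda>\<omega>. (Z d l a \<omega>)^2)"
    using rest2[OF assms] by linarith+
qed

lemma Z_cov:
  assumes d: "d \<in> {1, 2}" "l < N d" and a: "a \<in> U" "c \<in> U"
  shows "\<bar>expectation (\<lambda>\<omega>. Z d l a \<omega> * Z d l c \<omega>) - R d a c\<bar> \<le> 2 * sqrt \<theta>"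
proof -
  note ma = Z_m[OF d a(1)] zt_m[OF d a(1)] and mc = Z_m[OF d a(2)] zt_m[OF d a(2)]
  note [measurable] = ma mc
  let ?Da = "\<lambda>\<omega>. zt d l a \<omega> - Z d l a \<omega>" and ?Dc = "\<lambda>\<omega>. zt d l c \<omega> - Z d l c \<omega>"
  note A = expectation_abs_mult_le[of ?Da "zt d l c" \<theta>]
  have A: "integrable M (\<lambda>\<omega>. ?Da \<omega> * zt d l c \<omega>)" "expectation (\<lambda>\<omega>. \<bar>?Da \<omega> * zt d l c \<omega>\<bar>) \<le> sqrt \<theta>"
    using Z_int(4)[OF d a(1)] rest2[OF d a(1)] zt_int(2)[OF d a(2)] zt_var[OF d a(2)] theta
    by (intro expectation_abs_mult_le; simp)+
  have B: "integrable M (\<lambda>\<omega>. ?Dc \<omega> * Z d l a \<omega>)" "expectation (\<lambda>\<omega>. \<bar>?Dc \<omega> * Z d l a \<omega>\<bar>) \<le> sqrt \<theta>"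
    using Z_int(4)[OF d a(2)] rest2[OF d a(2)] Z_int(2)[OF d a(1)] Z_var[OF d a(1)] theta
    by (intro expectation_abs_mult_le; simp)+
  have iz: "integrable M (\<lambda>\<omega>. Z d l a \<omega> * Z d l c \<omega>)"
  proof (rule integrable_const_bound[where B="\<tau> * \<tau>"])
    show "AE \<omega> in M. norm (Z d l a \<omega> * Z d l c \<omega>) \<le> \<tau> * \<tau>"
      using trunc_le(1) tau by (intro AE_I2) (auto simp: abs_mult Z_def intro!: mult_mono)
  qed measurable
  have e: "zt d l a \<omega> * zt d l c \<omega> = Z d l a \<omega> * Z d l c \<omega> + (?Da \<omega> * zt d l c \<omega> + ?Dc \<omega> * Z d l a \<omega>)" for \<omega>
    by (simp add: algebra_simps)
  have "R d a c = expectation (\<lambda>\<omega>. Z d l a \<omega> * Z d l c \<omega>) + (expectation (\<lambda>\<omega>. ?Da \<omega> * zt d l c \<omega>) + expectation (\<lambda>\<omega>. ?Dc \<omega> * Z d l a \<omega>))"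
    unfolding zt_cov[OF assms, symmetric] e using A(1) B(1) iz by simp
  moreover have "\<bar>expectation (\<lambda>\<omega>. ?Da \<omega> * zt d l c \<omega>)\<bar> \<le> sqrt \<theta>"
    using integral_abs_bound[of M "\<lambda>\<omega>. ?Da \<omega> * zt d l c \<omega>"] A(2) by linarith
  moreover have "\<bar>expectation (\<lambda>\<omega>. ?Dc \<omega> * Z d l a \<omega>)\<bar> \<le> sqrt \<theta>"
    using integral_abs_bound[of M "\<lambda>\<omega>. ?Dc \<omega> * Z d l a \<omega>"] B(2) by linarith
  ultimately show ?thesis by linarith
qed

lemma sig2: "a \<in> U \<Longrightarrow> (sig a)^2 = V 1 a / real (N 1) + V 2 a / real (N 2)" "a \<in> U \<Longrightarrow> 0 < sig a"
proof -
  assume a: "a \<in> U"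
  have "0 < V 1 a / real (N 1) + V 2 a / real (N 2)"
    using Vpos[OF _ a, of 1] Vpos[OF _ a, of 2] npos by (intro add_pos_pos) auto
  then show "(sig a)^2 = V 1 a / real (N 1) + V 2 a / real (N 2)" "0 < sig a" by (simp_all add: sig_def)
qed

lemma cc_pos: "d \<in> {1, 2} \<Longrightarrow> a \<in> U \<Longrightarrow> 0 < cc d a"
  unfolding cc_def using Vpos sig2(2) Np by (intro divide_pos_pos mult_pos_pos) auto

lemma cc2:
  assumes d: "d \<in> {1, 2}" and a: "a \<in> U"
  shows "(cc d a)^2 = V d a / ((real (N d))^2 * (sig a)^2)" "(cc d a)^2 \<le> 1 / real (N d)"
proof -
  have v: "0 < V d a" by (rule Vpos[OF d a])
  have n: "0 < real (N d)" using Np[OF d] by simp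
  show 1: "(cc d a)^2 = V d a / ((real (N d))^2 * (sig a)^2)"
    using v by (simp add: cc_def power_divide power_mult_distrib)
  have "V d a / real (N d) \<le> (sig a)^2"
    unfolding sig2(1)[OF a] using d Vpos[OF _ a, of 1] Vpos[OF _ a, of 2] npos by (auto intro!: divide_nonneg_pos less_imp_le)
  then have "V d a / real (N d) / (real (N d) * (sig a)^2) \<le> (sig a)^2 / (real (N d) * (sig a)^2)"
    using n by (intro divide_right_mono) auto
  then show "(cc d a)^2 \<le> 1 / real (N d)"
    unfolding 1 using sig2(2)[OF a] by (simp add: power2_eq_square mult_ac)
qed

lemma cc_sum:
  assumes a: "a \<in> U" shows "(\<Sum>i\<in>\<Lambda>. (cc (fst i) a)^2) = 1"
proof -
  have "(\<Sum>i\<in>\<Lambda>. (cc (fst i) a)^2) = (\<Sum>d\<in>{1, 2}. \<Sum>l\<in>{..<N d}. (cc d a)^2)"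
    by (subst sum.Sigma) (auto simp: case_prod_beta)
  also have "\<dots> = real (N 1) * (cc 1 a)^2 + real (N 2) * (cc 2 a)^2" by simp
  also have "\<dots> = (V 1 a / real (N 1) + V 2 a / real (N 2)) / (sig a)^2"
    using npos cc2(1)[OF _ a, of 1] cc2(1)[OF _ a, of 2] by (simp add: power2_eq_square add_divide_distrib)
  also have "\<dots> = 1" unfolding sig2(1)[OF a, symmetric] using sig2(2)[OF a] by simp
  finally show ?thesis .
qed

lemma nn_pos: "0 < nn" unfolding nn_def using npos by (intro divide_pos_pos mult_pos_pos add_pos_pos) auto

lemma nn_le: "d \<in> {1, 2} \<Longrightarrow> nn \<le> real (N d)"
  unfolding nn_def using npos by (auto simp: field_simps)

lemma cc_le: "d \<in> {1, 2} \<Longrightarrow> a \<in> U \<Longrightarrow> cc d a \<le> 1 / sqrt nn"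
proof -
  assume d: "d \<in> {1, 2}" and a: "a \<in> U"
  have "(cc d a)^2 \<le> 1 / nn"
    using cc2(2)[OF d a] nn_le[OF d] nn_pos by (meson frac_le order_refl order_trans zero_le_one)
  then have "sqrt ((cc d a)^2) \<le> sqrt (1 / nn)" by (rule real_sqrt_le_mono)
  then show ?thesis using cc_pos[OF d a] by (simp add: real_sqrt_divide)
qed

definition strong :: "real \<Rightarrow> ((nat \<times> nat) \<times> (nat \<times> nat)) set" where
  "strong \<rho> = {(a, c). a \<in> U \<and> c \<in> U \<and> a \<noteq> c \<and> (\<rho> < \<bar>R 1 a c\<bar> \<or> \<rho> < \<bar>R 2 a c\<bar>)}"

lemma card_strong:
  assumes rho: "0 < \<rho>"
  shows "real (card (strong \<rho>)) \<le> (2 * C0^4) * real (card U) / \<rho>^2"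
proof -
  let ?f = "\<lambda>a c. ((R 1 a c)^2 + (R 2 a c)^2) / \<rho>^2"
  have fs: "finite (strong \<rho>)"
    by (rule finite_subset[of _ "U \<times> U"]) (auto simp: strong_def finU)
  have "real (card (strong \<rho>)) = (\<Sum>(a, c)\<in>strong \<rho>. 1)" by simp
  also have "\<dots> \<le> (\<Sum>(a, c)\<in>strong \<rho>. ?f a c)"
  proof (intro sum_mono, clarify)
    fix a a' c c' assume "((a, a'), (c, c')) \<in> strong \<rho>"
    then have "\<rho> < \<bar>R 1 (a, a') (c, c')\<bar> \<or> \<rho> < \<bar>R 2 (a, a') (c, c')\<bar>" by (auto simp: strong_def)
    then have "\<rho>^2 \<le> (R 1 (a, a') (c, c'))^2 \<or> \<rho>^2 \<le> (R 2 (a, a') (c, c'))^2"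
      using rho by (auto simp: abs_le_square_iff[symmetric])
    then have "\<rho>^2 \<le> (R 1 (a, a') (c, c'))^2 + (R 2 (a, a') (c, c'))^2"
      using zero_le_power2[of "R 1 (a, a') (c, c')"] zero_le_power2[of "R 2 (a, a') (c, c')"] by linarith
    then show "1 \<le> ?f (a, a') (c, c')" using rho by simp
  qed
  also have "\<dots> \<le> (\<Sum>(a, c)\<in>U \<times> U. ?f a c)"
    by (intro sum_mono2) (auto simp: strong_def finU)
  also have "\<dots> = (\<Sum>a\<in>U. \<Sum>c\<in>U. ?f a c)" by (simp add: sum.cartesian_product)
  also have "\<dots> \<le> (\<Sum>a\<in>U. (2 * C0^4) / \<rho>^2)"
  proof (intro sum_mono)
    fix a assume a: "a \<in> U"
    have "(\<Sum>c\<in>U. ?f a c) = ((\<Sum>c\<in>U. (R 1 a c)^2) + (\<Sum>c\<in>U. (R 2 a c)^2)) / \<rho>^2"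
      by (simp add: sum_divide_distrib[symmetric] sum.distrib)
    also have "\<dots> \<le> (C0^4 + C0^4) / \<rho>^2"
      using R_row[OF _ a, of 1] R_row[OF _ a, of 2] by (intro divide_right_mono add_mono) auto
    finally show "(\<Sum>c\<in>U. ?f a c) \<le> (2 * C0^4) / \<rho>^2" by simp
  qed
  also have "\<dots> = (2 * C0^4) * real (card U) / \<rho>^2" by simp
  finally show ?thesis .
qed

lemma X_indep: "indep_vars (\<lambda>_. PiM U (\<lambda>_. borel)) (\<lambda>i \<omega>. \<lambda>a\<in>U. X i a \<omega>) \<Lambda>"
proof -
  define G where "G i z = (\<lambda>a\<in>U. sn (fst i) * cc (fst i) a * trunc ((z a - m a) / sqrt (V (fst i) a)))"
    for i :: "nat \<times> nat" and z :: "nat \<times> nat \<Rightarrow> real"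
  have Gm: "G i \<in> measurable (PiM ({..<p} \<times> {..<p}) (\<lambda>_. borel)) (PiM U (\<lambda>_. borel))" for i
    unfolding G_def
    by (intro measurable_restrict borel_measurable_times borel_measurable_const measurable_compose[OF _ trunc_m]
        borel_measurable_divide borel_measurable_diff comp_m)
  have "indep_vars (\<lambda>_. PiM U (\<lambda>_. borel)) (\<lambda>i \<omega>. G i ((\<lambda>(d, l) \<omega>. restrict (\<lambda>(i, j). S d l \<omega> i j) ({..<p} \<times> {..<p})) i \<omega>)) \<Lambda>"
    by (rule indep_vars_compose2[OF indep]) (rule Gm)
  moreover have "G i ((\<lambda>(d, l) \<omega>. restrict (\<lambda>(i, j). S d l \<omega> i j) ({..<p} \<times> {..<p})) i \<omega>) = (\<lambda>a\<in>U. X i a \<omega>)"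
    if "i \<in> \<Lambda>" for i \<omega>
  proof -
    obtain d l where i: "i = (d, l)" by (cases i)
    show ?thesis unfolding G_def i prod.case fst_conv
    proof (rule restrict_ext)
      fix a assume a: "a \<in> U"
      show "sn d * cc d a * trunc ((restrict (\<lambda>(i, j). S d l \<omega> i j) ({..<p} \<times> {..<p}) a - m a) / sqrt (V d a)) = X (d, l) a \<omega>"
        unfolding restr_eval[OF a] using a that i by (simp add: X_def Z_def zt_def)
    qed
  qed
  ultimately show ?thesis by (simp cong: indep_vars_cong)
qed

lemma X_array:
  assumes rho: "0 < \<rho>"
  shows "max_array M \<Lambda> U X (\<lambda>i a. cc (fst i) a) (\<lambda>i. 1 / real (N (fst i))) (\<tau> / sqrt nn)
     (2 * sqrt (real (N 1) + real (N 2)) * sqrt \<pi>0) \<theta> (\<rho> + 3 * sqrt \<theta>) r (strong \<rho>)"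
proof
  have LD: "fst i \<in> {1, 2}" "snd i < N (fst i)" if "i \<in> \<Lambda>" for i using that by auto
  have Xin: "X i a = (\<lambda>\<omega>. sn (fst i) * cc (fst i) a * Z (fst i) (snd i) a \<omega>)" if "i \<in> \<Lambda>" "a \<in> U" for i a
    using that by (auto simp: X_def)
  have sn2: "(sn d)^2 = 1" "\<bar>sn d\<bar> = 1" "sn d * sn d = 1" for d by (auto simp: sn_def)
  have s1: "sqrt \<theta> * sqrt \<theta> = \<theta>" using theta by simp
  have th: "\<theta> \<le> sqrt \<theta>" using theta mult_left_mono[of "sqrt \<theta>" 1 "sqrt \<theta>"] s1 by simp
  show "finite \<Lambda>" by auto
  show "\<Lambda> \<noteq> {}" using npos by force
  show "finite U" by (rule finU)
  show "X i a \<in> borel_measurable M" for i a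
    unfolding X_def using LD[of i] by (cases "i \<in> \<Lambda> \<and> a \<in> U") (auto intro!: borel_measurable_times Z_m)
  show "\<bar>X i a \<omega>\<bar> \<le> \<tau> / sqrt nn" for i a \<omega>
  proof (cases "i \<in> \<Lambda> \<and> a \<in> U")
    case True
    have "cc (fst i) a * \<bar>Z (fst i) (snd i) a \<omega>\<bar> \<le> (1 / sqrt nn) * \<tau>"
      using cc_le[of "fst i" a] cc_pos[of "fst i" a] LD(1)[of i] True trunc_le(1) tau nn_pos
      by (intro mult_mono) (auto simp: Z_def)
    then show ?thesis using True cc_pos[of "fst i" a] LD(1)[of i] by (simp add: X_def abs_mult sn2 abs_of_pos)
  next
    case False
    then show ?thesis unfolding X_def using tau nn_pos by auto
  qed
  show "indep_vars (\<lambda>_. PiM U (\<lambda>_. borel)) (\<lambda>i \<omega>. \<lambda>a\<in>U. X i a \<omega>) \<Lambda>" by (rule X_indep)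
  show "0 < cc (fst i) a" if "i \<in> \<Lambda>" "a \<in> U" for i a using cc_pos LD that by blast
  show "cc (fst i) a \<le> \<tau> / sqrt nn" if "i \<in> \<Lambda>" "a \<in> U" for i a
  proof -
    have "1 / sqrt nn \<le> \<tau> / sqrt nn" using tau nn_pos by (intro divide_right_mono) auto
    then show ?thesis using cc_le[OF LD(1)[OF that(1)] that(2)] by linarith
  qed
  show "(\<Sum>i\<in>\<Lambda>. (cc (fst i) a)^2) = 1" if "a \<in> U" for a using that by (rule cc_sum)
  show "(\<Sum>i\<in>\<Lambda>. \<bar>expectation (X i a)\<bar>) \<le> 2 * sqrt (real (N 1) + real (N 2)) * sqrt \<pi>0" if a: "a \<in> U" for a
  proof -
    have "(\<Sum>i\<in>\<Lambda>. \<bar>expectation (X i a)\<bar>) \<le> (\<Sum>i\<in>\<Lambda>. (1 / sqrt (real (N (fst i)))) * sqrt \<pi>0)"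
    proof (intro sum_mono)
      fix i assume i: "i \<in> \<Lambda>"
      have "sqrt ((cc (fst i) a)^2) \<le> sqrt (1 / real (N (fst i)))" by (intro real_sqrt_le_mono cc2 LD[OF i] a)
      then have c: "cc (fst i) a \<le> 1 / sqrt (real (N (fst i)))" using cc_pos[OF LD(1)[OF i] a] by (simp add: real_sqrt_divide)
      have "\<bar>expectation (X i a)\<bar> = cc (fst i) a * \<bar>expectation (Z (fst i) (snd i) a)\<bar>"
        unfolding Xin[OF i a] using Z_int(1)[OF LD[OF i] a] cc_pos[OF LD(1)[OF i] a] by (simp add: abs_mult sn2 abs_of_pos)
      also have "\<dots> \<le> (1 / sqrt (real (N (fst i)))) * sqrt \<pi>0"
        using c Z_mean(1)[OF LD[OF i] a] by (intro mult_mono) auto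
      finally show "\<bar>expectation (X i a)\<bar> \<le> (1 / sqrt (real (N (fst i)))) * sqrt \<pi>0" .
    qed
    also have "\<dots> = (\<Sum>d\<in>{1, 2}. \<Sum>l\<in>{..<N d}. (1 / sqrt (real (N d))) * sqrt \<pi>0)"
      by (subst sum.Sigma) (auto simp: case_prod_beta)
    also have "\<dots> = (sqrt (real (N 1)) + sqrt (real (N 2))) * sqrt \<pi>0"
    proof -
      have "real n * (1 / sqrt (real n) * sqrt \<pi>0) = (real n / sqrt (real n)) * sqrt \<pi>0" for n by simp
      then have "real n * (1 / sqrt (real n) * sqrt \<pi>0) = sqrt (real n) * sqrt \<pi>0" for n by (simp only: real_div_sqrt of_nat_0_le_iff)
      then show ?thesis by (simp only: sum.insert sum_constant card_lessThan) (simp add: distrib_right)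
    qed
    also have "\<dots> \<le> (sqrt (real (N 1) + real (N 2)) + sqrt (real (N 1) + real (N 2))) * sqrt \<pi>0"
      using pi0 by (intro mult_right_mono add_mono) auto
    finally show ?thesis by simp
  qed
  have X2: "expectation (\<lambda>\<omega>. (X i a \<omega>)^2) = (cc (fst i) a)^2 * expectation (\<lambda>\<omega>. (Z (fst i) (snd i) a \<omega>)^2)"
    if "i \<in> \<Lambda>" "a \<in> U" for i a
    unfolding Xin[OF that] using Z_int(2)[OF LD[OF that(1)] that(2)] by (simp add: power_mult_distrib sn2)
  show "\<bar>expectation (\<lambda>\<omega>. (X i a \<omega>)^2) - (cc (fst i) a)^2\<bar> \<le> \<theta> * (1 / real (N (fst i)))" if ia: "i \<in> \<Lambda>" "a \<in> U" for i a
  proof -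
    let ?E = "expectation (\<lambda>\<omega>. (Z (fst i) (snd i) a \<omega>)^2)"
    have "\<bar>expectation (\<lambda>\<omega>. (X i a \<omega>)^2) - (cc (fst i) a)^2\<bar> = \<bar>(cc (fst i) a)^2 * (?E - 1)\<bar>"
      unfolding X2[OF ia] by (simp add: right_diff_distrib)
    also have "\<dots> = (cc (fst i) a)^2 * \<bar>?E - 1\<bar>" by (simp add: abs_mult)
    also have "\<dots> \<le> (1 / real (N (fst i))) * \<theta>"
      using Z_var[OF LD[OF ia(1)] ia(2)] by (intro mult_mono cc2 LD ia) auto
    finally show ?thesis by (simp add: mult.commute)
  qed
  show "expectation (\<lambda>\<omega>. (X i a \<omega>)^2) \<le> 1 / real (N (fst i))" if ia: "i \<in> \<Lambda>" "a \<in> U" for i a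
  proof -
    have "(cc (fst i) a)^2 * expectation (\<lambda>\<omega>. (Z (fst i) (snd i) a \<omega>)^2) \<le> (1 / real (N (fst i))) * 1"
      using Z_var[OF LD[OF ia(1)] ia(2)] by (intro mult_mono cc2 LD ia) auto
    then show ?thesis unfolding X2[OF ia] by simp
  qed
  show "0 \<le> 1 / real (N (fst i))" for i by simp
  have "(\<Sum>i\<in>\<Lambda>. 1 / real (N (fst i))) = (\<Sum>d\<in>{1, 2}. \<Sum>l\<in>{..<N d}. 1 / real (N d))"
    by (subst sum.Sigma) (auto simp: case_prod_beta)
  also have "\<dots> = 2" using npos by simp
  finally show "(\<Sum>i\<in>\<Lambda>. 1 / real (N (fst i))) \<le> 2" by simp
  show "0 \<le> 2 * sqrt (real (N 1) + real (N 2)) * sqrt \<pi>0" using pi0 by simp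
  show "0 \<le> \<theta>" "0 \<le> \<rho> + 3 * sqrt \<theta>" using theta rho by auto
  show "0 < r" "r < 1" by (rule r)+
  show "strong \<rho> \<subseteq> U \<times> U" "(a, a) \<notin> strong \<rho>" for a by (auto simp: strong_def)
  have XX: "expectation (\<lambda>\<omega>. X i a \<omega> * X i c \<omega>) = (cc (fst i) a * cc (fst i) c) * expectation (\<lambda>\<omega>. Z (fst i) (snd i) a \<omega> * Z (fst i) (snd i) c \<omega>)"
    if i: "i \<in> \<Lambda>" and a: "a \<in> U" "c \<in> U" for i a c
  proof -
    have "X i a \<omega> * X i c \<omega> = (cc (fst i) a * cc (fst i) c) * (Z (fst i) (snd i) a \<omega> * Z (fst i) (snd i) c \<omega>)" for \<omega>
    proof -
      have "X i a \<omega> * X i c \<omega> = (sn (fst i) * sn (fst i)) * ((cc (fst i) a * cc (fst i) c) * (Z (fst i) (snd i) a \<omega> * Z (fst i) (snd i) c \<omega>))"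
        unfolding Xin[OF i a(1)] Xin[OF i a(2)] by (simp only: mult_ac)
      then show ?thesis by (simp only: sn2 mult_1_left)
    qed
    then show ?thesis by simp
  qed
  have ccb: "cc (fst i) a * cc (fst i) c \<le> 1 / real (N (fst i))" "0 \<le> cc (fst i) a * cc (fst i) c"
    "cc (fst i) a * cc (fst i) c \<le> ((cc (fst i) a)^2 + (cc (fst i) c)^2) / 2"
    if i: "i \<in> \<Lambda>" and a: "a \<in> U" "c \<in> U" for i a c
  proof -
    show q: "cc (fst i) a * cc (fst i) c \<le> ((cc (fst i) a)^2 + (cc (fst i) c)^2) / 2"
      using zero_le_power2[of "cc (fst i) a - cc (fst i) c"] by (simp add: power2_diff)
    have "((cc (fst i) a)^2 + (cc (fst i) c)^2) / 2 \<le> (1 / real (N (fst i)) + 1 / real (N (fst i))) / 2"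
      by (intro divide_right_mono add_mono cc2(2) LD(1)[OF i] a) simp
    also have "\<dots> = 1 / real (N (fst i))" by simp
    finally show "cc (fst i) a * cc (fst i) c \<le> 1 / real (N (fst i))" using q by (rule order_trans[rotated])
    show "0 \<le> cc (fst i) a * cc (fst i) c"
      using cc_pos[OF LD(1)[OF i] a(1)] cc_pos[OF LD(1)[OF i] a(2)] by simp
  qed
  show "\<bar>expectation (\<lambda>\<omega>. X i a \<omega> * X i c \<omega>) - expectation (X i a) * expectation (X i c)\<bar>
     \<le> (\<rho> + 3 * sqrt \<theta>) * (1 / real (N (fst i)))"
    if i: "i \<in> \<Lambda>" and a: "a \<in> U" "c \<in> U" "a \<noteq> c" "(a, c) \<notin> strong \<rho>" for i a c
  proof -
    let ?EZ = "\<lambda>a. expectation (Z (fst i) (snd i) a)"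
    let ?D = "expectation (\<lambda>\<omega>. Z (fst i) (snd i) a \<omega> * Z (fst i) (snd i) c \<omega>) - ?EZ a * ?EZ c"
    have "expectation (X i a) * expectation (X i c) = (cc (fst i) a * cc (fst i) c) * (?EZ a * ?EZ c)"
    proof -
      have "expectation (X i a) * expectation (X i c) = (sn (fst i) * sn (fst i)) * ((cc (fst i) a * cc (fst i) c) * (?EZ a * ?EZ c))"
        unfolding Xin[OF i a(1)] Xin[OF i a(2)] using Z_int(1)[OF LD[OF i] a(1)] Z_int(1)[OF LD[OF i] a(2)] by simp
      then show ?thesis by (simp only: sn2 mult_1_left)
    qed
    then have eq: "expectation (\<lambda>\<omega>. X i a \<omega> * X i c \<omega>) - expectation (X i a) * expectation (X i c) = (cc (fst i) a * cc (fst i) c) * ?D"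
      unfolding XX[OF i a(1,2)] by (simp only: right_diff_distrib)
    have Rr: "\<bar>R (fst i) a c\<bar> \<le> \<rho>" using a LD(1)[OF i] by (auto simp: strong_def not_less)
    have "\<bar>?EZ a * ?EZ c\<bar> \<le> sqrt \<theta> * sqrt \<theta>"
      unfolding abs_mult using Z_mean(2)[OF LD[OF i] a(1)] Z_mean(2)[OF LD[OF i] a(2)] theta by (intro mult_mono) auto
    then have "\<bar>?EZ a * ?EZ c\<bar> \<le> sqrt \<theta>" using s1 th by linarith
    then have D: "\<bar>?D\<bar> \<le> \<rho> + 3 * sqrt \<theta>" using Z_cov[OF LD[OF i] a(1,2)] Rr by linarith
    have "\<bar>(cc (fst i) a * cc (fst i) c) * ?D\<bar> \<le> (1 / real (N (fst i))) * (\<rho> + 3 * sqrt \<theta>)"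
      unfolding abs_mult[of "cc (fst i) a * cc (fst i) c"] using ccb[OF i a(1,2)] D by (intro mult_mono) auto
    then show ?thesis unfolding eq by (simp only: mult.commute)
  qed
  show "\<bar>expectation (\<lambda>\<omega>. X i a \<omega> * X i c \<omega>)\<bar> \<le> r / 2 * ((cc (fst i) a)^2 + (cc (fst i) c)^2) + (\<rho> + 3 * sqrt \<theta>) * (1 / real (N (fst i)))"
    if i: "i \<in> \<Lambda>" and ac: "(a, c) \<in> strong \<rho>" for i a c
  proof -
    have a: "a \<in> U" "c \<in> U" "a \<noteq> c" using ac by (auto simp: strong_def)
    let ?E = "expectation (\<lambda>\<omega>. Z (fst i) (snd i) a \<omega> * Z (fst i) (snd i) c \<omega>)"
    let ?cc = "cc (fst i) a * cc (fst i) c"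
    have "\<bar>?E\<bar> \<le> r + 2 * sqrt \<theta>" using Z_cov[OF LD[OF i] a(1,2)] R_lt[OF LD(1)[OF i] a] by linarith
    then have "\<bar>?cc * ?E\<bar> \<le> ?cc * (r + 2 * sqrt \<theta>)"
      unfolding abs_mult[of ?cc] using ccb(2)[OF i a(1,2)] by (simp only: abs_of_nonneg mult_left_mono)
    also have "\<dots> = r * ?cc + (2 * sqrt \<theta>) * ?cc" by (simp add: algebra_simps)
    also have "\<dots> \<le> r * (((cc (fst i) a)^2 + (cc (fst i) c)^2) / 2) + (\<rho> + 3 * sqrt \<theta>) * (1 / real (N (fst i)))"
      using r rho theta ccb[OF i a(1,2)] by (intro add_mono mult_left_mono[OF ccb(3)] mult_mono) auto
    finally show ?thesis unfolding XX[OF i a(1,2)] by simp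
  qed
qed


section \<open>Replacing the empirical variances\<close>

abbreviation "\<Lambda>' d \<equiv> Pair d ` {..<N d}"

lemma Z_indep: "a \<in> U \<Longrightarrow> indep_vars (\<lambda>_. borel) (\<lambda>i. Z (fst i) (snd i) a) \<Lambda>"
proof -
  assume a: "a \<in> U"
  define G where "G i z = trunc ((z a - m a) / sqrt (V (fst i) a))"
    for i :: "nat \<times> nat" and z :: "nat \<times> nat \<Rightarrow> real"
  have Gm: "G i \<in> borel_measurable (PiM ({..<p} \<times> {..<p}) (\<lambda>_. borel))" for i
    unfolding G_def
    by (intro borel_measurable_const measurable_compose[OF _ trunc_m] borel_measurable_divide borel_measurable_diff comp_m a)
  have "indep_vars (\<lambda>_. borel) (\<lambda>i \<omega>. G i ((\<lambda>(d, l) \<omega>. restrict (\<lambda>(i, j). S d l \<omega> i j) ({..<p} \<times> {..<p})) i \<omega>)) \<Lambda>"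
    by (rule indep_vars_compose2[OF indep]) (rule Gm)
  moreover have "G i ((\<lambda>(d, l) \<omega>. restrict (\<lambda>(i, j). S d l \<omega> i j) ({..<p} \<times> {..<p})) i \<omega>) = Z (fst i) (snd i) a \<omega>" for i \<omega>
  proof -
    obtain d l where i: "i = (d, l)" by (cases i)
    show ?thesis unfolding G_def i prod.case fst_conv snd_conv restr_eval[OF a] by (simp add: Z_def zt_def)
  qed
  ultimately show ?thesis by simp
qed

lemma sum_sample: "(\<Sum>i\<in>\<Lambda>' d. f (fst i) (snd i)) = (\<Sum>l<N d. f d l)"
  by (subst sum.reindex) (auto simp: inj_on_def)

lemma card_sample: "card (\<Lambda>' d) = N d"
  by (subst card_image) (auto simp: inj_on_def)

definition t1 :: "real \<Rightarrow> real" where "t1 L = \<tau> * sqrt (8 * L / nn)"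
definition t2 :: "real \<Rightarrow> real" where "t2 L = sqrt (8 * L / nn)"

definition E0 :: "'a set" where
  "E0 = (\<Union>i\<in>\<Lambda>. \<Union>a\<in>U. {\<omega> \<in> space M. \<tau> < \<bar>zt (fst i) (snd i) a \<omega>\<bar>})"
definition E1 :: "real \<Rightarrow> 'a set" where
  "E1 L = (\<Union>d\<in>{1, 2}. \<Union>a\<in>U. {\<omega> \<in> space M. real (N d) * t1 L \<le>
     \<bar>\<Sum>i\<in>\<Lambda>' d. (Z (fst i) (snd i) a \<omega>)^2 - expectation (\<lambda>\<omega>. (Z (fst i) (snd i) a \<omega>)^2)\<bar>})"
definition E2 :: "real \<Rightarrow> 'a set" where
  "E2 L = (\<Union>d\<in>{1, 2}. \<Union>a\<in>U. {\<omega> \<in> space M. real (N d) * t2 L \<le>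
     \<bar>\<Sum>i\<in>\<Lambda>' d. Z (fst i) (snd i) a \<omega> - expectation (Z (fst i) (snd i) a)\<bar>})"
definition Bad :: "real \<Rightarrow> 'a set" where "Bad L = E0 \<union> (E1 L \<union> E2 L)"

lemma sample_meas:
  "d \<in> {1, 2} \<Longrightarrow> a \<in> U \<Longrightarrow> (\<lambda>\<omega>. \<Sum>i\<in>\<Lambda>' d. (Z (fst i) (snd i) a \<omega>)^2 - expectation (\<lambda>\<omega>. (Z (fst i) (snd i) a \<omega>)^2)) \<in> borel_measurable M"
  "d \<in> {1, 2} \<Longrightarrow> a \<in> U \<Longrightarrow> (\<lambda>\<omega>. \<Sum>i\<in>\<Lambda>' d. Z (fst i) (snd i) a \<omega> - expectation (Z (fst i) (snd i) a)) \<in> borel_measurable M"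
  by (auto intro!: borel_measurable_sum borel_measurable_diff borel_measurable_power Z_m)

lemma finite_Lam: "finite \<Lambda>" by auto

lemma E_sets: "E0 \<in> events" "E1 L \<in> events" "E2 L \<in> events"
proof -
  show "E0 \<in> events" unfolding E0_def
  proof (intro sets.finite_UN finite_Lam finU)
    fix i a assume i: "i \<in> \<Lambda>" and a: "a \<in> U"
    have [measurable]: "zt (fst i) (snd i) a \<in> borel_measurable M" using i a by (intro zt_m) auto
    show "{\<omega> \<in> space M. \<tau> < \<bar>zt (fst i) (snd i) a \<omega>\<bar>} \<in> events" by measurable
  qed
  show "E1 L \<in> events" unfolding E1_def
  proof (intro sets.finite_UN finU)
    fix d :: nat and a assume d: "d \<in> {1, 2}" and a: "a \<in> U"
    note [measurable] = sample_meas(1)[OF d a]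
    show "{\<omega> \<in> space M. real (N d) * t1 L \<le>
     \<bar>\<Sum>i\<in>\<Lambda>' d. (Z (fst i) (snd i) a \<omega>)^2 - expectation (\<lambda>\<omega>. (Z (fst i) (snd i) a \<omega>)^2)\<bar>} \<in> events" by measurable
  qed auto
  show "E2 L \<in> events" unfolding E2_def
  proof (intro sets.finite_UN finU)
    fix d :: nat and a assume d: "d \<in> {1, 2}" and a: "a \<in> U"
    note [measurable] = sample_meas(2)[OF d a]
    show "{\<omega> \<in> space M. real (N d) * t2 L \<le>
     \<bar>\<Sum>i\<in>\<Lambda>' d. Z (fst i) (snd i) a \<omega> - expectation (Z (fst i) (snd i) a)\<bar>} \<in> events" by measurable
  qed auto
qed

lemma Bad_sets: "Bad L \<in> events" unfolding Bad_def using E_sets by auto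

lemma prob_UN_le:
  assumes "finite I" "\<And>i. i \<in> I \<Longrightarrow> A i \<in> events" "\<And>i. i \<in> I \<Longrightarrow> prob (A i) \<le> c"
  shows "prob (\<Union>i\<in>I. A i) \<le> real (card I) * c"
proof -
  have "prob (\<Union>i\<in>I. A i) \<le> (\<Sum>i\<in>I. prob (A i))"
    using assms by (intro finite_measure_subadditive_finite) auto
  also have "\<dots> \<le> (\<Sum>i\<in>I. c)" using assms by (intro sum_mono)
  finally show ?thesis by simp
qed

lemma card_Lam: "card \<Lambda> = N 1 + N 2"
  by (subst card_SigmaI) auto

lemma prob_Bad:
  assumes L: "0 < L" and t: "t1 L \<le> 1"
  shows "prob (Bad L) \<le> (real (N 1) + real (N 2)) * (real (card U) * \<pi>0) + 8 * real (card U) * exp (- 2 * L)"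
proof -
  have tp: "0 < t1 L" "0 < t2 L" using L nn_pos tau by (auto simp: t1_def t2_def)
  have LD: "fst i \<in> {1, 2}" "snd i < N (fst i)" if "i \<in> \<Lambda>" for i using that by auto
  have p0: "prob E0 \<le> (real (N 1) + real (N 2)) * (real (card U) * \<pi>0)"
  proof -
    have m: "{\<omega> \<in> space M. \<tau> < \<bar>zt (fst i) (snd i) a \<omega>\<bar>} \<in> events" if "i \<in> \<Lambda>" "a \<in> U" for i a
    proof -
      have [measurable]: "zt (fst i) (snd i) a \<in> borel_measurable M" using that by (intro zt_m) auto
      show ?thesis by measurable
    qed
    have "prob E0 \<le> real (card \<Lambda>) * (real (card U) * \<pi>0)"
      unfolding E0_def by (intro prob_UN_le sets.finite_UN finite_Lam finU m tail_prob LD)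
    then show ?thesis by (simp only: card_Lam of_nat_add)
  qed
  have L8: "real (N d) * (8 * L / nn) \<ge> 8 * L" if "d \<in> {1, 2}" for d
    using nn_le[OF that] nn_pos L by (simp add: field_simps)
  have L8': "8 * L \<le> u \<Longrightarrow> - u / 4 \<le> - 2 * L" for u by linarith
  have sub: "\<Lambda>' d \<subseteq> \<Lambda>" if "d \<in> {1, 2}" for d using that by auto
  have p1: "prob (E1 L) \<le> 4 * real (card U) * exp (- 2 * L)"
  proof -
    have "prob (E1 L) \<le> real (card {1, 2::nat}) * (real (card U) * (2 * exp (- 2 * L)))"
      unfolding E1_def
    proof (intro prob_UN_le sets.finite_UN finU)
      fix d :: nat and a assume d: "d \<in> {1, 2}" and a: "a \<in> U"
      note [measurable] = sample_meas(1)[OF d a]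
      show "{\<omega> \<in> space M. real (N d) * t1 L \<le>
         \<bar>\<Sum>i\<in>\<Lambda>' d. (Z (fst i) (snd i) a \<omega>)^2 - expectation (\<lambda>\<omega>. (Z (fst i) (snd i) a \<omega>)^2)\<bar>} \<in> events" by measurable
      then show "{\<omega> \<in> space M. real (N d) * t1 L \<le>
         \<bar>\<Sum>i\<in>\<Lambda>' d. (Z (fst i) (snd i) a \<omega>)^2 - expectation (\<lambda>\<omega>. (Z (fst i) (snd i) a \<omega>)^2)\<bar>} \<in> events" .
      have "indep_vars (\<lambda>_. borel) (\<lambda>i \<omega>. (\<lambda>x. x^2) (Z (fst i) (snd i) a \<omega>)) \<Lambda>"
        by (rule indep_vars_compose2[OF Z_indep[OF a]]) measurable
      then have ind: "indep_vars (\<lambda>_. borel) (\<lambda>i \<omega>. (Z (fst i) (snd i) a \<omega>)^2) (\<Lambda>' d)"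
        by (rule indep_vars_subset) (rule sub[OF d])
      have "prob {\<omega> \<in> space M. \<bar>\<Sum>i\<in>\<Lambda>' d. (Z (fst i) (snd i) a \<omega>)^2 - expectation (\<lambda>\<omega>. (Z (fst i) (snd i) a \<omega>)^2)\<bar> \<ge> real (card (\<Lambda>' d)) * t1 L}
        \<le> 2 * exp (- real (card (\<Lambda>' d)) * (t1 L)^2 / (4 * \<tau>^2))"
      proof (rule bernstein[OF _ ind])
        fix i \<omega> assume i: "i \<in> \<Lambda>' d"
        show "\<bar>(Z (fst i) (snd i) a \<omega>)^2\<bar> \<le> \<tau>^2" using trunc_le(3) by (simp add: Z_def)
      next
        fix i assume i: "i \<in> \<Lambda>' d"
        have dl: "fst i \<in> {1, 2}" "snd i < N (fst i)" using i d by auto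
        note [measurable] = Z_m[OF dl a]
        have pw: "((Z (fst i) (snd i) a \<omega>)^2)^2 \<le> \<tau>^2 * (Z (fst i) (snd i) a \<omega>)^2" for \<omega>
          unfolding power2_eq_square[of "(Z (fst i) (snd i) a \<omega>)^2"] using trunc_le(3)
          by (intro mult_right_mono) (auto simp: Z_def)
        have "expectation (\<lambda>\<omega>. ((Z (fst i) (snd i) a \<omega>)^2)^2) \<le> expectation (\<lambda>\<omega>. \<tau>^2 * (Z (fst i) (snd i) a \<omega>)^2)"
        proof (intro integral_mono pw)
          show i2: "integrable M (\<lambda>\<omega>. \<tau>^2 * (Z (fst i) (snd i) a \<omega>)^2)" using Z_int(2)[OF dl a] by auto
          show "integrable M (\<lambda>\<omega>. ((Z (fst i) (snd i) a \<omega>)^2)^2)"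
            by (rule Bochner_Integration.integrable_bound[OF i2]) (use pw in auto)
        qed
        also have "\<dots> \<le> \<tau>^2 * 1" using mult_left_mono[OF Z_var(1)[OF dl a], of "\<tau>^2"] by simp
        finally show "expectation (\<lambda>\<omega>. ((Z (fst i) (snd i) a \<omega>)^2)^2) \<le> \<tau>^2" by simp
      next
        show "t1 L * \<tau>^2 \<le> \<tau>^2" using t by (simp add: mult_left_le_one_le tp less_imp_le)
      qed (use tp tau in auto)
      also have "\<dots> \<le> 2 * exp (- 2 * L)"
      proof -
        have "(t1 L)^2 = \<tau>^2 * (8 * L / nn)" using L nn_pos by (simp add: t1_def power_mult_distrib)
        then have "- real (N d) * (t1 L)^2 / (4 * \<tau>^2) = - (real (N d) * (8 * L / nn)) / 4" using tau by simp
        also have "\<dots> \<le> - 2 * L" by (rule L8'[OF L8[OF d]])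
        finally show ?thesis by (simp only: card_sample) simp
      qed
      finally show "prob {\<omega> \<in> space M. real (N d) * t1 L \<le>
         \<bar>\<Sum>i\<in>\<Lambda>' d. (Z (fst i) (snd i) a \<omega>)^2 - expectation (\<lambda>\<omega>. (Z (fst i) (snd i) a \<omega>)^2)\<bar>} \<le> 2 * exp (- 2 * L)"
        by (simp only: card_sample)
    qed auto
    then show ?thesis by simp
  qed
  have p2: "prob (E2 L) \<le> 4 * real (card U) * exp (- 2 * L)"
  proof -
    have "prob (E2 L) \<le> real (card {1, 2::nat}) * (real (card U) * (2 * exp (- 2 * L)))"
      unfolding E2_def
    proof (intro prob_UN_le sets.finite_UN finU)
      fix d :: nat and a assume d: "d \<in> {1, 2}" and a: "a \<in> U"
      note [measurable] = sample_meas(2)[OF d a]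
      show "{\<omega> \<in> space M. real (N d) * t2 L \<le>
         \<bar>\<Sum>i\<in>\<Lambda>' d. Z (fst i) (snd i) a \<omega> - expectation (Z (fst i) (snd i) a)\<bar>} \<in> events" by measurable
      then show "{\<omega> \<in> space M. real (N d) * t2 L \<le>
         \<bar>\<Sum>i\<in>\<Lambda>' d. Z (fst i) (snd i) a \<omega> - expectation (Z (fst i) (snd i) a)\<bar>} \<in> events" .
      have ind: "indep_vars (\<lambda>_. borel) (\<lambda>i. Z (fst i) (snd i) a) (\<Lambda>' d)"
        by (rule indep_vars_subset[OF Z_indep[OF a]]) (rule sub[OF d])
      have "prob {\<omega> \<in> space M. \<bar>\<Sum>i\<in>\<Lambda>' d. Z (fst i) (snd i) a \<omega> - expectation (Z (fst i) (snd i) a)\<bar> \<ge> real (card (\<Lambda>' d)) * t2 L}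
        \<le> 2 * exp (- real (card (\<Lambda>' d)) * (t2 L)^2 / (4 * 1))"
      proof (rule bernstein[OF _ ind])
        fix i \<omega> assume i: "i \<in> \<Lambda>' d"
        show "\<bar>Z (fst i) (snd i) a \<omega>\<bar> \<le> \<tau>" using trunc_le(1) by (simp add: Z_def)
      next
        fix i assume i: "i \<in> \<Lambda>' d"
        have dl: "fst i \<in> {1, 2}" "snd i < N (fst i)" using i d by auto
        show "expectation (\<lambda>\<omega>. (Z (fst i) (snd i) a \<omega>)^2) \<le> 1" by (rule Z_var(1)[OF dl a])
      next
        show "t2 L * \<tau> \<le> 1" using t by (simp add: t1_def t2_def mult.commute)
      qed (use tp in auto)
      also have "\<dots> \<le> 2 * exp (- 2 * L)"
      proof -
        have "(t2 L)^2 = 8 * L / nn" using L nn_pos by (simp add: t2_def)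
        then have "- real (N d) * (t2 L)^2 / (4 * 1) = - (real (N d) * (8 * L / nn)) / 4" by simp
        also have "\<dots> \<le> - 2 * L" by (rule L8'[OF L8[OF d]])
        finally show ?thesis by (simp only: card_sample) simp
      qed
      finally show "prob {\<omega> \<in> space M. real (N d) * t2 L \<le>
         \<bar>\<Sum>i\<in>\<Lambda>' d. Z (fst i) (snd i) a \<omega> - expectation (Z (fst i) (snd i) a)\<bar>} \<le> 2 * exp (- 2 * L)"
        by (simp only: card_sample)
    qed auto
    then show ?thesis by simp
  qed
  have "prob (Bad L) \<le> prob E0 + (prob (E1 L) + prob (E2 L))"
    unfolding Bad_def using E_sets
    by (intro order_trans[OF measure_Un_le] add_left_mono measure_Un_le) auto
  then show ?thesis using p0 p1 p2 by simp
qed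

definition dlt :: "real \<Rightarrow> real" where "dlt L = t1 L + \<theta> + (t2 L + sqrt \<theta>)^2"

lemma good_sums:
  assumes w: "\<omega> \<in> space M" "\<omega> \<notin> Bad L" and d: "d \<in> {1, 2}" and a: "a \<in> U" and L: "0 < L"
  shows "\<And>l. l < N d \<Longrightarrow> Z d l a \<omega> = zt d l a \<omega>"
    and "\<bar>((\<Sum>l<N d. (zt d l a \<omega>)^2) / real (N d) - ((\<Sum>l<N d. zt d l a \<omega>) / real (N d))^2) - 1\<bar> \<le> dlt L"
proof -
  have n: "0 < real (N d)" using Np[OF d] by simp
  show zz: "Z d l a \<omega> = zt d l a \<omega>" if l: "l < N d" for l
  proof -
    have "\<not> \<tau> < \<bar>zt d l a \<omega>\<bar>"
    proof
      assume "\<tau> < \<bar>zt d l a \<omega>\<bar>"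
      then have "\<omega> \<in> E0" unfolding E0_def using w d l a by (intro UN_I[of "(d, l)"] UN_I[of a]) auto
      then show False using w by (simp add: Bad_def)
    qed
    then show ?thesis by (simp add: Z_def trunc_def)
  qed
  have nE1: "\<bar>\<Sum>i\<in>\<Lambda>' d. (Z (fst i) (snd i) a \<omega>)^2 - expectation (\<lambda>\<omega>. (Z (fst i) (snd i) a \<omega>)^2)\<bar> < real (N d) * t1 L"
  proof (rule ccontr)
    assume "\<not> ?thesis"
    then have "\<omega> \<in> E1 L" unfolding E1_def using w d a by (intro UN_I[of d] UN_I[of a]) auto
    then show False using w by (simp add: Bad_def)
  qed
  have nE2: "\<bar>\<Sum>i\<in>\<Lambda>' d. Z (fst i) (snd i) a \<omega> - expectation (Z (fst i) (snd i) a)\<bar> < real (N d) * t2 L"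
  proof (rule ccontr)
    assume "\<not> ?thesis"
    then have "\<omega> \<in> E2 L" unfolding E2_def using w d a by (intro UN_I[of d] UN_I[of a]) auto
    then show False using w by (simp add: Bad_def)
  qed
  let ?A = "\<Sum>l<N d. (zt d l a \<omega>)^2" and ?B = "\<Sum>l<N d. zt d l a \<omega>"
  let ?EA = "\<Sum>l<N d. expectation (\<lambda>\<omega>. (Z d l a \<omega>)^2)" and ?EB = "\<Sum>l<N d. expectation (Z d l a)"
  have "(\<Sum>i\<in>\<Lambda>' d. (Z (fst i) (snd i) a \<omega>)^2 - expectation (\<lambda>\<omega>. (Z (fst i) (snd i) a \<omega>)^2)) = ?A - ?EA"
    using sum_sample[of "\<lambda>d l. (Z d l a \<omega>)^2 - expectation (\<lambda>\<omega>. (Z d l a \<omega>)^2)" d] zz by (simp add: sum_subtractf)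
  then have A: "\<bar>?A - ?EA\<bar> \<le> real (N d) * t1 L" using nE1 by simp
  have "(\<Sum>i\<in>\<Lambda>' d. Z (fst i) (snd i) a \<omega> - expectation (Z (fst i) (snd i) a)) = ?B - ?EB"
    using sum_sample[of "\<lambda>d l. Z d l a \<omega> - expectation (Z d l a)" d] zz by (simp add: sum_subtractf)
  then have B: "\<bar>?B - ?EB\<bar> \<le> real (N d) * t2 L" using nE2 by simp
  have EA: "\<bar>?EA - real (N d)\<bar> \<le> real (N d) * \<theta>"
  proof -
    have "\<bar>\<Sum>l<N d. expectation (\<lambda>\<omega>. (Z d l a \<omega>)^2) - 1\<bar> \<le> (\<Sum>l<N d. \<theta>)"
      using Z_var[OF d _ a] by (intro order_trans[OF sum_abs] sum_mono) (force simp: abs_le_iff)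
    then show ?thesis by (simp add: sum_subtractf)
  qed
  have EB: "\<bar>?EB\<bar> \<le> real (N d) * sqrt \<theta>"
  proof -
    have "\<bar>?EB\<bar> \<le> (\<Sum>l<N d. sqrt \<theta>)"
      using Z_mean(2)[OF d _ a] by (intro order_trans[OF sum_abs] sum_mono) auto
    then show ?thesis by simp
  qed
  have "\<bar>?A - real (N d)\<bar> \<le> real (N d) * (t1 L + \<theta>)" using A EA by (simp add: distrib_left)
  then have "\<bar>?A - real (N d)\<bar> / real (N d) \<le> t1 L + \<theta>" using n by (simp add: divide_le_eq mult.commute)
  moreover have "?A / real (N d) - 1 = (?A - real (N d)) / real (N d)" using n by (simp add: diff_divide_distrib)
  ultimately have A': "\<bar>?A / real (N d) - 1\<bar> \<le> t1 L + \<theta>" using n by (simp add: abs_divide)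
  have "\<bar>?B\<bar> \<le> real (N d) * (t2 L + sqrt \<theta>)" using B EB by (simp add: distrib_left)
  then have "\<bar>?B / real (N d)\<bar> \<le> t2 L + sqrt \<theta>" using n by (simp add: abs_divide divide_le_eq mult.commute)
  then have "(?B / real (N d))^2 \<le> (t2 L + sqrt \<theta>)^2" 
    using power_mono[of "\<bar>?B / real (N d)\<bar>" "t2 L + sqrt \<theta>" 2] by (simp only: abs_ge_zero power2_abs)
  moreover have "0 \<le> (?B / real (N d))^2" by simp
  ultimately show "\<bar>(?A / real (N d) - (?B / real (N d))^2) - 1\<bar> \<le> dlt L" using A' unfolding dlt_def by linarith
qed

definition Ts :: "nat \<times> nat \<Rightarrow> 'a \<Rightarrow> real" where
  "Ts a \<omega> = Tstat (N 1) (\<lambda>l i j. S 1 l \<omega> i j) (N 2) (\<lambda>l i j. S 2 l \<omega> i j) (fst a) (snd a)"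

lemma sample_stats:
  fixes \<omega> :: "'a"
  assumes d: "d \<in> {1, 2}" and a: "a \<in> U"
  defines "zb \<equiv> (\<Sum>l<N d. zt d l a \<omega>) / real (N d)"
  shows "sbar (N d) (\<lambda>l i j. S d l \<omega> i j) (fst a) (snd a) = m a + sqrt (V d a) * zb"
    and "vhat (N d) (\<lambda>l i j. S d l \<omega> i j) (fst a) (snd a) = V d a * ((\<Sum>l<N d. (zt d l a \<omega>)^2) / real (N d) - zb^2)"
proof -
  have n: "0 < real (N d)" using Np[OF d] by simp
  have v: "0 < V d a" by (rule Vpos[OF d a])
  have Sz: "S d l \<omega> (fst a) (snd a) = m a + sqrt (V d a) * zt d l a \<omega>" for l
    using v by (simp add: zt_def Sa_def)
  show sb: "sbar (N d) (\<lambda>l i j. S d l \<omega> i j) (fst a) (snd a) = m a + sqrt (V d a) * zb"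
    unfolding sbar_def Sz zb_def using n by (simp add: sum.distrib sum_distrib_left[symmetric] add_divide_distrib)
  have "(S d l \<omega> (fst a) (snd a) - (m a + sqrt (V d a) * zb))^2 = V d a * ((zt d l a \<omega>)^2 - 2 * zb * zt d l a \<omega> + zb^2)" for l
  proof -
    have "S d l \<omega> (fst a) (snd a) - (m a + sqrt (V d a) * zb) = sqrt (V d a) * (zt d l a \<omega> - zb)"
      unfolding Sz by (simp add: right_diff_distrib)
    then show ?thesis using v by (simp add: power_mult_distrib power2_diff mult_ac)
  qed
  then have "vhat (N d) (\<lambda>l i j. S d l \<omega> i j) (fst a) (snd a)
      = V d a * (\<Sum>l<N d. (zt d l a \<omega>)^2 - 2 * zb * zt d l a \<omega> + zb^2) / real (N d)"
    unfolding vhat_def sb by (simp add: sum_distrib_left)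
  also have "(\<Sum>l<N d. (zt d l a \<omega>)^2 - 2 * zb * zt d l a \<omega> + zb^2)
      = (\<Sum>l<N d. (zt d l a \<omega>)^2) - 2 * zb * (real (N d) * zb) + real (N d) * zb^2"
  proof -
    have "(\<Sum>l<N d. zt d l a \<omega>) = real (N d) * zb" using n by (simp add: zb_def)
    then show ?thesis by (simp add: sum.distrib sum_subtractf sum_distrib_left[symmetric])
  qed
  also have "V d a * ((\<Sum>l<N d. (zt d l a \<omega>)^2) - 2 * zb * (real (N d) * zb) + real (N d) * zb^2) / real (N d)
      = V d a * ((\<Sum>l<N d. (zt d l a \<omega>)^2) / real (N d) - zb^2)"
    using n by (simp add: field_simps power2_eq_square)
  finally show "vhat (N d) (\<lambda>l i j. S d l \<omega> i j) (fst a) (snd a) = V d a * ((\<Sum>l<N d. (zt d l a \<omega>)^2) / real (N d) - zb^2)" .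
qed

lemma T_good:
  assumes w: "\<omega> \<in> space M" "\<omega> \<notin> Bad L" and a: "a \<in> U" and L: "0 < L" and dl: "dlt L < 1"
  shows "(1 - dlt L) * (Ts a \<omega>)^2 \<le> (\<Sum>i\<in>\<Lambda>. X i a \<omega>)^2" "(\<Sum>i\<in>\<Lambda>. X i a \<omega>)^2 \<le> (1 + dlt L) * (Ts a \<omega>)^2"
proof -
  let ?zb = "\<lambda>d. (\<Sum>l<N d. zt d l a \<omega>) / real (N d)"
  let ?q = "\<lambda>d. (\<Sum>l<N d. (zt d l a \<omega>)^2) / real (N d) - (?zb d)^2"
  have o1: "(1::nat) \<in> {1, 2}" and o2: "(2::nat) \<in> {1, 2}" by auto
  have n: "0 < real (N 1)" "0 < real (N 2)" using npos by auto
  have q: "\<bar>?q d - 1\<bar> \<le> dlt L" if "d \<in> {1, 2}" for d by (rule good_sums(2)[OF w that a L])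
  define D where "D = V 1 a * ?q 1 / real (N 1) + V 2 a * ?q 2 / real (N 2)"
  have sg: "0 < sig a" by (rule sig2(2)[OF a])
  have T: "Ts a \<omega> = (sqrt (V 1 a) * ?zb 1 - sqrt (V 2 a) * ?zb 2) / sqrt D"
    unfolding Ts_def Tstat_def sample_stats[OF o1 a] sample_stats[OF o2 a] D_def by simp
  have SX: "(\<Sum>i\<in>\<Lambda>. X i a \<omega>) = (sqrt (V 1 a) * ?zb 1 - sqrt (V 2 a) * ?zb 2) / sig a"
  proof -
    have "(\<Sum>i\<in>\<Lambda>. X i a \<omega>) = (\<Sum>d\<in>{1, 2}. \<Sum>l\<in>{..<N d}. X (d, l) a \<omega>)"
      by (subst sum.Sigma) (auto simp: case_prod_beta)
    also have "\<dots> = (\<Sum>d\<in>{1, 2}. sn d * cc d a * (\<Sum>l<N d. zt d l a \<omega>))"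
      using good_sums(1)[OF w _ a L] a by (intro sum.cong refl) (auto simp: X_def sum_distrib_left intro!: sum.cong)
    also have "\<dots> = (sqrt (V 1 a) * ?zb 1 - sqrt (V 2 a) * ?zb 2) / sig a"
      by (simp add: sn_def cc_def diff_divide_distrib mult_ac)
    finally show ?thesis .
  qed
  have Dl: "(1 - dlt L) * (sig a)^2 \<le> D" and Du: "D \<le> (1 + dlt L) * (sig a)^2"
  proof -
    have q1: "1 - dlt L \<le> ?q d" "?q d \<le> 1 + dlt L" if "d \<in> {1, 2}" for d
      using q[OF that] by (auto simp only: abs_le_iff)
    have v: "0 \<le> V 1 a / real (N 1)" "0 \<le> V 2 a / real (N 2)"
      using Vpos[OF o1 a] Vpos[OF o2 a] n by (auto intro!: divide_nonneg_pos less_imp_le)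
    have D': "D = (V 1 a / real (N 1)) * ?q 1 + (V 2 a / real (N 2)) * ?q 2" by (simp add: D_def)
    have "(V 1 a / real (N 1)) * (1 - dlt L) + (V 2 a / real (N 2)) * (1 - dlt L) \<le> D"
      unfolding D' using q1[OF o1] q1[OF o2] v by (intro add_mono mult_left_mono)
    then show "(1 - dlt L) * (sig a)^2 \<le> D" unfolding sig2(1)[OF a] by (simp only: distrib_left mult.commute)
    have "D \<le> (V 1 a / real (N 1)) * (1 + dlt L) + (V 2 a / real (N 2)) * (1 + dlt L)"
      unfolding D' using q1[OF o1] q1[OF o2] v by (intro add_mono mult_left_mono)
    then show "D \<le> (1 + dlt L) * (sig a)^2" unfolding sig2(1)[OF a] by (simp only: distrib_left mult.commute)
  qed
  have Dp: "0 < D"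
  proof -
    have "0 < (1 - dlt L) * (sig a)^2" using dl sg by simp
    then show ?thesis using Dl by linarith
  qed
  let ?W = "sqrt (V 1 a) * ?zb 1 - sqrt (V 2 a) * ?zb 2"
  have T2: "(Ts a \<omega>)^2 = ?W^2 / D" unfolding T using Dp by (simp add: power_divide)
  have S2: "(\<Sum>i\<in>\<Lambda>. X i a \<omega>)^2 = ?W^2 / (sig a)^2" unfolding SX by (simp add: power_divide)
  have eq: "(\<Sum>i\<in>\<Lambda>. X i a \<omega>)^2 = (D / (sig a)^2) * (Ts a \<omega>)^2"
    unfolding T2 S2 using Dp by simp
  have "1 - dlt L \<le> D / (sig a)^2" "D / (sig a)^2 \<le> 1 + dlt L"
    using Dl Du sg by (simp_all add: le_divide_eq divide_le_eq)
  then show "(1 - dlt L) * (Ts a \<omega>)^2 \<le> (\<Sum>i\<in>\<Lambda>. X i a \<omega>)^2" "(\<Sum>i\<in>\<Lambda>. X i a \<omega>)^2 \<le> (1 + dlt L) * (Ts a \<omega>)^2"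
    unfolding eq by (simp_all only: mult_right_mono zero_le_power2)
qed

lemma Mstat_le_iff:
  assumes "U \<noteq> {}"
  shows "Mstat p (N 1) (\<lambda>l i j. S 1 l \<omega> i j) (N 2) (\<lambda>l i j. S 2 l \<omega> i j) \<le> c \<longleftrightarrow> (\<forall>a\<in>U. (Ts a \<omega>)^2 \<le> c)"
proof -
  have "{(Tstat (N 1) (\<lambda>l i j. S 1 l \<omega> i j) (N 2) (\<lambda>l i j. S 2 l \<omega> i j) i j)^2 | i j. i < j \<and> j < p} = (\<lambda>a. (Ts a \<omega>)^2) ` U"
    by (force simp: Ts_def upper_pairs_def image_iff)
  then show ?thesis unfolding Mstat_def using finU assms by (simp add: Max_le_iff)
qed

lemma Ts_meas: "a \<in> U \<Longrightarrow> Ts a \<in> borel_measurable M"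
proof -
  assume a: "a \<in> U"
  have sm: "(\<lambda>\<omega>. S d l \<omega> (fst a) (snd a)) \<in> borel_measurable M" if "d \<in> {1, 2}" "l < N d" for d l
    using Sm[OF that a] by (simp add: Sa_def[abs_def])
  have sb: "(\<lambda>\<omega>. sbar (N d) (\<lambda>l i j. S d l \<omega> i j) (fst a) (snd a)) \<in> borel_measurable M" if "d \<in> {1, 2}" for d
    unfolding sbar_def using sm[OF that] by (intro borel_measurable_divide borel_measurable_sum) auto
  have vh: "(\<lambda>\<omega>. vhat (N d) (\<lambda>l i j. S d l \<omega> i j) (fst a) (snd a)) \<in> borel_measurable M" if "d \<in> {1, 2}" for d
    unfolding vhat_def using sm[OF that] sb[OF that]
    by (intro borel_measurable_divide borel_measurable_sum borel_measurable_power borel_measurable_diff) auto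
  show ?thesis unfolding Ts_def[abs_def] Tstat_def
    using sb vh by (intro borel_measurable_divide borel_measurable_diff borel_measurable_add
      measurable_compose[OF _ borel_measurable_sqrt]) auto
qed

lemma X_sum_meas: "(\<lambda>\<omega>. \<Sum>i\<in>\<Lambda>. X i a \<omega>) \<in> borel_measurable M"
  using max_array.Xm[OF X_array[OF zero_less_one]] by (intro borel_measurable_sum)

lemma Mstat_prob_bounds:
  assumes ne: "U \<noteq> {}" and L: "0 < L" and dl: "dlt L < 1" and x: "0 \<le> x'" "0 \<le> x''" "0 \<le> c"
    and u: "c * (1 + dlt L) \<le> x'^2" and l: "x''^2 \<le> (1 - dlt L) * c"
  shows "prob {\<omega> \<in> space M. Mstat p (N 1) (\<lambda>l i j. S 1 l \<omega> i j) (N 2) (\<lambda>l i j. S 2 l \<omega> i j) \<le> c}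
      \<le> prob {\<omega> \<in> space M. \<forall>a\<in>U. \<bar>\<Sum>i\<in>\<Lambda>. X i a \<omega>\<bar> \<le> x'} + prob (Bad L)"
    and "prob {\<omega> \<in> space M. \<forall>a\<in>U. \<bar>\<Sum>i\<in>\<Lambda>. X i a \<omega>\<bar> \<le> x''} - prob (Bad L)
      \<le> prob {\<omega> \<in> space M. Mstat p (N 1) (\<lambda>l i j. S 1 l \<omega> i j) (N 2) (\<lambda>l i j. S 2 l \<omega> i j) \<le> c}"
proof -
  let ?T = "{\<omega> \<in> space M. \<forall>a\<in>U. (Ts a \<omega>)^2 \<le> c}"
  let ?S = "\<lambda>x. {\<omega> \<in> space M. \<forall>a\<in>U. \<bar>\<Sum>i\<in>\<Lambda>. X i a \<omega>\<bar> \<le> x}"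
  note [measurable] = X_sum_meas
  have Tm: "?T \<in> events"
  proof -
    have "{\<omega> \<in> space M. (Ts a \<omega>)^2 \<le> c} \<in> events" if "a \<in> U" for a
    proof -
      note [measurable] = Ts_meas[OF that]
      show ?thesis by measurable
    qed
    then show ?thesis using finU by (intro sets.sets_Collect_finite_All) auto
  qed
  have Sm': "?S x \<in> events" for x
    using finU by (intro sets.sets_Collect_finite_All) measurable
  have TT: "{\<omega> \<in> space M. Mstat p (N 1) (\<lambda>l i j. S 1 l \<omega> i j) (N 2) (\<lambda>l i j. S 2 l \<omega> i j) \<le> c} = ?T"
    unfolding Mstat_le_iff[OF ne] ..
  have d0: "0 \<le> dlt L"
  proof -
    have "0 \<le> t1 L" unfolding t1_def using tau L nn_pos by simp
    then show ?thesis unfolding dlt_def using theta by simp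
  qed
  have "?T \<subseteq> ?S x' \<union> Bad L"
  proof
    fix \<omega> assume w: "\<omega> \<in> ?T"
    show "\<omega> \<in> ?S x' \<union> Bad L"
    proof (cases "\<omega> \<in> Bad L")
      case False
      have "\<bar>\<Sum>i\<in>\<Lambda>. X i a \<omega>\<bar> \<le> x'" if a: "a \<in> U" for a
      proof -
        have "(\<Sum>i\<in>\<Lambda>. X i a \<omega>)^2 \<le> (1 + dlt L) * (Ts a \<omega>)^2" using w False by (intro T_good a L dl) auto
        also have "\<dots> \<le> (1 + dlt L) * c" using w a d0 by (intro mult_left_mono) auto
        also have "\<dots> \<le> x'^2" using u by (simp add: mult.commute)
        finally show ?thesis using x by (simp add: abs_le_square_iff[symmetric])
      qed
      then show ?thesis using w by auto
    qed simp
  qed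
  then have "prob ?T \<le> prob (?S x' \<union> Bad L)" using Sm' Bad_sets by (intro finite_measure_mono) auto
  also have "\<dots> \<le> prob (?S x') + prob (Bad L)" using Sm' Bad_sets by (intro measure_Un_le) auto
  finally show "prob {\<omega> \<in> space M. Mstat p (N 1) (\<lambda>l i j. S 1 l \<omega> i j) (N 2) (\<lambda>l i j. S 2 l \<omega> i j) \<le> c}
      \<le> prob (?S x') + prob (Bad L)" unfolding TT .
  have "?S x'' \<subseteq> ?T \<union> Bad L"
  proof
    fix \<omega> assume w: "\<omega> \<in> ?S x''"
    show "\<omega> \<in> ?T \<union> Bad L"
    proof (cases "\<omega> \<in> Bad L")
      case False
      have "(Ts a \<omega>)^2 \<le> c" if a: "a \<in> U" for a
      proof -
        have "(1 - dlt L) * (Ts a \<omega>)^2 \<le> (\<Sum>i\<in>\<Lambda>. X i a \<omega>)^2" using w False by (intro T_good a L dl) auto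
        also have "\<dots> \<le> x''^2" using w a x by (simp add: abs_le_square_iff[symmetric])
        also have "\<dots> \<le> (1 - dlt L) * c" by (rule l)
        finally show ?thesis using dl by simp
      qed
      then show ?thesis using w by auto
    qed simp
  qed
  then have "prob (?S x'') \<le> prob (?T \<union> Bad L)" using Tm Bad_sets by (intro finite_measure_mono) auto
  also have "\<dots> \<le> prob ?T + prob (Bad L)" using Tm Bad_sets by (intro measure_Un_le) auto
  finally show "prob (?S x'') - prob (Bad L)
      \<le> prob {\<omega> \<in> space M. Mstat p (N 1) (\<lambda>l i j. S 1 l \<omega> i j) (N 2) (\<lambda>l i j. S 2 l \<omega> i j) \<le> c}" unfolding TT by simp
qed

end

section \<open>Truncation levels and rates\<close>

lemma (in prob_space) expectation_le_of_nn_integral: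
  fixes f \<Phi> :: "'a \<Rightarrow> real"
  assumes P: "\<Phi> \<in> borel_measurable M" "(\<integral>\<^sup>+\<omega>. ennreal (\<Phi> \<omega>) \<partial>M) \<le> ennreal K"
    and c: "0 \<le> c" and K: "0 \<le> K" and f: "\<And>\<omega>. f \<omega> \<le> c * \<Phi> \<omega>"
  shows "expectation f \<le> c * K"
proof (rule integral_real_bounded)
  show "0 \<le> c * K" using c K by simp
  have "(\<integral>\<^sup>+\<omega>. ennreal (f \<omega>) \<partial>M) \<le> (\<integral>\<^sup>+\<omega>. ennreal c * ennreal (\<Phi> \<omega>) \<partial>M)"
    using f c by (intro nn_integral_mono) (simp add: ennreal_mult'[symmetric] ennreal_leI)
  also have "\<dots> = ennreal c * (\<integral>\<^sup>+\<omega>. ennreal (\<Phi> \<omega>) \<partial>M)" using P by (intro nn_integral_cmult) auto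
  also have "\<dots> \<le> ennreal c * ennreal K" using P by (intro mult_left_mono) auto
  also have "\<dots> = ennreal (c * K)" using c K by (simp add: ennreal_mult)
  finally show "(\<integral>\<^sup>+\<omega>. ennreal (f \<omega>) \<partial>M) \<le> ennreal (c * K)" .
qed

lemma (in prob_space) gaussian_tail_bounds:
  fixes z :: "'a \<Rightarrow> real"
  assumes [measurable]: "z \<in> borel_measurable M"
    and K: "(\<integral>\<^sup>+\<omega>. ennreal (exp (\<eta> * (z \<omega>)^2)) \<partial>M) \<le> ennreal K" "0 < K" and eta: "0 < \<eta>" and tau: "0 \<le> \<tau>"
  shows "expectation (\<lambda>\<omega>. if \<bar>z \<omega>\<bar> \<le> \<tau> then 0 else (z \<omega>)^2) \<le> (2 / \<eta> * exp (- \<eta> * \<tau>^2 / 2)) * K"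
    and "prob {\<omega> \<in> space M. \<tau> < \<bar>z \<omega>\<bar>} \<le> exp (- \<eta> * \<tau>^2) * K"
proof -
  have big: "\<tau>^2 \<le> (z \<omega>)^2" if "\<tau> < \<bar>z \<omega>\<bar>" for \<omega>
    using that tau power_mono[of \<tau> "\<bar>z \<omega>\<bar>" 2] by simp
  show "expectation (\<lambda>\<omega>. if \<bar>z \<omega>\<bar> \<le> \<tau> then 0 else (z \<omega>)^2) \<le> (2 / \<eta> * exp (- \<eta> * \<tau>^2 / 2)) * K"
  proof (rule expectation_le_of_nn_integral[OF _ K(1)])
    fix \<omega>
    show "(if \<bar>z \<omega>\<bar> \<le> \<tau> then 0 else (z \<omega>)^2) \<le> 2 / \<eta> * exp (- \<eta> * \<tau>^2 / 2) * exp (\<eta> * (z \<omega>)^2)"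
    proof (cases "\<bar>z \<omega>\<bar> \<le> \<tau>")
      case False
      have "\<eta> * (z \<omega>)^2 / 2 \<le> exp (\<eta> * (z \<omega>)^2 / 2)"
        using exp_ge_add_one_self[of "\<eta> * (z \<omega>)^2 / 2"] by linarith
      then have "(z \<omega>)^2 \<le> 2 / \<eta> * exp (\<eta> * (z \<omega>)^2 / 2)" using eta by (simp add: field_simps)
      also have "\<dots> \<le> 2 / \<eta> * (exp (- \<eta> * \<tau>^2 / 2) * exp (\<eta> * (z \<omega>)^2))"
      proof (intro mult_left_mono)
        have "\<eta> * \<tau>^2 \<le> \<eta> * (z \<omega>)^2" using big[of \<omega>] False eta by (intro mult_left_mono) auto
        then show "exp (\<eta> * (z \<omega>)^2 / 2) \<le> exp (- \<eta> * \<tau>^2 / 2) * exp (\<eta> * (z \<omega>)^2)"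
          unfolding exp_add[symmetric] by simp
      qed (use eta in auto)
      finally show ?thesis using False by (simp only: if_False mult.assoc)
    qed (use eta in auto)
  qed (use K eta in auto)
  have "expectation (indicator {\<omega> \<in> space M. \<tau> < \<bar>z \<omega>\<bar>}) \<le> exp (- \<eta> * \<tau>^2) * K"
  proof (rule expectation_le_of_nn_integral[OF _ K(1)])
    fix \<omega>
    show "indicator {\<omega> \<in> space M. \<tau> < \<bar>z \<omega>\<bar>} \<omega> \<le> exp (- \<eta> * \<tau>^2) * exp (\<eta> * (z \<omega>)^2)"
    proof (cases "\<tau> < \<bar>z \<omega>\<bar>")
      case True
      have "\<eta> * \<tau>^2 \<le> \<eta> * (z \<omega>)^2" using big[OF True] eta by (intro mult_left_mono) auto
      then have "1 \<le> exp (- \<eta> * \<tau>^2) * exp (\<eta> * (z \<omega>)^2)" unfolding exp_add[symmetric] by simp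
      then show ?thesis by (auto simp: indicator_def)
    qed (auto simp: indicator_def)
  qed (use K in auto)
  then show "prob {\<omega> \<in> space M. \<tau> < \<bar>z \<omega>\<bar>} \<le> exp (- \<eta> * \<tau>^2) * K" by simp
qed

lemma (in prob_space) polynomial_tail_bounds:
  fixes z :: "'a \<Rightarrow> real"
  assumes [measurable]: "z \<in> borel_measurable M"
    and K: "(\<integral>\<^sup>+\<omega>. ennreal (\<bar>z \<omega>\<bar> powr a) \<partial>M) \<le> ennreal K" "0 < K" and a: "2 \<le> a" and tau: "0 < \<tau>"
  shows "expectation (\<lambda>\<omega>. if \<bar>z \<omega>\<bar> \<le> \<tau> then 0 else (z \<omega>)^2) \<le> \<tau> powr (2 - a) * K"
    and "prob {\<omega> \<in> space M. \<tau> < \<bar>z \<omega>\<bar>} \<le> \<tau> powr (- a) * K"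
proof -
  show "expectation (\<lambda>\<omega>. if \<bar>z \<omega>\<bar> \<le> \<tau> then 0 else (z \<omega>)^2) \<le> \<tau> powr (2 - a) * K"
  proof (rule expectation_le_of_nn_integral[OF _ K(1)])
    fix \<omega>
    show "(if \<bar>z \<omega>\<bar> \<le> \<tau> then 0 else (z \<omega>)^2) \<le> \<tau> powr (2 - a) * \<bar>z \<omega>\<bar> powr a"
    proof (cases "\<bar>z \<omega>\<bar> \<le> \<tau>")
      case False
      have p: "0 < \<bar>z \<omega>\<bar>" using False tau by linarith
      have "(z \<omega>)^2 = \<bar>z \<omega>\<bar> powr (2 - a) * \<bar>z \<omega>\<bar> powr a"
        using p by (simp add: powr_add[symmetric])
      also have "\<dots> \<le> \<tau> powr (2 - a) * \<bar>z \<omega>\<bar> powr a"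
        using False tau a by (intro mult_right_mono powr_mono2') auto
      finally show ?thesis using False by simp
    qed simp
  qed (use K in auto)
  have "expectation (indicator {\<omega> \<in> space M. \<tau> < \<bar>z \<omega>\<bar>}) \<le> \<tau> powr (- a) * K"
  proof (rule expectation_le_of_nn_integral[OF _ K(1)])
    fix \<omega>
    show "indicator {\<omega> \<in> space M. \<tau> < \<bar>z \<omega>\<bar>} \<omega> \<le> \<tau> powr (- a) * \<bar>z \<omega>\<bar> powr a"
    proof (cases "\<tau> < \<bar>z \<omega>\<bar>")
      case True
      have "1 = \<tau> powr (- a) * \<tau> powr a" using tau by (simp add: powr_add[symmetric])
      also have "\<dots> \<le> \<tau> powr (- a) * \<bar>z \<omega>\<bar> powr a"
        using True tau a by (intro mult_left_mono powr_mono2) auto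
      finally show ?thesis by (auto simp: indicator_def)
    qed (auto simp: indicator_def)
  qed (use K in auto)
  then show "prob {\<omega> \<in> space M. \<tau> < \<bar>z \<omega>\<bar>} \<le> \<tau> powr (- a) * K" by simp
qed

lemma card_upper_pairs: "real (card (upper_pairs p)) = real p * (real p - 1) / 2"
proof -
  have "upper_pairs p = (SIGMA j:{..<p}. {..<j})\<inverse>"
    by (auto simp: upper_pairs_def)
  then have "card (upper_pairs p) = card (SIGMA j:{..<p}. {..<j})" by (simp add: card_inverse)
  also have "\<dots> = (\<Sum>j<p. j)" by (subst card_SigmaI) auto
  finally have "real (card (upper_pairs p)) = (\<Sum>j<p. real j)" by simp
  also have "\<dots> = real p * (real p - 1) / 2" by (induction p) (auto simp: field_simps)
  finally show ?thesis .
qed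

lemma nn_bounds:
  fixes n1 n2 c :: real
  assumes "0 < n1" "0 < n2" "n1 \<le> c * n2" "n2 \<le> c * n1"
  shows "n1 + n2 \<le> (2 * c + 2) * (n1 * n2 / (n1 + n2))"
proof -
  have "n1 * n1 \<le> (c * n2) * n1" "n2 * n2 \<le> (c * n1) * n2" using assms by (auto intro!: mult_right_mono)
  then have "(n1 + n2) * (n1 + n2) \<le> (2 * c + 2) * (n1 * n2)" by (simp add: algebra_simps)
  then show ?thesis using assms by (simp add: field_simps)
qed

lemma powr_neg_lim:
  assumes n: "filterlim n at_top sequentially" and e: "e < 0"
  shows "(\<lambda>k. C * (n k :: real) powr e) \<longlonglongrightarrow> 0"
  using tendsto_mult[OF tendsto_const[of C] tendsto_neg_powr[OF e n]] by simp

lemma rate_kappa: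
  fixes n L :: "nat \<Rightarrow> real"
  assumes n: "filterlim n at_top sequentially"
    and L: "eventually (\<lambda>k. 0 \<le> L k \<and> L k \<le> n k powr \<nu>) sequentially"
  shows "eventually (\<lambda>k. (L k powr (3/5))^3 \<le> n k powr (9 * \<nu> / 5)) sequentially"
    "eventually (\<lambda>k. (L k powr (3/5))^2 \<le> n k powr (6 * \<nu> / 5)) sequentially"
proof -
  have n1: "eventually (\<lambda>k. 1 \<le> n k) sequentially" using n by (simp add: filterlim_at_top)
  have *: "eventually (\<lambda>k. 0 \<le> L k powr (3/5) \<and> L k powr (3/5) \<le> n k powr (3 * \<nu> / 5)) sequentially"
    using L n1
  proof eventually_elim
    case (elim k)
    have "L k powr (3/5) \<le> (n k powr \<nu>) powr (3/5)" using elim by (intro powr_mono2) auto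
    then show ?case by (simp add: powr_powr mult.commute)
  qed
  show "eventually (\<lambda>k. (L k powr (3/5))^3 \<le> n k powr (9 * \<nu> / 5)) sequentially"
    using * n1
  proof eventually_elim
    case (elim k)
    have "(L k powr (3/5))^3 \<le> (n k powr (3 * \<nu> / 5))^3" using elim by (intro power_mono) auto
    also have "\<dots> = n k powr (9 * \<nu> / 5)" using elim by (simp add: powr_power)
    finally show ?case .
  qed
  show "eventually (\<lambda>k. (L k powr (3/5))^2 \<le> n k powr (6 * \<nu> / 5)) sequentially"
    using * n1
  proof eventually_elim
    case (elim k)
    have "(L k powr (3/5))^2 \<le> (n k powr (3 * \<nu> / 5))^2" using elim by (intro power_mono) auto
    also have "\<dots> = n k powr (6 * \<nu> / 5)" using elim by (simp add: powr_power)
    finally show ?case .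
  qed
qed

lemma rate_b:
  fixes n L :: "nat \<Rightarrow> real"
  assumes n: "filterlim n at_top sequentially"
    and L: "eventually (\<lambda>k. 0 \<le> L k \<and> L k \<le> n k powr \<nu>) sequentially"
    and e: "9 * \<nu> / 5 + \<alpha> < 1/2"
  shows "(\<lambda>k. (L k powr (3/5))^3 * (n k powr \<alpha> / sqrt (n k))) \<longlonglongrightarrow> 0"
proof (rule Lim_null_comparison)
  have "9 * \<nu> / 5 + \<alpha> - 1/2 < 0" using e by simp
  from powr_neg_lim[OF n this, of 1] show "(\<lambda>k. n k powr (9 * \<nu> / 5 + \<alpha> - 1/2)) \<longlonglongrightarrow> 0" by simp
  have n1: "eventually (\<lambda>k. 1 \<le> n k) sequentially" using n by (simp add: filterlim_at_top)
  show "eventually (\<lambda>k. norm ((L k powr (3/5))^3 * (n k powr \<alpha> / sqrt (n k))) \<le> n k powr (9 * \<nu> / 5 + \<alpha> - 1/2)) sequentially"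
    using rate_kappa(1)[OF n L] n1
  proof eventually_elim
    case (elim k)
    have "(L k powr (3/5))^3 * (n k powr \<alpha> / sqrt (n k)) \<le> n k powr (9 * \<nu> / 5) * (n k powr \<alpha> / sqrt (n k))"
      using elim by (intro mult_right_mono) auto
    also have "\<dots> = n k powr (9 * \<nu> / 5 + \<alpha> - 1/2)"
      using elim by (simp add: powr_add powr_diff powr_half_sqrt)
    finally show ?case using elim by simp
  qed
qed

lemma rates_C1:
  fixes n q h pp :: "nat \<Rightarrow> real"
  assumes n: "filterlim n at_top sequentially"
    and q: "eventually (\<lambda>k. 1 < q k \<and> q k \<le> (pp k)^2 \<and> 0 < pp k) sequentially"
    and h: "eventually (\<lambda>k. 0 \<le> h k \<and> h k \<le> c * n k) sequentially"
    and o: "(\<lambda>k. ln (pp k)) \<in> o(\<lambda>k. n k powr (1/5))" and eta: "0 < \<eta>" and K: "0 < K"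
  shows "(\<lambda>k. (ln (q k) powr (3/5))^3 * (n k powr (1/8) / sqrt (n k))) \<longlonglongrightarrow> 0"
    "(\<lambda>k. (ln (q k) powr (3/5))^2 * sqrt (2 / \<eta> * exp (- \<eta> * (n k powr (1/8))^2 / 2) * K)) \<longlonglongrightarrow> 0"
    "(\<lambda>k. h k * (q k * (exp (- \<eta> * (n k powr (1/8))^2) * K))) \<longlonglongrightarrow> 0"
proof -
  have n1: "eventually (\<lambda>k. 1 \<le> n k) sequentially" using n by (simp add: filterlim_at_top)
  have "eventually (\<lambda>k. norm (ln (pp k)) \<le> 1/2 * norm (n k powr (1/5))) sequentially"
    by (rule landau_o.smallD[OF o]) simp
  with q have L: "eventually (\<lambda>k. 0 \<le> ln (q k) \<and> ln (q k) \<le> n k powr (1/5)) sequentially"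
  proof eventually_elim
    case (elim k)
    have "ln (q k) \<le> ln ((pp k)^2)" using elim by (intro ln_mono) auto
    also have "\<dots> = 2 * ln (pp k)" using elim by (simp add: ln_realpow)
    finally show ?case using elim by (auto simp: abs_le_iff)
  qed
  show "(\<lambda>k. (ln (q k) powr (3/5))^3 * (n k powr (1/8) / sqrt (n k))) \<longlonglongrightarrow> 0"
    by (rule rate_b[OF n L]) simp
  have l2: "((\<lambda>x. x powr (6 * (1/5) / 5) * sqrt (2 / \<eta> * exp (- \<eta> * (x powr (1/8))^2 / 2) * K)) \<longlongrightarrow> 0) at_top"
    using eta K by real_asymp
  show "(\<lambda>k. (ln (q k) powr (3/5))^2 * sqrt (2 / \<eta> * exp (- \<eta> * (n k powr (1/8))^2 / 2) * K)) \<longlonglongrightarrow> 0"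
  proof (rule Lim_null_comparison[OF _ filterlim_compose[OF l2 n]])
    show "eventually (\<lambda>k. norm ((ln (q k) powr (3/5))^2 * sqrt (2 / \<eta> * exp (- \<eta> * (n k powr (1/8))^2 / 2) * K))
       \<le> n k powr (6 * (1/5) / 5) * sqrt (2 / \<eta> * exp (- \<eta> * (n k powr (1/8))^2 / 2) * K)) sequentially"
      using rate_kappa(2)[OF n L]
    proof eventually_elim
      case (elim k)
      have s0: "0 \<le> sqrt (2 / \<eta> * exp (- \<eta> * (n k powr (1/8))^2 / 2) * K)" using eta K by simp
      have "norm ((ln (q k) powr (3/5))^2 * sqrt (2 / \<eta> * exp (- \<eta> * (n k powr (1/8))^2 / 2) * K))
         = (ln (q k) powr (3/5))^2 * sqrt (2 / \<eta> * exp (- \<eta> * (n k powr (1/8))^2 / 2) * K)"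
        using s0 unfolding real_norm_def by (intro abs_of_nonneg mult_nonneg_nonneg) auto
      then show ?case using mult_right_mono[OF elim s0] by (simp only:)
    qed
  qed
  have l3: "((\<lambda>x. c * x * (exp (x powr (1/5)) * (exp (- \<eta> * (x powr (1/8))^2) * K))) \<longlongrightarrow> 0) at_top"
    using eta K by real_asymp
  show "(\<lambda>k. h k * (q k * (exp (- \<eta> * (n k powr (1/8))^2) * K))) \<longlonglongrightarrow> 0"
  proof (rule Lim_null_comparison[OF _ filterlim_compose[OF l3 n]])
    show "eventually (\<lambda>k. norm (h k * (q k * (exp (- \<eta> * (n k powr (1/8))^2) * K)))
       \<le> c * n k * (exp (n k powr (1/5)) * (exp (- \<eta> * (n k powr (1/8))^2) * K))) sequentially"
      using L q h
    proof eventually_elim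
      case (elim k)
      have "q k = exp (ln (q k))" using elim by simp
      also have "\<dots> \<le> exp (n k powr (1/5))" using elim(1) by (simp only: exp_le_cancel_iff)
      finally have qe: "q k \<le> exp (n k powr (1/5))" .
      have "h k * (q k * (exp (- \<eta> * (n k powr (1/8))^2) * K)) \<le> c * n k * (exp (n k powr (1/5)) * (exp (- \<eta> * (n k powr (1/8))^2) * K))"
        using elim qe K by (intro mult_mono mult_right_mono) auto
      moreover have "0 \<le> h k * (q k * (exp (- \<eta> * (n k powr (1/8))^2) * K))" using elim K by simp
      ultimately show ?case by (simp only: real_norm_def abs_of_nonneg)
    qed
  qed
qed

lemma rates_C2:
  fixes n q h pp :: "nat \<Rightarrow> real" and \<gamma>0 \<epsilon> c0 K :: real
  assumes n: "filterlim n at_top sequentially"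
    and q: "eventually (\<lambda>k. 1 < q k \<and> q k \<le> (pp k)^2 \<and> 0 < pp k) sequentially"
    and h: "eventually (\<lambda>k. 0 \<le> h k \<and> h k \<le> c * n k) sequentially" and c: "0 < c"
    and pp: "\<And>k. pp k \<le> c0 * n k powr \<gamma>0" and g: "0 < \<gamma>0" "0 < c0" and eps: "0 < \<epsilon>" and K: "0 < K"
  defines "a \<equiv> 4 * \<gamma>0 + 2 + \<epsilon>"
  defines "\<alpha> \<equiv> (2 * \<gamma>0 + 1 + \<epsilon> / 4) / a"
  shows "(\<lambda>k. (ln (q k) powr (3/5))^3 * (n k powr \<alpha> / sqrt (n k))) \<longlonglongrightarrow> 0"
    "(\<lambda>k. (ln (q k) powr (3/5))^2 * sqrt ((n k powr \<alpha>) powr (2 - a) * K)) \<longlonglongrightarrow> 0"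
    "(\<lambda>k. h k * (q k * ((n k powr \<alpha>) powr (- a) * K))) \<longlonglongrightarrow> 0"
proof -
  have n1: "eventually (\<lambda>k. 1 \<le> n k) sequentially" using n by (simp add: filterlim_at_top)
  have a2: "2 < a" using g eps by (simp add: a_def)
  have al0: "0 < \<alpha>" unfolding \<alpha>_def using g eps a2 by (intro divide_pos_pos) auto
  have al1: "\<alpha> < 1/2" unfolding \<alpha>_def using a2 eps by (simp add: divide_less_eq a_def)
  have ala: "\<alpha> * a = 2 * \<gamma>0 + 1 + \<epsilon> / 4" unfolding \<alpha>_def using a2 by simp
  define \<nu> where "\<nu> = min ((1/2 - \<alpha>) / 4) (\<alpha> * (a - 2) / 8)"
  have nu0: "0 < \<nu>" unfolding \<nu>_def using al0 al1 a2 by simp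
  have nu1: "\<nu> \<le> (1/2 - \<alpha>) / 4" "\<nu> \<le> \<alpha> * (a - 2) / 8" 
    unfolding \<nu>_def by (rule min.cobounded1, rule min.cobounded2)
  have "eventually (\<lambda>x. 2 * (ln c0 + \<gamma>0 * ln x) \<le> x powr \<nu>) at_top" using nu0 g by real_asymp
  then have "eventually (\<lambda>k. 2 * (ln c0 + \<gamma>0 * ln (n k)) \<le> n k powr \<nu>) sequentially"
    using n by (rule eventually_compose_filterlim)
  with q n1 have L: "eventually (\<lambda>k. 0 \<le> ln (q k) \<and> ln (q k) \<le> n k powr \<nu>) sequentially"
  proof eventually_elim
    case (elim k)
    have "ln (q k) \<le> ln ((pp k)^2)" using elim by (intro ln_mono) auto
    also have "\<dots> = 2 * ln (pp k)" using elim by (simp add: ln_realpow)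
    also have "\<dots> \<le> 2 * ln (c0 * n k powr \<gamma>0)" using elim pp[of k] by simp
    also have "ln (c0 * n k powr \<gamma>0) = ln c0 + \<gamma>0 * ln (n k)" using g elim by (simp add: ln_mult ln_powr)
    finally show ?case using elim by auto
  qed
  show "(\<lambda>k. (ln (q k) powr (3/5))^3 * (n k powr \<alpha> / sqrt (n k))) \<longlonglongrightarrow> 0"
    using nu1(1) al1 by (intro rate_b[OF n L]) (simp add: field_simps)
  have ex: "6 * \<nu> / 5 + \<alpha> * (2 - a) / 2 < 0"
  proof -
    have "0 < \<alpha> * (a - 2)" using al0 a2 by simp
    moreover have "\<alpha> * (2 - a) = - (\<alpha> * (a - 2))" by (simp add: algebra_simps)
    moreover have "0 < u \<Longrightarrow> v = - u \<Longrightarrow> \<nu> \<le> u / 8 \<Longrightarrow> 6 * \<nu> / 5 + v / 2 < 0" for u v :: real by linarith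
    ultimately show ?thesis using nu1(2) by blast
  qed
  show "(\<lambda>k. (ln (q k) powr (3/5))^2 * sqrt ((n k powr \<alpha>) powr (2 - a) * K)) \<longlonglongrightarrow> 0"
  proof (rule Lim_null_comparison[OF _ powr_neg_lim[OF n ex, of "sqrt K"]])
    show "eventually (\<lambda>k. norm ((ln (q k) powr (3/5))^2 * sqrt ((n k powr \<alpha>) powr (2 - a) * K))
       \<le> sqrt K * n k powr (6 * \<nu> / 5 + \<alpha> * (2 - a) / 2)) sequentially"
      using rate_kappa(2)[OF n L] n1
    proof eventually_elim
      case (elim k)
      have s: "sqrt ((n k powr \<alpha>) powr (2 - a) * K) = sqrt K * n k powr (\<alpha> * (2 - a) / 2)"
        using elim by (simp add: powr_powr real_sqrt_mult powr_half_sqrt[symmetric])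
      have s0: "0 \<le> sqrt K * n k powr (\<alpha> * (2 - a) / 2)" using K by simp
      have "(ln (q k) powr (3/5))^2 * (sqrt K * n k powr (\<alpha> * (2 - a) / 2)) \<le> n k powr (6 * \<nu> / 5) * (sqrt K * n k powr (\<alpha> * (2 - a) / 2))"
        using elim s0 by (intro mult_right_mono) auto
      also have "\<dots> = sqrt K * n k powr (6 * \<nu> / 5 + \<alpha> * (2 - a) / 2)" by (simp add: powr_add)
      finally show ?case unfolding s using K by (simp add: abs_mult)
    qed
  qed
  have e4: "- \<epsilon> / 4 < 0" using eps by simp
  show "(\<lambda>k. h k * (q k * ((n k powr \<alpha>) powr (- a) * K))) \<longlonglongrightarrow> 0"
  proof (rule Lim_null_comparison[OF _ powr_neg_lim[OF n e4, of "c * c0^2 * K"]])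
    show "eventually (\<lambda>k. norm (h k * (q k * ((n k powr \<alpha>) powr (- a) * K))) \<le> c * c0^2 * K * n k powr (- \<epsilon> / 4)) sequentially"
      using q h n1
    proof eventually_elim
      case (elim k)
      have "(pp k)^2 \<le> (c0 * n k powr \<gamma>0)^2" using elim pp[of k] by (intro power_mono) auto
      also have "\<dots> = c0^2 * n k powr (2 * \<gamma>0)" using elim by (simp add: power_mult_distrib powr_power mult.commute)
      finally have qq: "q k \<le> c0^2 * n k powr (2 * \<gamma>0)" using elim by linarith
      have t: "(n k powr \<alpha>) powr (- a) = n k powr (- (2 * \<gamma>0 + 1 + \<epsilon> / 4))"
        by (simp add: powr_powr ala)
      have "h k * (q k * ((n k powr \<alpha>) powr (- a) * K)) \<le> c * n k * ((c0^2 * n k powr (2 * \<gamma>0)) * (n k powr (- (2 * \<gamma>0 + 1 + \<epsilon> / 4)) * K))"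
        unfolding t using elim qq K c by (intro mult_mono mult_right_mono) auto
      also have "\<dots> = c * c0^2 * K * (n k powr 1 * n k powr (2 * \<gamma>0) * n k powr (- (2 * \<gamma>0 + 1 + \<epsilon> / 4)))"
        using elim by simp
      also have "n k powr 1 * n k powr (2 * \<gamma>0) * n k powr (- (2 * \<gamma>0 + 1 + \<epsilon> / 4)) = n k powr (- \<epsilon> / 4)"
        by (simp only: powr_add[symmetric]) (simp add: algebra_simps)
      finally have 1: "h k * (q k * ((n k powr \<alpha>) powr (- a) * K)) \<le> c * c0^2 * K * n k powr (- \<epsilon> / 4)" .
      have "0 \<le> h k * (q k * ((n k powr \<alpha>) powr (- a) * K))" using elim K by simp
      with 1 show ?case by (simp only: real_norm_def abs_of_nonneg)
    qed
  qed
qed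

section \<open>The limit distribution\<close>

lemma two_sample_gumbel:
  fixes M :: "nat \<Rightarrow> 'a measure" and N :: "nat \<Rightarrow> nat \<Rightarrow> nat" and p :: "nat \<Rightarrow> nat"
    and S :: "nat \<Rightarrow> nat \<Rightarrow> nat \<Rightarrow> 'a \<Rightarrow> nat \<Rightarrow> nat \<Rightarrow> real" and C0 r y :: real and \<tau> \<theta> \<pi>0 :: "nat \<Rightarrow> real"
  assumes ts: "eventually (\<lambda>k. two_sample (M k) (N k) (p k) (S k) C0 r (\<tau> k) (\<theta> k) (\<pi>0 k)) sequentially"
  defines "q \<equiv> \<lambda>k. real (p k) * (real (p k) - 1) / 2"
    and "nn \<equiv> \<lambda>k. real (N k 1) * real (N k 2) / (real (N k 1) + real (N k 2))"
  assumes limq: "filterlim q at_top sequentially"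
    and L1: "(\<lambda>k. (ln (q k) powr (3/5))^3 * (\<tau> k / sqrt (nn k))) \<longlonglongrightarrow> 0"
    and L2: "(\<lambda>k. (ln (q k) powr (3/5))^2 * sqrt (\<theta> k)) \<longlonglongrightarrow> 0"
    and L3: "(\<lambda>k. (real (N k 1) + real (N k 2)) * (q k * \<pi>0 k)) \<longlonglongrightarrow> 0"
  shows "(\<lambda>k. measure (M k) {\<omega> \<in> space (M k).
       Mstat (p k) (N k 1) (\<lambda>l i j. S k 1 l \<omega> i j) (N k 2) (\<lambda>l i j. S k 2 l \<omega> i j)
         - 2 * ln (q k) + ln (ln (q k)) \<le> y}) \<longlonglongrightarrow> gumbel y"
proof -
  define \<kappa> where "\<kappa> k = ln (q k) powr (3/5)" for k
  define \<rho> where "\<rho> k = 1 / (ln (q k))^2" for k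
  let ?I = "\<lambda>k. SIGMA d:{1, 2}. {..<N k d}"
  let ?X = "\<lambda>k. two_sample.X (M k) (N k) (p k) (S k) (\<tau> k)"
  let ?Sg = "\<lambda>k. two_sample.strong (M k) (p k) (S k) (\<rho> k)"
  have qc: "q k = real (card (upper_pairs (p k)))" for k by (simp add: q_def card_upper_pairs)
  have nnk: "two_sample.nn (N k) = nn k" if "two_sample (M k) (N k) (p k) (S k) C0 r (\<tau> k) (\<theta> k) (\<pi>0 k)" for k
    using two_sample.nn_def[OF that] by (simp add: nn_def)
  have lnq: "filterlim (\<lambda>k. ln (q k)) at_top sequentially" by (rule filterlim_compose[OF ln_at_top limq])
  have lnq1: "eventually (\<lambda>k. 1 \<le> ln (q k)) sequentially" using lnq by (simp add: filterlim_at_top)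
  have q1: "eventually (\<lambda>k. 1 < q k) sequentially" using limq by (simp add: filterlim_at_top_dense)
  have kap1: "eventually (\<lambda>k. 1 \<le> \<kappa> k \<and> ln (q k) \<le> (\<kappa> k)^2 \<and> (ln (q k))^2 \<le> ((\<kappa> k)^3)^2
      \<and> ln (q k) * sqrt (ln (q k)) \<le> (\<kappa> k)^3) sequentially"
    using lnq1
  proof eventually_elim
    case (elim k)
    let ?L = "ln (q k)"
    have k2: "(\<kappa> k)^2 = ?L powr (6/5)" and k3: "(\<kappa> k)^3 = ?L powr (9/5)"
      unfolding \<kappa>_def using elim by (simp_all add: powr_power)
    have "?L powr 1 \<le> ?L powr (6/5)" "?L powr 1 \<le> ?L powr (9/5)" "?L powr (3/2) \<le> ?L powr (9/5)"
      using elim by (intro powr_mono; simp)+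
    moreover have "?L * sqrt ?L = ?L powr 1 * ?L powr (1/2)" using elim by (simp add: powr_half_sqrt)
    then have "?L * sqrt ?L = ?L powr (1 + 1/2)" by (simp only: powr_add)
    then have "?L * sqrt ?L = ?L powr (3/2)" by simp
    moreover have "1 \<le> \<kappa> k" unfolding \<kappa>_def using elim by (simp add: ge_one_powr_ge_zero)
    ultimately show ?case unfolding k2 k3 using elim by simp
  qed
  have L1': "(\<lambda>k. \<kappa> k ^ 3 * (\<tau> k / sqrt (nn k))) \<longlonglongrightarrow> 0" using L1 by (simp add: \<kappa>_def)
  have L2': "(\<lambda>k. \<kappa> k ^ 2 * sqrt (\<theta> k)) \<longlonglongrightarrow> 0" using L2 by (simp add: \<kappa>_def)
  have th: "eventually (\<lambda>k. 0 < \<theta> k \<and> \<theta> k \<le> sqrt (\<theta> k) \<and> 0 < \<pi>0 k \<and> 1 \<le> \<tau> k \<and> 0 < nn k) sequentially"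
    using ts
  proof eventually_elim
    case (elim k)
    note t = two_sample.theta[OF elim]
    have "sqrt (\<theta> k) * sqrt (\<theta> k) \<le> sqrt (\<theta> k) * 1" using t by (intro mult_left_mono) auto
    then show ?case using t two_sample.pi0[OF elim] two_sample.tau[OF elim] two_sample.nn_pos[OF elim]
      by (simp add: nnk[OF elim])
  qed
  have L2t: "(\<lambda>k. \<kappa> k ^ 2 * \<theta> k) \<longlonglongrightarrow> 0"
  proof (rule Lim_null_comparison[OF _ L2'])
    show "eventually (\<lambda>k. norm (\<kappa> k ^ 2 * \<theta> k) \<le> \<kappa> k ^ 2 * sqrt (\<theta> k)) sequentially"
      using th by eventually_elim (auto simp: abs_mult intro!: mult_left_mono)
  qed
  interpret seq: max_array_seq M ?I "\<lambda>k. upper_pairs (p k)" ?X "\<lambda>k i a. two_sample.cc (M k) (N k) (S k) (fst i) a"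
    "\<lambda>k i. 1 / real (N k (fst i))" "\<lambda>k. \<tau> k / sqrt (nn k)"
    "\<lambda>k. 2 * sqrt (real (N k 1) + real (N k 2)) * sqrt (\<pi>0 k)" \<theta> "\<lambda>k. \<rho> k + 3 * sqrt (\<theta> k)" r "2 * C0^4" ?Sg q \<kappa>
  proof
    show "eventually (\<lambda>k. max_array (M k) (?I k) (upper_pairs (p k)) (?X k) (\<lambda>i a. two_sample.cc (M k) (N k) (S k) (fst i) a)
       (\<lambda>i. 1 / real (N k (fst i))) (\<tau> k / sqrt (nn k)) (2 * sqrt (real (N k 1) + real (N k 2)) * sqrt (\<pi>0 k))
       (\<theta> k) (\<rho> k + 3 * sqrt (\<theta> k)) r (?Sg k)) sequentially"
      using ts lnq1
    proof eventually_elim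
      case (elim k)
      have "0 < \<rho> k" using elim by (simp add: \<rho>_def)
      from two_sample.X_array[OF elim(1) this] show ?case by (simp only: nnk[OF elim(1)])
    qed
    show "q k = real (card (upper_pairs (p k)))" for k by (rule qc)
    show "filterlim q at_top sequentially" by fact
    show "\<kappa> k = ln (q k) powr (3/5)" for k by (simp add: \<kappa>_def)
    show "(\<lambda>k. \<kappa> k ^ 3 * (\<tau> k / sqrt (nn k))) \<longlonglongrightarrow> 0" by fact
    show "(\<lambda>k. \<kappa> k ^ 2 * \<theta> k) \<longlonglongrightarrow> 0" by fact
    show "(\<lambda>k. \<kappa> k * (2 * sqrt (real (N k 1) + real (N k 2)) * sqrt (\<pi>0 k))) \<longlonglongrightarrow> 0"
    proof -
      have "((\<lambda>Q::real. ln Q powr (3/5) / sqrt Q) \<longlongrightarrow> 0) at_top" by real_asymp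
      from filterlim_compose[OF this limq] have "(\<lambda>k. \<kappa> k / sqrt (q k)) \<longlonglongrightarrow> 0" by (simp add: \<kappa>_def)
      from tendsto_mult[OF tendsto_mult[OF tendsto_const[of 2] this] tendsto_real_sqrt[OF L3]]
      have "(\<lambda>k. 2 * (\<kappa> k / sqrt (q k)) * sqrt ((real (N k 1) + real (N k 2)) * (q k * \<pi>0 k))) \<longlonglongrightarrow> 0" by simp
      moreover have "eventually (\<lambda>k. 2 * (\<kappa> k / sqrt (q k)) * sqrt ((real (N k 1) + real (N k 2)) * (q k * \<pi>0 k))
         = \<kappa> k * (2 * sqrt (real (N k 1) + real (N k 2)) * sqrt (\<pi>0 k))) sequentially"
        using q1 by eventually_elim (simp add: real_sqrt_mult)
      ultimately show ?thesis by (rule Lim_transform_eventually)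
    qed
    show "(\<lambda>k. \<kappa> k ^ 2 * (\<rho> k + 3 * sqrt (\<theta> k))) \<longlonglongrightarrow> 0"
    proof -
      have "((\<lambda>Q::real. (ln Q powr (3/5))^2 * (1 / (ln Q)^2)) \<longlongrightarrow> 0) at_top" by real_asymp
      from filterlim_compose[OF this limq] have "(\<lambda>k. \<kappa> k ^ 2 * \<rho> k) \<longlonglongrightarrow> 0" by (simp add: \<kappa>_def \<rho>_def)
      from tendsto_add[OF this tendsto_mult[OF tendsto_const[of 3] L2']] show ?thesis by (simp add: distrib_left mult_ac)
    qed
    have "\<exists>k. two_sample (M k) (N k) (p k) (S k) C0 r (\<tau> k) (\<theta> k) (\<pi>0 k)"
      using eventually_happens[OF ts] by (simp add: trivial_limit_sequentially)
    then have "0 < C0" using two_sample.C0 by blast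
    then show "0 < 2 * C0^4" by simp
    show "eventually (\<lambda>k. real (card (?Sg k)) \<le> 2 * C0^4 * q k * (ln (q k))^4) sequentially"
      using ts lnq1
    proof eventually_elim
      case (elim k)
      have r0: "0 < \<rho> k" using elim by (simp add: \<rho>_def)
      have "(\<rho> k)^2 = 1 / (ln (q k))^4" by (simp add: \<rho>_def power_divide)
      then show ?case using two_sample.card_strong[OF elim(1) r0] by (simp add: qc)
    qed
  qed
  define Bd where "Bd k = measure (M k) (two_sample.Bad (M k) (N k) (p k) (S k) (\<tau> k) (ln (q k)))" for k
  define \<delta> where "\<delta> k = two_sample.dlt (N k) (\<tau> k) (\<theta> k) (ln (q k))" for k
  have dk: "\<delta> k = \<tau> k * sqrt (8 * ln (q k) / nn k) + \<theta> k + (sqrt (8 * ln (q k) / nn k) + sqrt (\<theta> k))^2"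
    if "two_sample (M k) (N k) (p k) (S k) C0 r (\<tau> k) (\<theta> k) (\<pi>0 k)" for k
    unfolding \<delta>_def two_sample.dlt_def[OF that] two_sample.t1_def[OF that] two_sample.t2_def[OF that] nnk[OF that] ..
  define b where "b k = \<tau> k / sqrt (nn k)" for k
  have t1b: "eventually (\<lambda>k. ln (q k) * (\<tau> k * sqrt (8 * ln (q k) / nn k)) \<le> sqrt 8 * (\<kappa> k ^ 3 * b k)) sequentially"
    using kap1 th lnq1
  proof eventually_elim
    case (elim k)
    have "ln (q k) * (\<tau> k * sqrt (8 * ln (q k) / nn k)) = sqrt 8 * ((ln (q k) * sqrt (ln (q k))) * b k)"
      by (simp add: b_def real_sqrt_mult real_sqrt_divide)
    also have "\<dots> \<le> sqrt 8 * (\<kappa> k ^ 3 * b k)"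
      using elim by (intro mult_left_mono mult_right_mono) (auto simp: b_def)
    finally show ?case .
  qed
  have b0: "(\<lambda>k. \<kappa> k ^ 3 * b k) \<longlonglongrightarrow> 0" using L1' by (simp add: b_def)
  have Ld: "(\<lambda>k. ln (q k) * \<delta> k) \<longlonglongrightarrow> 0"
  proof (rule Lim_null_comparison)
    have "(\<lambda>k. sqrt 8 * (\<kappa> k ^ 3 * b k) + 3 * (\<kappa> k ^ 2 * \<theta> k) + 16 * (\<kappa> k ^ 3 * b k)^2) \<longlonglongrightarrow> sqrt 8 * 0 + 3 * 0 + 16 * 0^2"
      by (intro tendsto_intros b0 L2t)
    then show "(\<lambda>k. sqrt 8 * (\<kappa> k ^ 3 * b k) + 3 * (\<kappa> k ^ 2 * \<theta> k) + 16 * (\<kappa> k ^ 3 * b k)^2) \<longlonglongrightarrow> 0" by simp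
    show "eventually (\<lambda>k. norm (ln (q k) * \<delta> k) \<le> sqrt 8 * (\<kappa> k ^ 3 * b k) + 3 * (\<kappa> k ^ 2 * \<theta> k) + 16 * (\<kappa> k ^ 3 * b k)^2) sequentially"
      using ts t1b kap1 th lnq1
    proof eventually_elim
      case (elim k)
      let ?L = "ln (q k)" and ?s = "sqrt (8 * ln (q k) / nn k)"
      have s2: "?s^2 = 8 * ?L / nn k" using elim by simp
      have "(?s + sqrt (\<theta> k))^2 \<le> 2 * ?s^2 + 2 * (sqrt (\<theta> k))^2"
        using zero_le_power2[of "?s - sqrt (\<theta> k)"] by (simp add: power2_sum power2_diff)
      then have "(?s + sqrt (\<theta> k))^2 \<le> 16 * ?L / nn k + 2 * \<theta> k" unfolding s2 using elim by simp
      then have "?L * (?s + sqrt (\<theta> k))^2 \<le> ?L * (16 * ?L / nn k + 2 * \<theta> k)" using elim by (intro mult_left_mono) auto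
      also have "\<dots> = 16 * (?L^2 / nn k) + 2 * (?L * \<theta> k)" by (simp add: power2_eq_square algebra_simps)
      finally have A: "?L * (?s + sqrt (\<theta> k))^2 \<le> 16 * (?L^2 / nn k) + 2 * (?L * \<theta> k)" .
      have Lth: "?L * \<theta> k \<le> \<kappa> k ^ 2 * \<theta> k" using elim by (intro mult_right_mono) auto
      have "?L^2 / nn k \<le> ((\<kappa> k)^3)^2 * (\<tau> k)^2 / nn k"
      proof (intro divide_right_mono)
        have "?L^2 * 1 \<le> ((\<kappa> k)^3)^2 * (\<tau> k)^2" using elim by (intro mult_mono) auto
        then show "?L^2 \<le> ((\<kappa> k)^3)^2 * (\<tau> k)^2" by simp
      qed (use elim in auto)
      also have "\<dots> = (\<kappa> k ^ 3 * b k)^2" using elim by (simp add: b_def power_mult_distrib power_divide)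
      finally have Ln: "?L^2 / nn k \<le> (\<kappa> k ^ 3 * b k)^2" .
      have d0: "0 \<le> \<delta> k" unfolding dk[OF elim(1)] using elim by (intro add_nonneg_nonneg) auto
      have "?L * \<delta> k = ?L * (\<tau> k * ?s) + ?L * \<theta> k + ?L * (?s + sqrt (\<theta> k))^2"
        unfolding dk[OF elim(1)] by (simp only: distrib_left)
      also have "\<dots> \<le> sqrt 8 * (\<kappa> k ^ 3 * b k) + 3 * (\<kappa> k ^ 2 * \<theta> k) + 16 * (\<kappa> k ^ 3 * b k)^2"
        using A Lth Ln elim(2) by linarith
      finally show ?case using d0 elim by (simp add: abs_mult)
    qed
  qed
  have Bd0: "Bd \<longlonglongrightarrow> 0"
  proof (rule Lim_null_comparison)
    have "(\<lambda>k. 8 / q k) \<longlonglongrightarrow> 0" by (rule real_tendsto_divide_at_top[OF tendsto_const limq])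
    from tendsto_add[OF L3 this] show "(\<lambda>k. (real (N k 1) + real (N k 2)) * (q k * \<pi>0 k) + 8 / q k) \<longlonglongrightarrow> 0" by simp
    have "eventually (\<lambda>k. sqrt 8 * (\<kappa> k ^ 3 * b k) < 1) sequentially"
      by (rule order_tendstoD(2)[OF tendsto_mult_right_zero[OF b0]]) simp
    with ts t1b lnq1 q1 th show "eventually (\<lambda>k. norm (Bd k) \<le> (real (N k 1) + real (N k 2)) * (q k * \<pi>0 k) + 8 / q k) sequentially"
    proof eventually_elim
      case (elim k)
      let ?t = "\<tau> k * sqrt (8 * ln (q k) / nn k)"
      have "0 \<le> ?t" using elim by simp
      then have "1 * ?t \<le> ln (q k) * ?t" using elim by (intro mult_right_mono) auto
      then have t: "two_sample.t1 (N k) (\<tau> k) (ln (q k)) \<le> 1"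
        unfolding two_sample.t1_def[OF elim(1)] nnk[OF elim(1)] using elim by linarith
      have "Bd k \<le> (real (N k 1) + real (N k 2)) * (real (card (upper_pairs (p k))) * \<pi>0 k)
          + 8 * real (card (upper_pairs (p k))) * exp (- 2 * ln (q k))"
        unfolding Bd_def using elim by (intro two_sample.prob_Bad[OF elim(1) _ t]) auto
      also have "8 * real (card (upper_pairs (p k))) * exp (- 2 * ln (q k)) = 8 / q k"
      proof -
        have "exp (- 2 * ln (q k)) = 1 / (q k * q k)"
          using elim by (simp add: exp_minus exp_double power2_eq_square inverse_eq_divide)
        then show ?thesis using elim by (simp add: qc[symmetric])
      qed
      finally show ?case by (simp add: qc[symmetric] Bd_def)
    qed
  qed
  let ?P = "\<lambda>k. measure (M k) {\<omega> \<in> space (M k).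
       Mstat (p k) (N k 1) (\<lambda>l i j. S k 1 l \<omega> i j) (N k 2) (\<lambda>l i j. S k 2 l \<omega> i j)
         - 2 * ln (q k) + ln (ln (q k)) \<le> y}"
  let ?c = "\<lambda>k. 2 * ln (q k) - ln (ln (q k)) + y"
  let ?Q = "\<lambda>z k. measure (M k) {\<omega> \<in> space (M k). \<forall>a\<in>upper_pairs (p k). \<bar>\<Sum>i\<in>?I k. ?X k i a \<omega>\<bar> \<le> xcrit z (q k)}"
  have main: "eventually (\<lambda>k. ?P k \<le> ?Q (y + d) k + Bd k \<and> ?Q (y - d) k - Bd k \<le> ?P k) sequentially" if d: "0 < d" for d
  proof -
    have c1: "eventually (\<lambda>Q::real. 2 * ln Q - ln (ln Q) + y \<le> 3 * ln Q \<and> d \<le> 2 * ln Q - ln (ln Q) + y) at_top"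
      by (intro eventually_conj; real_asymp)
    then have cl: "eventually (\<lambda>k. ?c k \<le> 3 * ln (q k) \<and> d \<le> ?c k) sequentially"
      using limq by (rule eventually_compose_filterlim)
    have dd: "eventually (\<lambda>k. 3 * (ln (q k) * \<delta> k) < min d 1) sequentially"
      using d by (intro order_tendstoD(2)[OF tendsto_mult_right_zero[OF Ld]]) simp
    show ?thesis using ts cl dd lnq1 q1 th
    proof eventually_elim
      case (elim k)
      interpret T: two_sample "M k" "N k" "p k" "S k" C0 r "\<tau> k" "\<theta> k" "\<pi>0 k" by (rule elim(1))
      let ?L = "ln (q k)"
      have d0: "0 \<le> \<delta> k" unfolding dk[OF elim(1)] using elim by (intro add_nonneg_nonneg) auto
      have "1 * \<delta> k \<le> ?L * \<delta> k" using elim d0 by (intro mult_right_mono) auto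
      moreover have "3 * (?L * \<delta> k) < 1" "3 * (?L * \<delta> k) < d" using elim(3) by auto
      ultimately have d1: "\<delta> k < 1" using d0 by linarith
      have "?c k * \<delta> k \<le> (3 * ?L) * \<delta> k" using elim d0 by (intro mult_right_mono) auto
      then have cd: "?c k * \<delta> k \<le> d" using elim(3) by simp
      have ne: "upper_pairs (p k) \<noteq> {}" using elim(5) unfolding qc by auto
      have x1: "(xcrit (y + d) (q k))^2 = ?c k + d" "(xcrit (y - d) (q k))^2 = ?c k - d"
        unfolding xcrit_def using elim(2) d by (simp_all add: real_sqrt_pow2)
      have x0: "0 \<le> xcrit z (q k)" if "z \<in> {y + d, y - d}" for z
        unfolding xcrit_def using elim(2) d that by auto
      have ev: "{\<omega> \<in> space (M k). Mstat (p k) (N k 1) (\<lambda>l i j. S k 1 l \<omega> i j) (N k 2) (\<lambda>l i j. S k 2 l \<omega> i j)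
         - 2 * ln (q k) + ln (ln (q k)) \<le> y} = {\<omega> \<in> space (M k). Mstat (p k) (N k 1) (\<lambda>l i j. S k 1 l \<omega> i j) (N k 2) (\<lambda>l i j. S k 2 l \<omega> i j) \<le> ?c k}"
        by (intro Collect_cong conj_cong refl) linarith
      have L0: "0 < ?L" using elim(4) by simp
      have dl: "T.dlt ?L < 1" using d1 by (simp add: \<delta>_def)
      have c0: "0 \<le> ?c k" using elim(2) d by linarith
      have u: "?c k * (1 + T.dlt ?L) \<le> (xcrit (y + d) (q k))^2"
        unfolding x1 \<delta>_def[symmetric] using cd by (simp add: distrib_left)
      have l: "(xcrit (y - d) (q k))^2 \<le> (1 - T.dlt ?L) * ?c k"
        unfolding x1 \<delta>_def[symmetric] using cd by (simp add: left_diff_distrib mult.commute)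
      show ?case unfolding ev Bd_def using T.Mstat_prob_bounds[OF ne L0 dl x0[of "y + d"] x0[of "y - d"] c0 u l] by simp
    qed
  qed
  show ?thesis
  proof (rule tendsto_shift_sandwich[OF isCont_gumbel])
    fix d :: real assume d: "0 < d"
    show "\<exists>u. u \<longlonglongrightarrow> gumbel (y + d) \<and> eventually (\<lambda>k. ?P k \<le> u k) sequentially"
    proof (intro exI conjI)
      show "(\<lambda>k. ?Q (y + d) k + Bd k) \<longlonglongrightarrow> gumbel (y + d)"
        using tendsto_add[OF seq.max_prob_lim Bd0] by simp
      show "eventually (\<lambda>k. ?P k \<le> ?Q (y + d) k + Bd k) sequentially" using main[OF d] by eventually_elim simp
    qed
    show "\<exists>l. l \<longlonglongrightarrow> gumbel (y - d) \<and> eventually (\<lambda>k. l k \<le> ?P k) sequentially"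
    proof (intro exI conjI)
      show "(\<lambda>k. ?Q (y - d) k - Bd k) \<longlonglongrightarrow> gumbel (y - d)"
        using tendsto_diff[OF seq.max_prob_lim Bd0] by simp
      show "eventually (\<lambda>k. ?Q (y - d) k - Bd k \<le> ?P k) sequentially" using main[OF d] by eventually_elim simp
    qed
  qed
qed

theorem theorem3p1:
  fixes M :: "nat \<Rightarrow> 'a measure"
    and N :: "nat \<Rightarrow> nat \<Rightarrow> nat"  \<comment> \<open>N k d = n_d in the k-th experiment, d = 1, 2\<close>
    and p :: "nat \<Rightarrow> nat"
    and S :: "nat \<Rightarrow> nat \<Rightarrow> nat \<Rightarrow> 'a \<Rightarrow> nat \<Rightarrow> nat \<Rightarrow> real"  \<comment> \<open>S k d l \<omega> i j\<close>
  defines "nn \<equiv> (\<lambda>k. real (N k 1) * real (N k 2) / (real (N k 1) + real (N k 2)))"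
    and "q \<equiv> (\<lambda>k. real (p k) * (real (p k) - 1) / 2)"
    and "Svec \<equiv> (\<lambda>k d l \<omega>. restrict (\<lambda>(i, j). S k d l \<omega> i j) ({..<p k} \<times> {..<p k}))"
    and "Gam \<equiv> (\<lambda>k d a b. covar (M k) (\<lambda>\<omega>. S k d 0 \<omega> (fst a) (snd a)) (\<lambda>\<omega>. S k d 0 \<omega> (fst b) (snd b)))"
  assumes prob: "\<And>k. prob_space (M k)"
    \<comment> \<open>entries are random variables, matrices symmetric\<close>
    and meas: "\<And>k d l i j. d \<in> {1, 2} \<Longrightarrow> l < N k d \<Longrightarrow> i < p k \<Longrightarrow> j < p k \<Longrightarrow>
                  (\<lambda>\<omega>. S k d l \<omega> i j) \<in> borel_measurable (M k)"
    and sym: "\<And>k d l \<omega> i j. d \<in> {1, 2} \<Longrightarrow> l < N k d \<Longrightarrow> i < p k \<Longrightarrow> j < p k \<Longrightarrow>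
                  S k d l \<omega> i j = S k d l \<omega> j i"
    \<comment> \<open>all matrices S_{d,l} mutually independent (within and between samples)\<close>
    and indep: "\<And>k. prob_space.indep_vars (M k)
                  (\<lambda>_. PiM ({..<p k} \<times> {..<p k}) (\<lambda>_. borel))
                  (\<lambda>(d, l). Svec k d l) (SIGMA d:{1, 2}. {..<N k d})"
    \<comment> \<open>identically distributed within each sample\<close>
    and ident: "\<And>k d l. d \<in> {1, 2} \<Longrightarrow> l < N k d \<Longrightarrow>
                  distr (M k) (PiM ({..<p k} \<times> {..<p k}) (\<lambda>_. borel)) (Svec k d l)
                = distr (M k) (PiM ({..<p k} \<times> {..<p k}) (\<lambda>_. borel)) (Svec k d 0)"
    \<comment> \<open>second moments exist, so that the covariance matrix Gamma_d is defined\<close>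
    and sq_int: "\<And>k d l i j. d \<in> {1, 2} \<Longrightarrow> l < N k d \<Longrightarrow> i < j \<Longrightarrow> j < p k \<Longrightarrow>
                  integrable (M k) (\<lambda>\<omega>. (S k d l \<omega> i j)^2)"
    \<comment> \<open>H0: s_1 = s_2\<close>
    and H0: "\<And>k i j. i < p k \<Longrightarrow> j < p k \<Longrightarrow>
                  (\<integral>\<omega>. S k 1 0 \<omega> i j \<partial>M k) = (\<integral>\<omega>. S k 2 0 \<omega> i j \<partial>M k)"
    \<comment> \<open>(A1)\<close>
    and A1: "\<exists>C0>0. \<forall>k. \<forall>d\<in>{1, 2}. \<forall>\<mu>. is_eigenvalue_on (upper_pairs (p k)) (Gam k d) \<mu> \<longrightarrow>
                  1 / C0 \<le> \<mu> \<and> \<mu> \<le> C0"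
    \<comment> \<open>(A2)\<close>
    and A2: "\<exists>r. 0 < r \<and> r < 1 \<and> (\<forall>k. \<forall>d\<in>{1, 2}. \<forall>a\<in>upper_pairs (p k). \<forall>b\<in>upper_pairs (p k). a \<noteq> b \<longrightarrow>
                  \<bar>correl (M k) (\<lambda>\<omega>. S k d 0 \<omega> (fst a) (snd a)) (\<lambda>\<omega>. S k d 0 \<omega> (fst b) (snd b))\<bar> < r)"
    \<comment> \<open>(C1) or (C2)\<close>
    and C: "((\<lambda>k. ln (real (p k))) \<in> o(\<lambda>k. nn k powr (1/5)) \<and>
              (\<exists>\<eta>>0. \<exists>K>0. \<forall>k. \<forall>d\<in>{1, 2}. \<forall>l<N k d. \<forall>i j. i < j \<and> j < p k \<longrightarrow>
                 (\<integral>\<^sup>+\<omega>. ennreal (exp (\<eta> * (S k d l \<omega> i j - (\<integral>\<omega>'. S k d l \<omega>' i j \<partial>M k))^2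
                      / covar (M k) (\<lambda>\<omega>'. S k d l \<omega>' i j) (\<lambda>\<omega>'. S k d l \<omega>' i j))) \<partial>M k) \<le> ennreal K))
          \<or> (\<exists>\<gamma>0>0. \<exists>c>0. (\<forall>k. real (p k) \<le> c * nn k powr \<gamma>0) \<and>
              (\<exists>\<epsilon>>0. \<exists>K>0. \<forall>k. \<forall>d\<in>{1, 2}. \<forall>l<N k d. \<forall>i j. i < j \<and> j < p k \<longrightarrow>
                 (\<integral>\<^sup>+\<omega>. ennreal (\<bar>(S k d l \<omega> i j - (\<integral>\<omega>'. S k d l \<omega>' i j \<partial>M k))
                      / sqrt (covar (M k) (\<lambda>\<omega>'. S k d l \<omega>' i j) (\<lambda>\<omega>'. S k d l \<omega>' i j))\<bar>
                      powr (4 * \<gamma>0 + 2 + \<epsilon>)) \<partial>M k) \<le> ennreal K))"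
    \<comment> \<open>n_1 asymp n_2, and n_1, n_2, q \<rightarrow> \<infinity>\<close>
    and asymp: "(\<lambda>k. real (N k 1)) \<in> \<Theta>(\<lambda>k. real (N k 2))"
    and lim1: "filterlim (\<lambda>k. N k 1) at_top sequentially"
    and lim2: "filterlim (\<lambda>k. N k 2) at_top sequentially"
    and limq: "filterlim q at_top sequentially"
  shows "\<forall>x::real.
           (\<lambda>k. measure (M k) {\<omega> \<in> space (M k).
               Mstat (p k) (N k 1) (\<lambda>l i j. S k 1 l \<omega> i j) (N k 2) (\<lambda>l i j. S k 2 l \<omega> i j)
                 - 2 * ln (q k) + ln (ln (q k)) \<le> x})
           \<longlonglongrightarrow> exp (- (1 / sqrt pi) * exp (- x / 2))"
proof
  fix x :: real
  from A1 obtain C0 where C0: "0 < C0" and A1': "\<forall>k. \<forall>d\<in>{1, 2}. \<forall>\<mu>.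
      is_eigenvalue_on (upper_pairs (p k)) (Gam k d) \<mu> \<longrightarrow> 1 / C0 \<le> \<mu> \<and> \<mu> \<le> C0"
    by (elim exE conjE)
  from A2 obtain r where r: "0 < r" "r < 1" and A2': "\<forall>k. \<forall>d\<in>{1, 2}. \<forall>a\<in>upper_pairs (p k). \<forall>b\<in>upper_pairs (p k). a \<noteq> b \<longrightarrow>
      \<bar>correl (M k) (\<lambda>\<omega>. S k d 0 \<omega> (fst a) (snd a)) (\<lambda>\<omega>. S k d 0 \<omega> (fst b) (snd b))\<bar> < r"
    by (elim exE conjE)
  define h where "h k = real (N k 1) + real (N k 2)" for k
  define z where "z k d l i j \<omega> = (S k d l \<omega> i j - (\<integral>\<omega>'. S k d l \<omega>' i j \<partial>M k))
      / sqrt (covar (M k) (\<lambda>\<omega>'. S k d l \<omega>' i j) (\<lambda>\<omega>'. S k d l \<omega>' i j))" for k d l i j \<omega>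
  have zm: "z k d l i j \<in> borel_measurable (M k)" if "d \<in> {1, 2}" "l < N k d" "i < j" "j < p k" for k d l i j
    unfolding z_def[abs_def] using that by (intro borel_measurable_divide borel_measurable_diff meas borel_measurable_const) auto
  have npos: "eventually (\<lambda>k. 0 < N k 1 \<and> 0 < N k 2) sequentially"
    by (intro eventually_conj eventually_compose_filterlim[OF eventually_gt_at_top lim1]
        eventually_compose_filterlim[OF eventually_gt_at_top lim2])
  obtain c1 where c1: "0 < c1" "eventually (\<lambda>k. norm (real (N k 1)) \<le> c1 * norm (real (N k 2))) sequentially"
    by (rule landau_o.bigE[OF bigthetaD1[OF asymp]])
  obtain c2 where c2: "0 < c2" "eventually (\<lambda>k. norm (real (N k 2)) \<le> c2 * norm (real (N k 1))) sequentially"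
    by (rule landau_o.bigE[OF bigthetaD1[OF asymp[THEN bigtheta_sym[THEN iffD1]]]])
  define c where "c = 2 * max c1 c2 + 2"
  have c0: "0 < c" unfolding c_def using c1(1) by simp
  have hn: "eventually (\<lambda>k. 0 \<le> h k \<and> h k \<le> c * nn k) sequentially"
    using npos c1(2) c2(2)
  proof eventually_elim
    case (elim k)
    have "real (N k 1) \<le> max c1 c2 * real (N k 2)" "real (N k 2) \<le> max c1 c2 * real (N k 1)"
      using elim(2,3) by (auto intro: order_trans[OF _ mult_right_mono])
    then show ?case using nn_bounds[of "real (N k 1)" "real (N k 2)" "max c1 c2"] elim
      by (simp add: h_def nn_def c_def)
  qed
  have h_lim: "filterlim h at_top sequentially"
    unfolding h_def[abs_def] using lim1 lim2
    by (intro filterlim_at_top_add_at_top filterlim_compose[OF filterlim_real_sequentially])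
  have nn_lim: "filterlim nn at_top sequentially"
  proof (rule filterlim_at_top_mono)
    show "filterlim (\<lambda>k. (1 / c) * h k) at_top sequentially"
      using c0 by (intro filterlim_tendsto_pos_mult_at_top[OF tendsto_const _ h_lim]) auto
    show "eventually (\<lambda>k. (1 / c) * h k \<le> nn k) sequentially"
      using hn by eventually_elim (use c0 in \<open>simp add: divide_le_eq mult.commute\<close>)
  qed
  have nn1: "eventually (\<lambda>k. 1 \<le> nn k) sequentially" using nn_lim by (simp add: filterlim_at_top)
  have q1: "eventually (\<lambda>k. 1 < q k \<and> q k \<le> (real (p k))^2 \<and> 0 < real (p k)) sequentially"
  proof -
    have "eventually (\<lambda>k. 1 < q k) sequentially" using limq by (simp add: filterlim_at_top_dense)
    then show ?thesis
    proof eventually_elim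
      case (elim k)
      have "0 < p k" using elim by (cases "p k = 0") (auto simp: q_def)
      moreover have "real (p k) * (real (p k) - 1) / 2 \<le> (real (p k))^2"
        by (simp add: power2_eq_square algebra_simps)
      ultimately show ?case using elim by (simp add: q_def)
    qed
  qed
  have kap1: "eventually (\<lambda>k. 1 \<le> ln (q k) powr (3/5)) sequentially"
    using filterlim_compose[OF kap_at_top limq] by (simp add: filterlim_at_top)
  have concl: "(\<lambda>k. measure (M k) {\<omega> \<in> space (M k).
               Mstat (p k) (N k 1) (\<lambda>l i j. S k 1 l \<omega> i j) (N k 2) (\<lambda>l i j. S k 2 l \<omega> i j)
                 - 2 * ln (q k) + ln (ln (q k)) \<le> x}) \<longlonglongrightarrow> gumbel x"
    if tau: "\<And>k. 1 \<le> nn k \<Longrightarrow> 1 \<le> \<tau> k" and pos: "\<And>k. 1 \<le> nn k \<Longrightarrow> 0 < \<theta> k \<and> 0 < \<pi>0 k"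
      and t2: "\<And>k d l i j. 1 \<le> nn k \<Longrightarrow> d \<in> {1, 2} \<Longrightarrow> l < N k d \<Longrightarrow> i < j \<Longrightarrow> j < p k \<Longrightarrow>
          (\<integral>\<omega>. (if \<bar>z k d l i j \<omega>\<bar> \<le> \<tau> k then 0 else (z k d l i j \<omega>)^2) \<partial>M k) \<le> \<theta> k"
      and t0: "\<And>k d l i j. 1 \<le> nn k \<Longrightarrow> d \<in> {1, 2} \<Longrightarrow> l < N k d \<Longrightarrow> i < j \<Longrightarrow> j < p k \<Longrightarrow>
          measure (M k) {\<omega> \<in> space (M k). \<tau> k < \<bar>z k d l i j \<omega>\<bar>} \<le> \<pi>0 k"
      and L1: "(\<lambda>k. (ln (q k) powr (3/5))^3 * (\<tau> k / sqrt (nn k))) \<longlonglongrightarrow> 0"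
      and L2: "(\<lambda>k. (ln (q k) powr (3/5))^2 * sqrt (\<theta> k)) \<longlonglongrightarrow> 0"
      and L3: "(\<lambda>k. h k * (q k * \<pi>0 k)) \<longlonglongrightarrow> 0"
    for \<tau> \<theta> \<pi>0 :: "nat \<Rightarrow> real"
    unfolding q_def
  proof (rule two_sample_gumbel[where ?C0.0 = C0 and r = r and \<tau> = \<tau> and \<theta> = \<theta> and ?\<pi>0.0 = \<pi>0])
    have "eventually (\<lambda>k. (ln (q k) powr (3/5))^2 * sqrt (\<theta> k) < 1) sequentially"
      using order_tendstoD(2)[OF L2, of 1] by simp
    with npos nn1 kap1
    show "eventually (\<lambda>k. two_sample (M k) (N k) (p k) (S k) C0 r (\<tau> k) (\<theta> k) (\<pi>0 k)) sequentially"
    proof eventually_elim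
      case (elim k)
      interpret P: prob_space "M k" by (rule prob)
      have th1: "\<theta> k \<le> 1"
      proof -
        have "1 * sqrt (\<theta> k) \<le> (ln (q k) powr (3/5))^2 * sqrt (\<theta> k)"
          using elim pos[of k] by (intro mult_right_mono) auto
        then have "sqrt (\<theta> k) < 1" using elim by linarith
        then show ?thesis by simp
      qed
      show ?case
      proof (intro two_sample.intro two_sample_axioms.intro prob)
        show "0 < N k 1" "0 < N k 2" using elim by auto
        show "0 < C0" "0 < r" "r < 1" by (rule C0, rule r(1), rule r(2))
        show "1 \<le> \<tau> k" "0 < \<theta> k" "0 < \<pi>0 k" using tau[of k] pos[of k] elim by auto
        show "\<theta> k \<le> 1" by (rule th1)
        show "prob_space.indep_vars (M k) (\<lambda>_. PiM ({..<p k} \<times> {..<p k}) (\<lambda>_. borel))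
           (\<lambda>(d, l) \<omega>. restrict (\<lambda>(i, j). S k d l \<omega> i j) ({..<p k} \<times> {..<p k})) (SIGMA d:{1, 2}. {..<N k d})"
          using indep[of k] unfolding Svec_def .
      next
        fix d l i j :: nat assume dl: "d \<in> {1, 2}" "l < N k d"
        show "distr (M k) (PiM ({..<p k} \<times> {..<p k}) (\<lambda>_. borel)) (\<lambda>\<omega>. restrict (\<lambda>(i, j). S k d l \<omega> i j) ({..<p k} \<times> {..<p k}))
          = distr (M k) (PiM ({..<p k} \<times> {..<p k}) (\<lambda>_. borel)) (\<lambda>\<omega>. restrict (\<lambda>(i, j). S k d 0 \<omega> i j) ({..<p k} \<times> {..<p k}))"
          using ident[OF dl] unfolding Svec_def .
        show "(\<lambda>\<omega>. S k d l \<omega> i j) \<in> borel_measurable (M k)" if "i < p k" "j < p k" by (rule meas[OF dl that])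
        assume ij: "i < j" "j < p k"
        show "integrable (M k) (\<lambda>\<omega>. (S k d l \<omega> i j)^2)" by (rule sq_int[OF dl ij])
        show "(\<integral>\<omega>. (let z = (S k d l \<omega> i j - (\<integral>\<omega>. S k d l \<omega> i j \<partial>M k))
           / sqrt (covar (M k) (\<lambda>\<omega>. S k d l \<omega> i j) (\<lambda>\<omega>. S k d l \<omega> i j)) in if \<bar>z\<bar> \<le> \<tau> k then 0 else z^2) \<partial>M k) \<le> \<theta> k"
          using t2[OF elim(2) dl ij] unfolding z_def Let_def .
        show "measure (M k) {\<omega> \<in> space (M k). \<tau> k < \<bar>(S k d l \<omega> i j - (\<integral>\<omega>. S k d l \<omega> i j \<partial>M k))
           / sqrt (covar (M k) (\<lambda>\<omega>. S k d l \<omega> i j) (\<lambda>\<omega>. S k d l \<omega> i j))\<bar>} \<le> \<pi>0 k"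
          using t0[OF elim(2) dl ij] unfolding z_def .
      next
        show "(\<integral>\<omega>. S k 1 0 \<omega> i j \<partial>M k) = (\<integral>\<omega>. S k 2 0 \<omega> i j \<partial>M k)" if "i < p k" "j < p k" for i j
          by (rule H0[OF that])
        show "1 / C0 \<le> \<mu> \<and> \<mu> \<le> C0" if "d \<in> {1, 2}" "is_eigenvalue_on (upper_pairs (p k))
            (\<lambda>a c. covar (M k) (\<lambda>\<omega>. S k d 0 \<omega> (fst a) (snd a)) (\<lambda>\<omega>. S k d 0 \<omega> (fst c) (snd c))) \<mu>" for d \<mu>
          by (rule A1'[unfolded Gam_def, THEN spec, THEN bspec, THEN spec, THEN mp, OF that])
        show "\<bar>correl (M k) (\<lambda>\<omega>. S k d 0 \<omega> (fst a) (snd a)) (\<lambda>\<omega>. S k d 0 \<omega> (fst c) (snd c))\<bar> < r"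
          if "d \<in> {1, 2}" "a \<in> upper_pairs (p k)" "c \<in> upper_pairs (p k)" "a \<noteq> c" for d a c
          by (rule A2'[THEN spec, THEN bspec, THEN bspec, THEN bspec, THEN mp, OF that])
      qed
    qed
    show "filterlim (\<lambda>k. real (p k) * (real (p k) - 1) / 2) at_top sequentially" using limq by (simp add: q_def)
  qed (use L1 L2 L3 in \<open>simp_all add: q_def nn_def h_def\<close>)
  have "(\<lambda>k. measure (M k) {\<omega> \<in> space (M k).
               Mstat (p k) (N k 1) (\<lambda>l i j. S k 1 l \<omega> i j) (N k 2) (\<lambda>l i j. S k 2 l \<omega> i j)
                 - 2 * ln (q k) + ln (ln (q k)) \<le> x}) \<longlonglongrightarrow> gumbel x"
    using C
  proof (elim disjE conjE exE)
    fix \<eta> K :: real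
    assume o: "(\<lambda>k. ln (real (p k))) \<in> o(\<lambda>k. nn k powr (1/5))" and eta: "0 < \<eta>" and K: "0 < K"
      and tail: "\<forall>k. \<forall>d\<in>{1, 2}. \<forall>l<N k d. \<forall>i j. i < j \<and> j < p k \<longrightarrow>
                 (\<integral>\<^sup>+\<omega>. ennreal (exp (\<eta> * (S k d l \<omega> i j - (\<integral>\<omega>'. S k d l \<omega>' i j \<partial>M k))^2
                      / covar (M k) (\<lambda>\<omega>'. S k d l \<omega>' i j) (\<lambda>\<omega>'. S k d l \<omega>' i j))) \<partial>M k) \<le> ennreal K"
    have z2: "\<eta> * (S k d l \<omega> i j - (\<integral>\<omega>'. S k d l \<omega>' i j \<partial>M k))^2
        / covar (M k) (\<lambda>\<omega>'. S k d l \<omega>' i j) (\<lambda>\<omega>'. S k d l \<omega>' i j) = \<eta> * (z k d l i j \<omega>)^2" for k d l i j \<omega>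
    proof -
      have "0 \<le> covar (M k) (\<lambda>\<omega>'. S k d l \<omega>' i j) (\<lambda>\<omega>'. S k d l \<omega>' i j)"
        unfolding covar_def by (intro Bochner_Integration.integral_nonneg) auto
      then show ?thesis by (simp add: z_def power_divide)
    qed
    have mom: "(\<integral>\<^sup>+\<omega>. ennreal (exp (\<eta> * (z k d l i j \<omega>)^2)) \<partial>M k) \<le> ennreal K"
      if "d \<in> {1, 2}" "l < N k d" "i < j" "j < p k" for k d l i j
      using tail[THEN spec[of _ k], THEN bspec, OF that(1), THEN spec, THEN mp, OF that(2), THEN spec, THEN spec, THEN mp, OF conjI, OF that(3,4)]
      unfolding z2 .
    show ?thesis
    proof (rule concl)
      note R = rates_C1[OF nn_lim q1 hn o eta K]
      show "(\<lambda>k. (ln (q k) powr (3/5))^3 * (nn k powr (1/8) / sqrt (nn k))) \<longlonglongrightarrow> 0" by (rule R(1))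
      show "(\<lambda>k. (ln (q k) powr (3/5))^2 * sqrt (2 / \<eta> * exp (- \<eta> * (nn k powr (1/8))^2 / 2) * K)) \<longlonglongrightarrow> 0" by (rule R(2))
      show "(\<lambda>k. h k * (q k * (exp (- \<eta> * (nn k powr (1/8))^2) * K))) \<longlonglongrightarrow> 0" by (rule R(3))
      show "1 \<le> nn k powr (1/8)" if "1 \<le> nn k" for k using that by (simp add: ge_one_powr_ge_zero)
      show "0 < 2 / \<eta> * exp (- \<eta> * (nn k powr (1/8))^2 / 2) * K \<and> 0 < exp (- \<eta> * (nn k powr (1/8))^2) * K" for k
        using eta K by simp
      fix k d l i j assume dl: "d \<in> {1, 2}" "l < N k d" "i < j" "j < p k"
      note T = prob_space.gaussian_tail_bounds[OF prob zm[OF dl] mom[OF dl] K eta, of "nn k powr (1/8)"]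
      show "(\<integral>\<omega>. (if \<bar>z k d l i j \<omega>\<bar> \<le> nn k powr (1/8) then 0 else (z k d l i j \<omega>)^2) \<partial>M k)
         \<le> 2 / \<eta> * exp (- \<eta> * (nn k powr (1/8))^2 / 2) * K" by (rule T(1)) simp
      show "measure (M k) {\<omega> \<in> space (M k). nn k powr (1/8) < \<bar>z k d l i j \<omega>\<bar>} \<le> exp (- \<eta> * (nn k powr (1/8))^2) * K"
        by (rule T(2)) simp
    qed
  next
    fix \<gamma>0 c' \<epsilon> K :: real
    assume g: "0 < \<gamma>0" "0 < c'" and pk: "\<forall>k. real (p k) \<le> c' * nn k powr \<gamma>0" and eps: "0 < \<epsilon>" and K: "0 < K"
      and tail: "\<forall>k. \<forall>d\<in>{1, 2}. \<forall>l<N k d. \<forall>i j. i < j \<and> j < p k \<longrightarrow>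
                 (\<integral>\<^sup>+\<omega>. ennreal (\<bar>(S k d l \<omega> i j - (\<integral>\<omega>'. S k d l \<omega>' i j \<partial>M k))
                      / sqrt (covar (M k) (\<lambda>\<omega>'. S k d l \<omega>' i j) (\<lambda>\<omega>'. S k d l \<omega>' i j))\<bar>
                      powr (4 * \<gamma>0 + 2 + \<epsilon>)) \<partial>M k) \<le> ennreal K"
    define a where "a = 4 * \<gamma>0 + 2 + \<epsilon>"
    define \<alpha> where "\<alpha> = (2 * \<gamma>0 + 1 + \<epsilon> / 4) / a"
    have a2: "2 \<le> a" using g eps by (simp add: a_def)
    have al: "0 \<le> \<alpha>" unfolding \<alpha>_def using g eps a2 by (intro divide_nonneg_nonneg) auto
    have mom: "(\<integral>\<^sup>+\<omega>. ennreal (\<bar>z k d l i j \<omega>\<bar> powr a) \<partial>M k) \<le> ennreal K"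
      if "d \<in> {1, 2}" "l < N k d" "i < j" "j < p k" for k d l i j
      using tail[THEN spec[of _ k], THEN bspec, OF that(1), THEN spec, THEN mp, OF that(2), THEN spec, THEN spec, THEN mp, OF conjI, OF that(3,4)]
      unfolding z_def a_def .
    show ?thesis
    proof (rule concl)
      have pp: "\<And>k. real (p k) \<le> c' * nn k powr \<gamma>0" by (rule pk[THEN spec])
      note R = rates_C2[OF nn_lim q1 hn c0 pp g eps K, folded a_def, folded \<alpha>_def]
      show "(\<lambda>k. (ln (q k) powr (3/5))^3 * (nn k powr \<alpha> / sqrt (nn k))) \<longlonglongrightarrow> 0" by (rule R(1))
      show "(\<lambda>k. (ln (q k) powr (3/5))^2 * sqrt ((nn k powr \<alpha>) powr (2 - a) * K)) \<longlonglongrightarrow> 0" by (rule R(2))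
      show "(\<lambda>k. h k * (q k * ((nn k powr \<alpha>) powr (- a) * K))) \<longlonglongrightarrow> 0" by (rule R(3))
      show "1 \<le> nn k powr \<alpha>" if "1 \<le> nn k" for k using that al by (simp add: ge_one_powr_ge_zero)
      show "0 < (nn k powr \<alpha>) powr (2 - a) * K \<and> 0 < (nn k powr \<alpha>) powr (- a) * K" if "1 \<le> nn k" for k
        using that K by simp
      fix k d l i j assume n1: "1 \<le> nn k" and dl: "d \<in> {1, 2}" "l < N k d" "i < j" "j < p k"
      have tp: "0 < nn k powr \<alpha>" using n1 by simp
      note T = prob_space.polynomial_tail_bounds[OF prob zm[OF dl] mom[OF dl] K a2 tp]
      show "(\<integral>\<omega>. (if \<bar>z k d l i j \<omega>\<bar> \<le> nn k powr \<alpha> then 0 else (z k d l i j \<omega>)^2) \<partial>M k)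
         \<le> (nn k powr \<alpha>) powr (2 - a) * K" by (rule T(1))
      show "measure (M k) {\<omega> \<in> space (M k). nn k powr \<alpha> < \<bar>z k d l i j \<omega>\<bar>} \<le> (nn k powr \<alpha>) powr (- a) * K"
        by (rule T(2))
    qed
  qed
  then show "(\<lambda>k. measure (M k) {\<omega> \<in> space (M k).
               Mstat (p k) (N k 1) (\<lambda>l i j. S k 1 l \<omega> i j) (N k 2) (\<lambda>l i j. S k 2 l \<omega> i j)
                 - 2 * ln (q k) + ln (ln (q k)) \<le> x}) \<longlonglongrightarrow> exp (- (1 / sqrt pi) * exp (- x / 2))"
    by (simp only: gumbel_def)
qed

end
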